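(* Let $\Omega=B(\mathbf 0,R)\subseteq\mathbb R^d$ be a ball, $d\ge2$, and let $f_1,\dots,f_m$ be radial functions such that $r\mapsto r^{\frac{d-1}2}f_i(r)$ belongs to $L^2((0,R))$ for $i=1,\dots,m$. Then the optimal flux $\bm\sigma^*$ (defined in the context) is given by $$\bm\sigma_i^*=\sigma_i^*(r)\,\mathbf e_r,\qquad \sigma_i^*(r)=-\frac1{r^{d-1}}\int_0^r\rho^{d-1}f_i(\rho)\,d\rho,\qquad i=1,\dots,m.$$ Moreover, if $\bm\theta^*\in\mathcal T$ is a radial maximizer of $\int_\Omega\sum_{j=1}^N\frac{\theta_j}{\lambda_1(\mathbf M_j)}\psi\,d\mathbf x$ over $\bm\theta\in\mathcal T$, where $\psi=\sum_{i=1}^m\mu_i|\bm\sigma_i^*|^2$, then: (a) $\bm\theta^*$ maximizes $I$ over $\mathcal T$; (b) if $\mathbf A$ is the conductivity of a simple laminate with local proportions $\bm\theta^*$ and layers orthogonal to the radial direction (as specified in the context), then $(\bm\theta^*,\mathbf A)$ maximizes $J$ over $\mathcal B$ and also maximizes $J$ over $\mathcal A$.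
   Context: Setting. $r=|\mathbf x|$, and $\mathbf e_r=\mathbf x/|\mathbf x|$ is the outward radial unit vector; a function is radial if it depends only on $r$. $\mu$ is the $d$-dimensional Lebesgue measure, $N,m\ge1$. $\mathbf M_1,\dots,\mathbf M_N$ are symmetric positive definite $d\times d$ real matrices; $\lambda_1(\mathbf M)$ and $\lambda_d(\mathbf M)$ denote the smallest and largest eigenvalue of a symmetric matrix $\mathbf M$; $\mathbf I$ is the identity matrix. $q_1,\dots,q_N\ge0$ are prescribed amounts with $\sum_{i=1}^Nq_i=\mu(\Omega)$, and $\mu_1,\dots,\mu_m>0$ are weights. Let $K=\{\bm\theta\in[0,1]^N:\sum_{i=1}^N\theta_i=1\}$, and $\mathcal T=\{\bm\theta\in L^\infty(\Omega;K):\int_\Omega\theta_i\,d\mathbf x=q_i,\ i=1,\dots,N\}$. For $\bm\theta\in K$ define $\lambda_\pm(\bm\theta)$ by $\frac1{\lambda_-(\bm\theta)}=\sum_{i=1}^N\frac{\theta_i}{\lambda_1(\mathbf M_i)}$ and $\lambda_+(\bm\theta)=\sum_{i=1}^N\theta_i\lambda_d(\mathbf M_i)$. Composite materials. For $\bm\vartheta\in K$, the set $\mathcal K(\bm\vartheta)$ consists of all matrices $\mathbf A$ for which there are sequences $\bm\chi^n\in L^\infty(\Omega;\{\mathbf e_1,\dots,\mathbf e_N\})$ ($\mathbf e_i$ the canonical basis of $\mathbb R^N$) and $\mathbf R_n\in L^\infty(\Omega;\mathrm{SO}(\mathbb R^d))$ such that $\bm\chi^n$ converges weakly-$*$ in $L^\infty$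 to some $\bm\theta$, $\mathbf A^n=\sum_{i=1}^N\chi_i^n\mathbf R_n^{\top}\mathbf M_i\mathbf R_n$ $H$-converges to some $\mathbf A^\infty$, and $\mathbf A=\mathbf A^\infty(\widetilde{\mathbf x})$, $\bm\vartheta=\bm\theta(\widetilde{\mathbf x})$ for some common Lebesgue point $\widetilde{\mathbf x}$ of $\mathbf A^\infty$ and $\bm\theta$. With $\mathrm{Sym}_d$ the symmetric $d\times d$ real matrices, let $$\mathcal A=\{(\bm\theta,\mathbf A)\in L^\infty(\Omega;K\times\mathrm{Sym}_d):\bm\theta\in\mathcal T,\ \mathbf A(\mathbf x)\in\mathcal K(\bm\theta(\mathbf x))\ \text{a.e. }\mathbf x\in\Omega\},$$ $$\mathcal B=\{(\bm\theta,\mathbf A)\in L^\infty(\Omega;K\times\mathrm{Sym}_d):\bm\theta\in\mathcal T,\ \lambda_-(\bm\theta)\mathbf I\le\mathbf A\le\lambda_+(\bm\theta)\mathbf I\ \text{a.e. on }\Omega\};$$ it is known that $\mathcal A\subseteq\mathcal B$. Functionals. For $(\bm\theta,\mathbf A)\in\mathcal B$ let $u_i\in H^1_0(\Omega)$ solve $-\mathrm{div}(\mathbf A\nabla u_i)=f_i$, $i=1,\dots,m$, and $J(\bm\theta,\mathbf A)=\sum_{i=1}^m\mu_i\int_\Omega f_iu_i\,d\mathbf x$. For $\bm\theta\in\mathcal T$ put $I(\bm\theta)=J(\bm\theta,\lambda_-(\bm\theta)\mathbf I)$. Optimal flux. Let $\mathcal S=\{\bm\sigma\in L^2(\Omega;\mathbb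 R^d)^m:-\mathrm{div}\,\bm\sigma_i=f_i,\ i=1,\dots,m\}$ and $H(\bm\theta,\bm\sigma)=\sum_{i=1}^m\mu_i\int_\Omega\frac{|\bm\sigma_i|^2}{\lambda_-(\bm\theta)}\,d\mathbf x$ on $\mathcal T\times\mathcal S$. A saddle point is a pair $(\bm\theta^*,\bm\sigma^* )\in\mathcal T\times\mathcal S$ with $H(\bm\theta,\bm\sigma^* )\le H(\bm\theta^*,\bm\sigma^* )\le H(\bm\theta^*,\bm\sigma)$ for all $\bm\theta\in\mathcal T,\bm\sigma\in\mathcal S$. Saddle points exist by the classical saddle-point theorem, and all have the same $\bm\sigma$-component $\bm\sigma^*$, called the optimal flux. Simple laminate. Let $\mathbf R_1,\dots,\mathbf R_N\in L^\infty(\Omega;\mathrm{SO}(\mathbb R^d))$ be such that $\mathbf e_r$ is a.e. an eigenvector of $\mathbf R_i^\top\mathbf M_i\mathbf R_i$ for the eigenvalue $\lambda_1(\mathbf M_i)$. The simple laminate of these rotated phases with local proportions $\bm\theta^*$ and layers orthogonal to $\mathbf e_r$ has conductivity $$\mathbf A=\lambda_-(\bm\theta^* )\,\mathbf e_r\otimes\mathbf e_r+\sum_{i=1}^N\theta_i^*\big(\mathbf R_i^\top\mathbf M_i\mathbf R_i-\lambda_1(\mathbf M_i)\,\mathbf e_r\otimes\mathbf e_r\big),$$ and it is a standard fact of homogenization theory that $\mathbf A(\mathbf x)\in\mathcal K(\bm\theta^*(\mathbf x))$ for a.e. $\mathbf x\in\Omega$. *)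

theory Defs
  imports "HOL-Analysis.Analysis"
begin

section \<open>Function spaces\<close>

text \<open>Elements of Lebesgue and Sobolev spaces are represented by functions on the whole space, of which
  only the restriction to \<open>\<Omega>\<close>, up to null sets, matters.\<close>

definition L1 :: "'a::euclidean_space set \<Rightarrow> ('a \<Rightarrow> 'b::euclidean_space) set" where
  "L1 \<Omega> = {f. integrable (lebesgue_on \<Omega>) f}"

definition L2 :: "'a::euclidean_space set \<Rightarrow> ('a \<Rightarrow> 'b::euclidean_space) set" where
  "L2 \<Omega> = {f \<in> borel_measurable (lebesgue_on \<Omega>). integrable (lebesgue_on \<Omega>) (\<lambda>x. (norm (f x))\<^sup>2)}"

definition Linf :: "'a::euclidean_space set \<Rightarrow> ('a \<Rightarrow> 'b::euclidean_space) set" where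
  "Linf \<Omega> = {f \<in> borel_measurable (lebesgue_on \<Omega>). \<exists>C. AE x in lebesgue_on \<Omega>. norm (f x) \<le> C}"

definition Linf_into :: "'a::euclidean_space set \<Rightarrow> 'b::euclidean_space set \<Rightarrow> ('a \<Rightarrow> 'b) set" where
  "Linf_into \<Omega> S = {f \<in> Linf \<Omega>. AE x in lebesgue_on \<Omega>. f x \<in> S}"

definition weakly_L2 ::
    "'a::euclidean_space set \<Rightarrow> (nat \<Rightarrow> 'a \<Rightarrow> 'b::euclidean_space) \<Rightarrow> ('a \<Rightarrow> 'b) \<Rightarrow> bool" where
  "weakly_L2 \<Omega> u v \<longleftrightarrow> (\<forall>n. u n \<in> L2 \<Omega>) \<and> v \<in> L2 \<Omega> \<and>
     (\<forall>g\<in>L2 \<Omega>. (\<lambda>n. LINT x|lebesgue_on \<Omega>. u n x \<bullet> g x) \<longlonglongrightarrow> (LINT x|lebesgue_on \<Omega>. v x \<bullet> g x))"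

definition weakly_star_Linf ::
    "'a::euclidean_space set \<Rightarrow> (nat \<Rightarrow> 'a \<Rightarrow> 'b::euclidean_space) \<Rightarrow> ('a \<Rightarrow> 'b) \<Rightarrow> bool" where
  "weakly_star_Linf \<Omega> u v \<longleftrightarrow> (\<forall>n. u n \<in> Linf \<Omega>) \<and> v \<in> Linf \<Omega> \<and>
     (\<forall>g\<in>L1 \<Omega>. (\<lambda>n. LINT x|lebesgue_on \<Omega>. u n x \<bullet> g x) \<longlonglongrightarrow> (LINT x|lebesgue_on \<Omega>. v x \<bullet> g x))"

definition lebesgue_point ::
    "'a::euclidean_space set \<Rightarrow> ('a \<Rightarrow> 'b::euclidean_space) \<Rightarrow> 'a \<Rightarrow> bool" where
  "lebesgue_point \<Omega> f x \<longleftrightarrow> x \<in> \<Omega> \<and>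
     ((\<lambda>r. (LINT y|lebesgue_on (\<Omega> \<inter> ball x r). norm (f y - f x)) / measure lebesgue (ball x r))
        \<longlongrightarrow> 0) (at_right 0)"

definition radial_on :: "'a::euclidean_space set \<Rightarrow> ('a \<Rightarrow> 'b) \<Rightarrow> bool" where
  "radial_on \<Omega> f \<longleftrightarrow> (\<exists>p. AE x in lebesgue_on \<Omega>. f x = p (norm x))"

definition e_r :: "real^'d \<Rightarrow> real^'d" where
  "e_r x = (1 / norm x) *\<^sub>R x"


section \<open>Test functions, \<open>H\<^sup>1\<^sub>0\<close>, and weak solutions\<close>

primrec C_k :: "nat \<Rightarrow> (real^'d \<Rightarrow> real) \<Rightarrow> bool" where
  "C_k 0 f \<longleftrightarrow> continuous_on UNIV f"
| "C_k (Suc k) f \<longleftrightarrow> (\<forall>x. f differentiable (at x)) \<and>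
     (\<forall>v. C_k k (\<lambda>x. frechet_derivative f (at x) v))"

definition test_functions :: "(real^'d) set \<Rightarrow> (real^'d \<Rightarrow> real) set" where
  "test_functions \<Omega> = {\<phi>. (\<forall>k. C_k k \<phi>) \<and>
     compact (closure {x. \<phi> x \<noteq> 0}) \<and> closure {x. \<phi> x \<noteq> 0} \<subseteq> \<Omega>}"

definition grad :: "(real^'d \<Rightarrow> real) \<Rightarrow> real^'d \<Rightarrow> real^'d" where
  "grad \<phi> x = (\<chi> i. frechet_derivative \<phi> (at x) (axis i 1))"

definition weak_gradient ::
    "(real^'d) set \<Rightarrow> (real^'d \<Rightarrow> real) \<Rightarrow> (real^'d \<Rightarrow> real^'d) \<Rightarrow> bool" where
  "weak_gradient \<Omega> u G \<longleftrightarrow> u \<in> L2 \<Omega> \<and> G \<in> L2 \<Omega> \<and>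
     (\<forall>\<phi>\<in>test_functions \<Omega>.
        (LINT x|lebesgue_on \<Omega>. u x *\<^sub>R grad \<phi> x) = - (LINT x|lebesgue_on \<Omega>. \<phi> x *\<^sub>R G x))"

definition H1_0 :: "(real^'d) set \<Rightarrow> (real^'d \<Rightarrow> real) set" where
  "H1_0 \<Omega> = {u. \<exists>G. weak_gradient \<Omega> u G \<and>
     (\<exists>\<phi>. (\<forall>n. \<phi> n \<in> test_functions \<Omega>) \<and>
        (\<lambda>n::nat. (LINT x|lebesgue_on \<Omega>. (\<phi> n x - u x)\<^sup>2) +
                  (LINT x|lebesgue_on \<Omega>. (norm (grad (\<phi> n) x - G x))\<^sup>2)) \<longlonglongrightarrow> 0)}"

text \<open>Elements of \<open>H\<^sup>-\<^sup>1(\<Omega>)\<close> are given by their values on test functions; being bounded for the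
  \<open>H\<^sup>1\<close>-norm, such functionals extend uniquely to \<open>H\<^sup>1\<^sub>0(\<Omega>)\<close>.\<close>

definition H_minus_1 :: "(real^'d) set \<Rightarrow> ((real^'d \<Rightarrow> real) \<Rightarrow> real) set" where
  "H_minus_1 \<Omega> = {l.
     (\<forall>\<phi>\<in>test_functions \<Omega>. \<forall>\<psi>\<in>test_functions \<Omega>. l (\<lambda>x. \<phi> x + \<psi> x) = l \<phi> + l \<psi>) \<and>
     (\<forall>c. \<forall>\<phi>\<in>test_functions \<Omega>. l (\<lambda>x. c * \<phi> x) = c * l \<phi>) \<and>
     (\<exists>C. \<forall>\<phi>\<in>test_functions \<Omega>.
        \<bar>l \<phi>\<bar> \<le> C * sqrt ((LINT x|lebesgue_on \<Omega>. (\<phi> x)\<^sup>2) +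
                            (LINT x|lebesgue_on \<Omega>. (norm (grad \<phi> x))\<^sup>2)))}"

definition L2_functional :: "(real^'d) set \<Rightarrow> (real^'d \<Rightarrow> real) \<Rightarrow> (real^'d \<Rightarrow> real) \<Rightarrow> real" where
  "L2_functional \<Omega> f \<phi> = (LINT x|lebesgue_on \<Omega>. f x * \<phi> x)"

text \<open>\<open>- div \<sigma> = l\<close> in the sense of distributions:\<close>

definition neg_div_eq ::
    "(real^'d) set \<Rightarrow> (real^'d \<Rightarrow> real^'d) \<Rightarrow> ((real^'d \<Rightarrow> real) \<Rightarrow> real) \<Rightarrow> bool" where
  "neg_div_eq \<Omega> \<sigma> l \<longleftrightarrow>
     (\<forall>\<phi>\<in>test_functions \<Omega>. (LINT x|lebesgue_on \<Omega>. \<sigma> x \<bullet> grad \<phi> x) = l \<phi>)"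

text \<open>\<open>u \<in> H\<^sup>1\<^sub>0(\<Omega>)\<close>, with gradient \<open>G\<close>, solves \<open>- div (A \<nabla>u) = l\<close>:\<close>

definition dirichlet_solution ::
    "(real^'d) set \<Rightarrow> (real^'d \<Rightarrow> real^'d^'d) \<Rightarrow> ((real^'d \<Rightarrow> real) \<Rightarrow> real)
       \<Rightarrow> (real^'d \<Rightarrow> real) \<Rightarrow> (real^'d \<Rightarrow> real^'d) \<Rightarrow> bool" where
  "dirichlet_solution \<Omega> A l u G \<longleftrightarrow>
     u \<in> H1_0 \<Omega> \<and> weak_gradient \<Omega> u G \<and> neg_div_eq \<Omega> (\<lambda>x. A x *v G x) l"


section \<open>Matrices and \<open>H\<close>-convergence\<close>

definition Sym :: "(real^'d^'d) set" where
  "Sym = {A. transpose A = A}"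

definition pos_def :: "real^'d^'d \<Rightarrow> bool" where
  "pos_def A \<longleftrightarrow> (\<forall>v. v \<noteq> 0 \<longrightarrow> v \<bullet> (A *v v) > 0)"

definition eigenvector :: "real^'d^'d \<Rightarrow> real^'d \<Rightarrow> real \<Rightarrow> bool" where
  "eigenvector A v c \<longleftrightarrow> v \<noteq> 0 \<and> A *v v = c *\<^sub>R v"

definition lambda_min :: "real^'d^'d \<Rightarrow> real" where
  "lambda_min A = Min {c. \<exists>v. eigenvector A v c}"

definition lambda_max :: "real^'d^'d \<Rightarrow> real" where
  "lambda_max A = Max {c. \<exists>v. eigenvector A v c}"

definition loewner_le :: "real^'d^'d \<Rightarrow> real^'d^'d \<Rightarrow> bool" where
  "loewner_le A B \<longleftrightarrow> (\<forall>v. v \<bullet> (A *v v) \<le> v \<bullet> (B *v v))"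

definition tensor :: "real^'d \<Rightarrow> real^'d \<Rightarrow> real^'d^'d" where
  "tensor a b = (\<chi> i j. a $ i * b $ j)"

text \<open>The class \<open>M(\<alpha>, \<beta>; \<Omega>)\<close> of Murat and Tartar, and \<open>H\<close>-convergence within such a class.  Weak
  convergence in \<open>H\<^sup>1\<^sub>0(\<Omega>)\<close> is weak convergence in \<open>L\<^sup>2(\<Omega>)\<close> of the functions and of their gradients.\<close>

definition coeff_class :: "(real^'d) set \<Rightarrow> real \<Rightarrow> real \<Rightarrow> (real^'d \<Rightarrow> real^'d^'d) set" where
  "coeff_class \<Omega> \<alpha> \<beta> = {A \<in> Linf \<Omega>. AE x in lebesgue_on \<Omega>.
     invertible (A x) \<and> (\<forall>v. v \<bullet> (A x *v v) \<ge> \<alpha> * (norm v)\<^sup>2) \<and>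
     (\<forall>v. v \<bullet> (matrix_inv (A x) *v v) \<ge> (1 / \<beta>) * (norm v)\<^sup>2)}"

definition H_converges ::
    "(real^'d) set \<Rightarrow> (nat \<Rightarrow> real^'d \<Rightarrow> real^'d^'d) \<Rightarrow> (real^'d \<Rightarrow> real^'d^'d) \<Rightarrow> bool" where
  "H_converges \<Omega> A B \<longleftrightarrow>
     (\<exists>\<alpha>>0. \<exists>\<beta>>0. (\<forall>n. A n \<in> coeff_class \<Omega> \<alpha> \<beta>) \<and> B \<in> coeff_class \<Omega> \<alpha> \<beta>) \<and>
     (\<forall>l\<in>H_minus_1 \<Omega>. \<forall>u G. (\<forall>n. dirichlet_solution \<Omega> (A n) l (u n) (G n)) \<longrightarrow>
        (\<exists>v F. dirichlet_solution \<Omega> B l v F \<and> weakly_L2 \<Omega> u v \<and> weakly_L2 \<Omega> G F \<and>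
           weakly_L2 \<Omega> (\<lambda>n x. A n x *v G n x) (\<lambda>x. B x *v F x)))"


section \<open>Composite materials\<close>

definition proportions :: "(real^'N) set" where
  "proportions = {\<theta>. (\<forall>i. 0 \<le> \<theta> $ i \<and> \<theta> $ i \<le> 1) \<and> (\<Sum>i\<in>UNIV. \<theta> $ i) = 1}"

definition lam_minus :: "('N \<Rightarrow> real^'d^'d) \<Rightarrow> real^'N \<Rightarrow> real" where
  "lam_minus M \<theta> = 1 / (\<Sum>i\<in>UNIV. \<theta> $ i / lambda_min (M i))"

definition lam_plus :: "('N \<Rightarrow> real^'d^'d) \<Rightarrow> real^'N \<Rightarrow> real" where
  "lam_plus M \<theta> = (\<Sum>i\<in>UNIV. \<theta> $ i * lambda_max (M i))"

definition admissible :: "(real^'d) set \<Rightarrow> ('N \<Rightarrow> real) \<Rightarrow> (real^'d \<Rightarrow> real^'N) set" where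
  "admissible \<Omega> q = {\<theta> \<in> Linf_into \<Omega> proportions. \<forall>i. (LINT x|lebesgue_on \<Omega>. \<theta> x $ i) = q i}"

definition composites ::
    "(real^'d) set \<Rightarrow> ('N \<Rightarrow> real^'d^'d) \<Rightarrow> real^'N \<Rightarrow> (real^'d^'d) set" where
  "composites \<Omega> M t = {A. \<exists>\<chi>' R \<theta> B z.
     (\<forall>n::nat. \<chi>' n \<in> Linf_into \<Omega> (range (\<lambda>i. axis i 1)) \<and>
               R n \<in> Linf_into \<Omega> {Q. rotation_matrix Q}) \<and>
     weakly_star_Linf \<Omega> \<chi>' \<theta> \<and>
     H_converges \<Omega>
       (\<lambda>n x. \<Sum>i\<in>UNIV. (\<chi>' n x $ i) *\<^sub>R (transpose (R n x) ** M i ** R n x)) B \<and>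
     lebesgue_point \<Omega> B z \<and> lebesgue_point \<Omega> \<theta> z \<and> A = B z \<and> t = \<theta> z}"

definition set_A ::
    "(real^'d) set \<Rightarrow> ('N \<Rightarrow> real^'d^'d) \<Rightarrow> ('N \<Rightarrow> real)
       \<Rightarrow> ((real^'d \<Rightarrow> real^'N) \<times> (real^'d \<Rightarrow> real^'d^'d)) set" where
  "set_A \<Omega> M q = {(\<theta>, A). \<theta> \<in> admissible \<Omega> q \<and> A \<in> Linf_into \<Omega> Sym \<and>
     (AE x in lebesgue_on \<Omega>. A x \<in> composites \<Omega> M (\<theta> x))}"

definition set_B ::
    "(real^'d) set \<Rightarrow> ('N \<Rightarrow> real^'d^'d) \<Rightarrow> ('N \<Rightarrow> real)
       \<Rightarrow> ((real^'d \<Rightarrow> real^'N) \<times> (real^'d \<Rightarrow> real^'d^'d)) set" where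
  "set_B \<Omega> M q = {(\<theta>, A). \<theta> \<in> admissible \<Omega> q \<and> A \<in> Linf_into \<Omega> Sym \<and>
     (AE x in lebesgue_on \<Omega>. loewner_le (lam_minus M (\<theta> x) *\<^sub>R mat 1) (A x) \<and>
                              loewner_le (A x) (lam_plus M (\<theta> x) *\<^sub>R mat 1))}"


section \<open>Functionals\<close>

text \<open>Solutions are unique up to null sets only, so one of them is chosen; \<open>J_cost\<close> does not depend on
  the choice.\<close>

definition state ::
    "(real^'d) set \<Rightarrow> (real^'d \<Rightarrow> real^'d^'d) \<Rightarrow> (real^'d \<Rightarrow> real) \<Rightarrow> real^'d \<Rightarrow> real" where
  "state \<Omega> A f = (SOME u. \<exists>G. dirichlet_solution \<Omega> A (L2_functional \<Omega> f) u G)"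

definition J_cost ::
    "(real^'d) set \<Rightarrow> ('m::finite \<Rightarrow> real) \<Rightarrow> ('m \<Rightarrow> real^'d \<Rightarrow> real)
       \<Rightarrow> (real^'d \<Rightarrow> real^'N) \<times> (real^'d \<Rightarrow> real^'d^'d) \<Rightarrow> real" where
  "J_cost \<Omega> \<mu> f = (\<lambda>(\<theta>, A). \<Sum>i\<in>UNIV. \<mu> i * (LINT x|lebesgue_on \<Omega>. f i x * state \<Omega> A (f i) x))"

definition I_cost ::
    "(real^'d) set \<Rightarrow> ('N \<Rightarrow> real^'d^'d) \<Rightarrow> ('m::finite \<Rightarrow> real) \<Rightarrow> ('m \<Rightarrow> real^'d \<Rightarrow> real)
       \<Rightarrow> (real^'d \<Rightarrow> real^'N) \<Rightarrow> real" where
  "I_cost \<Omega> M \<mu> f \<theta> = J_cost \<Omega> \<mu> f (\<theta>, \<lambda>x. lam_minus M (\<theta> x) *\<^sub>R mat 1)"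

definition fluxes ::
    "(real^'d) set \<Rightarrow> ('m \<Rightarrow> real^'d \<Rightarrow> real) \<Rightarrow> ('m \<Rightarrow> real^'d \<Rightarrow> real^'d) set" where
  "fluxes \<Omega> f = {\<sigma>. \<forall>i. \<sigma> i \<in> L2 \<Omega> \<and> neg_div_eq \<Omega> (\<sigma> i) (L2_functional \<Omega> (f i))}"

definition H_cost ::
    "(real^'d) set \<Rightarrow> ('N \<Rightarrow> real^'d^'d) \<Rightarrow> ('m::finite \<Rightarrow> real)
       \<Rightarrow> (real^'d \<Rightarrow> real^'N) \<Rightarrow> ('m \<Rightarrow> real^'d \<Rightarrow> real^'d) \<Rightarrow> real" where
  "H_cost \<Omega> M \<mu> \<theta> \<sigma> =
     (\<Sum>i\<in>UNIV. \<mu> i * (LINT x|lebesgue_on \<Omega>. (norm (\<sigma> i x))\<^sup>2 / lam_minus M (\<theta> x)))"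

definition saddle_point ::
    "(real^'d) set \<Rightarrow> ('N \<Rightarrow> real^'d^'d) \<Rightarrow> ('N \<Rightarrow> real) \<Rightarrow> ('m::finite \<Rightarrow> real)
       \<Rightarrow> ('m \<Rightarrow> real^'d \<Rightarrow> real)
       \<Rightarrow> (real^'d \<Rightarrow> real^'N) \<Rightarrow> ('m \<Rightarrow> real^'d \<Rightarrow> real^'d) \<Rightarrow> bool" where
  "saddle_point \<Omega> M q \<mu> f \<theta>s \<sigma>s \<longleftrightarrow> \<theta>s \<in> admissible \<Omega> q \<and> \<sigma>s \<in> fluxes \<Omega> f \<and>
     (\<forall>\<theta>\<in>admissible \<Omega> q. H_cost \<Omega> M \<mu> \<theta> \<sigma>s \<le> H_cost \<Omega> M \<mu> \<theta>s \<sigma>s) \<and>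
     (\<forall>\<sigma>\<in>fluxes \<Omega> f. H_cost \<Omega> M \<mu> \<theta>s \<sigma>s \<le> H_cost \<Omega> M \<mu> \<theta>s \<sigma>)"

definition optimal_flux ::
    "(real^'d) set \<Rightarrow> ('N::finite \<Rightarrow> real^'d^'d) \<Rightarrow> ('N \<Rightarrow> real) \<Rightarrow> ('m::finite \<Rightarrow> real)
       \<Rightarrow> ('m \<Rightarrow> real^'d \<Rightarrow> real) \<Rightarrow> ('m \<Rightarrow> real^'d \<Rightarrow> real^'d) \<Rightarrow> bool" where
  "optimal_flux \<Omega> M q \<mu> f \<sigma>s \<longleftrightarrow> (\<exists>\<theta>. saddle_point \<Omega> M q \<mu> f \<theta> \<sigma>s) \<and>
     (\<forall>\<theta> \<sigma>. saddle_point \<Omega> M q \<mu> f \<theta> \<sigma> \<longrightarrow>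
        (\<forall>i. AE x in lebesgue_on \<Omega>. \<sigma> i x = \<sigma>s i x))"


section \<open>Radial data and simple laminates\<close>

definition radial_flux :: "(real \<Rightarrow> real) \<Rightarrow> real^'d \<Rightarrow> real^'d" where
  "radial_flux g x =
     (- (1 / norm x ^ (CARD('d) - 1)) *
        (LINT \<rho>|lebesgue_on {0<..<norm x}. \<rho> ^ (CARD('d) - 1) * g \<rho>)) *\<^sub>R e_r x"

definition laminate_rotations ::
    "(real^'d) set \<Rightarrow> ('N \<Rightarrow> real^'d^'d) \<Rightarrow> ('N \<Rightarrow> real^'d \<Rightarrow> real^'d^'d) \<Rightarrow> bool" where
  "laminate_rotations \<Omega> M R \<longleftrightarrow> (\<forall>i. R i \<in> Linf_into \<Omega> {Q. rotation_matrix Q} \<and>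
     (AE x in lebesgue_on \<Omega>.
        eigenvector (transpose (R i x) ** M i ** R i x) (e_r x) (lambda_min (M i))))"

definition simple_laminate ::
    "('N \<Rightarrow> real^'d^'d) \<Rightarrow> ('N \<Rightarrow> real^'d \<Rightarrow> real^'d^'d) \<Rightarrow> (real^'d \<Rightarrow> real^'N)
       \<Rightarrow> real^'d \<Rightarrow> real^'d^'d" where
  "simple_laminate M R \<theta> x =
     lam_minus M (\<theta> x) *\<^sub>R tensor (e_r x) (e_r x) +
     (\<Sum>i\<in>UNIV. (\<theta> x $ i) *\<^sub>R
        (transpose (R i x) ** M i ** R i x - lambda_min (M i) *\<^sub>R tensor (e_r x) (e_r x)))"

end

theory Submission
  imports Defs
begin

text \<open>For radial \<open>\<theta>\<close> the fields \<open>\<sigma>\<^sub>i\<^sup>* / \<lambda>\<^sub>-(\<theta>)\<close> are of the form \<open>h(r) e\<^sub>r\<close>, hence orthogonal in \<open>L\<^sup>2\<close> to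
  every divergence-free field, so that \<open>\<sigma>\<^sup>*\<close> is the unique minimizer of \<open>H(\<theta>, \<cdot>)\<close>.  A radial maximizer of
  \<open>H(\<cdot>, \<sigma>\<^sup>*)\<close> exists by the bathtub principle, because its integrand is radial; together they form a saddle
  point.  If \<open>A \<ge> \<lambda>\<^sub>-(\<theta>) I\<close>, testing the equation with \<open>\<sigma>\<^sup>*\<close> and completing the square gives
  \<open>J(\<theta>, A) \<le> H(\<theta>, \<sigma>\<^sup>*)\<close>, with equality if \<open>\<theta>\<close> is radial and \<open>A e\<^sub>r = \<lambda>\<^sub>-(\<theta>) e\<^sub>r\<close>.  That composites satisfy
  the lower bound follows from the energies of oscillating test functions, and simple laminates are composites
  because the \<open>H\<close>-limit of a layered material is explicit.\<close>

section \<open>Square-integrable functions\<close>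

text \<open>Three obstacles shape the argument. A radial field h(r) e_r is the gradient of a radial
  potential, but that potential may be unbounded at the origin. Orthogonality to divergence-free
  fields is therefore derived from smooth functions of |x|^2 and from the image of Lebesgue measure
  under the norm, without forming the potential. Next, a saddle point may a priori carry non-radial
  proportions, while minimality of the explicit flux is available only for radial ones; uniqueness
  comes from pairing an arbitrary saddle flux with the radial maximizer. Finally, composites are
  defined through Lebesgue points of arbitrary H-limits. The lower bound must be localized from
  integrals to such points. Membership of a laminate, on the other hand, is a question about a
  single point, so normal, rotations and proportions can be frozen there, and a periodic layering of
  the whole domain with a constant H-limit is enough. Throughout, 1 / \<lambda>_- is linear in the
  proportions, which is what makes it compatible with weak-star limits.\<close>

lemmas lint_cong = Bochner_Integration.integral_cong
 and L1_bound = Bochner_Integration.integrable_bound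
 and lint_diff = Bochner_Integration.integral_diff
 and lint_sum = Bochner_Integration.integral_sum
 and lint_nonneg = Bochner_Integration.integral_nonneg
 and lint_add = Bochner_Integration.integral_add
 and L1_sum = Bochner_Integration.integrable_sum
 and L1_diff = Bochner_Integration.integrable_diff

lemma L2_D:
 assumes "f \<in> L2 X"
 shows "f \<in> borel_measurable (lebesgue_on X)" "integrable (lebesgue_on X) (\<lambda>x. (norm (f x))^2)"
 using assms by (auto simp: L2_def)

lemma L2_bound:
 fixes f :: "'a::euclidean_space \<Rightarrow> 'b::euclidean_space" and g :: "'a \<Rightarrow> 'c::euclidean_space"
 assumes "f \<in> borel_measurable (lebesgue_on X)" "g \<in> L2 X"
  and "AE x in lebesgue_on X. norm (f x) \<le> norm (g x)"
 shows "f \<in> L2 X"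
proof -
 have "integrable (lebesgue_on X) (\<lambda>x. (norm (f x))^2)"
  by (rule L1_bound[OF L2_D(2)[OF assms(2)]])
   (use assms in \<open>auto intro!: power_mono elim!: eventually_mono\<close>)
 then show ?thesis using assms(1) by (simp add: L2_def)
qed

lemma L2_scaleR [intro]:
 "f \<in> L2 X ==> (\<lambda>x. c *\<^sub>R f x) \<in> L2 X"
 by (auto simp: L2_def power_mult_distrib)

lemma L2_uminus [intro]: "f \<in> L2 X ==> (\<lambda>x. - f x) \<in> L2 X"
 by (auto simp: L2_def)

lemma norm_add_sq_le: "(norm (a + b))^2 \<le> 2 * (norm a)^2 + 2 * (norm (b::'a::real_inner))^2"
proof -
 have "(norm (a + b))^2 \<le> (norm a + norm b)^2" by (intro power_mono norm_triangle_ineq) auto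
 also have "\<dots> \<le> 2 * (norm a)^2 + 2 * (norm b)^2"
  using zero_le_power2[of "norm a - norm b"] by (simp add: power2_eq_square algebra_simps)
 finally show ?thesis .
qed

lemma norm_add_sq: "(norm (a + b))^2 = (norm a)^2 + 2 * (a \<bullet> b) + (norm (b::'a::real_inner))^2"
 unfolding power2_norm_eq_inner by (simp add: inner_add inner_commute)

lemma L2_add [intro]:
 assumes "f \<in> L2 X" "g \<in> L2 X" shows "(\<lambda>x. f x + g x) \<in> L2 X"
proof -
 have "integrable (lebesgue_on X) (\<lambda>x. (norm (f x + g x))^2)"
  by (rule L1_bound[of _ "\<lambda>x. 2 * (norm (f x))^2 + 2 * (norm (g x))^2"])
   (use assms[THEN L2_D(1)] assms[THEN L2_D(2)] norm_add_sq_le in auto)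
 then show ?thesis using assms by (auto simp: L2_def)
qed

lemma L2_diff [intro]:
 "f \<in> L2 X ==> g \<in> L2 X ==> (\<lambda>x. f x - g x) \<in> L2 X"
 using L2_add[of f X "\<lambda>x. - g x"] by (auto simp: L2_uminus)

lemma L2_zero [simp, intro]: "(\<lambda>x. 0) \<in> L2 X"
 by (auto simp: L2_def)

lemma L2_sum [intro]:
 "(\<And>i. i \<in> I ==> f i \<in> L2 X) ==> (\<lambda>x. \<Sum>i\<in>I. f i x) \<in> L2 X"
 by (induction I rule: infinite_finite_induct) auto

lemma L2_norm_mult_integrable:
 assumes "f \<in> L2 X" "g \<in> L2 X"
 shows "integrable (lebesgue_on X) (\<lambda>x. norm (f x) * norm (g x))"
proof (rule L1_bound[of _ "\<lambda>x. (norm (f x))^2 + (norm (g x))^2"])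
 have "norm (f x) * norm (g x) \<le> (norm (f x))^2 + (norm (g x))^2" for x
  using sum_squares_bound[of "norm (f x)" "norm (g x)"] mult_nonneg_nonneg[OF norm_ge_zero[of "f x"] norm_ge_zero[of "g x"]]
  by linarith
 then show "AE x in lebesgue_on X. norm (norm (f x) * norm (g x)) \<le> norm ((norm (f x))^2 + (norm (g x))^2)"
  by simp
qed (use assms[THEN L2_D(1)] assms[THEN L2_D(2)] in auto)

lemma L2_inner_integrable:
 assumes "f \<in> L2 X" "g \<in> L2 X"
 shows "integrable (lebesgue_on X) (\<lambda>x. f x \<bullet> g x)"
 by (rule L1_bound[OF L2_norm_mult_integrable[OF assms]])
  (use assms[THEN L2_D(1)] in \<open>auto simp: Cauchy_Schwarz_ineq2\<close>)

lemma L2_mult_integrable: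
 fixes f :: "'a::euclidean_space \<Rightarrow> real"
 assumes "f \<in> L2 X" "g \<in> L2 X"
 shows "integrable (lebesgue_on X) (\<lambda>x. f x * g x)"
 using L2_inner_integrable[OF assms] by simp

lemma L2_scaleR_integrable:
 fixes f :: "'a::euclidean_space \<Rightarrow> real"
 assumes "f \<in> L2 X" "g \<in> L2 X"
 shows "integrable (lebesgue_on X) (\<lambda>x. f x *\<^sub>R g x)"
 by (rule L1_bound[OF L2_norm_mult_integrable[OF assms]])
  (use assms[THEN L2_D(1)] in auto)

lemma L2_bounded_mult:
 fixes f :: "'a::euclidean_space \<Rightarrow> real" and g :: "'a \<Rightarrow> 'b::euclidean_space"
 assumes "f \<in> borel_measurable (lebesgue_on X)" "AE x in lebesgue_on X. \<bar>f x\<bar> \<le> C" "g \<in> L2 X"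
 shows "(\<lambda>x. f x *\<^sub>R g x) \<in> L2 X"
proof (rule L2_bound[OF _ L2_scaleR[OF assms(3), of C]])
 show "AE x in lebesgue_on X. norm (f x *\<^sub>R g x) \<le> norm (C *\<^sub>R g x)"
  using assms(2) by eventually_elim (auto intro!: mult_right_mono)
qed (use assms L2_D(1)[OF assms(3)] in auto)

section \<open>The L2 norm and the Cauchy-Schwarz inequality\<close>

definition l2norm :: "'a::euclidean_space set \<Rightarrow> ('a \<Rightarrow> 'b::euclidean_space) \<Rightarrow> real" where
 "l2norm X f = sqrt (LINT x|lebesgue_on X. (norm (f x))^2)"

lemma l2norm_ge0 [simp]: "0 \<le> l2norm X f"
 by (simp add: l2norm_def)

lemma l2norm_sq: "(l2norm X f)^2 = (LINT x|lebesgue_on X. (norm (f x))^2)"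
 by (simp add: l2norm_def)

lemma l2norm_norm: "l2norm X (\<lambda>x. norm (f x)) = l2norm X f"
 by (simp add: l2norm_def)

lemma L2_norm: "f \<in> L2 X ==> (\<lambda>x. norm (f x)) \<in> L2 X"
 by (auto simp: L2_def)

lemma l2_cauchy_schwarz:
 assumes "f \<in> L2 X" "g \<in> L2 X"
 shows "\<bar>LINT x|lebesgue_on X. f x \<bullet> g x\<bar> \<le> l2norm X f * l2norm X g"
proof -
 let ?X = "LINT x|lebesgue_on X. (norm (f x))^2" let ?Y = "LINT x|lebesgue_on X. (norm (g x))^2"
 let ?Z = "LINT x|lebesgue_on X. f x \<bullet> g x"
 note i = L2_D(2)[OF assms(1)] L2_D(2)[OF assms(2)] L2_inner_integrable[OF assms]
 have q: "0 \<le> t^2 * ?X + 2 * t * ?Z + ?Y" for t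
 proof -
  have "0 \<le> (LINT x|lebesgue_on X. (norm (t *\<^sub>R f x + g x))^2)" by simp
  also have "(\<lambda>x. (norm (t *\<^sub>R f x + g x))^2) = (\<lambda>x. t^2 * (norm (f x))^2 + 2 * t * (f x \<bullet> g x) + (norm (g x))^2)"
   by (simp add: norm_add_sq power_mult_distrib mult.assoc)
  also have "(LINT x|lebesgue_on X. t^2 * (norm (f x))^2 + 2 * t * (f x \<bullet> g x) + (norm (g x))^2)
    = t^2 * ?X + 2 * t * ?Z + ?Y"
   using i by simp
  finally show ?thesis .
 qed
 have X0: "0 \<le> ?X" by simp
 have "?Z^2 \<le> ?X * ?Y"
 proof (cases "?X = 0")
  case True
  have "?Z = 0"
  proof (rule ccontr)
   assume "?Z \<noteq> 0"
   \<comment> \<open>With \<open>?X = 0\<close> the quadratic in t degenerates to an affine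
     function, and this t gives it the value -1.\<close>
   then show False using q[of "-(?Y + 1) / (2 * ?Z)"] True by (simp add: field_simps)
  qed
  then show ?thesis using True by simp
 next
  case False
  then have "0 \<le> ?X * ((- ?Z / ?X)\<^sup>2 * ?X + 2 * (- ?Z / ?X) * ?Z + ?Y)" using X0 by (intro mult_nonneg_nonneg q)
  also have "\<dots> = ?X * ?Y - ?Z^2" using False by (simp add: field_simps power2_eq_square)
  finally show ?thesis by simp
 qed
 then have "sqrt (?Z^2) \<le> sqrt (?X * ?Y)" by (rule real_sqrt_le_mono)
 then show ?thesis by (simp add: l2norm_def real_sqrt_mult)
qed

lemma l2_cauchy_schwarz_mult:
 fixes f :: "'a::euclidean_space \<Rightarrow> real"
 assumes "f \<in> L2 X" "g \<in> L2 X"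
 shows "\<bar>LINT x|lebesgue_on X. f x * g x\<bar> \<le> l2norm X f * l2norm X g"
 using l2_cauchy_schwarz[OF assms] by simp

lemma l2norm_scaleR: "l2norm X (\<lambda>x. c *\<^sub>R f x) = \<bar>c\<bar> * l2norm X f"
 by (simp add: l2norm_def power_mult_distrib real_sqrt_mult)

lemma l2norm_minus: "l2norm X (\<lambda>x. - f x) = l2norm X f"
 by (simp add: l2norm_def)

lemma l2norm_minus_commute: "l2norm X (\<lambda>x. f x - g x) = l2norm X (\<lambda>x. g x - f x)"
 by (simp add: l2norm_def norm_minus_commute)

lemma l2norm_add_sq:
 assumes "f \<in> L2 X" "g \<in> L2 X"
 shows "(l2norm X (\<lambda>x. f x + g x))^2 = (l2norm X f)^2 + 2 * (LINT x|lebesgue_on X. f x \<bullet> g x) + (l2norm X g)^2"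
proof -
 note i = L2_D(2)[OF assms(1)] L2_D(2)[OF assms(2)] L2_inner_integrable[OF assms]
 have "(\<lambda>x. (norm (f x + g x))^2) = (\<lambda>x. (norm (f x))^2 + 2 * (f x \<bullet> g x) + (norm (g x))^2)"
  by (simp add: norm_add_sq)
 then show ?thesis using i by (simp add: l2norm_sq)
qed

lemma l2norm_triangle:
 assumes "f \<in> L2 X" "g \<in> L2 X"
 shows "l2norm X (\<lambda>x. f x + g x) \<le> l2norm X f + l2norm X g"
proof (rule power2_le_imp_le)
 show "(l2norm X (\<lambda>x. f x + g x))^2 \<le> (l2norm X f + l2norm X g)^2"
  using l2_cauchy_schwarz[OF assms] l2norm_add_sq[OF assms] by (simp add: power2_sum abs_le_iff)
qed simp

lemma l2norm_triangle_diff: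
 assumes "f \<in> L2 X" "g \<in> L2 X" "h \<in> L2 X"
 shows "l2norm X (\<lambda>x. f x - h x) \<le> l2norm X (\<lambda>x. f x - g x) + l2norm X (\<lambda>x. g x - h x)"
 using l2norm_triangle[of "\<lambda>x. f x - g x" X "\<lambda>x. g x - h x"] assms by (auto simp: L2_diff)

lemma l2norm_mono:
 fixes f :: "'a::euclidean_space \<Rightarrow> 'b::euclidean_space" and g :: "'a \<Rightarrow> 'c::euclidean_space"
 assumes "f \<in> L2 X" "g \<in> L2 X" "AE x in lebesgue_on X. norm (f x) \<le> norm (g x)"
 shows "l2norm X f \<le> l2norm X g"
 unfolding l2norm_def
 by (intro real_sqrt_le_mono integral_mono_AE L2_D(2)[OF assms(1)] L2_D(2)[OF assms(2)])
  (use assms(3) in \<open>auto elim!: eventually_mono intro!: power_mono\<close>)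

lemma l2norm_eq_0_iff:
 assumes "f \<in> L2 X"
 shows "l2norm X f = 0 \<longleftrightarrow> (AE x in lebesgue_on X. f x = 0)"
 using integral_nonneg_eq_0_iff_AE[OF L2_D(2)[OF assms]] by (simp add: l2norm_def)

lemma l2norm_cong_AE:
 assumes "AE x in lebesgue_on X. f x = g x" "f \<in> L2 X" "g \<in> L2 X"
 shows "l2norm X f = l2norm X g"
 by (rule antisym; rule l2norm_mono) (use assms in \<open>auto elim!: eventually_mono\<close>)

section \<open>Strong convergence in L2\<close>

definition l2_lim :: "'a::euclidean_space set \<Rightarrow> (nat \<Rightarrow> 'a \<Rightarrow> 'b::euclidean_space) \<Rightarrow> ('a \<Rightarrow> 'b) \<Rightarrow> bool" where
 "l2_lim X f g \<longleftrightarrow> (\<forall>n. f n \<in> L2 X) \<and> g \<in> L2 X \<and> (\<lambda>n. l2norm X (\<lambda>x. f n x - g x)) \<longlonglongrightarrow> 0"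

lemma l2_lim_D:
 assumes "l2_lim X f g"
 shows "f n \<in> L2 X" "g \<in> L2 X" "(\<lambda>n. l2norm X (\<lambda>x. f n x - g x)) \<longlonglongrightarrow> 0"
 using assms by (auto simp: l2_lim_def)

lemma l2_lim_norm:
 assumes "l2_lim X f g"
 shows "(\<lambda>n. l2norm X (f n)) \<longlonglongrightarrow> l2norm X g"
proof -
 note D = l2_lim_D[OF assms]
 have "\<bar>l2norm X (f n) - l2norm X g\<bar> \<le> l2norm X (\<lambda>x. f n x - g x)" for n
  using l2norm_triangle_diff[OF D(1,2) L2_zero, of n] l2norm_triangle_diff[OF D(2,1) L2_zero, of n]
   l2norm_minus_commute[of X "f n" g] by simp
 then have "(\<lambda>n. l2norm X (f n) - l2norm X g) \<longlonglongrightarrow> 0"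
  by (intro tendsto_0_le[OF D(3), where K=1]) (auto simp: eventually_sequentially)
 then show ?thesis by (simp add: LIM_zero_cancel)
qed

lemma l2_lim_inner:
 assumes "l2_lim X f f'" "l2_lim X g g'"
 shows "(\<lambda>n. LINT x|lebesgue_on X. f n x \<bullet> g n x) \<longlonglongrightarrow> (LINT x|lebesgue_on X. f' x \<bullet> g' x)"
proof -
 note F = l2_lim_D[OF assms(1)] and G = l2_lim_D[OF assms(2)]
 have le: "\<bar>(LINT x|lebesgue_on X. f n x \<bullet> g n x) - (LINT x|lebesgue_on X. f' x \<bullet> g' x)\<bar>
   \<le> l2norm X (\<lambda>x. f n x - f' x) * l2norm X (g n) + l2norm X f' * l2norm X (\<lambda>x. g n x - g' x)" (is "?l n \<le> ?r n") for n
 proof -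
  have "(LINT x|lebesgue_on X. f n x \<bullet> g n x) - (LINT x|lebesgue_on X. f' x \<bullet> g' x)
   = (LINT x|lebesgue_on X. (f n x - f' x) \<bullet> g n x) + (LINT x|lebesgue_on X. f' x \<bullet> (g n x - g' x))"
   using F(1,2) G(1,2) by (simp add: inner_diff_left inner_diff_right L2_inner_integrable)
  moreover have "\<bar>LINT x|lebesgue_on X. (f n x - f' x) \<bullet> g n x\<bar> \<le> l2norm X (\<lambda>x. f n x - f' x) * l2norm X (g n)"
   "\<bar>LINT x|lebesgue_on X. f' x \<bullet> (g n x - g' x)\<bar> \<le> l2norm X f' * l2norm X (\<lambda>x. g n x - g' x)"
   using F(1,2) G(1,2) by (intro l2_cauchy_schwarz; auto)+
  ultimately show ?thesis by linarith
 qed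
 have "?r \<longlonglongrightarrow> 0 * l2norm X g' + l2norm X f' * 0"
  by (intro tendsto_intros F(3) G(3) l2_lim_norm[OF assms(2)])
 then have r: "?r \<longlonglongrightarrow> 0" by simp
 have "(\<lambda>n. (LINT x|lebesgue_on X. f n x \<bullet> g n x) - (LINT x|lebesgue_on X. f' x \<bullet> g' x)) \<longlonglongrightarrow> 0"
  by (rule Lim_null_comparison[OF _ r]) (simp add: le)
 then show ?thesis by (simp add: LIM_zero_cancel)
qed

lemma l2_lim_const: "g \<in> L2 X ==> l2_lim X (\<lambda>n. g) g"
 by (auto simp: l2_lim_def l2norm_def)

lemma l2_lim_inner_left:
 assumes "l2_lim X f f'" "g \<in> L2 X"
 shows "(\<lambda>n. LINT x|lebesgue_on X. f n x \<bullet> g x) \<longlonglongrightarrow> (LINT x|lebesgue_on X. f' x \<bullet> g x)"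
  "(\<lambda>n. LINT x|lebesgue_on X. g x \<bullet> f n x) \<longlonglongrightarrow> (LINT x|lebesgue_on X. g x \<bullet> f' x)"
 using l2_lim_inner[OF assms(1) l2_lim_const[OF assms(2)]] by (auto simp: inner_commute)

text \<open>Transfers L2 convergence through pointwise operations that share a Lipschitz constant,
  such as an inner product with a fixed vector or a bounded matrix field. The constant is not
  assumed to be nonnegative, whence its absolute value in the estimates.\<close>

lemma l2_lim_bounded_linear:
 assumes "l2_lim X f g" "\<And>n. F n \<in> borel_measurable (lebesgue_on X)" "G \<in> borel_measurable (lebesgue_on X)"
  "AE x in lebesgue_on X. norm (G x) \<le> C * norm (g x)"
  "\<And>n. AE x in lebesgue_on X. norm (F n x - G x) \<le> C * norm (f n x - g x)"
 shows "l2_lim X F G"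
proof -
 note D = l2_lim_D[OF assms(1)]
 have G: "G \<in> L2 X"
  by (rule L2_bound[OF assms(3) L2_scaleR[OF D(2), of C]])
   (use assms(4) in eventually_elim, simp, meson abs_ge_self mult_right_mono norm_ge_zero order_trans)
 have FG: "(\<lambda>x. F n x - G x) \<in> L2 X" and AE: "AE x in lebesgue_on X. norm (F n x - G x) \<le> norm (C *\<^sub>R (f n x - g x))" for n
 proof -
  show *: "AE x in lebesgue_on X. norm (F n x - G x) \<le> norm (C *\<^sub>R (f n x - g x))"
   using assms(5)[of n] by eventually_elim (simp, meson abs_ge_self mult_right_mono norm_ge_zero order_trans)
  show "(\<lambda>x. F n x - G x) \<in> L2 X"
   by (rule L2_bound[OF _ L2_scaleR[OF L2_diff[OF D(1) D(2), of n], of C] *]) (use assms(2,3) in auto)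
 qed
 have F: "F n \<in> L2 X" for n using L2_add[OF FG[of n] G] by simp
 have "l2norm X (\<lambda>x. F n x - G x) \<le> l2norm X (\<lambda>x. f n x - g x) * \<bar>C\<bar>" for n
  using l2norm_mono[OF FG L2_scaleR[OF L2_diff[OF D(1) D(2), of n], of C] AE] by (simp add: l2norm_scaleR mult.commute)
 then have "(\<lambda>n. l2norm X (\<lambda>x. F n x - G x)) \<longlonglongrightarrow> 0"
  by (intro tendsto_0_le[OF D(3), where K="\<bar>C\<bar>"]) (auto simp: eventually_sequentially)
 then show ?thesis using F G by (auto simp: l2_lim_def)
qed

lemma l2_lim_dominated:
 assumes "\<And>n. f n \<in> borel_measurable (lebesgue_on X)" "g \<in> borel_measurable (lebesgue_on X)" "h \<in> L2 X"
  "\<And>n. AE x in lebesgue_on X. norm (f n x) \<le> norm (h x)"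
  "AE x in lebesgue_on X. (\<lambda>n. f n x) \<longlonglongrightarrow> g x"
 shows "l2_lim X f g"
proof -
 have all: "AE x in lebesgue_on X. \<forall>n. norm (f n x) \<le> norm (h x)" using assms(4) by (simp add: AE_all_countable)
 have ng: "AE x in lebesgue_on X. norm (g x) \<le> norm (h x)"
  using all assms(5)
  by eventually_elim (rule Lim_norm_ubound[of sequentially], auto)
 have f: "f n \<in> L2 X" for n by (rule L2_bound[OF assms(1,3,4)])
 have g: "g \<in> L2 X" by (rule L2_bound[OF assms(2,3) ng])
 have "(\<lambda>n. LINT x|lebesgue_on X. (norm (f n x - g x))^2) \<longlonglongrightarrow> (LINT x|lebesgue_on X. 0)"
 \<comment> \<open>Both terms are dominated by h, so |f_n - g|^2 is at most 2 |h|^2 + 2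
   |h|^2.\<close>
 proof (rule integral_dominated_convergence[where w="\<lambda>x. 4 * (norm (h x))^2"])
  show "AE x in lebesgue_on X. (\<lambda>i. (norm (f i x - g x))^2) \<longlonglongrightarrow> 0"
   using assms(5) by eventually_elim (auto intro!: tendsto_eq_intros simp: LIM_zero)
  fix n
  show "AE x in lebesgue_on X. norm ((norm (f n x - g x))^2) \<le> 4 * (norm (h x))^2"
   using assms(4)[of n] ng
  proof eventually_elim
   case (elim x)
   then have "(norm (f n x))^2 \<le> (norm (h x))^2" "(norm (g x))^2 \<le> (norm (h x))^2" by (auto intro: power_mono)
   moreover have "norm ((norm (f n x - g x))^2) = (norm (f n x - g x))^2" by simp
   moreover have "(norm (f n x - g x))^2 \<le> 2 * (norm (f n x))^2 + 2 * (norm (g x))^2"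
    using norm_add_sq_le[of "f n x" "- g x"] by simp
   ultimately show ?case by linarith
  qed
 qed (use assms(1,2) L2_D(2)[OF assms(3)] in auto)
 then have "(\<lambda>n. l2norm X (\<lambda>x. f n x - g x)) \<longlonglongrightarrow> 0"
  unfolding l2norm_def by (auto intro!: tendsto_eq_intros)
 then show ?thesis using f g by (simp add: l2_lim_def)
qed

lemma L2_const: "X \<in> lmeasurable ==> (\<lambda>x. c) \<in> L2 X"
 unfolding L2_def using finite_measure_lebesgue_on by (auto intro: finite_measure.integrable_const)

lemma L2_bounded:
 fixes f :: "'a::euclidean_space \<Rightarrow> 'b::euclidean_space"
 assumes "X \<in> lmeasurable" "f \<in> borel_measurable (lebesgue_on X)" "AE x in lebesgue_on X. norm (f x) \<le> C"
 shows "f \<in> L2 X"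
 by (rule L2_bound[OF assms(2) L2_const[OF assms(1), of C]]) (use assms(3) in \<open>auto elim: eventually_mono\<close>)

lemma L2_imp_integrable:
 assumes "X \<in> lmeasurable" "f \<in> L2 X"
 shows "integrable (lebesgue_on X) f"
 using L2_scaleR_integrable[OF L2_const[OF assms(1), of "1::real"] assms(2)] by simp

text \<open>Riesz-Fischer on a set of finite measure: an L2-Cauchy sequence is L1-Cauchy, so a
  subsequence converges almost everywhere, and Fatou's lemma along this subsequence bounds the L2
  distance of every late term to the pointwise limit.\<close>

lemma l2_complete:
 fixes f :: "nat \<Rightarrow> 'a::euclidean_space \<Rightarrow> 'b::euclidean_space"
 assumes fin: "X \<in> lmeasurable" and f: "\<And>n. f n \<in> L2 X"
  and C: "\<And>e. e > 0 ==> \<exists>N. \<forall>m\<ge>N. \<forall>n\<ge>N. l2norm X (\<lambda>x. f m x - f n x) < e"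
 obtains g where "l2_lim X f g"
proof -
 let ?M = "lebesgue_on X" let ?c = "l2norm X (\<lambda>x. 1::real)"
 have L1: "\<exists>N. \<forall>i\<ge>N. \<forall>j\<ge>N. (LINT x|?M. norm (f i x - f j x)) < e" if e0: "e > 0" for e
 proof -
  have c: "0 < ?c + 1" using l2norm_ge0[of X "\<lambda>x. 1::real"] by linarith
  obtain N where N: "\<forall>m\<ge>N. \<forall>n\<ge>N. l2norm X (\<lambda>x. f m x - f n x) < e / (?c + 1)"
   using C[OF divide_pos_pos[OF e0 c]] by blast
  have "(LINT x|?M. norm (f i x - f j x)) < e" if "i \<ge> N" "j \<ge> N" for i j
  proof -
   have "(LINT x|?M. norm (f i x - f j x) * 1) \<le> l2norm X (\<lambda>x. f i x - f j x) * ?c"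
    using l2_cauchy_schwarz_mult[OF L2_norm[OF L2_diff[OF f f]] L2_const[OF fin], of i j 1]
    by (simp add: l2norm_norm)
   also have "\<dots> \<le> l2norm X (\<lambda>x. f i x - f j x) * (?c + 1)" by (simp add: mult_left_mono)
   also have "\<dots> < e" using N that c e0 by (simp add: pos_less_divide_eq)
   finally show ?thesis by simp
  qed
  then show ?thesis by blast
 qed
 obtain r where r: "strict_mono r" "AE x in ?M. Cauchy (\<lambda>i. f (r i) x)"
  using cauchy_L1_AE_cauchy_subseq[OF L2_imp_integrable[OF fin f] L1] by blast
 define g where "g x = lim (\<lambda>i. f (r i) x)" for x
 have gm[measurable]: "g \<in> borel_measurable ?M"
  unfolding g_def by (intro borel_measurable_lim_metric L2_D(1)[OF f])
 note [measurable] = L2_D(1)[OF f]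
 have lim: "AE x in ?M. (\<lambda>i. f (r i) x) \<longlonglongrightarrow> g x"
  using r(2) by eventually_elim (simp add: g_def Cauchy_convergent_iff convergent_LIMSEQ_iff)
 have key: "(\<integral>\<^sup>+x. ennreal ((norm (f n x - g x))^2) \<partial>?M) \<le> ennreal (e^2)"
  if N: "\<forall>m\<ge>N. \<forall>n\<ge>N. l2norm X (\<lambda>x. f m x - f n x) < e" and n: "n \<ge> N" for e N n
 proof -
  have "(\<integral>\<^sup>+x. ennreal ((norm (f n x - g x))^2) \<partial>?M) = (\<integral>\<^sup>+x. liminf (\<lambda>i. ennreal ((norm (f n x - f (r i) x))^2)) \<partial>?M)"
  proof (rule nn_integral_cong_AE, use lim in eventually_elim)
   case (elim x)
   have "(\<lambda>i. ennreal ((norm (f n x - f (r i) x))^2)) \<longlonglongrightarrow> ennreal ((norm (f n x - g x))^2)"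
    by (intro tendsto_intros elim)
   from lim_imp_Liminf[OF _ this] show ?case by simp
  qed
  also have "\<dots> \<le> liminf (\<lambda>i. \<integral>\<^sup>+x. ennreal ((norm (f n x - f (r i) x))^2) \<partial>?M)"
   by (rule nn_integral_liminf) simp
  also have "\<dots> \<le> ennreal (e^2)"
  proof (rule Liminf_le)
   show "\<forall>\<^sub>F i in sequentially. (\<integral>\<^sup>+x. ennreal ((norm (f n x - f (r i) x))^2) \<partial>?M) \<le> ennreal (e^2)"
    unfolding eventually_sequentially
   proof (intro exI[of _ N] allI impI)
    fix i assume "i \<ge> N"
    then have "l2norm X (\<lambda>x. f n x - f (r i) x) \<le> e" using N n seq_suble[OF r(1), of i]
     by (simp add: less_imp_le)
    then have "(l2norm X (\<lambda>x. f n x - f (r i) x))^2 \<le> e^2" by (simp add: power_mono)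
    then show "(\<integral>\<^sup>+x. ennreal ((norm (f n x - f (r i) x))^2) \<partial>?M) \<le> ennreal (e^2)"
     using L2_D(2)[OF L2_diff[OF f f], of n "r i"] by (simp add: nn_integral_eq_integral l2norm_sq ennreal_leI)
   qed
  qed simp
  finally show ?thesis .
 qed
 have L2d: "(\<lambda>x. f n x - g x) \<in> L2 X \<and> l2norm X (\<lambda>x. f n x - g x) \<le> e"
  if "\<forall>m\<ge>N. \<forall>n\<ge>N. l2norm X (\<lambda>x. f m x - f n x) < e" "n \<ge> N" "e > 0" for e N n
 proof -
  note k = key[OF that(1,2)]
  have "integrable ?M (\<lambda>x. (norm (f n x - g x))^2)"
   by (rule integrableI_bounded) (use k in \<open>auto simp: le_less_trans\<close>)
  moreover from this k have "(LINT x|?M. (norm (f n x - g x))^2) \<le> e^2"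
   by (simp add: nn_integral_eq_integral)
  ultimately show ?thesis using that(3) real_sqrt_le_mono[of _ "e^2"] unfolding L2_def l2norm_def by fastforce
 qed
 have gL: "g \<in> L2 X"
 proof -
  obtain N where N: "\<forall>m\<ge>N. \<forall>n\<ge>N. l2norm X (\<lambda>x. f m x - f n x) < 1" using C[of 1] by auto
  show ?thesis using L2_diff[OF f[of N] conjunct1[OF L2d[OF N order_refl]]] by simp
 qed
 have "(\<lambda>n. l2norm X (\<lambda>x. f n x - g x)) \<longlonglongrightarrow> 0"
 proof (rule LIMSEQ_I)
  fix e :: real assume "e > 0"
  then obtain N where N: "\<forall>m\<ge>N. \<forall>n\<ge>N. l2norm X (\<lambda>x. f m x - f n x) < e/2" using C[of "e/2"] by auto
  then show "\<exists>no. \<forall>n\<ge>no. norm (l2norm X (\<lambda>x. f n x - g x) - 0) < e"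
   using L2d[OF N] \<open>e > 0\<close> by (intro exI[of _ N]) fastforce
 qed
 then show thesis using that f gL by (auto simp: l2_lim_def)
qed

section \<open>Smooth functions and test functions\<close>

text \<open>Replaces the Frechet derivative of the definition by an arbitrary witness, so that
  closure properties follow by exhibiting a derivative. The defining equation is withdrawn from the
  simplifier in favour of this form.\<close>

lemma C_k_Suc_iff:
 "C_k (Suc k) f \<longleftrightarrow> (\<exists>f'. (\<forall>x. (f has_derivative f' x) (at x)) \<and> (\<forall>v. C_k k (\<lambda>x. f' x v)))"
proof
 assume "C_k (Suc k) f"
 then show "\<exists>f'. (\<forall>x. (f has_derivative f' x) (at x)) \<and> (\<forall>v. C_k k (\<lambda>x. f' x v))"
  by (intro exI[of _ "\<lambda>x. frechet_derivative f (at x)"]) (simp add: frechet_derivative_works)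
next
 assume "\<exists>f'. (\<forall>x. (f has_derivative f' x) (at x)) \<and> (\<forall>v. C_k k (\<lambda>x. f' x v))"
 then obtain f' where f': "\<And>x. (f has_derivative f' x) (at x)" "\<And>v. C_k k (\<lambda>x. f' x v)" by blast
 have "frechet_derivative f (at x) = f' x" for x using frechet_derivative_at[OF f'(1)] by simp
 then show "C_k (Suc k) f" using f' by (auto simp: differentiable_def)
qed

declare C_k.simps(2) [simp del]

lemma C_k_Suc_D:
 assumes "C_k (Suc k) f"
 shows "C_k k f"
 using assms
proof (induction k arbitrary: f)
 case 0
 then show ?case
  unfolding C_k_Suc_iff by (metis C_k.simps(1) continuous_at_imp_continuous_on has_derivative_continuous)
next
 case (Suc k)
 then show ?case unfolding C_k_Suc_iff[of "Suc k"] C_k_Suc_iff[of k] by blast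
qed

lemma C_k_const: "C_k k (\<lambda>x. c)"
proof (induction k arbitrary: c)
 case (Suc k)
 then show ?case unfolding C_k_Suc_iff by (intro exI[of _ "\<lambda>x v. 0"]) auto
qed auto

lemma C_k_inner: "C_k k (\<lambda>x. x \<bullet> a)"
proof (cases k)
 case (Suc j)
 then show ?thesis unfolding Suc C_k_Suc_iff
  by (intro exI[of _ "\<lambda>x v. v \<bullet> a"]) (auto simp: C_k_const intro!: derivative_eq_intros)
qed (auto intro: continuous_intros)

lemma C_k_add:
 assumes "C_k k f" "C_k k g"
 shows "C_k k (\<lambda>x. f x + g x)"
 using assms
proof (induction k arbitrary: f g)
 case (Suc k)
 obtain f' where f': "\<And>x. (f has_derivative f' x) (at x)" "\<And>v. C_k k (\<lambda>x. f' x v)"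
  using Suc.prems(1) unfolding C_k_Suc_iff by blast
 obtain g' where g': "\<And>x. (g has_derivative g' x) (at x)" "\<And>v. C_k k (\<lambda>x. g' x v)"
  using Suc.prems(2) unfolding C_k_Suc_iff by blast
 show ?case unfolding C_k_Suc_iff
  by (intro exI[of _ "\<lambda>x v. f' x v + g' x v"] conjI allI has_derivative_add Suc.IH f' g')
qed (auto intro: continuous_intros)

lemma C_k_mult:
 assumes "C_k k f" "C_k k g"
 shows "C_k k (\<lambda>x. f x * g x)"
 using assms
proof (induction k arbitrary: f g)
 case (Suc k)
 obtain f' where f': "\<And>x. (f has_derivative f' x) (at x)" "\<And>v. C_k k (\<lambda>x. f' x v)"
  using Suc.prems(1) unfolding C_k_Suc_iff by blast
 obtain g' where g': "\<And>x. (g has_derivative g' x) (at x)" "\<And>v. C_k k (\<lambda>x. g' x v)"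
  using Suc.prems(2) unfolding C_k_Suc_iff by blast
 show ?case unfolding C_k_Suc_iff
  by (intro exI[of _ "\<lambda>x v. f x * g' x v + f' x v * g x"] conjI allI has_derivative_mult C_k_add Suc.IH f' g'
    C_k_Suc_D[OF Suc.prems(1)] C_k_Suc_D[OF Suc.prems(2)])
qed (auto intro: continuous_intros)

lemma C_k_sum: "(\<And>i. i \<in> I ==> C_k k (f i)) ==> C_k k (\<lambda>x. \<Sum>i\<in>I. f i x)"
 by (induction I rule: infinite_finite_induct) (auto intro: C_k_add C_k_const)

lemma C_k_prod: "(\<And>i. i \<in> I ==> C_k k (f i)) ==> C_k k (\<lambda>x. \<Prod>i\<in>I. f i x)"
 by (induction I rule: infinite_finite_induct) (auto intro: C_k_mult C_k_const)

lemma C_k_power: "C_k k f ==> C_k k (\<lambda>x. f x ^ n)"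
 by (induction n) (auto intro: C_k_mult C_k_const)

section \<open>Smooth functions of one real variable\<close>

primrec Ck_real :: "nat \<Rightarrow> (real \<Rightarrow> real) \<Rightarrow> bool" where
 "Ck_real 0 f \<longleftrightarrow> continuous_on UNIV f"
| "Ck_real (Suc k) f \<longleftrightarrow> (\<exists>f'. (\<forall>x. (f has_real_derivative f' x) (at x)) \<and> Ck_real k f')"

lemma Ck_real_Suc_D:
 assumes "Ck_real (Suc k) f"
 shows "Ck_real k f"
 using assms
proof (induction k arbitrary: f)
 case 0
 then show ?case by (metis Ck_real.simps continuous_at_imp_continuous_on DERIV_isCont)
qed auto

definition smooth_real :: "(real \<Rightarrow> real) \<Rightarrow> bool" where
 "smooth_real f \<longleftrightarrow> (\<forall>k. Ck_real k f)"

lemma smooth_real_I: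
 assumes "\<And>x. (f has_real_derivative f' x) (at x)" "smooth_real f'"
 shows "smooth_real f"
 unfolding smooth_real_def
proof
 fix k show "Ck_real k f"
  by (rule Ck_real_Suc_D) (use assms in \<open>auto simp: smooth_real_def\<close>)
qed

text \<open>Membership in a family that contains a derivative of each of its members propagates to
  all orders by induction. The families in use are the span of sin and cos and the functions p(1/s)
  exp(-1/s).\<close>

lemma smooth_real_coinduct:
 assumes "f \<in> D" "\<And>f. f \<in> D ==> \<exists>f'\<in>D. \<forall>x. (f has_real_derivative f' x) (at x)"
 shows "smooth_real f"
proof -
 have "\<forall>f\<in>D. Ck_real k f" for k
 proof (induction k)
  case 0
  then show ?case
   using assms(2) by (metis Ck_real.simps(1) continuous_at_imp_continuous_on DERIV_isCont)
 next
  case (Suc k) then show ?case using assms(2) unfolding Ck_real.simps by meson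
 qed
 then show ?thesis using assms(1) by (auto simp: smooth_real_def)
qed

lemma smooth_real_D:
 assumes "smooth_real f"
 obtains f' where "\<And>x. (f has_real_derivative f' x) (at x)" "smooth_real f'"
proof -
 have "\<exists>f'. (\<forall>x. (f has_real_derivative f' x) (at x)) \<and> Ck_real k f'" for k
  using assms unfolding smooth_real_def by (metis Ck_real.simps(2))
 then obtain F where F: "\<And>k x. (f has_real_derivative F k x) (at x)" "\<And>k. Ck_real k (F k)" by metis
 \<comment> \<open>The witness could depend on the order k; uniqueness of the derivative makes it
   the same for all orders.\<close>
 have "F k = F 0" for k using F(1) DERIV_unique by blast
 then have "smooth_real (F 0)" using F(2) by (metis smooth_real_def)
 then show ?thesis using F(1) that by blast
qed

lemma smooth_real_isCont: "smooth_real f ==> isCont f x"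
 by (meson DERIV_isCont smooth_real_D)

lemma smooth_real_continuous_on: "smooth_real f ==> continuous_on S f"
 by (simp add: continuous_at_imp_continuous_on smooth_real_isCont)

lemma smooth_real_deriv: "smooth_real f ==> (\<And>x. (f has_real_derivative f' x) (at x)) ==> smooth_real f'"
 by (metis smooth_real_D DERIV_unique ext)

lemma smooth_real_const: "smooth_real (\<lambda>x. c)"
 by (rule smooth_real_coinduct[of _ "{\<lambda>x. c, \<lambda>x. 0}"]) (auto intro!: derivative_eq_intros)

lemma Ck_real_const: "Ck_real k (\<lambda>x. c)" using smooth_real_const by (simp add: smooth_real_def)

lemma Ck_real_add:
 assumes "Ck_real k f" "Ck_real k g"
 shows "Ck_real k (\<lambda>x. f x + g x)"
 using assms
proof (induction k arbitrary: f g)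
 case (Suc k)
 then obtain f' g' where "\<And>x. (f has_real_derivative f' x) (at x)" "Ck_real k f'"
  "\<And>x. (g has_real_derivative g' x) (at x)" "Ck_real k g'" by auto
 then show ?case by (auto intro!: exI[of _ "\<lambda>x. f' x + g' x"] DERIV_add Suc.IH)
qed (auto intro: continuous_intros)

lemma Ck_real_mult:
 assumes "Ck_real k f" "Ck_real k g"
 shows "Ck_real k (\<lambda>x. f x * g x)"
 using assms
proof (induction k arbitrary: f g)
 case (Suc k)
 then obtain f' g' where "\<And>x. (f has_real_derivative f' x) (at x)" "Ck_real k f'"
  "\<And>x. (g has_real_derivative g' x) (at x)" "Ck_real k g'" by auto
 then show ?case using Ck_real_Suc_D[OF Suc.prems(1)] Ck_real_Suc_D[OF Suc.prems(2)]
  by (auto intro!: exI[of _ "\<lambda>x. f' x * g x + g' x * f x"] DERIV_mult Ck_real_add Suc.IH)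
qed (auto intro: continuous_intros)

lemma smooth_real_add: "smooth_real f ==> smooth_real g ==> smooth_real (\<lambda>x. f x + g x)"
 by (simp add: smooth_real_def Ck_real_add)

lemma smooth_real_mult: "smooth_real f ==> smooth_real g ==> smooth_real (\<lambda>x. f x * g x)"
 by (simp add: smooth_real_def Ck_real_mult)

lemma smooth_real_cmult: "smooth_real f ==> smooth_real (\<lambda>x. c * f x)"
 by (intro smooth_real_mult smooth_real_const)

lemma smooth_real_affine: 
 assumes "smooth_real f" shows "smooth_real (\<lambda>x. f (a * x + b))"
proof -
 have "Ck_real k (\<lambda>x. f (a * x + b))" if "smooth_real f" for k f
  using that
 proof (induction k arbitrary: f)
  case 0
  then show ?case
   by (auto intro!: continuous_on_compose2[OF smooth_real_continuous_on[of f UNIV]] continuous_intros)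
 next
  case (Suc k)
  then obtain f' where f': "\<And>x. (f has_real_derivative f' x) (at x)" "smooth_real f'" using smooth_real_D by blast
  have "((\<lambda>x. f (a * x + b)) has_real_derivative a * f' (a * x + b)) (at x)" for x
   by (rule DERIV_chain2[OF f'(1), THEN DERIV_cong]) (auto intro!: derivative_eq_intros)
  moreover have "Ck_real k (\<lambda>x. a * f' (a * x + b))" by (intro Ck_real_mult Suc f' Ck_real_const)
  ultimately show ?case unfolding Ck_real.simps
   by (intro exI[of _ "\<lambda>x. a * f' (a * x + b)"] conjI allI)
 qed
 then show ?thesis using assms by (auto simp: smooth_real_def)
qed

lemma smooth_real_sin: "smooth_real (\<lambda>x. sin x)" and smooth_real_cos: "smooth_real (\<lambda>x. cos x)"
proof -
 have "\<exists>f'\<in>{\<lambda>x. c * sin x + d * cos x | c d. True}. \<forall>x. (f has_real_derivative f' x) (at x)"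
  if f: "f \<in> {\<lambda>x. c * sin x + d * cos x | c d. True}" for f :: "real \<Rightarrow> real"
 proof -
  obtain c d where "f = (\<lambda>x. c * sin x + d * cos x)" using f by blast
  then have "\<forall>x. (f has_real_derivative (- d) * sin x + c * cos x) (at x)" by (auto intro!: derivative_eq_intros)
  then show ?thesis by (intro bexI[of _ "\<lambda>x. (- d) * sin x + c * cos x"]) blast+
 qed
 note * = smooth_real_coinduct[OF _ this]
 show "smooth_real (\<lambda>x. sin x)" by (rule *, rule CollectI, rule exI[of _ 1], rule exI[of _ 0]) simp
 show "smooth_real (\<lambda>x. cos x)" by (rule *, rule CollectI, rule exI[of _ 0], rule exI[of _ 1]) simp
qed

lemma C_k_compose:
 assumes "smooth_real p" "\<And>k. C_k k q"
 shows "C_k k (\<lambda>x. p (q x))"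
 using assms(1)
proof (induction k arbitrary: p)
 case 0
 then show ?case using assms(2)[of 0]
  by (auto intro!: continuous_on_compose2[of UNIV p] smooth_real_continuous_on)
next
 case (Suc k)
 then obtain p' where p': "\<And>x. (p has_real_derivative p' x) (at x)" "smooth_real p'" using smooth_real_D by blast
 obtain q' where q': "\<And>x. (q has_derivative q' x) (at x)" "\<And>v. C_k k (\<lambda>x. q' x v)"
  using assms(2)[of "Suc k"] unfolding C_k_Suc_iff by metis
 have "((\<lambda>x. p (q x)) has_derivative (\<lambda>v. p' (q x) * q' x v)) (at x)" for x
  using has_derivative_compose[OF q'(1) p'(1)[unfolded has_field_derivative_def]] by simp
 then show ?case unfolding C_k_Suc_iff
  by (intro exI[of _ "\<lambda>x v. p' (q x) * q' x v"]) (auto intro!: C_k_mult q' Suc.IH p')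
qed

section \<open>The smooth function exp(-1/s), extended by 0\<close>

definition exp_bump :: "real \<Rightarrow> real" where
 "exp_bump s = (if s > 0 then exp (- 1 / s) else 0)"

lemma poly_exp_tendsto_0:
 fixes p :: "real poly"
 shows "((\<lambda>y. poly p y * exp (- y)) \<longlongrightarrow> 0) at_top"
proof (induction p)
 case (pCons a p)
 have "((\<lambda>y. y * poly p y * exp (- y)) \<longlongrightarrow> 0) at_top"
 proof -
  have "((\<lambda>y. (\<Sum>i\<le>degree p. coeff p i * (y ^ Suc i / exp y))) \<longlongrightarrow> (\<Sum>i\<le>degree p. coeff p i * 0)) at_top"
   by (intro tendsto_intros tendsto_power_div_exp_0)
  moreover have "(\<Sum>i\<le>degree p. coeff p i * (y ^ Suc i / exp y)) = y * poly p y * exp (- y)" for y :: real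
   by (simp add: poly_altdef sum_distrib_left sum_distrib_right exp_minus field_simps)
  ultimately show ?thesis by simp
 qed
 moreover have "((\<lambda>y. a * (y ^ 0 / exp y)) \<longlongrightarrow> a * 0) at_top"
  by (intro tendsto_intros tendsto_power_div_exp_0)
 ultimately have "((\<lambda>y. a * (y ^ 0 / exp y) + y * poly p y * exp (- y)) \<longlongrightarrow> a * 0 + 0) at_top"
  by (rule tendsto_add[rotated])
 then show ?case by (simp add: exp_minus field_simps)
qed simp

text \<open>On the positive axis the derivative of p(1/s) exp(-1/s) has the same shape with the
  polynomial X^2 (p - p'), so the family is closed under differentiation. At 0 the right difference
  quotient is y p(y) exp(-y) with y = 1/s, which vanishes at infinity.\<close>

lemma poly_exp_deriv:
 fixes p :: "real poly"
 defines "F \<equiv> \<lambda>(p::real poly) s. if s > 0 then poly p (1 / s) * exp (- 1 / s) else 0"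
 shows "(F p has_real_derivative F ([:0,0,1:] * (p - pderiv p)) s) (at s)"
proof -
 consider "s > 0" | "s < 0" | "s = 0" by linarith
 then show ?thesis
 proof cases
  case 1
  have "((\<lambda>s. poly p (1 / s) * exp (- 1 / s)) has_real_derivative F ([:0,0,1:] * (p - pderiv p)) s) (at s)"
   using 1 by (auto intro!: derivative_eq_intros DERIV_chain2[OF poly_DERIV]
     simp: F_def field_simps power2_eq_square)
  then show ?thesis
   by (rule has_field_derivative_transform_within_open[of _ _ _ "{0<..}"]) (use 1 in \<open>auto simp: F_def\<close>)
 next
  case 2
  have "((\<lambda>s. 0) has_real_derivative F ([:0,0,1:] * (p - pderiv p)) s) (at s)" using 2 by (auto simp: F_def)
  then show ?thesis
   by (rule has_field_derivative_transform_within_open[of _ _ _ "{..<0}"]) (use 2 in \<open>auto simp: F_def\<close>)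
 next
  case 3
  have "((\<lambda>h. F p h / h) \<longlongrightarrow> 0) (at 0)"
  proof (rule filterlim_split_at)
   show "((\<lambda>h. F p h / h) \<longlongrightarrow> 0) (at_left 0)"
    by (rule tendsto_eventually) (auto simp: F_def eventually_at_filter)
   have "((\<lambda>h. poly (pCons 0 p) (inverse h) * exp (- inverse h)) \<longlongrightarrow> 0) (at_right 0)"
    using poly_exp_tendsto_0[of "pCons 0 p"] filterlim_inverse_at_top_right by (rule filterlim_compose)
   then show "((\<lambda>h. F p h / h) \<longlongrightarrow> 0) (at_right 0)"
    by (rule Lim_transform_eventually) (auto simp: F_def eventually_at_filter field_simps)
  qed
  then show ?thesis using 3 by (simp add: has_field_derivative_iff F_def)
 qed
qed

lemma smooth_real_exp_bump: "smooth_real exp_bump"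
proof -
 define F where "F = (\<lambda>(p::real poly) (s::real). if s > 0 then poly p (1 / s) * exp (- 1 / s) else 0)"
 have "\<exists>f'\<in>range F. \<forall>x. (f has_real_derivative f' x) (at x)" if f: "f \<in> range F" for f
 proof -
  obtain p where p: "f = F p" using f by blast
  show ?thesis unfolding p F_def by (rule bexI[OF _ rangeI[of _ "[:0,0,1:] * (p - pderiv p)"]]) (intro allI poly_exp_deriv)
 qed
 then have "smooth_real (F [:1:])" by (intro smooth_real_coinduct[of _ "range F"]) auto
 moreover have "F [:1:] = exp_bump" by (auto simp: F_def exp_bump_def)
 ultimately show ?thesis by simp
qed

lemma exp_bump_props:
 "0 \<le> exp_bump s" "exp_bump s \<le> 1" "s \<le> 0 ==> exp_bump s = 0" "s > 0 ==> exp_bump s > 0"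
 by (auto simp: exp_bump_def)

lemma exp_bump_lim: "(\<lambda>n. exp_bump (real n * s)) \<longlonglongrightarrow> (if s > 0 then 1 else 0)"
proof (cases "s > 0")
 case True
 have "(\<lambda>n. exp (- (1 / s) * inverse (real n))) \<longlonglongrightarrow> exp (- (1 / s) * 0)"
  by (intro tendsto_intros lim_inverse_n)
 moreover have "\<forall>\<^sub>F n in sequentially. exp (- (1 / s) * inverse (real n)) = exp_bump (real n * s)"
  using eventually_gt_at_top[of 0] by eventually_elim (use True in \<open>auto simp: exp_bump_def field_simps\<close>)
 ultimately show ?thesis using True by (auto intro: Lim_transform_eventually)
next
 case False
 then show ?thesis by (auto simp: exp_bump_def zero_less_mult_iff)
qed

section \<open>Test functions and their gradients\<close>

lemma test_functions_I:
 assumes "\<And>k. C_k k \<phi>" "compact K" "K \<subseteq> X" "\<And>x. x \<notin> K ==> \<phi> x = 0"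
 shows "\<phi> \<in> test_functions X"
proof -
 have "{x. \<phi> x \<noteq> 0} \<subseteq> K" using assms(4) by blast
 then have c: "closure {x. \<phi> x \<noteq> 0} \<subseteq> K" using assms(2) by (simp add: closure_minimal compact_imp_closed)
 moreover have "compact (closure {x. \<phi> x \<noteq> 0})"
  by (metis assms(2) c closed_Int_compact closed_closure inf.absorb1)
 ultimately show ?thesis using assms by (auto simp: test_functions_def)
qed

lemma test_functions_D:
 assumes "\<phi> \<in> test_functions X"
 shows "C_k k \<phi>" "compact (closure {x. \<phi> x \<noteq> 0})" "closure {x. \<phi> x \<noteq> 0} \<subseteq> X"
  "x \<notin> closure {x. \<phi> x \<noteq> 0} ==> \<phi> x = 0" "x \<notin> X ==> \<phi> x = 0"
 using assms closure_subset[of "{x. \<phi> x \<noteq> 0}"] by (auto simp: test_functions_def)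

lemma C_k_has_derivative:
 assumes "C_k (Suc k) \<phi>"
 shows "(\<phi> has_derivative frechet_derivative \<phi> (at x)) (at x)"
 using assms by (simp add: C_k.simps frechet_derivative_works)

lemma frechet_eq_grad:
 assumes "(\<phi> has_derivative D) (at x)"
 shows "D v = grad \<phi> x \<bullet> v"
proof -
 interpret D: bounded_linear D using assms by (rule has_derivative_bounded_linear)
 have "D v = D (\<Sum>i\<in>UNIV. (v $ i) *\<^sub>R axis i 1)"
  by (simp add: basis_expansion scalar_mult_eq_scaleR[symmetric])
 also have "\<dots> = (\<Sum>i\<in>UNIV. v $ i * D (axis i 1))" by (simp add: D.sum D.scaleR)
 finally show ?thesis
  using frechet_derivative_at[OF assms] by (simp add: grad_def inner_vec_def mult.commute)
qed

lemma grad_eqI: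
 assumes "(\<phi> has_derivative (\<lambda>v. G \<bullet> v)) (at x)"
 shows "grad \<phi> x = G"
 by (rule vector_eq_rdot[THEN iffD1]) (use frechet_eq_grad[OF assms] in auto)

lemma test_has_derivative:
 assumes "\<phi> \<in> test_functions X"
 shows "(\<phi> has_derivative (\<lambda>v. grad \<phi> x \<bullet> v)) (at x)"
proof -
 note D = C_k_has_derivative[OF test_functions_D(1)[OF assms, of 1, unfolded One_nat_def], of x]
 have "frechet_derivative \<phi> (at x) = (\<lambda>v. grad \<phi> x \<bullet> v)" using frechet_eq_grad[OF D] by (intro ext)
 then show ?thesis using D by simp
qed

lemma test_continuous: "\<phi> \<in> test_functions X ==> continuous_on S \<phi>"
 using test_functions_D(1)[of \<phi> X 0] continuous_on_subset by auto

text \<open>Outside the closed support the function is locally zero, hence so is its derivative.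
  Closure under differentiation allows the two successive integrations by parts in
  \<open>oscillation_curl\<close>.\<close>

lemma test_dir_deriv:
 assumes "\<phi> \<in> test_functions X"
 shows "(\<lambda>x. grad \<phi> x \<bullet> v) \<in> test_functions X"
proof (rule test_functions_I[OF _ test_functions_D(2)[OF assms] test_functions_D(3)[OF assms]])
 have eq: "frechet_derivative \<phi> (at x) v = grad \<phi> x \<bullet> v" for x
  using frechet_eq_grad[OF C_k_has_derivative[OF test_functions_D(1)[OF assms, of 1, unfolded One_nat_def], of x]] .
 show "C_k k (\<lambda>x. grad \<phi> x \<bullet> v)" for k
 proof -
  have "C_k k (\<lambda>x. frechet_derivative \<phi> (at x) v)"
   using test_functions_D(1)[OF assms, of "Suc k"] unfolding C_k.simps by (rule allE[OF conjunct2])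
  then show ?thesis by (simp add: eq)
 qed
 fix x assume x: "x \<notin> closure {x. \<phi> x \<noteq> 0}"
 have "((\<lambda>x. 0) has_derivative (\<lambda>v. grad \<phi> x \<bullet> v)) (at x)"
 proof (rule has_derivative_transform_within_open[OF test_has_derivative[OF assms]])
  show "open (- closure {x. \<phi> x \<noteq> 0})" by auto
  show "x \<in> - closure {x. \<phi> x \<noteq> 0}" using x by blast
  show "\<phi> y = 0" if "y \<in> - closure {x. \<phi> x \<noteq> 0}" for y
   by (rule test_functions_D(4)[OF assms]) (use that in blast)
 qed
 then have "(\<lambda>v. grad \<phi> x \<bullet> v) = (\<lambda>v. 0)" by (rule has_derivative_unique) simp
 then show "grad \<phi> x \<bullet> v = 0" by meson
qed

lemma test_mult_smooth:
 assumes "\<phi> \<in> test_functions X" "\<And>k. C_k k p"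
 shows "(\<lambda>x. p x * \<phi> x) \<in> test_functions X"
proof (rule test_functions_I[OF C_k_mult[OF assms(2) test_functions_D(1)[OF assms(1)]] test_functions_D(2,3)[OF assms(1)]])
 fix x assume "x \<notin> closure {x. \<phi> x \<noteq> 0}"
 then have "\<phi> x = 0" by (rule test_functions_D(4)[OF assms(1)])
 then show "p x * \<phi> x = 0" by simp
qed

lemma test_cmult: "\<phi> \<in> test_functions X ==> (\<lambda>x. c * \<phi> x) \<in> test_functions X"
 by (rule test_mult_smooth[OF _ C_k_const])

lemma test_add:
 assumes "\<phi> \<in> test_functions X" "\<psi> \<in> test_functions X"
 shows "(\<lambda>x. \<phi> x + \<psi> x) \<in> test_functions X"
proof (rule test_functions_I[OF C_k_add[OF test_functions_D(1)[OF assms(1)] test_functions_D(1)[OF assms(2)]]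
   compact_Un[OF test_functions_D(2)[OF assms(1)] test_functions_D(2)[OF assms(2)]]])
 fix x assume "x \<notin> closure {x. \<phi> x \<noteq> 0} \<union> closure {x. \<psi> x \<noteq> 0}"
 then have "\<phi> x = 0" "\<psi> x = 0"
  by (auto intro: test_functions_D(4)[OF assms(1)] test_functions_D(4)[OF assms(2)])
 then show "\<phi> x + \<psi> x = 0" by simp
qed (use test_functions_D(3)[OF assms(1)] test_functions_D(3)[OF assms(2)] in blast)

lemma test_zero: "(\<lambda>x. 0) \<in> test_functions X"
 by (rule test_functions_I[of _ "{}", OF C_k_const]) auto

lemma test_diff:
 assumes "\<phi> \<in> test_functions X" "\<psi> \<in> test_functions X"
 shows "(\<lambda>x. \<phi> x - \<psi> x) \<in> test_functions X"
 using test_add[OF assms(1) test_cmult[OF assms(2), of "-1"]] by simp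

lemma test_grad_add:
 "\<phi> \<in> test_functions X ==> \<psi> \<in> test_functions X ==> grad (\<lambda>x. \<phi> x + \<psi> x) x = grad \<phi> x + grad \<psi> x"
 by (intro grad_eqI) (auto intro!: derivative_eq_intros test_has_derivative simp: inner_add)

lemma test_grad_diff:
 "\<phi> \<in> test_functions X ==> \<psi> \<in> test_functions X ==> grad (\<lambda>x. \<phi> x - \<psi> x) x = grad \<phi> x - grad \<psi> x"
 by (intro grad_eqI) (auto intro!: derivative_eq_intros test_has_derivative simp: inner_diff)

lemma test_grad_cmult:
 "\<phi> \<in> test_functions X ==> grad (\<lambda>x. c * \<phi> x) x = c *\<^sub>R grad \<phi> x"
 by (intro grad_eqI) (auto intro!: derivative_eq_intros test_has_derivative)

lemma test_grad_mult:
 assumes "\<phi> \<in> test_functions X" "(p has_derivative (\<lambda>v. P \<bullet> v)) (at x)"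
 shows "grad (\<lambda>x. p x * \<phi> x) x = p x *\<^sub>R grad \<phi> x + \<phi> x *\<^sub>R P"
 by (intro grad_eqI) (auto intro!: derivative_eq_intros assms(2) test_has_derivative[OF assms(1)] simp: inner_add algebra_simps)

lemma grad_component: "grad \<phi> x $ i = grad \<phi> x \<bullet> axis i 1"
 by (simp add: inner_axis)

lemma test_grad_continuous:
 assumes "\<phi> \<in> test_functions X"
 shows "continuous_on S (grad \<phi>)"
proof -
 have "continuous_on S (\<lambda>x. \<chi> i. grad \<phi> x $ i)"
  unfolding grad_component by (intro continuous_on_vec_lambda test_continuous[OF test_dir_deriv[OF assms]])
 then show ?thesis by simp
qed

lemma test_bounded:
 assumes "\<phi> \<in> test_functions X"
 obtains C where "C > 0" "\<And>x. \<bar>\<phi> x\<bar> \<le> C" "\<And>x. norm (grad \<phi> x) \<le> C"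
proof -
 have *: "\<exists>C\<ge>0. \<forall>x. \<bar>\<psi> x\<bar> \<le> C" if "\<psi> \<in> test_functions X" for \<psi>
 proof -
  have "compact (\<psi> ` closure {x. \<psi> x \<noteq> 0})"
   by (intro compact_continuous_image test_continuous[OF that] test_functions_D(2)[OF that])
  then obtain C where "\<forall>y\<in>\<psi> ` closure {x. \<psi> x \<noteq> 0}. norm y \<le> C"
   using compact_imp_bounded bounded_iff by metis
  then have "\<bar>\<psi> x\<bar> \<le> max C 0" for x
   using test_functions_D(4)[OF that, of x] by (cases "x \<in> closure {x. \<psi> x \<noteq> 0}") auto
  then show ?thesis by (intro exI[of _ "max C 0"]) auto
 qed
 obtain C0 where C0: "C0 \<ge> 0" "\<And>x. \<bar>\<phi> x\<bar> \<le> C0" using *[OF assms] by blast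
 obtain c where c: "\<And>i. c i \<ge> 0" "\<And>i x. \<bar>grad \<phi> x \<bullet> axis i 1\<bar> \<le> c i"
  using *[OF test_dir_deriv[OF assms, of "axis i 1" for i]] by metis
 have "norm (grad \<phi> x) \<le> (\<Sum>i\<in>UNIV. c i)" for x
  using order_trans[OF norm_le_l1_cart sum_mono] c(2) by (metis grad_component)
 moreover have "0 \<le> (\<Sum>i\<in>UNIV. c i)" using c(1) by (simp add: sum_nonneg)
 ultimately show thesis
  by (intro that[of "C0 + (\<Sum>i\<in>UNIV. c i) + 1"]) (use C0 in \<open>fastforce intro: order_trans\<close>)+
qed

section \<open>Bounded open sets\<close>

text \<open>Integrating difference quotients, whose integrals vanish by translation invariance, replaces Fubini
 and the fundamental theorem of calculus.\<close>

lemma integral_directional_derivative_eq_0: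
 fixes \<psi> :: "'a::euclidean_space \<Rightarrow> real"
 assumes lip: "L-lipschitz_on UNIV \<psi>" and supp: "\<And>x. norm x \<ge> r ==> \<psi> x = 0"
  and D: "D \<in> borel_measurable lebesgue"
  and lim: "AE x in lebesgue. (\<lambda>n. real (Suc n) * (\<psi> (x + (1 / real (Suc n)) *\<^sub>R e) - \<psi> x)) \<longlonglongrightarrow> D x"
 shows "integral\<^sup>L lebesgue D = 0"
proof -
 define q where "q n x = real (Suc n) * (\<psi> (x + (1 / real (Suc n)) *\<^sub>R e) - \<psi> x)" for n x
 have [measurable]: "\<psi> \<in> borel_measurable borel"
  by (intro borel_measurable_continuous_onI lipschitz_on_continuous_on[OF lip])
 have cl: "(\<lambda>n. integral\<^sup>L lebesgue (q n)) \<longlonglongrightarrow> integral\<^sup>L lebesgue D"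
 \<comment> \<open>The steps are at most 1 in units of e, so the quotients live in the ball enlarged
   by |e| and are bounded by L |e|.\<close>
 proof (rule integral_dominated_convergence[where w="\<lambda>x. indicator (cball 0 (\<bar>r\<bar> + norm e)) x * (L * norm e)"])
  have "emeasure lborel (cball 0 (\<bar>r\<bar> + norm e) :: 'a set) < \<infinity>" by (rule emeasure_lborel_cball_finite)
  then show "integrable lebesgue (\<lambda>x::'a. indicator (cball 0 (\<bar>r\<bar> + norm e)) x * (L * norm e))"
   by (intro integrable_mult_left) (auto simp: integrable_completion)
  have "q i \<in> borel_measurable borel" for i unfolding q_def by measurable
  then show "q i \<in> borel_measurable lebesgue" for i by (simp add: measurable_completion)
  show "AE x in lebesgue. norm (q i x) \<le> indicator (cball 0 (\<bar>r\<bar> + norm e)) x * (L * norm e)" for i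
  proof (rule AE_I2)
   fix x :: 'a
   have s: "norm ((1 / real (Suc i)) *\<^sub>R e) \<le> norm e" using mult_left_le[of "1 / real (Suc i)" "norm e"] by (simp add: mult.commute)
   show "norm (q i x) \<le> indicator (cball 0 (\<bar>r\<bar> + norm e)) x * (L * norm e)"
   proof (cases "norm x \<le> \<bar>r\<bar> + norm e")
    case True
    have "\<bar>\<psi> (x + (1 / real (Suc i)) *\<^sub>R e) - \<psi> x\<bar> \<le> L * (1 / real (Suc i) * norm e)"
     using lipschitz_onD[OF lip, of "x + (1 / real (Suc i)) *\<^sub>R e" x] by (simp add: dist_norm)
    then have "norm (q i x) \<le> real (Suc i) * (L * (1 / real (Suc i) * norm e))"
     unfolding q_def norm_mult real_norm_def abs_mult abs_of_nat by (rule mult_left_mono) simp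
    moreover have "real (Suc i) * (L * (1 / real (Suc i) * norm e)) = L * norm e" by (simp del: of_nat_Suc)
    ultimately show ?thesis using True by simp
   next
    case False
    have "norm x \<le> norm (x + (1 / real (Suc i)) *\<^sub>R e) + norm ((1 / real (Suc i)) *\<^sub>R e)"
     by (metis add_diff_cancel_right' norm_triangle_ineq4)
    then have "norm (x + (1 / real (Suc i)) *\<^sub>R e) \<ge> r" using False s by linarith
    moreover have "norm x \<ge> r" using False norm_ge_zero[of e] by linarith
    ultimately have "q i x = 0" unfolding q_def using supp by simp
    then show ?thesis using False by simp
   qed
  qed
 qed (use D lim in \<open>auto simp: q_def\<close>)
 have qm: "q n \<in> borel_measurable borel" for n unfolding q_def by measurable
 have "integral\<^sup>L lebesgue (q n) = 0" for n
 proof -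
  let ?t = "(1 / real (Suc n)) *\<^sub>R e"
  have i: "integrable lborel \<psi>"
  proof (rule L1_bound[where f="\<lambda>x. indicator (cball 0 \<bar>r\<bar>) x * (\<bar>\<psi> 0\<bar> + L * \<bar>r\<bar>)"])
   have "emeasure lborel (cball 0 \<bar>r\<bar> :: 'a set) < \<infinity>" by (rule emeasure_lborel_cball_finite)
   then show "integrable lborel (\<lambda>x::'a. indicator (cball 0 \<bar>r\<bar>) x * (\<bar>\<psi> 0\<bar> + L * \<bar>r\<bar>))" by (intro integrable_mult_left) simp
   have "\<bar>\<psi> x\<bar> \<le> indicator (cball 0 \<bar>r\<bar>) x * (\<bar>\<psi> 0\<bar> + L * \<bar>r\<bar>)" for x
   proof (cases "norm x \<le> \<bar>r\<bar>")
    case True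
    have "\<bar>\<psi> x - \<psi> 0\<bar> \<le> L * norm x" using lipschitz_onD[OF lip, of x 0] by (simp add: dist_norm)
    also have "\<dots> \<le> L * \<bar>r\<bar>" using True lipschitz_on_nonneg[OF lip] by (rule mult_left_mono)
    finally show ?thesis using True by simp
   next
    case False then show ?thesis using supp[of x] by simp
   qed
   then show "AE x in lborel. norm (\<psi> x) \<le> norm (indicator (cball 0 \<bar>r\<bar>) x * (\<bar>\<psi> 0\<bar> + L * \<bar>r\<bar>))"
    by (intro AE_I2) (smt (verit) real_norm_def)
  qed simp
  have "integral\<^sup>L lborel \<psi> = integral\<^sup>L (distr lborel borel ((+) ?t)) \<psi>" by (simp add: lborel_distr_plus)
  also have "\<dots> = (LINT x|lborel. \<psi> (?t + x))" by (subst integral_distr) auto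
  finally have e: "(LINT x|lborel. \<psi> (x + ?t)) = integral\<^sup>L lborel \<psi>" by (simp add: add.commute)
  have "integrable (distr lborel borel ((+) ?t)) \<psi>" using i by (simp add: lborel_distr_plus)
  then have i2: "integrable lborel (\<lambda>x. \<psi> (x + ?t))" by (subst (asm) integrable_distr_eq) (auto simp: add.commute)
  have "integral\<^sup>L lebesgue (q n) = integral\<^sup>L lborel (q n)"
   by (rule integral_completion) (simp add: qm)
  also have "\<dots> = real (Suc n) * ((LINT x|lborel. \<psi> (x + ?t)) - integral\<^sup>L lborel \<psi>)"
   unfolding q_def using i i2 by simp
  finally show ?thesis using e by simp
 qed
 then have "(\<lambda>n. 0) \<longlonglongrightarrow> integral\<^sup>L lebesgue D" using cl by simp
 then show ?thesis by (simp add: LIMSEQ_const_iff)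
qed

lemma difference_quotient_tendsto:
 assumes "(\<psi> has_derivative \<psi>') (at x)"
 shows "(\<lambda>n. real (Suc n) * (\<psi> (x + (1 / real (Suc n)) *\<^sub>R e) - \<psi> x)) \<longlonglongrightarrow> (\<psi>' e :: real)"
proof -
 interpret bounded_linear \<psi>' using assms by (rule has_derivative_bounded_linear)
 have "((\<lambda>t. \<psi> (x + t *\<^sub>R e)) has_derivative (\<lambda>t. \<psi>' (t *\<^sub>R e))) (at 0)"
  by (rule has_derivative_compose[of "\<lambda>t. x + t *\<^sub>R e" "\<lambda>t. t *\<^sub>R e" 0 UNIV \<psi> \<psi>'])
   (use assms in \<open>auto intro!: derivative_eq_intros\<close>)
 then have "((\<lambda>t. \<psi> (x + t *\<^sub>R e)) has_real_derivative \<psi>' e) (at 0)"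
  by (simp add: has_field_derivative_def scaleR mult.commute[of _ "\<psi>' e"])
 then have "((\<lambda>h. (\<psi> (x + h *\<^sub>R e) - \<psi> x) / h) \<longlongrightarrow> \<psi>' e) (at 0)"
  by (simp add: has_field_derivative_iff)
 moreover have "filterlim (\<lambda>n. 1 / real (Suc n)) (at 0) sequentially"
  using LIMSEQ_Suc[OF lim_1_over_n] by (intro filterlim_atI) auto
 ultimately have l: "(\<lambda>n. (\<psi> (x + (1 / real (Suc n)) *\<^sub>R e) - \<psi> x) / (1 / real (Suc n))) \<longlonglongrightarrow> \<psi>' e"
  by (rule filterlim_compose)
 have "real (Suc n) * (\<psi> (x + (1 / real (Suc n)) *\<^sub>R e) - \<psi> x)
   = (\<psi> (x + (1 / real (Suc n)) *\<^sub>R e) - \<psi> x) / (1 / real (Suc n))" for n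
  by (simp only: divide_divide_eq_right div_by_1 mult.commute)
 then show ?thesis using l by (simp only:)
qed

section \<open>Integration by parts and the Poincare inequality\<close>

locale bounded_open =
 fixes X :: "(real^'d::finite) set"
 assumes open_dom: "open X" and bounded_dom: "bounded X"
begin

abbreviation "LM \<equiv> lebesgue_on X"
abbreviation "test \<equiv> test_functions X"

lemma lmeas: "X \<in> lmeasurable"
 by (rule lmeasurable_open[OF bounded_dom open_dom])

lemma setsl [simp]: "X \<in> sets lebesgue" by (rule fmeasurableD[OF lmeas])

lemma measurable_borel_dom: "f \<in> borel_measurable borel ==> f \<in> borel_measurable LM"
 by (simp add: measurable_completion measurable_restrict_space1)

lemma continuous_measurable_dom: "continuous_on UNIV f ==> f \<in> borel_measurable LM"
 by (intro measurable_borel_dom borel_measurable_continuous_onI)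

lemma test_lipschitz:
 assumes "\<phi> \<in> test"
 obtains L where "L-lipschitz_on UNIV \<phi>"
proof -
 obtain C where C: "C > 0" "\<And>x. \<bar>\<phi> x\<bar> \<le> C" "\<And>x. norm (grad \<phi> x) \<le> C" using test_bounded[OF assms] by blast
 have "C-lipschitz_on UNIV \<phi>"
 proof (rule bounded_derivative_imp_lipschitz)
  show "(\<phi> has_derivative (\<lambda>v. grad \<phi> x \<bullet> v)) (at x within UNIV)" for x using test_has_derivative[OF assms] by simp
  show "onorm (\<lambda>v. grad \<phi> x \<bullet> v) \<le> C" for x
   using C by (intro onorm_bound) (auto intro!: order_trans[OF Cauchy_Schwarz_ineq2] mult_right_mono)
 qed (use C in auto)
 then show thesis using that by blast
qed

lemma test_support_bounded:
 obtains r where "\<And>\<phi> x. \<phi> \<in> test ==> norm x \<ge> r ==> \<phi> x = 0"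
proof -
 obtain r where r: "\<And>x. x \<in> X ==> norm x < r" using bounded_dom bounded_pos_less by metis
 then show thesis using that[of r] test_functions_D(5) by (metis linorder_not_le)
qed

lemma integral_dom_eq:
 fixes f :: "real^'d \<Rightarrow> 'b::euclidean_space"
 assumes "\<And>x. x \<notin> X ==> f x = 0"
 shows "integral\<^sup>L LM f = integral\<^sup>L lebesgue f"
proof -
 have "(\<lambda>x. indicator X x *\<^sub>R f x) = f" using assms by (auto simp: indicator_def)
 then show ?thesis by (simp add: integral_restrict_space)
qed

lemma integral_test_deriv:
 assumes "\<phi> \<in> test" shows "(LINT x|LM. grad \<phi> x \<bullet> e) = 0"
proof -
 obtain L where L: "L-lipschitz_on UNIV \<phi>" using test_lipschitz[OF assms] .
 obtain r where r: "\<And>x. norm x \<ge> r ==> \<phi> x = 0" using test_support_bounded assms by metis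
 have "integral\<^sup>L lebesgue (\<lambda>x. grad \<phi> x \<bullet> e) = 0"
 proof (rule integral_directional_derivative_eq_0[OF L r])
  show "(\<lambda>x. grad \<phi> x \<bullet> e) \<in> borel_measurable lebesgue"
   by (intro measurable_completion) (simp, intro borel_measurable_continuous_onI test_continuous[OF test_dir_deriv[OF assms]])
  show "AE x in lebesgue. (\<lambda>n. real (Suc n) * (\<phi> (x + (1 / real (Suc n)) *\<^sub>R e) - \<phi> x)) \<longlonglongrightarrow> grad \<phi> x \<bullet> e"
   by (intro AE_I2 difference_quotient_tendsto[OF test_has_derivative[OF assms]])
 qed
 then show ?thesis using test_functions_D(5)[OF test_dir_deriv[OF assms]] by (subst integral_dom_eq) auto
qed

lemma test_L2: "\<phi> \<in> test ==> \<phi> \<in> L2 X" and grad_test_L2: "\<phi> \<in> test ==> grad \<phi> \<in> L2 X"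
proof -
 assume t: "\<phi> \<in> test"
 obtain C where C: "C > 0" "\<And>x. \<bar>\<phi> x\<bar> \<le> C" "\<And>x. norm (grad \<phi> x) \<le> C" using test_bounded[OF t] by blast
 show "\<phi> \<in> L2 X" by (rule L2_bounded[OF lmeas, of _ C]) (use C t in \<open>auto intro!: continuous_measurable_dom test_continuous\<close>)
 show "grad \<phi> \<in> L2 X" by (rule L2_bounded[OF lmeas, of _ C]) (use C t in \<open>auto intro!: continuous_measurable_dom test_grad_continuous\<close>)
qed

lemma test_mult: "\<phi> \<in> test ==> \<psi> \<in> test ==> (\<lambda>x. \<phi> x * \<psi> x) \<in> test"
 by (rule test_mult_smooth[OF _ test_functions_D(1)])

lemma test_ibp:
 assumes "\<phi> \<in> test" "\<psi> \<in> test"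
 shows "(LINT x|LM. \<phi> x * (grad \<psi> x \<bullet> e)) = - (LINT x|LM. \<psi> x * (grad \<phi> x \<bullet> e))"
proof -
 have "grad (\<lambda>x. \<phi> x * \<psi> x) x \<bullet> e = \<phi> x * (grad \<psi> x \<bullet> e) + \<psi> x * (grad \<phi> x \<bullet> e)" for x
  using test_grad_mult[OF assms(2) test_has_derivative[OF assms(1)]] by (simp add: inner_add)
 then have "0 = (LINT x|LM. \<phi> x * (grad \<psi> x \<bullet> e) + \<psi> x * (grad \<phi> x \<bullet> e))"
  using integral_test_deriv[OF test_mult[OF assms], of e] by simp
 then show ?thesis
  using L2_mult_integrable[OF test_L2[OF assms(1)] test_L2[OF test_dir_deriv[OF assms(2), of e]]]
   L2_mult_integrable[OF test_L2[OF assms(2)] test_L2[OF test_dir_deriv[OF assms(1), of e]]] by simp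
qed

text \<open>Integrating by parts with the weight x.a, whose derivative along the unit vector a is 1,
  expresses the integral of \<phi>^2 as -2 times that of (x.a) \<phi> times the derivative of \<phi>
  along a. Cauchy-Schwarz and |x.a| \<le> r on X yield the constant 2r.\<close>

lemma poincare_const:
 obtains C where "C > 0" "\<And>\<phi>. \<phi> \<in> test ==> l2norm X \<phi> \<le> C * l2norm X (grad \<phi>)"
proof -
 obtain r where r: "r > 0" "\<And>x. x \<in> X ==> norm x < r" using bounded_dom bounded_pos_less by metis
 define a :: "real^'d" where "a = axis undefined 1"
 have na: "norm a = 1" by (simp add: a_def)
 have aa: "a \<bullet> a = 1" using na by (simp add: norm_eq_1)
 have "l2norm X \<phi> \<le> 2 * r * l2norm X (grad \<phi>)" if t: "\<phi> \<in> test" for \<phi>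
 proof -
  have x\<phi>: "(\<lambda>x. (x \<bullet> a) * \<phi> x) \<in> test" by (rule test_mult_smooth[OF t C_k_inner])
  have g: "grad (\<lambda>x. (x \<bullet> a) * \<phi> x) x \<bullet> a = (x \<bullet> a) * (grad \<phi> x \<bullet> a) + \<phi> x" for x
  proof -
   have "((\<lambda>x. x \<bullet> a) has_derivative (\<lambda>v. a \<bullet> v)) (at x)" by (auto intro!: derivative_eq_intros simp: inner_commute)
   from test_grad_mult[OF t this] show ?thesis by (simp add: inner_add aa)
  qed
  note L = test_L2[OF t] test_L2[OF x\<phi>] test_L2[OF test_dir_deriv[OF t, of a]]
  have "(LINT x|LM. \<phi> x * ((x \<bullet> a) * (grad \<phi> x \<bullet> a) + \<phi> x)) = - (LINT x|LM. ((x \<bullet> a) * \<phi> x) * (grad \<phi> x \<bullet> a))"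
   using test_ibp[OF t x\<phi>, of a] by (simp add: g)
  moreover have "(\<lambda>x. \<phi> x * ((x \<bullet> a) * (grad \<phi> x \<bullet> a) + \<phi> x)) = (\<lambda>x. ((x \<bullet> a) * \<phi> x) * (grad \<phi> x \<bullet> a) + \<phi> x * \<phi> x)"
   by (auto simp: algebra_simps)
  ultimately have "(LINT x|LM. \<phi> x * \<phi> x) = - 2 * (LINT x|LM. ((x \<bullet> a) * \<phi> x) * (grad \<phi> x \<bullet> a))"
   using L2_mult_integrable[OF L(2,3)] L2_mult_integrable[OF L(1,1)] by simp
  also have "\<dots> \<le> 2 * (l2norm X (\<lambda>x. (x \<bullet> a) * \<phi> x) * l2norm X (\<lambda>x. grad \<phi> x \<bullet> a))"
   using l2_cauchy_schwarz_mult[OF L(2,3)] by linarith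
  also have "\<dots> \<le> 2 * ((r * l2norm X \<phi>) * l2norm X (grad \<phi>))"
  proof (intro mult_left_mono mult_mono)
   have "l2norm X (\<lambda>x. (x \<bullet> a) * \<phi> x) \<le> l2norm X (\<lambda>x. r *\<^sub>R \<phi> x)"
   proof (rule l2norm_mono[OF L(2) L2_scaleR[OF L(1)]], rule AE_I2)
    fix x assume "x \<in> space LM"
    then have "norm x < r" using r(2) by simp
    then have "\<bar>x \<bullet> a\<bar> \<le> r" using Cauchy_Schwarz_ineq2[of x a] na by simp
    then show "norm ((x \<bullet> a) * \<phi> x) \<le> norm (r *\<^sub>R \<phi> x)" using r(1) by (simp add: abs_mult mult_right_mono)
   qed
   then show "l2norm X (\<lambda>x. (x \<bullet> a) * \<phi> x) \<le> r * l2norm X \<phi>" using r(1) l2norm_scaleR[of X r \<phi>] by simp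
   show "l2norm X (\<lambda>x. grad \<phi> x \<bullet> a) \<le> l2norm X (grad \<phi>)"
    by (rule l2norm_mono[OF L(3) grad_test_L2[OF t]]) (use Cauchy_Schwarz_ineq2[of _ a] na in auto)
  qed (use r in auto)
  finally have "(LINT x|LM. \<phi> x * \<phi> x) \<le> 2 * ((r * l2norm X \<phi>) * l2norm X (grad \<phi>))" .
  moreover have "(l2norm X \<phi>)^2 = (LINT x|LM. \<phi> x * \<phi> x)"
   unfolding l2norm_sq by (simp add: power2_eq_square)
  ultimately have "(l2norm X \<phi>)^2 \<le> (2 * r * l2norm X (grad \<phi>)) * l2norm X \<phi>"
   by (simp add: mult_ac)
  then show ?thesis by (cases "l2norm X \<phi> = 0") (use r in \<open>auto simp: power2_eq_square order_less_le\<close>)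
 qed
 then show thesis using that[of "2 * r"] r(1) by simp
qed

end

text \<open>The closure rules for \<open>C_k\<close> start from x.a, so the squared distance is
  rewritten as a sum of squared coordinates.\<close>

lemma C_k_sqdist: "C_k k (\<lambda>y::real^'d::finite. (norm (y - z))^2)"
proof -
 have eq: "(\<lambda>y::real^'d. (norm (y - z))\<^sup>2) = (\<lambda>y. \<Sum>i\<in>UNIV. (y \<bullet> axis i 1 + (- z $ i))^2)"
  by (auto simp: norm_vec_def L2_set_def inner_axis sum_nonneg)
 show ?thesis unfolding eq by (intro C_k_sum C_k_power C_k_add C_k_inner C_k_const)
qed

section \<open>Density of test functions in L2\<close>

context bounded_open
begin

text \<open>By Lindelof, U is a countable union of balls whose closed balls stay inside U. One minus
  the product of the factors 1 - bump merges the first n bumps into a smooth function with values in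
  [0,1], supported in a finite union of closed balls; a single bump tending to 1 already drives the
  product to 0.\<close>

lemma open_indicator_approx:
 assumes "open U" "U \<subseteq> X"
 obtains \<phi> where "\<And>n. \<phi> n \<in> test" "\<And>n x. \<bar>\<phi> n x\<bar> \<le> 1" "\<And>x. (\<lambda>n::nat. \<phi> n x) \<longlonglongrightarrow> indicator U x"
proof (cases "U = {}")
 case True
 then show thesis using that[of "\<lambda>n x. 0"] by (auto simp: test_zero)
next
 case False
 define F where "F = {ball x r | x r. 0 < r \<and> cball x r \<subseteq> U}"
 obtain F' where F': "F' \<subseteq> F" "countable F'" "\<Union>F' = \<Union>F" by (rule Lindelof[of F]) (auto simp: F_def)
 have UF: "\<Union>F = U"
 proof
  show "U \<subseteq> \<Union>F"
  proof
   fix x assume "x \<in> U"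
   then obtain r where "0 < r" "cball x r \<subseteq> U" using assms(1) open_contains_cball by blast
   then show "x \<in> \<Union>F" by (auto simp: F_def intro!: exI[of _ "ball x r"])
  qed
 qed (auto simp: F_def)
 then have ne: "F' \<noteq> {}" using F' False by auto
 have "\<exists>x r. from_nat_into F' i = ball x r \<and> 0 < r \<and> cball x r \<subseteq> U" for i
  using from_nat_into[OF ne, of i] F'(1) by (auto simp: F_def)
 then obtain c r where cr: "\<And>i. from_nat_into F' i = ball (c i) (r i)" "\<And>i. 0 < r i" "\<And>i. cball (c i) (r i) \<subseteq> U" by metis
 \<comment> \<open>Positive exactly inside ball i, and smooth, unlike the distance itself. Writing
   differences as sums with the factor - 1 matches the closure rules for \<open>C_k\<close>.\<close>
 define s where "s i y = (r i)\<^sup>2 + (- 1) * (norm (y - c i))\<^sup>2" for i :: nat and y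
 define \<phi> where "\<phi> n y = 1 + (- 1) * (\<Prod>i<n. 1 + (- 1) * exp_bump (real n * s i y))" for n y
 have p: "0 \<le> (\<Prod>i<n. 1 + (- 1) * exp_bump (real n * s i y))" "(\<Prod>i<n. 1 + (- 1) * exp_bump (real n * s i y)) \<le> 1" for n y
  using exp_bump_props(1,2) by (auto intro!: prod_nonneg prod_le_1)
 have Ck: "C_k k (\<phi> n)" for k n
 proof -
  have "C_k k (\<lambda>y. exp_bump (real n * ((r i)\<^sup>2 + (- 1) * (norm (y - c i))\<^sup>2)))" for k i
   by (rule C_k_compose[OF smooth_real_exp_bump C_k_mult[OF C_k_const C_k_add[OF C_k_const C_k_mult[OF C_k_const C_k_sqdist]]]])
  then show ?thesis unfolding \<phi>_def s_def
   by (intro C_k_add C_k_const C_k_mult C_k_prod)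
 qed
 have "\<phi> n \<in> test" for n
 proof (rule test_functions_I[OF Ck, of "\<Union>i<n. cball (c i) (r i)"])
  show "(\<Union>i<n. cball (c i) (r i)) \<subseteq> X" using cr(3) assms(2) by blast
  fix x assume x: "x \<notin> (\<Union>i<n. cball (c i) (r i))"
  have "exp_bump (real n * s i x) = 0" if "i < n" for i
  proof -
   have "x \<notin> cball (c i) (r i)" using x that by blast
   then have "r i < norm (x - c i)" by (auto simp: dist_norm norm_minus_commute)
   then have "(r i)^2 \<le> (norm (x - c i))^2" using cr(2)[of i] by (intro power_mono) auto
   then show ?thesis by (intro exp_bump_props(3)) (auto simp: s_def mult_nonneg_nonpos)
  qed
  then show "\<phi> n x = 0" by (simp add: \<phi>_def)
 qed (auto intro!: compact_UN)
 moreover have "\<bar>\<phi> n x\<bar> \<le> 1" for n x using p[of n x] by (simp add: \<phi>_def)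
 moreover have "(\<lambda>n. \<phi> n x) \<longlonglongrightarrow> indicator U x" for x
 proof (cases "x \<in> U")
  case False
  have "\<phi> n x = 0" for n
  proof -
   have "exp_bump (real n * s i x) = 0" for i
   proof -
    have "x \<notin> cball (c i) (r i)" using cr(3) False by blast
    then have "r i \<le> norm (x - c i)" by (auto simp: dist_norm norm_minus_commute)
    then have "(r i)^2 \<le> (norm (x - c i))^2" using cr(2)[of i] by (intro power_mono) auto
    then show ?thesis by (intro exp_bump_props(3)) (auto simp: s_def mult_nonneg_nonpos)
   qed
   then show ?thesis by (simp add: \<phi>_def)
  qed
  then show ?thesis using False by simp
 next
  case True
  then obtain B where "B \<in> F'" "x \<in> B" using UF F'(3) by blast
  then obtain j where j: "x \<in> ball (c j) (r j)" using from_nat_into_surj[OF F'(2)] cr(1) by metis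
  then have "norm (x - c j) < r j" by (auto simp: dist_norm norm_minus_commute)
  then have "(norm (x - c j))^2 < (r j)^2" by (intro power_strict_mono) auto
  then have "(\<lambda>n. exp_bump (real n * s j x)) \<longlonglongrightarrow> 1" using exp_bump_lim[of "s j x"] by (auto simp: s_def)
  then have l0: "(\<lambda>n. 1 - exp_bump (real n * s j x)) \<longlonglongrightarrow> 0" by (auto intro!: tendsto_eq_intros)
  have "(\<lambda>n. \<Prod>i<n. 1 + (- 1) * exp_bump (real n * s i x)) \<longlonglongrightarrow> 0"
  proof (rule Lim_null_comparison[OF _ l0])
   show "\<forall>\<^sub>F n in sequentially. norm (\<Prod>i<n. 1 + (- 1) * exp_bump (real n * s i x)) \<le> 1 - exp_bump (real n * s j x)"
    using eventually_gt_at_top[of j]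
   proof eventually_elim
    case (elim n)
    have "(\<Prod>i<n. 1 + (- 1) * exp_bump (real n * s i x)) = (1 + (-1) * exp_bump (real n * s j x)) * (\<Prod>i\<in>{..<n} - {j}. 1 + (- 1) * exp_bump (real n * s i x))"
     by (rule prod.remove) (use elim in auto)
    also have "\<dots> \<le> (1 + (-1) * exp_bump (real n * s j x)) * 1"
     using exp_bump_props(1,2) by (intro mult_left_mono prod_le_1) auto
    finally show ?case using p(1)[where n=n and y=x] by simp
   qed
  qed
  then have "(\<lambda>n. \<phi> n x) \<longlonglongrightarrow> 1 + (-1) * 0" unfolding \<phi>_def by (intro tendsto_intros)
  then show ?thesis using True by simp
 qed
 ultimately show thesis using that by blast
qed

definition approximable :: "(real^'d \<Rightarrow> real) \<Rightarrow> bool" where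
 "approximable g \<longleftrightarrow> g \<in> L2 X \<and> (\<forall>e>0. \<exists>\<phi>\<in>test. l2norm X (\<lambda>x. \<phi> x - g x) < e)"

lemma approximable_lim:
 assumes "l2_lim X f g" "\<And>n. approximable (f n)"
 shows "approximable g"
 unfolding approximable_def
proof (intro conjI allI impI)
 note D = l2_lim_D[OF assms(1)]
 show "g \<in> L2 X" by (rule D)
 fix e :: real assume "e > 0"
 then obtain n where n: "l2norm X (\<lambda>x. f n x - g x) < e / 2"
  using order_tendstoD(2)[OF D(3), of "e/2"] by (auto simp: eventually_sequentially)
 obtain \<phi> where \<phi>: "\<phi> \<in> test" "l2norm X (\<lambda>x. \<phi> x - f n x) < e / 2"
  using assms(2)[of n] \<open>e > 0\<close> by (auto simp: approximable_def dest: spec[of _ "e/2"])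
 have "l2norm X (\<lambda>x. \<phi> x - g x) < e"
  using l2norm_triangle_diff[OF test_L2[OF \<phi>(1)] D(1) D(2), of n] n \<phi>(2) by linarith
 then show "\<exists>\<phi>\<in>test. l2norm X (\<lambda>x. \<phi> x - g x) < e" using \<phi>(1) by blast
qed

lemma approximable_test: "\<phi> \<in> test ==> approximable \<phi>"
 by (auto simp: approximable_def test_L2 l2norm_def intro!: bexI[of _ \<phi>])

lemma approximable_add:
 assumes "approximable f" "approximable g"
 shows "approximable (\<lambda>x. f x + g x)"
 unfolding approximable_def
proof (intro conjI allI impI)
 have L: "f \<in> L2 X" "g \<in> L2 X" using assms by (auto simp: approximable_def)
 then show "(\<lambda>x. f x + g x) \<in> L2 X" by auto
 fix e :: real assume e: "e > 0"
 obtain \<phi> where \<phi>: "\<phi> \<in> test" "l2norm X (\<lambda>x. \<phi> x - f x) < e / 2"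
  using assms(1) e by (auto simp: approximable_def dest: spec[of _ "e/2"])
 obtain \<psi> where \<psi>: "\<psi> \<in> test" "l2norm X (\<lambda>x. \<psi> x - g x) < e / 2"
  using assms(2) e by (auto simp: approximable_def dest: spec[of _ "e/2"])
 have "l2norm X (\<lambda>x. (\<phi> x - f x) + (\<psi> x - g x)) < e"
  using l2norm_triangle[OF L2_diff[OF test_L2[OF \<phi>(1)] L(1)] L2_diff[OF test_L2[OF \<psi>(1)] L(2)]] \<phi>(2) \<psi>(2) by linarith
 then show "\<exists>\<phi>\<in>test. l2norm X (\<lambda>x. \<phi> x - (f x + g x)) < e"
  using test_add[OF \<phi>(1) \<psi>(1)] by (intro bexI[of _ "\<lambda>x. \<phi> x + \<psi> x"]) (auto simp: algebra_simps)
qed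

lemma approximable_cmult:
 assumes "approximable f"
 shows "approximable (\<lambda>x. c * f x)"
 unfolding approximable_def
proof (intro conjI allI impI)
 have L: "f \<in> L2 X" using assms by (auto simp: approximable_def)
 then show "(\<lambda>x. c * f x) \<in> L2 X" using L2_scaleR[OF L, of c] by simp
 fix e :: real assume e: "e > 0"
 obtain \<phi> where \<phi>: "\<phi> \<in> test" "l2norm X (\<lambda>x. \<phi> x - f x) < e / (\<bar>c\<bar> + 1)"
  using assms e by (auto simp: approximable_def dest: spec[of _ "e/(\<bar>c\<bar> + 1)"])
 have "l2norm X (\<lambda>x. c *\<^sub>R (\<phi> x - f x)) \<le> (\<bar>c\<bar> + 1) * l2norm X (\<lambda>x. \<phi> x - f x)"
  unfolding l2norm_scaleR by (intro mult_right_mono) auto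
 also have "\<dots> < e" using \<phi>(2) by (simp add: pos_less_divide_eq mult.commute)
 finally show "\<exists>\<phi>\<in>test. l2norm X (\<lambda>x. \<phi> x - c * f x) < e"
  using test_cmult[OF \<phi>(1), of c] by (intro bexI[of _ "\<lambda>x. c * \<phi> x"]) (auto simp: algebra_simps)
qed

lemma approximable_sum: "(\<And>i. i \<in> I ==> approximable (f i)) ==> approximable (\<lambda>x. \<Sum>i\<in>I. f i x)"
 by (induction I rule: infinite_finite_induct) (auto intro: approximable_add approximable_test test_zero)

lemma approximable_cong:
 assumes "approximable f" "\<And>x. x \<in> X ==> g x = f x"
 shows "approximable g"
proof -
 have g: "g \<in> L2 X"
 proof (rule L2_bound)
  show "f \<in> L2 X" using assms(1) by (simp add: approximable_def)
  then show "g \<in> borel_measurable LM" using assms(2) L2_D(1) measurable_cong[of LM g f] by simp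
 qed (use assms(2) in auto)
 have "l2norm X (\<lambda>x. \<phi> x - g x) = l2norm X (\<lambda>x. \<phi> x - f x)" for \<phi>
  unfolding l2norm_def using assms(2) by (intro arg_cong[of _ _ sqrt] lint_cong) auto
 then show ?thesis using assms(1) g by (simp add: approximable_def)
qed

text \<open>Outer regularity supplies open sets between A and X whose excess over A has small
  measure. The L2 distance of the two indicators is the square root of this measure, and indicators
  of open sets are limits of test functions.\<close>

lemma approximable_indicator:
 assumes "A \<in> sets LM"
 shows "approximable (indicator A)"
proof -
 have A: "A \<in> sets lebesgue" "A \<subseteq> X" using assms by (auto simp: sets_restrict_space)
 have op: "approximable (indicator U)" if "open U" "U \<subseteq> X" for U
 proof -
  obtain \<phi> where \<phi>: "\<And>n. \<phi> n \<in> test" "\<And>n x. \<bar>\<phi> n x\<bar> \<le> 1" "\<And>x. (\<lambda>n::nat. \<phi> n x) \<longlonglongrightarrow> indicator U x"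
   using open_indicator_approx[OF \<open>open U\<close> \<open>U \<subseteq> X\<close>] by blast
  have "l2_lim X \<phi> (indicator U)"
   by (rule l2_lim_dominated[OF _ _ L2_const[OF lmeas, of "1::real"]])
    (use \<phi> that in \<open>auto intro: continuous_measurable_dom[OF test_continuous] measurable_borel_dom\<close>)
  then show ?thesis using approximable_lim approximable_test \<phi>(1) by blast
 qed
 have "\<exists>U. open U \<and> U \<subseteq> X \<and> A \<subseteq> U \<and> U - A \<in> lmeasurable \<and> measure lebesgue (U - A) < e" if e0: "e > 0" for e
 proof -
  obtain T where T: "open T" "A \<subseteq> T" "T - A \<in> lmeasurable" "emeasure lebesgue (T - A) < ennreal e"
   using sets_lebesgue_outer_open[OF A(1) e0] by blast
  have s: "(T \<inter> X) - A \<in> sets lebesgue" using T(1) A open_dom by auto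
  have "emeasure lebesgue ((T \<inter> X) - A) \<le> emeasure lebesgue (T - A)"
   using T(3) by (intro emeasure_mono) auto
  then have l: "emeasure lebesgue ((T \<inter> X) - A) < ennreal e" using T(4) by order
  then have "(T \<inter> X) - A \<in> lmeasurable" using s by (intro fmeasurableI) (auto intro: less_trans)
  moreover from this l have "measure lebesgue ((T \<inter> X) - A) < e" using e0 by (simp add: emeasure_eq_measure2 ennreal_less_iff)
  ultimately show ?thesis using T A open_dom by (intro exI[of _ "T \<inter> X"]) auto
 qed
 then have "\<exists>U. open U \<and> U \<subseteq> X \<and> A \<subseteq> U \<and> U - A \<in> lmeasurable \<and> measure lebesgue (U - A) < 1 / real (Suc n)" for n by simp
 then obtain U where U: "\<And>n. open (U n)" "\<And>n. U n \<subseteq> X" "\<And>n. A \<subseteq> U n" "\<And>n. U n - A \<in> lmeasurable"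
  "\<And>n. measure lebesgue (U n - A) < 1 / real (Suc n)" by metis
 have m: "(indicator S :: _ \<Rightarrow> real) \<in> L2 X" if "S \<in> sets lebesgue" for S :: "(real^'d) set"
  by (rule L2_bounded[OF lmeas, of _ 1]) (use that in \<open>auto intro: measurable_restrict_space1 simp: indicator_def\<close>)
 have "l2norm X (\<lambda>x. indicator (U n) x - indicator A x :: real) = sqrt (measure lebesgue (U n - A))" for n
 proof -
  have "(\<lambda>x. (norm (indicator (U n) x - indicator A x :: real))^2) = indicator (U n - A)"
   using U(3)[of n] by (intro ext) (auto simp: indicator_def)
  then have "(LINT x|LM. (norm (indicator (U n) x - indicator A x :: real))^2) = integral\<^sup>L LM (indicator (U n - A))"
   by simp
  also have "\<dots> = integral\<^sup>L lebesgue (indicator (U n - A))" using U(2)[of n] by (intro integral_dom_eq) (auto simp: indicator_def)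
  finally show ?thesis using U(4)[of n] by (simp add: l2norm_def fmeasurable_def)
 qed
 moreover have "(\<lambda>n. sqrt (measure lebesgue (U n - A))) \<longlonglongrightarrow> sqrt 0"
 proof (intro tendsto_real_sqrt Lim_null_comparison[OF _ LIMSEQ_Suc[OF lim_1_over_n]])
  show "\<forall>\<^sub>F n in sequentially. norm (measure lebesgue (U n - A)) \<le> 1 / real (Suc n)" using U(5) by (simp add: less_imp_le)
 qed
 ultimately have "l2_lim X (\<lambda>n. indicator (U n)) (indicator A :: _ \<Rightarrow> real)"
  using m A U(1) by (auto simp: l2_lim_def)
 then show ?thesis by (rule approximable_lim) (use op U in blast)
qed

lemma test_dense:
 assumes g: "g \<in> L2 X"
 shows "approximable g"
proof -
 obtain s where s: "\<And>i. simple_function LM (s i)" "\<And>x. x \<in> X ==> (\<lambda>i. s i x) \<longlonglongrightarrow> g x"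
  "\<And>i x. x \<in> X ==> norm (s i x) \<le> 2 * norm (g x)"
  using borel_measurable_implies_sequence_metric[OF L2_D(1)[OF g], of 0] by (simp, metis)
 have lim: "l2_lim X s g"
  by (rule l2_lim_dominated[OF _ _ L2_scaleR[OF g, of 2]])
   (use s L2_D(1)[OF g] in \<open>auto intro!: borel_measurable_simple_function AE_I2 simp: abs_mult\<close>)
 have "approximable (s i)" for i
 proof -
  have a: "approximable (\<lambda>x. \<Sum>y\<in>s i ` X. y * indicator (s i -` {y} \<inter> X) x)"
   by (intro approximable_sum approximable_cmult approximable_indicator)
    (use simple_functionD(2)[OF s(1)[of i]] in simp)
  have eq: "s i x = (\<Sum>y\<in>s i ` X. y * indicator (s i -` {y} \<inter> X) x)" if "x \<in> X" for x
   by (rule trans[OF simple_function_indicator_representation_banach[OF s(1)[of i], of x]])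
    (simp_all add: that mult.commute)
  show ?thesis by (rule approximable_cong[OF a eq])
 qed
 then show ?thesis by (rule approximable_lim[OF lim])
qed

end

section \<open>The Dirichlet problem\<close>

lemma norm_matrix_vector_le: "norm (A *v v) \<le> norm A * norm (v::real^'n::finite)"
 for A :: "real^'n^'m::finite"
proof -
 have "norm (A *v v) = L2_set (\<lambda>i. norm ((A *v v) $ i)) UNIV" by (simp add: norm_vec_def)
 also have "\<dots> \<le> L2_set (\<lambda>i. norm (A $ i) * norm v) UNIV"
  by (intro L2_set_mono) (auto simp: matrix_vector_mul_component Cauchy_Schwarz_ineq2)
 also have "\<dots> = norm A * norm v" by (simp add: L2_set_left_distrib norm_vec_def)
 finally show ?thesis .
qed

lemma bounded_bilinear_matrix_vector:
 "bounded_bilinear ((*v) :: real^'n::finite^'m::finite \<Rightarrow> real^'n \<Rightarrow> real^'m)"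
 by (standard; (intro exI[of _ 1])?)
  (auto simp: matrix_vector_mult_add_rdistrib matrix_vector_right_distrib scaleR_matrix_vector_assoc
   matrix_vector_mult_scaleR norm_matrix_vector_le)

lemma matrix_vector_measurable [measurable (raw)]:
 fixes A :: "'a \<Rightarrow> real^'n::finite^'m::finite"
 assumes "A \<in> borel_measurable M" "G \<in> borel_measurable M"
 shows "(\<lambda>x. A x *v G x) \<in> borel_measurable M"
 by (rule borel_measurable_continuous_Pair[OF assms])
  (intro bounded_bilinear.continuous_on[OF bounded_bilinear_matrix_vector] continuous_intros)

lemma Linf_D:
 assumes "f \<in> Linf X"
 obtains C where "f \<in> borel_measurable (lebesgue_on X)" "C \<ge> 0" "AE x in lebesgue_on X. norm (f x) \<le> C"
proof -
 obtain C where C: "AE x in lebesgue_on X. norm (f x) \<le> C" using assms by (auto simp: Linf_def)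
 have "AE x in lebesgue_on X. norm (f x) \<le> max C 0" using C by eventually_elim auto
 then show thesis using that[of "max C 0"] assms by (auto simp: Linf_def)
qed

lemma Linf_L2_matrix_vector:
 fixes A :: "'a::euclidean_space \<Rightarrow> real^'n::finite^'m::finite"
 assumes "A \<in> Linf X" "G \<in> L2 X"
 shows "(\<lambda>x. A x *v G x) \<in> L2 X"
proof -
 obtain C where C: "A \<in> borel_measurable (lebesgue_on X)" "C \<ge> 0" "AE x in lebesgue_on X. norm (A x) \<le> C"
  using Linf_D[OF assms(1)] .
 show ?thesis
 proof (rule L2_bound[OF matrix_vector_measurable[OF C(1) L2_D(1)[OF assms(2)]] L2_scaleR[OF assms(2), of C]])
  show "AE x in lebesgue_on X. norm (A x *v G x) \<le> norm (C *\<^sub>R G x)"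
   using C(3) by eventually_elim (use C(2) in \<open>auto intro!: order_trans[OF norm_matrix_vector_le] mult_right_mono\<close>)
 qed
qed

lemma l2_lim_matrix_vector:
 fixes A :: "'a::euclidean_space \<Rightarrow> real^'n::finite^'m::finite"
 assumes "A \<in> Linf X" "l2_lim X F G"
 shows "l2_lim X (\<lambda>n x. A x *v F n x) (\<lambda>x. A x *v G x)"
proof -
 obtain C where C: "A \<in> borel_measurable (lebesgue_on X)" "C \<ge> 0" "AE x in lebesgue_on X. norm (A x) \<le> C"
  using Linf_D[OF assms(1)] .
 note D = l2_lim_D[OF assms(2)]
 show ?thesis
 proof (rule l2_lim_bounded_linear[OF assms(2), where C=C])
  show "AE x in lebesgue_on X. norm (A x *v G x) \<le> C * norm (G x)"
   using C(3) by eventually_elim (auto intro!: order_trans[OF norm_matrix_vector_le] mult_right_mono)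
  show "AE x in lebesgue_on X. norm (A x *v F n x - A x *v G x) \<le> C * norm (F n x - G x)" for n
   using C(3) by eventually_elim
    (auto simp: matrix_vector_mult_diff_distrib[symmetric] intro!: order_trans[OF norm_matrix_vector_le] mult_right_mono)
 qed (use C D L2_D(1) in \<open>auto intro!: matrix_vector_measurable\<close>)
qed

lemma symmetric_inner: "transpose A = A ==> (A *v v) \<bullet> w = v \<bullet> (A *v (w::real^'n::finite))"
 by (metis dot_lmul_matrix vector_transpose_matrix inner_commute)

lemma l2_lim_subst:
 assumes "l2_lim X f g" "AE x in lebesgue_on X. g x = h x" "h \<in> L2 X"
 shows "l2_lim X f h"
proof -
 note D = l2_lim_D[OF assms(1)]
 have "l2norm X (\<lambda>x. f n x - h x) = l2norm X (\<lambda>x. f n x - g x)" for n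
  by (rule l2norm_cong_AE) (use D assms in \<open>auto elim!: eventually_mono\<close>)
 then show ?thesis using D assms(3) by (simp add: l2_lim_def)
qed

lemma l2_lim_diff:
 assumes "l2_lim X f f'" "l2_lim X g g'"
 shows "l2_lim X (\<lambda>n x. f n x - g n x) (\<lambda>x. f' x - g' x)"
proof -
 note F = l2_lim_D[OF assms(1)] and G = l2_lim_D[OF assms(2)]
 have le: "l2norm X (\<lambda>x. (f n x - g n x) - (f' x - g' x)) \<le> l2norm X (\<lambda>x. f n x - f' x) + l2norm X (\<lambda>x. g n x - g' x)" for n
 proof -
  have "(\<lambda>x. (f n x - g n x) - (f' x - g' x)) = (\<lambda>x. (f n x - f' x) + (g' x - g n x))" by auto
  then show ?thesis using l2norm_triangle[OF L2_diff[OF F(1,2)] L2_diff[OF G(2,1)], of n n] unfolding l2norm_minus_commute[of X g' "g n"] by (simp only:)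
 qed
 have "(\<lambda>n. l2norm X (\<lambda>x. f n x - f' x) + l2norm X (\<lambda>x. g n x - g' x)) \<longlonglongrightarrow> 0 + 0"
  by (intro tendsto_add F G)
 then have r: "(\<lambda>n. l2norm X (\<lambda>x. f n x - f' x) + l2norm X (\<lambda>x. g n x - g' x)) \<longlonglongrightarrow> 0" by simp
 have "(\<lambda>n. l2norm X (\<lambda>x. (f n x - g n x) - (f' x - g' x))) \<longlonglongrightarrow> 0"
  by (rule Lim_null_comparison[OF always_eventually r], intro allI) (unfold real_norm_def abs_of_nonneg[OF l2norm_ge0], rule le)
 then show ?thesis using F G by (auto simp: l2_lim_def)
qed

section \<open>Functions in H^1_0 together with their gradients\<close>

context bounded_open
begin

text \<open>Function and gradient are L2 limits of the same test functions, so identities for test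
  gradients pass directly to G. The agreement with \<open>H1_0\<close> plus a weak gradient is part
  of \<open>dirichlet_solution_iff\<close>.\<close>

definition h10 :: "(real^'d \<Rightarrow> real) \<Rightarrow> (real^'d \<Rightarrow> real^'d) \<Rightarrow> bool" where
 "h10 u G \<longleftrightarrow> (\<exists>\<phi>. (\<forall>n. \<phi> n \<in> test) \<and> l2_lim X \<phi> u \<and> l2_lim X (\<lambda>n. grad (\<phi> n)) G)"

lemma h10_test: "\<phi> \<in> test ==> h10 \<phi> (grad \<phi>)"
 unfolding h10_def by (intro exI[of _ "\<lambda>n. \<phi>"]) (auto intro!: l2_lim_const test_L2 grad_test_L2)

lemma h10_L2: "h10 u G ==> u \<in> L2 X" "h10 u G ==> G \<in> L2 X"
 unfolding h10_def using l2_lim_D(2) by blast+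

lemma h10_diff:
 assumes "h10 u G" "h10 v F"
 shows "h10 (\<lambda>x. u x - v x) (\<lambda>x. G x - F x)"
proof -
 obtain \<phi> where \<phi>: "\<And>n. \<phi> n \<in> test" "l2_lim X \<phi> u" "l2_lim X (\<lambda>n. grad (\<phi> n)) G" using assms(1) by (auto simp: h10_def)
 obtain \<psi> where \<psi>: "\<And>n. \<psi> n \<in> test" "l2_lim X \<psi> v" "l2_lim X (\<lambda>n. grad (\<psi> n)) F" using assms(2) by (auto simp: h10_def)
 have "grad (\<lambda>x. \<phi> n x - \<psi> n x) = (\<lambda>x. grad (\<phi> n) x - grad (\<psi> n) x)" for n
  using test_grad_diff[OF \<phi>(1) \<psi>(1)] by blast
 then show ?thesis unfolding h10_def
  using l2_lim_diff[OF \<phi>(2) \<psi>(2)] l2_lim_diff[OF \<phi>(3) \<psi>(3)] test_diff[OF \<phi>(1) \<psi>(1)]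
  by (intro exI[of _ "\<lambda>n x. \<phi> n x - \<psi> n x"]) auto
qed

lemma h10_ortho:
 assumes "h10 u G" "\<sigma> \<in> L2 X" "\<And>\<phi>. \<phi> \<in> test ==> (LINT x|LM. \<sigma> x \<bullet> grad \<phi> x) = (LINT x|LM. \<tau> x \<bullet> grad \<phi> x)" "\<tau> \<in> L2 X"
 shows "(LINT x|LM. \<sigma> x \<bullet> G x) = (LINT x|LM. \<tau> x \<bullet> G x)"
proof -
 obtain \<phi> where \<phi>: "\<And>n. \<phi> n \<in> test" "l2_lim X \<phi> u" "l2_lim X (\<lambda>n. grad (\<phi> n)) G" using assms(1) by (auto simp: h10_def)
 show ?thesis using l2_lim_inner_left(2)[OF \<phi>(3) assms(2)] l2_lim_inner_left(2)[OF \<phi>(3) assms(4)]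
  unfolding assms(3)[OF \<phi>(1)] by (rule LIMSEQ_unique)
qed

lemma h10_poincare:
 obtains C where "C > 0" "\<And>u G. h10 u G ==> l2norm X u \<le> C * l2norm X G"
proof -
 obtain C where C: "C > 0" "\<And>\<phi>. \<phi> \<in> test ==> l2norm X \<phi> \<le> C * l2norm X (grad \<phi>)" using poincare_const by blast
 have "l2norm X u \<le> C * l2norm X G" if h: "h10 u G" for u G
 proof -
  obtain \<phi> where \<phi>: "\<And>n. \<phi> n \<in> test" "l2_lim X \<phi> u" "l2_lim X (\<lambda>n. grad (\<phi> n)) G" using h by (auto simp: h10_def)
  show ?thesis
   by (rule LIMSEQ_le[OF l2_lim_norm[OF \<phi>(2)] tendsto_mult_left[OF l2_lim_norm[OF \<phi>(3)]]]) (use C(2)[OF \<phi>(1)] in auto)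
 qed
 then show thesis using that C(1) by blast
qed

lemma integral_inner_const:
 fixes F :: "real^'d \<Rightarrow> 'b::euclidean_space"
 assumes "integrable LM F"
 shows "(LINT x|LM. F x) \<bullet> e = (LINT x|LM. F x \<bullet> e)"
 using assms by (simp add: integral_inner_left)

lemma weak_gradient_iff:
 "weak_gradient X u G \<longleftrightarrow> u \<in> L2 X \<and> G \<in> L2 X \<and>
  (\<forall>\<phi>\<in>test. \<forall>e. (LINT x|LM. u x * (grad \<phi> x \<bullet> e)) = - (LINT x|LM. \<phi> x * (G x \<bullet> e)))"
proof -
 have "((LINT x|LM. u x *\<^sub>R grad \<phi> x) = - (LINT x|LM. \<phi> x *\<^sub>R G x)) \<longleftrightarrow>
  (\<forall>e. (LINT x|LM. u x * (grad \<phi> x \<bullet> e)) = - (LINT x|LM. \<phi> x * (G x \<bullet> e)))"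
  if "u \<in> L2 X" "G \<in> L2 X" "\<phi> \<in> test" for \<phi>
 proof -
  have "(LINT x|LM. u x *\<^sub>R grad \<phi> x) \<bullet> e = (LINT x|LM. u x * (grad \<phi> x \<bullet> e))" 
   "(- (LINT x|LM. \<phi> x *\<^sub>R G x)) \<bullet> e = - (LINT x|LM. \<phi> x * (G x \<bullet> e))" for e
   using integral_inner_const[OF L2_scaleR_integrable[OF that(1) grad_test_L2[OF that(3)]]]
    integral_inner_const[OF L2_scaleR_integrable[OF test_L2[OF that(3)] that(2)]] by simp_all
  then show ?thesis by (subst vector_eq_rdot[symmetric]) (simp only:)
 qed
 then show ?thesis unfolding weak_gradient_def by blast
qed

lemma L2_inner_const:
 assumes "G \<in> L2 X" shows "(\<lambda>x. G x \<bullet> e) \<in> L2 X"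
proof (rule L2_bound[OF _ L2_scaleR[OF assms, of "norm e"]])
 show "(\<lambda>x. G x \<bullet> e) \<in> borel_measurable LM" using L2_D(1)[OF assms] by measurable
qed (simp, subst mult.commute, intro AE_I2 Cauchy_Schwarz_ineq2)

lemma l2_lim_inner_const:
 assumes "l2_lim X F G" shows "l2_lim X (\<lambda>n x. F n x \<bullet> e) (\<lambda>x. G x \<bullet> e)"
proof (rule l2_lim_bounded_linear[OF assms, where C="norm e"])
 show "AE x in LM. norm (F n x \<bullet> e - G x \<bullet> e) \<le> norm e * norm (F n x - G x)" for n
  unfolding inner_diff_left[symmetric] real_norm_def mult.commute[of "norm e"] by (intro AE_I2 Cauchy_Schwarz_ineq2)
 show "AE x in LM. norm (G x \<bullet> e) \<le> norm e * norm (G x)"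
  unfolding real_norm_def mult.commute[of "norm e"] by (intro AE_I2 Cauchy_Schwarz_ineq2)
qed (use l2_lim_D[OF assms] in \<open>auto intro!: L2_D(1) L2_inner_const\<close>)

lemma h10_weak_gradient:
 assumes "h10 u G" shows "weak_gradient X u G"
 unfolding weak_gradient_iff
proof (intro conjI ballI allI)
 fix \<phi> e assume t: "\<phi> \<in> test"
 obtain \<psi> where \<psi>: "\<And>n. \<psi> n \<in> test" "l2_lim X \<psi> u" "l2_lim X (\<lambda>n. grad (\<psi> n)) G" using assms by (auto simp: h10_def)
 have 1: "(\<lambda>n. LINT x|LM. \<psi> n x * (grad \<phi> x \<bullet> e)) \<longlonglongrightarrow> (LINT x|LM. u x * (grad \<phi> x \<bullet> e))"
  using l2_lim_inner_left(1)[OF \<psi>(2) test_L2[OF test_dir_deriv[OF t, of e]]] by simp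
 have 2: "(\<lambda>n. LINT x|LM. \<phi> x * (grad (\<psi> n) x \<bullet> e)) \<longlonglongrightarrow> (LINT x|LM. \<phi> x * (G x \<bullet> e))"
  using l2_lim_inner_left(2)[OF l2_lim_inner_const[OF \<psi>(3), of e] test_L2[OF t]] by simp
 have "(LINT x|LM. \<psi> n x * (grad \<phi> x \<bullet> e)) = - (LINT x|LM. \<phi> x * (grad (\<psi> n) x \<bullet> e))" for n
  by (rule test_ibp[OF \<psi>(1) t])
 then show "(LINT x|LM. u x * (grad \<phi> x \<bullet> e)) = - (LINT x|LM. \<phi> x * (G x \<bullet> e))"
  using LIMSEQ_unique[OF 1] tendsto_minus[OF 2] by simp
qed (use assms h10_L2 in auto)

text \<open>Approximating g within e by a test function gives |g|^2 \<le> e |g| for the L2 norm and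
  every e > 0; the choice e = |g| / 2 forces the norm to vanish.\<close>

lemma test_ortho_imp_0:
 assumes g: "g \<in> L2 X" and o: "\<And>\<phi>. \<phi> \<in> test ==> (LINT x|LM. \<phi> x * g x) = 0"
 shows "AE x in LM. g x = 0"
proof -
 have "(l2norm X g)^2 \<le> e * l2norm X g" if e: "e > 0" for e
 proof -
  obtain \<phi> where \<phi>: "\<phi> \<in> test" "l2norm X (\<lambda>x. \<phi> x - g x) < e"
   using test_dense[OF g] e by (auto simp: approximable_def)
  have "(l2norm X g)^2 = (LINT x|LM. (g x - \<phi> x) * g x)"
   using o[OF \<phi>(1)] L2_mult_integrable[OF g g] L2_mult_integrable[OF test_L2[OF \<phi>(1)] g]
   unfolding l2norm_sq by (simp add: power2_eq_square algebra_simps)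
  also have "\<dots> \<le> l2norm X (\<lambda>x. g x - \<phi> x) * l2norm X g"
   using l2_cauchy_schwarz_mult[OF L2_diff[OF g test_L2[OF \<phi>(1)]] g] by linarith
  also have "\<dots> \<le> e * l2norm X g" using \<phi>(2) l2norm_minus_commute[of X \<phi> g] by (intro mult_right_mono) auto
  finally show ?thesis .
 qed
 from this[of "l2norm X g / 2"] have "l2norm X g = 0"
  by (cases "l2norm X g = 0") (auto simp: power2_eq_square order_less_le)
 then show ?thesis using l2norm_eq_0_iff[OF g] by simp
qed

text \<open>Membership in \<open>H1_0\<close> and the equation in \<open>dirichlet_solution\<close>
  may come with different versions of the gradient; this identifies them.\<close>

lemma weak_gradient_unique:
 assumes "weak_gradient X u G" "weak_gradient X u F"
 shows "AE x in LM. G x = F x"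
proof -
 note D = assms[unfolded weak_gradient_iff]
 have "AE x in LM. (G x - F x) \<bullet> axis i 1 = 0" for i
 proof (rule test_ortho_imp_0)
  show "(\<lambda>x. (G x - F x) \<bullet> axis i 1) \<in> L2 X" using D by (intro L2_inner_const) auto
  fix \<phi> assume t: "\<phi> \<in> test"
  have "(LINT x|LM. \<phi> x * (G x \<bullet> axis i 1)) = (LINT x|LM. \<phi> x * (F x \<bullet> axis i 1))" using D(1)[THEN conjunct2, THEN conjunct2, rule_format, OF t, of "axis i 1"]
    D(2)[THEN conjunct2, THEN conjunct2, rule_format, OF t, of "axis i 1"] by linarith
  then show "(LINT x|LM. \<phi> x * ((G x - F x) \<bullet> axis i 1)) = 0"
   using L2_mult_integrable[OF test_L2[OF t] L2_inner_const[of G "axis i 1"]]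
    L2_mult_integrable[OF test_L2[OF t] L2_inner_const[of F "axis i 1"]] D
   by (simp add: inner_diff_left right_diff_distrib)
 qed
 then have "AE x in LM. \<forall>i. (G x - F x) \<bullet> axis i 1 = 0" by (simp add: AE_all_countable)
 then show ?thesis by eventually_elim (simp add: vec_eq_iff inner_axis)
qed

lemma H1_0_obtain:
 assumes "u \<in> H1_0 X"
 obtains G where "h10 u G"
proof -
 obtain G \<phi> where G: "weak_gradient X u G" and \<phi>: "\<And>n::nat. \<phi> n \<in> test"
  and l: "(\<lambda>n. (LINT x|LM. (\<phi> n x - u x)^2) + (LINT x|LM. (norm (grad (\<phi> n) x - G x))^2)) \<longlonglongrightarrow> 0"
  using assms by (auto simp: H1_0_def)
 have L: "u \<in> L2 X" "G \<in> L2 X" using G by (auto simp: weak_gradient_def)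
 have "(\<lambda>n. (LINT x|LM. (\<phi> n x - u x)^2)) \<longlonglongrightarrow> 0" "(\<lambda>n. (LINT x|LM. (norm (grad (\<phi> n) x - G x))^2)) \<longlonglongrightarrow> 0"
  by (rule Lim_null_comparison[OF _ l]; auto)+
 then have "l2_lim X \<phi> u" "l2_lim X (\<lambda>n. grad (\<phi> n)) G"
  using L \<phi> test_L2 grad_test_L2 unfolding l2_lim_def l2norm_def by (auto intro!: tendsto_eq_intros)
 then have "h10 u G" using \<phi> by (auto simp: h10_def)
 then show thesis using that by blast
qed

lemma h10_H1_0: "h10 u G ==> u \<in> H1_0 X"
proof -
 assume h: "h10 u G"
 then obtain \<phi> where \<phi>: "\<And>n. \<phi> n \<in> test" "l2_lim X \<phi> u" "l2_lim X (\<lambda>n. grad (\<phi> n)) G" by (auto simp: h10_def)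
 have "(\<lambda>n. (l2norm X (\<lambda>x. \<phi> n x - u x))^2 + (l2norm X (\<lambda>x. grad (\<phi> n) x - G x))^2) \<longlonglongrightarrow> 0^2 + 0^2"
  by (intro tendsto_intros l2_lim_D(3) \<phi>)
 then show ?thesis using h10_weak_gradient[OF h] \<phi>(1) unfolding H1_0_def l2norm_sq by auto
qed

text \<open>The gradient that accompanies membership in \<open>H1_0\<close> agrees almost everywhere
  with the one in the equation, so it can be exchanged in the L2 limit. Later arguments work with
  the right-hand side.\<close>

lemma dirichlet_solution_iff:
 "dirichlet_solution X A l u G \<longleftrightarrow> h10 u G \<and> neg_div_eq X (\<lambda>x. A x *v G x) l"
proof
 assume d: "dirichlet_solution X A l u G"
 then obtain F where F: "h10 u F" using H1_0_obtain by (auto simp: dirichlet_solution_def)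
 have w: "weak_gradient X u G" using d by (simp add: dirichlet_solution_def)
 have ae: "AE x in LM. F x = G x" using weak_gradient_unique[OF h10_weak_gradient[OF F] w] .
 obtain \<phi> where \<phi>: "\<And>n. \<phi> n \<in> test" "l2_lim X \<phi> u" "l2_lim X (\<lambda>n. grad (\<phi> n)) F" using F by (auto simp: h10_def)
 have "l2_lim X (\<lambda>n. grad (\<phi> n)) G" by (rule l2_lim_subst[OF \<phi>(3) ae]) (use w in \<open>auto simp: weak_gradient_def\<close>)
 then have "h10 u G" using \<phi> by (auto simp: h10_def)
 then show "h10 u G \<and> neg_div_eq X (\<lambda>x. A x *v G x) l" using d by (auto simp: dirichlet_solution_def)
next
 assume "h10 u G \<and> neg_div_eq X (\<lambda>x. A x *v G x) l"
 then show "dirichlet_solution X A l u G"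
  by (auto simp: dirichlet_solution_def h10_H1_0 h10_weak_gradient)
qed

section \<open>Solvability for symmetric elliptic coefficients and the representation of
  H^-1\<close>

definition sym_elliptic :: "real \<Rightarrow> (real^'d \<Rightarrow> real^'d^'d) \<Rightarrow> bool" where
 "sym_elliptic \<alpha> A \<longleftrightarrow> \<alpha> > 0 \<and> A \<in> Linf X \<and>
   (AE x in LM. transpose (A x) = A x \<and> (\<forall>v. \<alpha> * (norm v)^2 \<le> v \<bullet> (A x *v v)))"

lemma elliptic_lower:
 fixes A :: "real^'d \<Rightarrow> real^'n::finite^'n"
 assumes "A \<in> Linf X" "AE x in LM. \<forall>v. \<alpha> * (norm v)^2 \<le> v \<bullet> (A x *v v)" "F \<in> L2 X"
 shows "\<alpha> * (l2norm X F)^2 \<le> (LINT x|LM. F x \<bullet> (A x *v F x))"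
proof -
 have "(LINT x|LM. \<alpha> * (norm (F x))^2) \<le> (LINT x|LM. F x \<bullet> (A x *v F x))"
  by (rule integral_mono_AE)
   (use assms L2_D(2)[OF assms(3)] L2_inner_integrable[OF assms(3) Linf_L2_matrix_vector[OF assms(1,3)]] in \<open>auto elim!: eventually_mono\<close>)
 then show ?thesis by (simp add: l2norm_sq)
qed

text \<open>Poincare's inequality absorbs the L2 part of the H^1 norm, so the gradient alone
  controls the functional. The added 1 keeps the constant positive.\<close>

lemma H_minus_1_bound:
 assumes "l \<in> H_minus_1 X"
 obtains C where "C > 0" "\<And>\<phi>. \<phi> \<in> test ==> \<bar>l \<phi>\<bar> \<le> C * l2norm X (grad \<phi>)"
proof -
 obtain C where C: "\<And>\<phi>. \<phi> \<in> test ==> \<bar>l \<phi>\<bar> \<le> C * sqrt ((LINT x|LM. (\<phi> x)^2) + (LINT x|LM. (norm (grad \<phi> x))^2))"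
  using assms unfolding H_minus_1_def by blast
 obtain P where P: "P > 0" "\<And>\<phi>. \<phi> \<in> test ==> l2norm X \<phi> \<le> P * l2norm X (grad \<phi>)" using poincare_const by blast
 have "\<bar>l \<phi>\<bar> \<le> (\<bar>C\<bar> * (P + 1) + 1) * l2norm X (grad \<phi>)" if t: "\<phi> \<in> test" for \<phi>
 proof -
  have "sqrt ((LINT x|LM. (\<phi> x)^2) + (LINT x|LM. (norm (grad \<phi> x))^2)) = sqrt ((l2norm X \<phi>)^2 + (l2norm X (grad \<phi>))^2)"
   by (simp add: l2norm_sq)
  also have "\<dots> \<le> l2norm X \<phi> + l2norm X (grad \<phi>)" by (rule sqrt_sum_squares_le_sum) auto
  also have "\<dots> \<le> (P + 1) * l2norm X (grad \<phi>)" using P(2)[OF t] by (simp add: algebra_simps)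
  finally have "\<bar>C\<bar> * sqrt ((LINT x|LM. (\<phi> x)^2) + (LINT x|LM. (norm (grad \<phi> x))^2)) \<le> \<bar>C\<bar> * ((P + 1) * l2norm X (grad \<phi>))"
   by (rule mult_left_mono) simp
  moreover have "C * sqrt ((LINT x|LM. (\<phi> x)^2) + (LINT x|LM. (norm (grad \<phi> x))^2)) \<le> \<bar>C\<bar> * sqrt ((LINT x|LM. (\<phi> x)^2) + (LINT x|LM. (norm (grad \<phi> x))^2))"
   by (rule mult_right_mono) auto
  moreover have "0 \<le> l2norm X (grad \<phi>)" by simp
  moreover have "(\<bar>C\<bar> * (P + 1) + 1) * l2norm X (grad \<phi>) = \<bar>C\<bar> * ((P + 1) * l2norm X (grad \<phi>)) + l2norm X (grad \<phi>)"
   by (simp add: algebra_simps)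
  ultimately show ?thesis using C[OF t] by linarith
 qed
 moreover have "\<bar>C\<bar> * (P + 1) + 1 > 0" using P(1) by (simp add: add_nonneg_pos)
 ultimately show thesis using that by blast
qed

text \<open>By Poincare's inequality a Cauchy sequence of gradients makes the functions Cauchy as
  well; both limits exist and belong together.\<close>

lemma h10_complete:
 assumes \<phi>: "\<And>n. \<phi> n \<in> test"
  and C: "\<And>e. e > 0 ==> \<exists>N. \<forall>m\<ge>N. \<forall>n\<ge>N. l2norm X (\<lambda>x. grad (\<phi> m) x - grad (\<phi> n) x) < e"
 obtains u G where "h10 u G" "l2_lim X \<phi> u" "l2_lim X (\<lambda>n. grad (\<phi> n)) G"
proof -
 obtain P where P: "P > 0" "\<And>\<phi>. \<phi> \<in> test ==> l2norm X \<phi> \<le> P * l2norm X (grad \<phi>)" using poincare_const by blast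
 obtain G where G: "l2_lim X (\<lambda>n. grad (\<phi> n)) G"
  using l2_complete[OF lmeas grad_test_L2[OF \<phi>] C] by blast
 have C2: "\<exists>N. \<forall>m\<ge>N. \<forall>n\<ge>N. l2norm X (\<lambda>x. \<phi> m x - \<phi> n x) < e" if e: "e > 0" for e
 proof -
  have "e / P > 0" using e P by simp
  then obtain N where N: "\<forall>m\<ge>N. \<forall>n\<ge>N. l2norm X (\<lambda>x. grad (\<phi> m) x - grad (\<phi> n) x) < e / P" using C by blast
  have "l2norm X (\<lambda>x. \<phi> m x - \<phi> n x) < e" if "m \<ge> N" "n \<ge> N" for m n
  proof -
   have "grad (\<lambda>x. \<phi> m x - \<phi> n x) = (\<lambda>x. grad (\<phi> m) x - grad (\<phi> n) x)" using test_grad_diff[OF \<phi> \<phi>] by blast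
   then have "l2norm X (\<lambda>x. \<phi> m x - \<phi> n x) \<le> P * l2norm X (\<lambda>x. grad (\<phi> m) x - grad (\<phi> n) x)"
    using P(2)[OF test_diff[OF \<phi> \<phi>], of m n] by simp
   also have "\<dots> < e" using N that P(1) by (simp add: pos_less_divide_eq mult.commute)
   finally show ?thesis .
  qed
  then show ?thesis by blast
 qed
 obtain u where u: "l2_lim X \<phi> u" using l2_complete[OF lmeas test_L2[OF \<phi>] C2] by blast
 have "h10 u G" using u G \<phi> by (auto simp: h10_def)
 then show thesis using that u G by blast
qed

text \<open>The direct method: by the parallelogram identity a minimizing sequence of the energy is Cauchy.\<close>

lemma dirichlet_exists:
 assumes ell: "sym_elliptic \<alpha> A" and l: "l \<in> H_minus_1 X"
 obtains u G where "dirichlet_solution X A l u G"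
proof -
 have \<alpha>: "\<alpha> > 0" and A: "A \<in> Linf X" and co: "AE x in LM. \<forall>v. \<alpha> * (norm v)^2 \<le> v \<bullet> (A x *v v)"
  and sy: "AE x in LM. transpose (A x) = A x" using ell by (auto simp: sym_elliptic_def)
 define a where "a F G = (LINT x|LM. F x \<bullet> (A x *v G x))" for F G
 define E where "E \<phi> = a (grad \<phi>) (grad \<phi>) / 2 - l \<phi>" for \<phi>
 note AL = Linf_L2_matrix_vector[OF A]
 note I = L2_inner_integrable[OF _ AL]
 have acomm: "a F G = a G F" if "F \<in> L2 X" "G \<in> L2 X" for F G
  unfolding a_def
 proof (rule integral_cong_AE)
  show "AE x in LM. F x \<bullet> (A x *v G x) = G x \<bullet> (A x *v F x)"
   using sy by eventually_elim (metis inner_commute symmetric_inner)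
 qed (intro borel_measurable_integrable I that)+
 have aadd: "a (\<lambda>x. F x + t *\<^sub>R G x) (\<lambda>x. F x + t *\<^sub>R G x) = a F F + 2 * t * a F G + t^2 * a G G"
  if "F \<in> L2 X" "G \<in> L2 X" for F G t
 proof -
  have "a (\<lambda>x. F x + t *\<^sub>R G x) (\<lambda>x. F x + t *\<^sub>R G x) = (LINT x|LM. F x \<bullet> (A x *v F x) + t * (F x \<bullet> (A x *v G x)) + t * (G x \<bullet> (A x *v F x)) + t^2 * (G x \<bullet> (A x *v G x)))"
   unfolding a_def
   by (intro lint_cong) (auto simp: matrix_vector_right_distrib matrix_vector_mult_scaleR inner_add algebra_simps power2_eq_square)
  also have "\<dots> = a F F + t * a F G + t * a G F + t^2 * a G G"
   unfolding a_def using that I by simp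
  finally show ?thesis using acomm[OF that] by simp
 qed
 have alow: "\<alpha> * (l2norm X F)^2 \<le> a F F" if "F \<in> L2 X" for F
  unfolding a_def by (rule elliptic_lower[OF A co that])
 have ladd: "l (\<lambda>x. \<phi> x + t * \<psi> x) = l \<phi> + t * l \<psi>" if "\<phi> \<in> test" "\<psi> \<in> test" for \<phi> \<psi> t
  using l that test_cmult[OF that(2), of t] by (auto simp: H_minus_1_def)
 have Eadd: "E (\<lambda>x. \<phi> x + t * \<psi> x) = E \<phi> + t * (a (grad \<phi>) (grad \<psi>) - l \<psi>) + t^2 / 2 * a (grad \<psi>) (grad \<psi>)"
  if "\<phi> \<in> test" "\<psi> \<in> test" for \<phi> \<psi> t
 proof -
  have "grad (\<lambda>x. \<phi> x + t * \<psi> x) = (\<lambda>x. grad \<phi> x + t *\<^sub>R grad \<psi> x)"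
   using test_grad_add[OF that(1) test_cmult[OF that(2), of t]] test_grad_cmult[OF that(2), of t] by auto
  then show ?thesis unfolding E_def ladd[OF that] using aadd[OF grad_test_L2[OF that(1)] grad_test_L2[OF that(2)]]
   by (simp add: field_simps)
 qed
 obtain C where C: "C > 0" "\<And>\<phi>. \<phi> \<in> test ==> \<bar>l \<phi>\<bar> \<le> C * l2norm X (grad \<phi>)" using H_minus_1_bound[OF l] by blast
 have Elow: "E \<phi> \<ge> - (C\<^sup>2 / (2 * \<alpha>))" if t: "\<phi> \<in> test" for \<phi>
 proof -
  define y where "y = l2norm X (grad \<phi>)"
  \<comment> \<open>Completes the square in \<alpha> y^2 / 2 - C y, which bounds the energy from
    below in terms of the gradient norm y.\<close>
  have "0 \<le> (\<alpha> * y - C)^2 / (2 * \<alpha>)" using \<alpha> by simp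
  also have "\<dots> = \<alpha> * y^2 / 2 - C * y + C^2 / (2 * \<alpha>)" using \<alpha> by (simp add: field_simps power2_eq_square)
  finally show ?thesis using alow[OF grad_test_L2[OF t]] C(2)[OF t] unfolding E_def y_def by (simp add: abs_le_iff)
 qed
 define m where "m = Inf (E ` test)"
 have bdd: "bdd_below (E ` test)" using Elow by (intro bdd_belowI2)
 have mle: "m \<le> E \<phi>" if "\<phi> \<in> test" for \<phi> unfolding m_def using that by (intro cInf_lower bdd) auto
 have "\<exists>\<phi>\<in>test. E \<phi> < m + 1 / real (Suc n)" for n
 proof -
  have "E ` test \<noteq> {}" using test_zero by blast
  then show ?thesis using cInf_lessD[of "E ` test" "m + 1 / real (Suc n)"] by (auto simp: m_def)
 qed
 then obtain \<phi> where \<phi>: "\<And>n. \<phi> n \<in> test" "\<And>n. E (\<phi> n) < m + 1 / real (Suc n)" by metis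
 \<comment> \<open>For the midpoint, E(i) + E(j) - 2 E(mid) is a quarter of the quadratic form of
   the difference. The infimum bounds E(mid) from below, so this is at most the sum of the two
   excesses over the infimum.\<close>
 have par: "\<alpha> * (l2norm X (\<lambda>x. grad (\<phi> i) x - grad (\<phi> j) x))^2 \<le> 4 * (1 / real (Suc i) + 1 / real (Suc j))" for i j
 proof -
  have d: "(\<lambda>x. \<phi> j x - \<phi> i x) \<in> test" by (rule test_diff[OF \<phi>(1) \<phi>(1)])
  have gd: "grad (\<lambda>x. \<phi> j x - \<phi> i x) = (\<lambda>x. grad (\<phi> j) x - grad (\<phi> i) x)" using test_grad_diff[OF \<phi>(1) \<phi>(1)] by blast
  let ?b = "a (grad (\<phi> i)) (grad (\<lambda>x. \<phi> j x - \<phi> i x)) - l (\<lambda>x. \<phi> j x - \<phi> i x)"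
  let ?q = "a (grad (\<lambda>x. \<phi> j x - \<phi> i x)) (grad (\<lambda>x. \<phi> j x - \<phi> i x))"
  have "E (\<phi> j) = E (\<phi> i) + ?b + ?q / 2" using Eadd[OF \<phi>(1) d, of i 1] by simp
  moreover have "E (\<lambda>x. \<phi> i x + 1/2 * (\<phi> j x - \<phi> i x)) = E (\<phi> i) + ?b / 2 + ?q / 8"
   using Eadd[OF \<phi>(1) d, of i "1/2"] by (simp add: power2_eq_square)
  moreover have "m \<le> E (\<lambda>x. \<phi> i x + 1/2 * (\<phi> j x - \<phi> i x))"
   by (intro mle test_add \<phi>(1) test_cmult d)
  ultimately have "?q \<le> 4 * (1 / real (Suc i) + 1 / real (Suc j))" using \<phi>(2)[of i] \<phi>(2)[of j] by argo
  moreover have "\<alpha> * (l2norm X (\<lambda>x. grad (\<phi> i) x - grad (\<phi> j) x))^2 \<le> ?q"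
   using alow[OF grad_test_L2[OF d]] by (simp add: gd l2norm_minus_commute[of X "grad (\<phi> j)"])
  ultimately show ?thesis by linarith
 qed
 have cau: "\<exists>N. \<forall>i\<ge>N. \<forall>j\<ge>N. l2norm X (\<lambda>x. grad (\<phi> i) x - grad (\<phi> j) x) < e" if e: "e > 0" for e
 proof -
  obtain N where N: "inverse (real (Suc N)) < \<alpha> * e^2 / 8" using reals_Archimedean[of "\<alpha> * e^2 / 8"] e \<alpha> by auto
  have "l2norm X (\<lambda>x. grad (\<phi> i) x - grad (\<phi> j) x) < e" if "i \<ge> N" "j \<ge> N" for i j
  proof (rule power2_less_imp_less)
   have "1 / real (Suc i) \<le> inverse (real (Suc N))" "1 / real (Suc j) \<le> inverse (real (Suc N))"
    using that by (auto simp: field_simps)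
   moreover have "4 * (y + z) < c" if "y \<le> k" "z \<le> k" "k < c / 8" for y z c k :: real
    using that by (simp add: field_simps)
   ultimately have "4 * (1 / real (Suc i) + 1 / real (Suc j)) < \<alpha> * e^2" using N by blast
   then have "\<alpha> * (l2norm X (\<lambda>x. grad (\<phi> i) x - grad (\<phi> j) x))^2 < \<alpha> * e^2" by (rule le_less_trans[OF par])
   then show "(l2norm X (\<lambda>x. grad (\<phi> i) x - grad (\<phi> j) x))^2 < e^2" using \<alpha> by simp
  qed (use e in auto)
  then show ?thesis by blast
 qed
 obtain u G where u: "h10 u G" "l2_lim X (\<lambda>n. grad (\<phi> n)) G"
  by (rule h10_complete[of \<phi>]) (use \<phi>(1) cau in blast)+
 have "(LINT x|LM. (A x *v G x) \<bullet> grad \<psi> x) = l \<psi>" if t: "\<psi> \<in> test" for \<psi>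
 proof -
  note g = grad_test_L2[OF t]
  have lim: "(\<lambda>n. a (grad (\<phi> n)) (grad \<psi>)) \<longlonglongrightarrow> a G (grad \<psi>)"
   unfolding a_def by (rule l2_lim_inner_left(1)[OF u(2) AL[OF g]])
  define b where "b = a G (grad \<psi>) - l \<psi>"
  \<comment> \<open>The excess over the infimum at \<open>\<phi> n + t \<psi>\<close>, passed to the
    limit in n. Validity for all real t forces the linear coefficient b, the residual of the
    equation, to vanish.\<close>
  have q: "0 \<le> t * b + t^2 / 2 * a (grad \<psi>) (grad \<psi>)" for t
  proof (rule LIMSEQ_le_const)
   have "(\<lambda>n. 1 / real (Suc n) + t * (a (grad (\<phi> n)) (grad \<psi>) - l \<psi>) + t^2 / 2 * a (grad \<psi>) (grad \<psi>))
    \<longlonglongrightarrow> 0 + t * (a G (grad \<psi>) - l \<psi>) + t^2 / 2 * a (grad \<psi>) (grad \<psi>)"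
    by (intro tendsto_intros lim LIMSEQ_Suc[OF lim_1_over_n])
   then show "(\<lambda>n. 1 / real (Suc n) + t * (a (grad (\<phi> n)) (grad \<psi>) - l \<psi>) + t^2 / 2 * a (grad \<psi>) (grad \<psi>))
    \<longlonglongrightarrow> t * b + t^2 / 2 * a (grad \<psi>) (grad \<psi>)" by (simp add: b_def)
   have "0 \<le> 1 / real (Suc n) + t * (a (grad (\<phi> n)) (grad \<psi>) - l \<psi>) + t^2 / 2 * a (grad \<psi>) (grad \<psi>)" for n
   proof -
    have "m \<le> E (\<lambda>x. \<phi> n x + t * \<psi> x)" by (intro mle test_add \<phi>(1) test_cmult \<open>\<psi> \<in> test\<close>)
    then show ?thesis using Eadd[OF \<phi>(1)[of n] \<open>\<psi> \<in> test\<close>, of t] \<phi>(2)[of n] by linarith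
   qed
   then show "\<exists>N. \<forall>n\<ge>N. 0 \<le> 1 / real (Suc n) + t * (a (grad (\<phi> n)) (grad \<psi>) - l \<psi>) + t^2 / 2 * a (grad \<psi>) (grad \<psi>)"
    by blast
  qed
  define c where "c = a (grad \<psi>) (grad \<psi>)"
  have c0: "c \<ge> 0" using alow[OF g] \<alpha> unfolding c_def by (smt (verit) mult_nonneg_nonneg zero_le_power2)
  \<comment> \<open>The inequality is used at - t. The summand 1 avoids a division by 0 and leaves -
    t^2 (c / 2 + 1) on the right.\<close>
  define t where "t = b / (c + 1)"
  have bt: "b = t * (c + 1)" using c0 by (simp add: t_def)
  have "0 \<le> (- t) * b + (- t)\<^sup>2 / 2 * c" using q c_def by blast
  also have "\<dots> = - (t\<^sup>2 * (c / 2 + 1))" unfolding bt by (simp add: field_simps power2_eq_square)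
  finally have "t^2 * (c / 2 + 1) \<le> 0" by simp
  then have "t = 0" using c0 by (simp add: mult_le_0_iff)
  then have "b = 0" using bt by simp
  then have "a G (grad \<psi>) = l \<psi>" by (simp add: b_def)
  then show ?thesis using acomm[OF h10_L2(2)[OF u(1)] g] by (simp add: a_def inner_commute)
 qed
 then have "dirichlet_solution X A l u G" unfolding dirichlet_solution_iff neg_div_eq_def using u(1) by blast
 then show thesis using that by blast
qed

lemma H_minus_1_field:
 assumes "W \<in> L2 X"
 shows "(\<lambda>\<phi>. LINT x|LM. W x \<bullet> grad \<phi> x) \<in> H_minus_1 X"
 unfolding H_minus_1_def
proof (safe, goal_cases)
 case (1 \<phi> \<psi>)
 then show ?case using L2_inner_integrable[OF assms grad_test_L2] test_grad_add[OF 1] by (simp add: inner_add_right)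
next
 case (2 c \<phi>)
 then show ?case using test_grad_cmult[OF 2] by simp
next
 case 3
 show ?case
 proof (intro exI[of _ "l2norm X W"] ballI)
  fix \<phi> assume t: "\<phi> \<in> test"
  have "l2norm X (grad \<phi>) \<le> sqrt ((LINT x|LM. (\<phi> x)^2) + (LINT x|LM. (norm (grad \<phi> x))^2))"
   unfolding l2norm_def by (intro real_sqrt_le_mono) simp
  then show "\<bar>LINT x|LM. W x \<bullet> grad \<phi> x\<bar> \<le> l2norm X W * sqrt ((LINT x|LM. (\<phi> x)^2) + (LINT x|LM. (norm (grad \<phi> x))^2))"
   using l2_cauchy_schwarz[OF assms grad_test_L2[OF t]] mult_left_mono[OF _ l2norm_ge0[of X W]] by (meson order_trans)
 qed
qed

lemma H_minus_1_function:
 assumes "f \<in> L2 X"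
 shows "L2_functional X f \<in> H_minus_1 X"
 unfolding H_minus_1_def L2_functional_def
proof (safe, goal_cases)
 case (1 \<phi> \<psi>)
 then show ?case using L2_mult_integrable[OF assms test_L2] by (simp add: distrib_left)
next
 case (2 c \<phi>)
 then show ?case by (simp add: mult.left_commute)
next
 case 3
 show ?case
 proof (intro exI[of _ "l2norm X f"] ballI)
  fix \<phi> assume t: "\<phi> \<in> test"
  have "l2norm X \<phi> \<le> sqrt ((LINT x|LM. (\<phi> x)^2) + (LINT x|LM. (norm (grad \<phi> x))^2))"
   unfolding l2norm_def by (intro real_sqrt_le_mono) simp
  then show "\<bar>LINT x|LM. f x * \<phi> x\<bar> \<le> l2norm X f * sqrt ((LINT x|LM. (\<phi> x)^2) + (LINT x|LM. (norm (grad \<phi> x))^2))"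
   using l2_cauchy_schwarz_mult[OF assms test_L2[OF t]] mult_left_mono[OF _ l2norm_ge0[of X f]] by (meson order_trans)
 qed
qed

lemma sym_elliptic_id: "sym_elliptic 1 (\<lambda>x. mat 1)"
 by (auto simp: sym_elliptic_def Linf_def power2_norm_eq_inner transpose_mat)

text \<open>The gradient of the solution with identity coefficients and load l is a representing
  field: its weak equation is the claim.\<close>

lemma H_minus_1_riesz:
 assumes "l \<in> H_minus_1 X"
 obtains W where "W \<in> L2 X" "\<And>\<phi>. \<phi> \<in> test ==> l \<phi> = (LINT x|LM. W x \<bullet> grad \<phi> x)"
proof -
 obtain u G where "dirichlet_solution X (\<lambda>x. mat 1) l u G" using dirichlet_exists[OF sym_elliptic_id assms] .
 then have h: "h10 u G" and n: "\<And>\<phi>. \<phi> \<in> test ==> (LINT x|LM. G x \<bullet> grad \<phi> x) = l \<phi>"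
  by (auto simp: dirichlet_solution_iff neg_div_eq_def)
 show thesis by (rule that[of G]) (use h10_L2(2)[OF h] n in auto)
qed

end

section \<open>Oscillating functions of one variable\<close>

text \<open>Encodes that h is a primitive of \<xi> although \<xi> may jump: on [-S, S] the pair is a
  bounded pointwise limit of smooth functions and their derivatives. Dominated convergence then
  admits discontinuous layer profiles in integrations by parts stated for smooth test functions. The
  window is finite because primitives such as ramps are unbounded.\<close>

definition smooth_pair :: "real \<Rightarrow> (real \<Rightarrow> real) \<Rightarrow> (real \<Rightarrow> real) \<Rightarrow> bool" where
 "smooth_pair S \<xi> h \<longleftrightarrow> (\<exists>P p C. (\<forall>k::nat. smooth_real (P k)) \<and> (\<forall>k s. (P k has_real_derivative p k s) (at s)) \<and>
   (\<forall>k s. \<bar>s\<bar> \<le> S \<longrightarrow> \<bar>P k s\<bar> \<le> C \<and> \<bar>p k s\<bar> \<le> C) \<and>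
   (\<forall>s. \<bar>s\<bar> \<le> S \<longrightarrow> (\<lambda>k. P k s) \<longlonglongrightarrow> h s \<and> (\<lambda>k. p k s) \<longlonglongrightarrow> \<xi> s))"

lemma smooth_pair_add:
 assumes "smooth_pair S \<xi> h" "smooth_pair S \<xi>' h'"
 shows "smooth_pair S (\<lambda>s. \<xi> s + \<xi>' s) (\<lambda>s. h s + h' s)"
proof -
 obtain P p C where 1: "\<And>k::nat. smooth_real (P k)" "\<And>k s. (P k has_real_derivative p k s) (at s)"
   "\<And>k s. \<bar>s\<bar> \<le> S ==> \<bar>P k s\<bar> \<le> C \<and> \<bar>p k s\<bar> \<le> C"
   "\<And>s. \<bar>s\<bar> \<le> S ==> (\<lambda>k. P k s) \<longlonglongrightarrow> h s \<and> (\<lambda>k. p k s) \<longlonglongrightarrow> \<xi> s"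
  using assms(1) unfolding smooth_pair_def by blast
 obtain P' p' C' where 2: "\<And>k::nat. smooth_real (P' k)" "\<And>k s. (P' k has_real_derivative p' k s) (at s)"
   "\<And>k s. \<bar>s\<bar> \<le> S ==> \<bar>P' k s\<bar> \<le> C' \<and> \<bar>p' k s\<bar> \<le> C'"
   "\<And>s. \<bar>s\<bar> \<le> S ==> (\<lambda>k. P' k s) \<longlonglongrightarrow> h' s \<and> (\<lambda>k. p' k s) \<longlonglongrightarrow> \<xi>' s"
  using assms(2) unfolding smooth_pair_def by blast
 have b: "\<bar>P k s + P' k s\<bar> \<le> C + C' \<and> \<bar>p k s + p' k s\<bar> \<le> C + C'" if "\<bar>s\<bar> \<le> S" for k s
  using 1(3)[OF that, of k] 2(3)[OF that, of k] by linarith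
 have l: "(\<lambda>k. P k s + P' k s) \<longlonglongrightarrow> h s + h' s \<and> (\<lambda>k. p k s + p' k s) \<longlonglongrightarrow> \<xi> s + \<xi>' s" if "\<bar>s\<bar> \<le> S" for s
  using 1(4)[OF that] 2(4)[OF that] by (auto intro: tendsto_add)
 show ?thesis unfolding smooth_pair_def
  by (intro exI[of _ "\<lambda>k s. P k s + P' k s"] exI[of _ "\<lambda>k s. p k s + p' k s"] exI[of _ "C + C'"] conjI allI impI
    smooth_real_add 1(1) 2(1) DERIV_add 1(2) 2(2)) (use b l in blast)+
qed

lemma smooth_pair_cmult:
 assumes "smooth_pair S \<xi> h"
 shows "smooth_pair S (\<lambda>s. c * \<xi> s) (\<lambda>s. c * h s)"
proof -
 obtain P p C where 1: "\<And>k::nat. smooth_real (P k)" "\<And>k s. (P k has_real_derivative p k s) (at s)"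
   "\<And>k s. \<bar>s\<bar> \<le> S ==> \<bar>P k s\<bar> \<le> C \<and> \<bar>p k s\<bar> \<le> C"
   "\<And>s. \<bar>s\<bar> \<le> S ==> (\<lambda>k. P k s) \<longlonglongrightarrow> h s \<and> (\<lambda>k. p k s) \<longlonglongrightarrow> \<xi> s"
  using assms(1) unfolding smooth_pair_def by blast
 have b: "\<bar>c * P k s\<bar> \<le> \<bar>c\<bar> * C \<and> \<bar>c * p k s\<bar> \<le> \<bar>c\<bar> * C" if "\<bar>s\<bar> \<le> S" for k s
  using 1(3)[OF that, of k] by (auto simp: abs_mult intro: mult_left_mono)
 have l: "(\<lambda>k. c * P k s) \<longlonglongrightarrow> c * h s \<and> (\<lambda>k. c * p k s) \<longlonglongrightarrow> c * \<xi> s" if "\<bar>s\<bar> \<le> S" for s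
  using 1(4)[OF that] by (auto intro: tendsto_mult_left)
 show ?thesis unfolding smooth_pair_def
  by (intro exI[of _ "\<lambda>k s. c * P k s"] exI[of _ "\<lambda>k s. c * p k s"] exI[of _ "\<bar>c\<bar> * C"] conjI allI impI
    smooth_real_cmult 1(1) DERIV_cmult 1(2)) (use b l in blast)+
qed

lemma smooth_real_id: "smooth_real (\<lambda>s. s)"
 by (rule smooth_real_I[of _ "\<lambda>s. 1"]) (auto intro: smooth_real_const)

lemma smooth_pair_const: "smooth_pair S (\<lambda>s. 0) (\<lambda>s. c)"
 unfolding smooth_pair_def
 by (intro exI[of _ "\<lambda>k s. c"] exI[of _ "\<lambda>k s. 0"] exI[of _ "\<bar>c\<bar>"]) (auto simp: smooth_real_const)

lemma smooth_pair_linear: "smooth_pair S (\<lambda>s. c) (\<lambda>s. c * s)"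
proof -
 have "smooth_pair S (\<lambda>s. 1) (\<lambda>s. s)"
  unfolding smooth_pair_def
  by (intro exI[of _ "\<lambda>k s. s"] exI[of _ "\<lambda>k s. 1"] exI[of _ "max S 1"]) (auto simp: smooth_real_id)
 from smooth_pair_cmult[OF this, of c] show ?thesis by simp
qed

lemma smooth_pair_sum:
 assumes "\<And>j. j \<in> I ==> smooth_pair S (\<xi> j) (h j)"
 shows "smooth_pair S (\<lambda>s. \<Sum>j\<in>I. \<xi> j s) (\<lambda>s. \<Sum>j\<in>I. h j s)"
 using assms by (induction I rule: infinite_finite_induct) (auto intro: smooth_pair_add smooth_pair_const[of S 0, simplified])

lemma smooth_pair_cong:
 assumes "smooth_pair S \<xi> h" "\<And>s. \<bar>s\<bar> \<le> S ==> \<xi> s = \<xi>' s" "\<And>s. \<bar>s\<bar> \<le> S ==> h s = h' s"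
 shows "smooth_pair S \<xi>' h'"
 using assms unfolding smooth_pair_def by metis

lemma smooth_pair_scale:
 assumes "smooth_pair (n * S) \<xi> h" "n > 0"
 shows "smooth_pair S (\<lambda>s. \<xi> (n * s)) (\<lambda>s. h (n * s) / n)"
proof -
 obtain P p C where 1: "\<And>k::nat. smooth_real (P k)" "\<And>k s. (P k has_real_derivative p k s) (at s)"
   "\<And>k s. \<bar>s\<bar> \<le> n * S ==> \<bar>P k s\<bar> \<le> C \<and> \<bar>p k s\<bar> \<le> C"
   "\<And>s. \<bar>s\<bar> \<le> n * S ==> (\<lambda>k. P k s) \<longlonglongrightarrow> h s \<and> (\<lambda>k. p k s) \<longlonglongrightarrow> \<xi> s"
  using assms(1) unfolding smooth_pair_def by blast
 have s: "smooth_real (\<lambda>s. 1 / n * P k (n * s))" for k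
  using smooth_real_affine[OF 1(1)[of k], of n 0] by (intro smooth_real_cmult) simp
 have d: "((\<lambda>s. 1 / n * P k (n * s)) has_real_derivative p k (n * s)) (at s)" for k s
 proof -
  have "((\<lambda>s. n * s) has_real_derivative n) (at s)" by (auto intro!: derivative_eq_intros)
  from DERIV_cmult[OF DERIV_chain2[OF 1(2)[of k "n * s"] this], of "1 / n"] show ?thesis using assms(2) by simp
 qed
 have m: "\<bar>n * s\<bar> \<le> n * S" if "\<bar>s\<bar> \<le> S" for s using assms(2) that by (simp add: abs_mult)
 have b: "\<bar>1 / n * P k (n * s)\<bar> \<le> max (C / n) C \<and> \<bar>p k (n * s)\<bar> \<le> max (C / n) C" if "\<bar>s\<bar> \<le> S" for k s
  using 1(3)[OF m[OF that], of k] assms(2) by (auto simp: abs_mult le_max_iff_disj divide_right_mono)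
 have l: "(\<lambda>k. 1 / n * P k (n * s)) \<longlonglongrightarrow> h (n * s) / n \<and> (\<lambda>k. p k (n * s)) \<longlonglongrightarrow> \<xi> (n * s)" if "\<bar>s\<bar> \<le> S" for s
  using 1(4)[OF m[OF that]] tendsto_mult_left[of "\<lambda>k. P k (n * s)" "h (n * s)" sequentially "1 / n"] by simp
 show ?thesis unfolding smooth_pair_def
  by (intro exI[of _ "\<lambda>k s. 1 / n * P k (n * s)"] exI[of _ "\<lambda>k s. p k (n * s)"] exI[of _ "max (C / n) C"] conjI allI impI
    s d) (use b l in blast)+
qed

lemma exp_bump_deriv:
 "(exp_bump has_real_derivative (if s > 0 then exp_bump s / s^2 else 0)) (at s)"
proof -
 have "exp_bump = (\<lambda>s. if s > 0 then poly [:1:] (1 / s) * exp (- 1 / s) else 0)" by (auto simp: exp_bump_def)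
 then show ?thesis using poly_exp_deriv[of "[:1:]" s]
  by (simp add: exp_bump_def pderiv_pCons power2_eq_square cong: if_cong)
qed

text \<open>The ramp is approximated by s exp(-1/(k s)) for s > 0. With y = k s its derivative is
  exp(-1/y) (1 + 1/y), and 1/y \<le> exp(1/y) gives the bound 2 uniformly in k.\<close>

lemma smooth_ramp:
 obtains P p where "\<And>k::nat. smooth_real (P k)" "\<And>k s. (P k has_real_derivative p k s) (at s)"
  "\<And>k s. s \<le> 0 ==> P k s = 0" "\<And>k s. \<bar>P k s\<bar> \<le> \<bar>s\<bar>" "\<And>k s. \<bar>p k s\<bar> \<le> 2"
  "\<And>s. (\<lambda>k. P k s) \<longlonglongrightarrow> max s 0" "\<And>s. (\<lambda>k. p k s) \<longlonglongrightarrow> (if s > 0 then 1 else 0)"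
proof -
 define P where "P k s = s * exp_bump (real k * s)" for k :: nat and s
 define p where "p k s = exp_bump (real k * s) + (if s > 0 \<and> k > 0 then exp_bump (real k * s) / (real k * s) else 0)" for k :: nat and s
 have d: "(P k has_real_derivative p k s) (at s)" for k s
 proof -
  let ?y = "real k * s"
  have "((\<lambda>s. real k * s) has_real_derivative real k) (at s)" by (auto intro!: derivative_eq_intros)
  note D = DERIV_chain2[OF exp_bump_deriv[of ?y] this]
  have "((\<lambda>s. s) has_real_derivative 1) (at s)" by (auto intro!: derivative_eq_intros)
  from DERIV_mult[OF this D]
  have "(P k has_real_derivative (1 * exp_bump ?y + (if ?y > 0 then exp_bump ?y / ?y^2 else 0) * real k * s)) (at s)"
   unfolding P_def by simp
  moreover have "1 * exp_bump ?y + (if ?y > 0 then exp_bump ?y / ?y^2 else 0) * real k * s = p k s"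
   unfolding p_def by (auto simp: power2_eq_square zero_less_mult_iff)
  ultimately show ?thesis by simp
 qed
 have sm: "smooth_real (P k)" for k
  unfolding P_def using smooth_real_affine[OF smooth_real_exp_bump, of "real k" 0] by (intro smooth_real_mult smooth_real_id) simp
 have eb: "exp_bump y / y \<le> 1" if "y > 0" for y
 proof -
  have "1 / y \<le> exp (1 / y)" using exp_ge_add_one_self[of "1 / y"] by linarith
  then have "1 / y * exp (- 1 / y) \<le> exp (1 / y) * exp (- 1 / y)" by (intro mult_right_mono) auto
  also have "\<dots> = 1" by (simp flip: exp_add)
  finally show ?thesis using that by (simp add: exp_bump_def)
 qed
 have b1: "\<bar>P k s\<bar> \<le> \<bar>s\<bar>" for k s
  unfolding P_def abs_mult using exp_bump_props(1,2) by (intro mult_left_le) auto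
 have b2: "\<bar>p k s\<bar> \<le> 2" for k s
 proof -
  have "0 \<le> p k s" unfolding p_def using exp_bump_props(1) by (auto intro!: add_nonneg_nonneg divide_nonneg_nonneg)
  moreover have "p k s \<le> 1 + 1" unfolding p_def
  proof (rule add_mono[OF exp_bump_props(2)])
   show "(if s > 0 \<and> k > 0 then exp_bump (real k * s) / (real k * s) else 0) \<le> 1"
   proof (cases "s > 0 \<and> k > 0")
    case True
    then have "exp_bump (real k * s) / (real k * s) \<le> 1" by (intro eb) auto
    then show ?thesis by (simp only: if_P[OF True])
   qed simp
  qed
  ultimately show ?thesis by simp
 qed
 have l1: "(\<lambda>k. P k s) \<longlonglongrightarrow> max s 0" for s
 proof -
  have "(\<lambda>k. s * exp_bump (real k * s)) \<longlonglongrightarrow> s * (if s > 0 then 1 else 0)"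
   by (intro tendsto_intros exp_bump_lim)
  then show ?thesis unfolding P_def by (auto simp: max_def split: if_splits)
 qed
 have l2: "(\<lambda>k. p k s) \<longlonglongrightarrow> (if s > 0 then 1 else 0)" for s
 proof -
  have q: "(\<lambda>k. if s > 0 \<and> k > 0 then exp_bump (real k * s) / (real k * s) else 0) \<longlonglongrightarrow> 0"
  proof (cases "s > 0")
   case True
   have "(\<lambda>k. (1 / s) * inverse (real k)) \<longlonglongrightarrow> (1 / s) * 0" by (intro tendsto_intros lim_inverse_n)
   then have z: "(\<lambda>k. (1 / s) * inverse (real k)) \<longlonglongrightarrow> 0" by simp
   show ?thesis
   proof (rule Lim_null_comparison[OF always_eventually z], intro allI)
    fix k :: nat
    have "exp_bump (real k * s) / (real k * s) \<le> 1 / (real k * s)"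
     using True exp_bump_props(2) by (intro divide_right_mono) auto
    then show "norm (if s > 0 \<and> k > 0 then exp_bump (real k * s) / (real k * s) else 0) \<le> (1 / s) * inverse (real k)"
     using True exp_bump_props(1)[of "real k * s"] by (auto simp: field_simps abs_mult)
   qed
  qed simp
  show ?thesis unfolding p_def using tendsto_add[OF exp_bump_lim[of s] q] by simp
 qed
 have z: "P k s = 0" if "s \<le> 0" for k s
  unfolding P_def using that exp_bump_props(3)[of "real k * s"] by (simp add: mult_nonneg_nonpos)
 show thesis by (rule that[OF sm d z b1 b2 l1 l2])
qed

lemma smooth_pair_ramp:
 "smooth_pair S (\<lambda>s. if s > a then 1 else 0) (\<lambda>s. max (s - a) 0)"
proof -
 obtain P p where P: "\<And>k::nat. smooth_real (P k)" "\<And>k s. (P k has_real_derivative p k s) (at s)"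
  "\<And>k s. s \<le> 0 ==> P k s = 0" "\<And>k s. \<bar>P k s\<bar> \<le> \<bar>s\<bar>" "\<And>k s. \<bar>p k s\<bar> \<le> 2"
  "\<And>s. (\<lambda>k. P k s) \<longlonglongrightarrow> max s 0" "\<And>s. (\<lambda>k. p k s) \<longlonglongrightarrow> (if s > 0 then 1 else 0)"
  by (rule smooth_ramp) blast
 have sm: "smooth_real (\<lambda>s. P k (s - a))" for k using smooth_real_affine[OF P(1)[of k], of 1 "-a"] by simp
 have d: "((\<lambda>s. P k (s - a)) has_real_derivative p k (s - a)) (at s)" for k s
 proof -
  have "((\<lambda>s. s - a) has_real_derivative 1) (at s)" by (auto intro!: derivative_eq_intros)
  from DERIV_chain2[OF P(2)[of k "s - a"] this] show ?thesis by simp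
 qed
 have b: "\<bar>P k (s - a)\<bar> \<le> max (S + \<bar>a\<bar>) 2 \<and> \<bar>p k (s - a)\<bar> \<le> max (S + \<bar>a\<bar>) 2" if "\<bar>s\<bar> \<le> S" for k s
  using P(4)[of k "s - a"] P(5)[of k "s - a"] that abs_triangle_ineq4[of s a] by (auto simp: le_max_iff_disj)
 have l: "(\<lambda>k. P k (s - a)) \<longlonglongrightarrow> max (s - a) 0 \<and> (\<lambda>k. p k (s - a)) \<longlonglongrightarrow> (if s > a then 1 else 0)" for s
  using P(6)[of "s - a"] P(7)[of "s - a"] by simp
 show ?thesis unfolding smooth_pair_def
  by (intro exI[of _ "\<lambda>k s. P k (s - a)"] exI[of _ "\<lambda>k s. p k (s - a)"] exI[of _ "max (S + \<bar>a\<bar>) 2"] conjI allI impI sm d)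
   (use b l in blast)+
qed

text \<open>A fractional part with values in (0, 1], so that cells are (m, m + 1]. This matches the
  strict inequality in the jump functions of \<open>smooth_pair_ramp\<close>.\<close>

definition upper_frac :: "real \<Rightarrow> real" where
 "upper_frac s = s - (of_int \<lceil>s\<rceil> - 1)"

lemma upper_frac_bounds: "0 < upper_frac s" "upper_frac s \<le> 1"
 unfolding upper_frac_def by linarith+

lemma upper_frac_measurable [measurable]: "upper_frac \<in> borel_measurable borel"
 unfolding upper_frac_def by measurable

text \<open>On a bounded window a periodic jump function is a finite combination of ramp derivatives
  and a constant. The cell function has mean zero, so its primitive is again periodic and stays
  bounded when the frequency grows.\<close>

lemma smooth_pair_cell:
 assumes b: "0 \<le> b" "b \<le> 1"
 shows "smooth_pair S (\<lambda>s. (if upper_frac s \<le> b then 1 else 0) - b) (\<lambda>s. min (upper_frac s) b - b * upper_frac s)"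
proof -
 obtain J :: nat where J: "\<bar>S\<bar> + 2 < real J" using reals_Archimedean2 by blast
 let ?J = "{- int J..int J}"
 define \<xi> where "\<xi> s = (\<Sum>j\<in>?J. (if s > of_int j then 1 else 0) + (-1) * (if s > of_int j + b then 1 else 0)) + (- b)" for s :: real
 \<comment> \<open>The full cells between - J and m contribute b (m + J) in total. Together with - b
   s this is - b times the position in the current cell plus b J, which the last constant
   removes.\<close>
 define h where "h s = (\<Sum>j\<in>?J. max (s - of_int j) 0 + (-1) * max (s - (of_int j + b)) 0) + (- b) * s + (- b * real J)" for s :: real
 have sp: "smooth_pair S \<xi> h"
 proof -
  have "smooth_pair S (\<lambda>s. (\<Sum>j\<in>?J. (if s > of_int j then 1 else 0) + (-1) * (if s > of_int j + b then 1 else 0)) + (- b) + 0) h"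
   unfolding h_def
   by (intro smooth_pair_add smooth_pair_sum smooth_pair_cmult smooth_pair_ramp smooth_pair_linear smooth_pair_const)
  then show ?thesis unfolding \<xi>_def by simp
 qed
 have eq: "\<xi> s = (if upper_frac s \<le> b then 1 else 0) - b \<and> h s = min (upper_frac s) b - b * upper_frac s" if s: "\<bar>s\<bar> \<le> S" for s
 proof -
  define m where "m = \<lceil>s\<rceil> - 1"
  have m: "of_int m < s" "s \<le> of_int m + 1" unfolding m_def by linarith+
  have r: "upper_frac s = s - of_int m" by (simp add: upper_frac_def m_def)
  have mJ: "m \<in> ?J" using m J s by auto
  have split: "(\<Sum>j\<in>?J. F j) = (\<Sum>j\<in>{- int J..<m}. F j) + F m + (\<Sum>j\<in>{m<..int J}. F j)" for F :: "int \<Rightarrow> real"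
  proof -
   have "?J = ({- int J..<m} \<union> {m}) \<union> {m<..int J}" using mJ by auto
   then show ?thesis by (simp only:) (subst sum.union_disjoint; auto simp: sum.union_disjoint)
  qed
  have lo: "of_int j + b < s" "of_int j < s" if "j < m" for j
  proof -
   have "of_int j + 1 \<le> (of_int m :: real)" using that by linarith
   then show "of_int j + b < s" "of_int j < s" using m b by linarith+
  qed
  have hi: "s \<le> of_int j" "s \<le> of_int j + b" if "m < j" for j
  proof -
   have "of_int m + 1 \<le> (of_int j :: real)" using that by linarith
   then show "s \<le> of_int j" "s \<le> of_int j + b" using m b by linarith+
  qed
  have "\<xi> s = 0 + ((if s > of_int m then 1 else 0) + (-1) * (if s > of_int m + b then 1 else 0)) + 0 + (- b)"
   unfolding \<xi>_def split using lo hi by (intro arg_cong2[of _ _ _ _ "(+)"] refl sum.neutral) (auto simp: not_less)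
  then have 1: "\<xi> s = (if upper_frac s \<le> b then 1 else 0) - b" using m by (auto simp: r)
  have "(\<Sum>j\<in>{- int J..<m}. max (s - of_int j) 0 + (-1) * max (s - (of_int j + b)) 0) = (\<Sum>j\<in>{- int J..<m}. b)"
   using lo by (intro sum.cong) (auto simp: max_def not_le less_imp_le dest: lo)
  also have "\<dots> = b * (of_int m + real J)" using mJ by simp
  finally have "h s = b * (of_int m + real J) + (max (s - of_int m) 0 + (-1) * max (s - (of_int m + b)) 0) + 0 + (- b) * s + (- b * real J)"
   unfolding h_def split using hi by (intro arg_cong2[of _ _ _ _ "(+)"] refl sum.neutral) auto
  then have "h s = min (upper_frac s) b - b * upper_frac s" using m b unfolding r by (auto simp: max_def min_def algebra_simps)
  then show ?thesis using 1 by blast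
 qed
 show ?thesis by (rule smooth_pair_cong[OF sp]) (use eq in auto)
qed

section \<open>Oscillating multipliers in weak formulations\<close>

context bounded_open
begin

lemma inner_bound:
 obtains S where "S > 0" "\<And>x e. x \<in> X ==> norm e = 1 ==> \<bar>x \<bullet> e\<bar> \<le> S"
proof -
 obtain r where r: "r > 0" "\<And>x. x \<in> X ==> norm x < r" using bounded_dom bounded_pos_less by metis
 have "\<bar>x \<bullet> e\<bar> \<le> r" if "x \<in> X" "norm e = 1" for x e
  using Cauchy_Schwarz_ineq2[of x e] r(2)[OF that(1)] that(2) by simp
 then show thesis using that r(1) by blast
qed

text \<open>Turns bounded pointwise convergence of the profiles into L2 convergence after
  multiplication by an arbitrary L2 field, the form in which limits enter the oscillation
  identities.\<close>

lemma smooth_pair_obtain: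
 assumes sp: "smooth_pair S \<xi> h" and S: "\<And>x. x \<in> X ==> \<bar>x \<bullet> e\<bar> \<le> S"
 obtains P p where "\<And>k::nat. smooth_real (P k)" "\<And>k s. (P k has_real_derivative p k s) (at s)"
  "\<And>F :: real^'d \<Rightarrow> 'b::euclidean_space. F \<in> L2 X ==> l2_lim X (\<lambda>k x. P k (x \<bullet> e) *\<^sub>R F x) (\<lambda>x. h (x \<bullet> e) *\<^sub>R F x)"
  "\<And>F :: real^'d \<Rightarrow> 'b::euclidean_space. F \<in> L2 X ==> l2_lim X (\<lambda>k x. p k (x \<bullet> e) *\<^sub>R F x) (\<lambda>x. \<xi> (x \<bullet> e) *\<^sub>R F x)"
proof -
 obtain P p C where 1: "\<And>k::nat. smooth_real (P k)" "\<And>k s. (P k has_real_derivative p k s) (at s)"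
   "\<And>k s. \<bar>s\<bar> \<le> S ==> \<bar>P k s\<bar> \<le> C \<and> \<bar>p k s\<bar> \<le> C"
   "\<And>s. \<bar>s\<bar> \<le> S ==> (\<lambda>k. P k s) \<longlonglongrightarrow> h s \<and> (\<lambda>k. p k s) \<longlonglongrightarrow> \<xi> s"
  using sp unfolding smooth_pair_def by blast
 have key: "l2_lim X (\<lambda>k x. q k (x \<bullet> e) *\<^sub>R F x) (\<lambda>x. \<eta> (x \<bullet> e) *\<^sub>R F x)"
  if F: "F \<in> L2 X" and c: "\<And>k. continuous_on UNIV (q k)" and b: "\<And>k s. \<bar>s\<bar> \<le> S ==> \<bar>q k s\<bar> \<le> C"
   and l: "\<And>s. \<bar>s\<bar> \<le> S ==> (\<lambda>k. q k s) \<longlonglongrightarrow> \<eta> s"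
  for F :: "real^'d \<Rightarrow> 'b" and q :: "nat \<Rightarrow> real \<Rightarrow> real" and \<eta> :: "real \<Rightarrow> real"
 proof -
  have qm: "(\<lambda>x. q k (x \<bullet> e)) \<in> borel_measurable LM" for k
   by (intro continuous_measurable_dom continuous_on_compose2[OF c]) (auto intro: continuous_intros)
  have m: "(\<lambda>x. \<eta> (x \<bullet> e)) \<in> borel_measurable LM"
   by (rule borel_measurable_LIMSEQ_metric[where f="\<lambda>k x. q k (x \<bullet> e)", OF qm]) (use l S in auto)
  show ?thesis
  proof (rule l2_lim_dominated[OF _ _ L2_scaleR[OF F, of C]])
   show "AE x in LM. norm (q k (x \<bullet> e) *\<^sub>R F x) \<le> norm (C *\<^sub>R F x)" for k
    using b S by (intro AE_I2) (auto intro!: mult_right_mono order_trans[OF b])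
   show "AE x in LM. (\<lambda>k. q k (x \<bullet> e) *\<^sub>R F x) \<longlonglongrightarrow> \<eta> (x \<bullet> e) *\<^sub>R F x"
    using l S by (intro AE_I2) (auto intro!: tendsto_scaleR)
  qed (use L2_D(1)[OF F] qm m in auto)
 qed
 have sp: "smooth_real (p k)" for k using smooth_real_deriv 1(1,2) by blast
 show thesis
 proof (rule that[OF 1(1,2)])
  fix F :: "real^'d \<Rightarrow> 'b" assume F: "F \<in> L2 X"
  show "l2_lim X (\<lambda>k x. P k (x \<bullet> e) *\<^sub>R F x) (\<lambda>x. h (x \<bullet> e) *\<^sub>R F x)"
   by (rule key[OF F]) (use 1 in \<open>auto intro: smooth_real_continuous_on\<close>)
  show "l2_lim X (\<lambda>k x. p k (x \<bullet> e) *\<^sub>R F x) (\<lambda>x. \<xi> (x \<bullet> e) *\<^sub>R F x)"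
   by (rule key[OF F]) (use 1 sp in \<open>auto intro: smooth_real_continuous_on\<close>)
 qed
qed

lemma C_k_direction: "smooth_real P ==> C_k k (\<lambda>x::real^'d. P (x \<bullet> e))"
 by (rule C_k_compose[OF _ C_k_inner])

lemma test_direction: "smooth_real P ==> \<phi> \<in> test ==> (\<lambda>x. P (x \<bullet> e) * \<phi> x) \<in> test"
 by (rule test_mult_smooth[OF _ C_k_direction])

lemma grad_direction:
 assumes "\<And>s. (P has_real_derivative p s) (at s)" "\<phi> \<in> test"
 shows "grad (\<lambda>x. P (x \<bullet> e) * \<phi> x) x = P (x \<bullet> e) *\<^sub>R grad \<phi> x + (p (x \<bullet> e) * \<phi> x) *\<^sub>R e"
proof -
 have "((\<lambda>x. P (x \<bullet> e)) has_derivative (\<lambda>v. p (x \<bullet> e) * (v \<bullet> e))) (at x)"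
  by (rule has_derivative_compose[of "\<lambda>x. x \<bullet> e" "\<lambda>v. v \<bullet> e" x UNIV P "(*) (p (x \<bullet> e))"])
   (use assms(1) in \<open>auto intro!: derivative_eq_intros simp: has_field_derivative_def\<close>)
 then have "((\<lambda>x. P (x \<bullet> e)) has_derivative (\<lambda>v. (p (x \<bullet> e) *\<^sub>R e) \<bullet> v)) (at x)" by (simp add: inner_commute)
 from test_grad_mult[OF assms(2) this] show ?thesis by (simp add: mult.commute)
qed

text \<open>Test with P(x.e) \<phi> and let the smooth profiles tend to the pair. The normal
  component of a divergence-free field can thus be integrated against the oscillation \<xi> at the
  price of its primitive h, which will be small.\<close>

lemma oscillation_div:
 assumes sp: "smooth_pair S \<xi> h" and S: "\<And>x. x \<in> X ==> \<bar>x \<bullet> e\<bar> \<le> S"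
  and \<sigma>: "\<sigma> \<in> L2 X" "\<And>\<phi>. \<phi> \<in> test ==> (LINT x|LM. \<sigma> x \<bullet> grad \<phi> x) = 0" and t: "\<phi> \<in> test"
 shows "(LINT x|LM. \<xi> (x \<bullet> e) * ((\<sigma> x \<bullet> e) * \<phi> x)) = - (LINT x|LM. h (x \<bullet> e) * (\<sigma> x \<bullet> grad \<phi> x))"
proof -
 obtain P p where P: "\<And>k::nat. smooth_real (P k)" "\<And>k s. (P k has_real_derivative p k s) (at s)"
  "\<And>F :: real^'d \<Rightarrow> real^'d. F \<in> L2 X ==> l2_lim X (\<lambda>k x. P k (x \<bullet> e) *\<^sub>R F x) (\<lambda>x. h (x \<bullet> e) *\<^sub>R F x)"
  "\<And>F :: real^'d \<Rightarrow> real^'d. F \<in> L2 X ==> l2_lim X (\<lambda>k x. p k (x \<bullet> e) *\<^sub>R F x) (\<lambda>x. \<xi> (x \<bullet> e) *\<^sub>R F x)"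
  using smooth_pair_obtain[OF sp S] by blast
 have te: "(\<lambda>x. \<phi> x *\<^sub>R e) \<in> L2 X"
  by (rule L2_bound[OF _ L2_scaleR[OF test_L2[OF t], of "norm e"]]) (use L2_D(1)[OF test_L2[OF t]] in \<open>auto simp: mult.commute\<close>)
 note l1 = l2_lim_inner_left(2)[OF P(3)[OF grad_test_L2[OF t]] \<sigma>(1)] and l2 = l2_lim_inner_left(2)[OF P(4)[OF te] \<sigma>(1)]
 have "(LINT x|LM. \<sigma> x \<bullet> (P k (x \<bullet> e) *\<^sub>R grad \<phi> x)) + (LINT x|LM. \<sigma> x \<bullet> (p k (x \<bullet> e) *\<^sub>R \<phi> x *\<^sub>R e)) = 0" for k
 proof -
  have "(LINT x|LM. \<sigma> x \<bullet> grad (\<lambda>x. P k (x \<bullet> e) * \<phi> x) x) = 0" by (rule \<sigma>(2)[OF test_direction[OF P(1) t]])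
  then show ?thesis
   using L2_inner_integrable[OF \<sigma>(1) l2_lim_D(1)[OF P(3)[OF grad_test_L2[OF t]]], of k]
    L2_inner_integrable[OF \<sigma>(1) l2_lim_D(1)[OF P(4)[OF te]], of k]
   by (simp add: grad_direction[OF P(2) t] inner_add_right)
 qed
 then have "(LINT x|LM. \<sigma> x \<bullet> (h (x \<bullet> e) *\<^sub>R grad \<phi> x)) + (LINT x|LM. \<sigma> x \<bullet> (\<xi> (x \<bullet> e) *\<^sub>R \<phi> x *\<^sub>R e)) = 0"
  using LIMSEQ_unique[OF tendsto_add[OF l1 l2]] by simp
 then show ?thesis by (simp add: mult_ac)
qed

text \<open>For gradients the components tangential to the layers are the favourable ones. A
  derivative along \<tau> does not hit a profile of x.e, so it can be moved from u to \<phi> while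
  \<xi> stays; a second integration by parts, along e, then replaces \<xi> by its primitive
  h.\<close>

lemma oscillation_curl:
 assumes sp: "smooth_pair S \<xi> h" and S: "\<And>x. x \<in> X ==> \<bar>x \<bullet> e\<bar> \<le> S"
  and u: "weak_gradient X u G" and \<tau>: "\<tau> \<bullet> e = 0" and e: "norm e = 1" and t: "\<phi> \<in> test"
 shows "(LINT x|LM. \<xi> (x \<bullet> e) * ((G x \<bullet> \<tau>) * \<phi> x)) =
  (LINT x|LM. h (x \<bullet> e) * ((G x \<bullet> e) * (grad \<phi> x \<bullet> \<tau>))) + (LINT x|LM. h (x \<bullet> e) * (u x * (grad (\<lambda>x. grad \<phi> x \<bullet> \<tau>) x \<bullet> e)))"
proof -
 obtain P p where P: "\<And>k::nat. smooth_real (P k)" "\<And>k s. (P k has_real_derivative p k s) (at s)"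
  "\<And>F :: real^'d \<Rightarrow> real. F \<in> L2 X ==> l2_lim X (\<lambda>k x. P k (x \<bullet> e) *\<^sub>R F x) (\<lambda>x. h (x \<bullet> e) *\<^sub>R F x)"
  "\<And>F :: real^'d \<Rightarrow> real. F \<in> L2 X ==> l2_lim X (\<lambda>k x. p k (x \<bullet> e) *\<^sub>R F x) (\<lambda>x. \<xi> (x \<bullet> e) *\<^sub>R F x)"
  using smooth_pair_obtain[OF sp S] by blast
 have ee: "e \<bullet> e = 1" using e by (simp add: norm_eq_1)
 note w = u[unfolded weak_gradient_iff]
 have uL: "u \<in> L2 X" and GL: "\<And>c. (\<lambda>x. G x \<bullet> c) \<in> L2 X" using w L2_inner_const by auto
 have w': "(LINT x|LM. u x * (grad \<phi> x \<bullet> e)) = - (LINT x|LM. \<phi> x * (G x \<bullet> e))" if "\<phi> \<in> test" for \<phi> e using w that by blast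
 have t1: "(\<lambda>x. grad \<phi> x \<bullet> \<tau>) \<in> test" by (rule test_dir_deriv[OF t])
 have t2: "(\<lambda>x. grad (\<lambda>x. grad \<phi> x \<bullet> \<tau>) x \<bullet> e) \<in> test" by (rule test_dir_deriv[OF t1])
 have spk: "smooth_real (p k)" for k using smooth_real_deriv P(1,2) by blast
 obtain p' where p': "\<And>k s. (p k has_real_derivative p' k s) (at s)" proof -
  have "\<exists>f'. \<forall>s. (p k has_real_derivative f' s) (at s)" for k using smooth_real_D[OF spk[of k]] by blast
  then show thesis using that by metis
 qed
 note L1 = P(4)[OF test_L2[OF t]] and L3 = P(3)[OF test_L2[OF t1]] and L4 = P(3)[OF test_L2[OF t2]] and L5 = P(4)[OF test_L2[OF t1]]
 have id: "(LINT x|LM. (p k (x \<bullet> e) *\<^sub>R \<phi> x) * (G x \<bullet> \<tau>)) =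
   (LINT x|LM. (P k (x \<bullet> e) *\<^sub>R (grad \<phi> x \<bullet> \<tau>)) * (G x \<bullet> e)) + (LINT x|LM. (P k (x \<bullet> e) *\<^sub>R (grad (\<lambda>x. grad \<phi> x \<bullet> \<tau>) x \<bullet> e)) * u x)" for k
 proof -
  have "(LINT x|LM. u x * (grad (\<lambda>x. p k (x \<bullet> e) * \<phi> x) x \<bullet> \<tau>)) = - (LINT x|LM. (p k (x \<bullet> e) * \<phi> x) * (G x \<bullet> \<tau>))"
   by (rule w'[OF test_direction[OF spk t]])
  moreover have "grad (\<lambda>x. p k (x \<bullet> e) * \<phi> x) x \<bullet> \<tau> = p k (x \<bullet> e) * (grad \<phi> x \<bullet> \<tau>)" for x
   unfolding grad_direction[OF p' t] using \<tau> by (simp add: inner_add_left inner_add_right inner_commute)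
  ultimately have 1: "(LINT x|LM. u x * (p k (x \<bullet> e) * (grad \<phi> x \<bullet> \<tau>))) = - (LINT x|LM. (p k (x \<bullet> e) * \<phi> x) * (G x \<bullet> \<tau>))"
   by simp
  have "(LINT x|LM. u x * (grad (\<lambda>x. P k (x \<bullet> e) * (grad \<phi> x \<bullet> \<tau>)) x \<bullet> e)) = - (LINT x|LM. (P k (x \<bullet> e) * (grad \<phi> x \<bullet> \<tau>)) * (G x \<bullet> e))"
   by (rule w'[OF test_direction[OF P(1) t1]])
  moreover have "grad (\<lambda>x. P k (x \<bullet> e) * (grad \<phi> x \<bullet> \<tau>)) x \<bullet> e
    = P k (x \<bullet> e) * (grad (\<lambda>x. grad \<phi> x \<bullet> \<tau>) x \<bullet> e) + p k (x \<bullet> e) * (grad \<phi> x \<bullet> \<tau>)" for x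
   unfolding grad_direction[OF P(2) t1] by (simp add: inner_add_left ee)
  ultimately have 2: "(LINT x|LM. u x * (P k (x \<bullet> e) * (grad (\<lambda>x. grad \<phi> x \<bullet> \<tau>) x \<bullet> e) + p k (x \<bullet> e) * (grad \<phi> x \<bullet> \<tau>)))
    = - (LINT x|LM. (P k (x \<bullet> e) * (grad \<phi> x \<bullet> \<tau>)) * (G x \<bullet> e))" by simp
  have "(LINT x|LM. u x * (P k (x \<bullet> e) * (grad (\<lambda>x. grad \<phi> x \<bullet> \<tau>) x \<bullet> e) + p k (x \<bullet> e) * (grad \<phi> x \<bullet> \<tau>)))
   = (LINT x|LM. u x * (P k (x \<bullet> e) * (grad (\<lambda>x. grad \<phi> x \<bullet> \<tau>) x \<bullet> e))) + (LINT x|LM. u x * (p k (x \<bullet> e) * (grad \<phi> x \<bullet> \<tau>)))"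
   using L2_mult_integrable[OF uL l2_lim_D(1)[OF L4, of k]] L2_mult_integrable[OF uL l2_lim_D(1)[OF L5, of k]]
   by (simp add: distrib_left)
  then show ?thesis using 1 2 by (simp add: mult_ac)
 qed
 have a: "(\<lambda>k. LINT x|LM. (p k (x \<bullet> e) *\<^sub>R \<phi> x) * (G x \<bullet> \<tau>)) \<longlonglongrightarrow> (LINT x|LM. (\<xi> (x \<bullet> e) *\<^sub>R \<phi> x) * (G x \<bullet> \<tau>))"
  using l2_lim_inner_left(1)[OF L1 GL] by simp
 have b: "(\<lambda>k. LINT x|LM. (P k (x \<bullet> e) *\<^sub>R (grad \<phi> x \<bullet> \<tau>)) * (G x \<bullet> e)) \<longlonglongrightarrow> (LINT x|LM. (h (x \<bullet> e) *\<^sub>R (grad \<phi> x \<bullet> \<tau>)) * (G x \<bullet> e))"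
  using l2_lim_inner_left(1)[OF L3 GL] by simp
 have c: "(\<lambda>k. LINT x|LM. (P k (x \<bullet> e) *\<^sub>R (grad (\<lambda>x. grad \<phi> x \<bullet> \<tau>) x \<bullet> e)) * u x)
   \<longlonglongrightarrow> (LINT x|LM. (h (x \<bullet> e) *\<^sub>R (grad (\<lambda>x. grad \<phi> x \<bullet> \<tau>) x \<bullet> e)) * u x)"
  using l2_lim_inner_left(1)[OF L4 uL] by simp
 have "(LINT x|LM. (\<xi> (x \<bullet> e) *\<^sub>R \<phi> x) * (G x \<bullet> \<tau>)) = (LINT x|LM. (h (x \<bullet> e) *\<^sub>R (grad \<phi> x \<bullet> \<tau>)) * (G x \<bullet> e))
   + (LINT x|LM. (h (x \<bullet> e) *\<^sub>R (grad (\<lambda>x. grad \<phi> x \<bullet> \<tau>) x \<bullet> e)) * u x)"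
  by (rule LIMSEQ_unique[OF a]) (use tendsto_add[OF b c] id in simp)
 then show ?thesis by (simp add: mult_ac)
qed

text \<open>The constant field e is divergence-free, and \<open>oscillation_div\<close> applies to
  it.\<close>

lemma oscillation_test:
 assumes sp: "smooth_pair S \<xi> h" and S: "\<And>x. x \<in> X ==> \<bar>x \<bullet> e\<bar> \<le> S"
  and e: "norm e = 1" and t: "\<phi> \<in> test"
 shows "(LINT x|LM. \<xi> (x \<bullet> e) * \<phi> x) = - (LINT x|LM. h (x \<bullet> e) * (grad \<phi> x \<bullet> e))"
proof -
 have "e \<bullet> e = 1" using e by (simp add: norm_eq_1)
 then show ?thesis
  using oscillation_div[OF sp S L2_const[OF lmeas, of e] _ t] integral_test_deriv[of _ e] by (simp add: inner_commute)
qed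

lemma oscillation_measurable:
 assumes sp: "smooth_pair S \<xi> h" and S: "\<And>x. x \<in> X ==> \<bar>x \<bullet> e\<bar> \<le> S"
 shows "(\<lambda>x. h (x \<bullet> e)) \<in> borel_measurable LM" "(\<lambda>x. \<xi> (x \<bullet> e)) \<in> borel_measurable LM"
proof -
 obtain P p where P: "\<And>k::nat. smooth_real (P k)" "\<And>k s. (P k has_real_derivative p k s) (at s)"
  "\<And>F :: real^'d \<Rightarrow> real. F \<in> L2 X ==> l2_lim X (\<lambda>k x. P k (x \<bullet> e) *\<^sub>R F x) (\<lambda>x. h (x \<bullet> e) *\<^sub>R F x)"
  "\<And>F :: real^'d \<Rightarrow> real. F \<in> L2 X ==> l2_lim X (\<lambda>k x. p k (x \<bullet> e) *\<^sub>R F x) (\<lambda>x. \<xi> (x \<bullet> e) *\<^sub>R F x)"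
  using smooth_pair_obtain[OF sp S] by blast
 show "(\<lambda>x. h (x \<bullet> e)) \<in> borel_measurable LM" "(\<lambda>x. \<xi> (x \<bullet> e)) \<in> borel_measurable LM"
  using L2_D(1)[OF l2_lim_D(2)[OF P(3)[OF L2_const[OF lmeas, of 1]]]]
   L2_D(1)[OF l2_lim_D(2)[OF P(4)[OF L2_const[OF lmeas, of 1]]]] by simp_all
qed

end

section \<open>Layered structures\<close>

lemma measurable_combination:
 assumes "\<And>i. c i \<in> borel_measurable M" shows "(\<lambda>x. \<Sum>i\<in>I. c i x *\<^sub>R (P i :: 'b::euclidean_space)) \<in> borel_measurable M"
 using assms by measurable

lemma tensor_mult: "tensor a b *v v = (b \<bullet> v) *\<^sub>R a"
 by (simp add: tensor_def matrix_vector_mult_def vec_eq_iff inner_vec_def sum_distrib_left mult_ac)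

lemma matrix_sum_mult: "(\<Sum>i\<in>I. A i) *v v = (\<Sum>i\<in>I. A i *v (v::real^'n::finite))"
 by (induction I rule: infinite_finite_induct) (auto simp: matrix_vector_mult_add_rdistrib)

lemma invertible_of_coercive:
 fixes A :: "real^'n::finite^'n"
 assumes "\<alpha> > 0" "\<And>v. \<alpha> * (norm v)^2 \<le> v \<bullet> (A *v v)"
 shows "invertible A"
proof -
 have "v = 0" if "A *v v = 0" for v
 proof -
  have "\<alpha> * (norm v)^2 \<le> 0" using assms(2)[of v] that by simp
  then show ?thesis using assms(1) by (simp add: mult_le_0_iff)
 qed
 then show ?thesis using invertible_left_inverse matrix_left_invertible_ker by blast
qed

text \<open>Writing v = A w, one has |v| \<le> C |w|, while the form is at least \<alpha> |w|^2.
  Hence the constant C^2 / \<alpha> for the second bound of the Murat-Tartar class.\<close>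

lemma coercive_inverse:
 fixes A :: "real^'n::finite^'n"
 assumes \<alpha>: "\<alpha> > 0" "\<And>v. \<alpha> * (norm v)^2 \<le> v \<bullet> (A *v v)" and C: "norm A \<le> C" "C > 0"
 shows "v \<bullet> (matrix_inv A *v v) \<ge> 1 / (C^2 / \<alpha>) * (norm v)^2"
proof -
 define w where "w = matrix_inv A *v v"
 have v: "v = A *v w"
  using someI_ex[OF invertible_of_coercive[OF \<alpha>, unfolded invertible_def]]
  by (simp add: w_def matrix_vector_mul_assoc matrix_inv_def)
 have "norm v \<le> C * norm w" unfolding v using norm_matrix_vector_le[of A w] C by (meson mult_right_mono norm_ge_zero order_trans)
 then have "(norm v)^2 \<le> (C * norm w)^2" by (intro power_mono) auto
 then have "1 / (C^2 / \<alpha>) * (norm v)^2 \<le> \<alpha> * (norm w)^2" using C \<alpha> by (simp add: field_simps)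
 also have "\<dots> \<le> w \<bullet> (A *v w)" by (rule \<alpha>)
 finally show ?thesis unfolding w_def[symmetric] by (simp add: v[symmetric] inner_commute)
qed

lemma coeff_class_I:
 assumes "A \<in> Linf X" "\<alpha> > 0" "AE x in lebesgue_on X. \<forall>v. \<alpha> * (norm v)^2 \<le> v \<bullet> (A x *v v)"
  "AE x in lebesgue_on X. norm (A x) \<le> C" "C > 0"
 shows "A \<in> coeff_class X \<alpha> (C^2 / \<alpha>)"
 unfolding coeff_class_def using assms(1)
proof (safe)
 show "AE x in lebesgue_on X. invertible (A x) \<and> (\<forall>v. \<alpha> * (norm v)^2 \<le> v \<bullet> (A x *v v)) \<and>
  (\<forall>v. 1 / (C^2 / \<alpha>) * (norm v)^2 \<le> v \<bullet> (matrix_inv (A x) *v v))"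
  using assms(3,4) by eventually_elim (use assms(2,5) invertible_of_coercive coercive_inverse in blast)
qed

text \<open>A measurable function of one real variable selecting phase \<open>i\<close> on a fraction \<open>t $ i\<close> of each period.\<close>

lemma periodic_selector:
 fixes t :: "real^'N::finite"
 assumes t: "t \<in> proportions"
 obtains lo where "\<And>i. 0 \<le> lo i" "\<And>i. lo i + t $ i \<le> 1"
  "\<And>r. 0 < r ==> r \<le> 1 ==> \<exists>i. \<forall>j. (lo j < r \<and> r \<le> lo j + t $ j) \<longleftrightarrow> j = i"
proof -
 \<comment> \<open>An injection into the naturals orders the phases. \<open>lo i\<close> is the
   total fraction of the phases before i, so the phases occupy consecutive half-open subintervals of
   (0, 1].\<close>
 obtain f :: "'N \<Rightarrow> nat" where f: "inj f" using finite_imp_inj_to_nat_seg[OF finite_class.finite_UNIV] by metis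
 define lo where "lo i = (\<Sum>j | f j < f i. t $ j)" for i
 have t0: "t $ i \<ge> 0" for i using t by (simp add: proportions_def)
 have t1: "(\<Sum>i\<in>UNIV. t $ i) = 1" using t by (simp add: proportions_def)
 have hi: "lo i + t $ i = (\<Sum>j | f j \<le> f i. t $ j)" for i
 proof -
  have "{j. f j \<le> f i} = insert i {j. f j < f i}" using f by (auto simp: inj_def order_le_less)
  then show ?thesis by (simp add: lo_def add.commute)
 qed
 have mono: "(\<Sum>j\<in>A. t $ j) \<le> (\<Sum>j\<in>B. t $ j)" if "A \<subseteq> B" for A B :: "'N set"
  using that t0 by (intro sum_mono2) auto
 have ord: "lo i + t $ i \<le> lo k" if "f i < f k" for i k
  unfolding hi unfolding lo_def using that by (intro mono) auto
 show thesis
 proof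
  show "0 \<le> lo i" for i unfolding lo_def using t0 by (intro sum_nonneg) auto
  show "lo i + t $ i \<le> 1" for i unfolding hi using mono[of "{j. f j \<le> f i}" UNIV] t1 by simp
  fix r :: real assume r: "0 < r" "r \<le> 1"
  have "\<exists>i. r \<le> lo i + t $ i"
  proof -
   have "Max (range f) \<in> range f" by (intro Max_in) auto
   then obtain i where i0: "Max (range f) = f i" by blast
   have i: "f j \<le> f i" for j unfolding i0[symmetric] by (intro Max_ge) auto
   then have "{j. f j \<le> f i} = UNIV" by auto
   then show ?thesis using r t1 hi[of i] by (intro exI[of _ i]) simp
  qed
  \<comment> \<open>The first phase whose right end reaches r. If r were at most
    \<open>lo i\<close>, its predecessor, which ends at \<open>lo i\<close>, would reach r as
    well.\<close>
  then obtain i where i: "r \<le> lo i + t $ i" "\<And>k. r \<le> lo k + t $ k ==> f i \<le> f k"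
   using ex_has_least_nat[of "\<lambda>i. r \<le> lo i + t $ i" _ f] by metis
  have lor: "lo i < r"
  proof (rule ccontr)
   assume "\<not> lo i < r"
   then have ri: "r \<le> lo i" by simp
   have "{j. f j < f i} \<noteq> {}"
   proof
    assume "{j. f j < f i} = {}"
    then show False using ri r(1) unfolding lo_def by simp
   qed
   then have "Max (f ` {j. f j < f i}) \<in> f ` {j. f j < f i}" by (intro Max_in) auto
   then obtain k where k0: "Max (f ` {j. f j < f i}) = f k" "f k < f i" by blast
   have k: "f k < f i" "\<And>j. f j < f i ==> f j \<le> f k"
    using k0(2) unfolding k0(1)[symmetric] by (auto intro!: Max_ge)
   then have "{j. f j \<le> f k} = {j. f j < f i}" by auto
   then have "lo k + t $ k = lo i" unfolding hi unfolding lo_def by simp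
   then show False using i(2)[of k] ri k(1) by simp
  qed
  have "j = i" if j: "lo j < r" "r \<le> lo j + t $ j" for j
  proof -
   have "\<not> f i < f j" using ord[of i j] i(1) j(1) by auto
   moreover have "\<not> f j < f i" using ord[of j i] lor j(2) by auto
   ultimately show ?thesis using f by (metis injD linorder_neqE_nat)
  qed
  then show "\<exists>i. \<forall>j. (lo j < r \<and> r \<le> lo j + t $ j) \<longleftrightarrow> j = i" using i(1) lor by blast
 qed
qed

section \<open>Weak limits of bounded sequences\<close>

context bounded_open
begin

lemma integral_bounded_factor_le:
 fixes g :: "real^'d \<Rightarrow> real"
 assumes g: "integrable LM g" and h: "h \<in> borel_measurable LM" "\<And>x. x \<in> X ==> \<bar>h x\<bar> \<le> \<epsilon>"
 shows "\<bar>LINT x|LM. h x * g x\<bar> \<le> \<epsilon> * (LINT x|LM. \<bar>g x\<bar>)"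
proof -
 have i: "integrable LM (\<lambda>x. h x * g x)"
  by (rule L1_bound[OF integrable_mult_right[of \<epsilon>, OF g]])
   (use g h in \<open>auto simp: abs_mult intro!: AE_I2 mult_right_mono order_trans[OF h(2)]\<close>)
 have "\<bar>LINT x|LM. h x * g x\<bar> \<le> (LINT x|LM. \<bar>h x * g x\<bar>)" by (rule integral_abs_bound)
 also have "\<dots> \<le> (LINT x|LM. \<epsilon> * \<bar>g x\<bar>)"
  by (rule integral_mono_AE) (use integrable_abs[OF i] g h in \<open>auto simp: abs_mult intro!: AE_I2 mult_right_mono\<close>)
 finally show ?thesis by simp
qed

lemma integral_abs_mult_le:
 assumes "f \<in> L2 X" "g \<in> L2 X"
 shows "(LINT x|LM. \<bar>f x * g x\<bar>) \<le> l2norm X f * l2norm X g"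
 using l2_cauchy_schwarz_mult[OF L2_norm[OF assms(1)] L2_norm[OF assms(2)]] unfolding l2norm_norm by (simp add: abs_mult abs_le_iff)

lemma integral_abs_inner_le:
 assumes "f \<in> L2 X" "g \<in> L2 X"
 shows "(LINT x|LM. \<bar>f x \<bullet> g x\<bar>) \<le> l2norm X f * l2norm X g"
proof -
 have "(LINT x|LM. \<bar>f x \<bullet> g x\<bar>) \<le> (LINT x|LM. norm (f x) * norm (g x))"
  by (rule integral_mono_AE) (use L2_inner_integrable[OF assms] L2_norm_mult_integrable[OF assms] in \<open>auto simp: Cauchy_Schwarz_ineq2\<close>)
 also have "\<dots> \<le> l2norm X f * l2norm X g"
  using l2_cauchy_schwarz_mult[OF L2_norm[OF assms(1)] L2_norm[OF assms(2)]] by (simp add: l2norm_norm abs_le_iff)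
 finally show ?thesis .
qed

text \<open>Truncation brings an integrable function into L2, where test functions are dense; on a
  bounded set the L2 distance controls the L1 distance.\<close>

lemma L1_approx:
 fixes g :: "real^'d \<Rightarrow> real"
 assumes g: "integrable LM g" and "\<epsilon> > 0"
 obtains \<phi> where "\<phi> \<in> test" "(LINT x|LM. \<bar>g x - \<phi> x\<bar>) < \<epsilon>"
proof -
 define c where "c n x = max (- real n) (min (real n) (g x))" for n x
 have gm: "g \<in> borel_measurable LM" using g by auto
 have cm: "c n \<in> borel_measurable LM" for n unfolding c_def using gm by measurable
 have "(\<lambda>n. LINT x|LM. \<bar>g x - c n x\<bar>) \<longlonglongrightarrow> (LINT x|LM. 0)"
 proof (rule integral_dominated_convergence[where w="\<lambda>x. \<bar>g x\<bar>"])
  show "AE x in LM. (\<lambda>n. \<bar>g x - c n x\<bar>) \<longlonglongrightarrow> 0"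
  proof (rule AE_I2)
   fix x
   obtain N where "\<bar>g x\<bar> \<le> real N" using real_arch_simple by blast
   then have "c n x = g x" if "n \<ge> N" for n using that unfolding c_def by (auto simp: max_def min_def abs_le_iff)
   then have "\<forall>\<^sub>F n in sequentially. \<bar>g x - c n x\<bar> = 0" unfolding eventually_sequentially by (intro exI[of _ N]) auto
   then show "(\<lambda>n. \<bar>g x - c n x\<bar>) \<longlonglongrightarrow> 0" by (rule tendsto_eventually)
  qed
  show "AE x in LM. norm \<bar>g x - c n x\<bar> \<le> \<bar>g x\<bar>" for n
   unfolding c_def by (intro AE_I2) (auto simp: max_def min_def)
 qed (use g gm cm in auto)
 then obtain n where n: "(LINT x|LM. \<bar>g x - c n x\<bar>) < \<epsilon> / 2"
  using order_tendstoD(2)[of _ 0 sequentially "\<epsilon> / 2"] assms(2) by (auto simp: eventually_sequentially)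
 have cL: "c n \<in> L2 X"
  by (rule L2_bounded[OF lmeas cm, of _ "real n"]) (auto simp: c_def max_def min_def)
 let ?o = "l2norm X (\<lambda>x. 1::real)"
 have o: "?o + 1 > 0" using l2norm_ge0[of X "\<lambda>x. 1::real"] by linarith
 then obtain \<phi> where \<phi>: "\<phi> \<in> test" "l2norm X (\<lambda>x. \<phi> x - c n x) < \<epsilon> / 2 / (?o + 1)"
  using test_dense[OF cL] assms(2) unfolding approximable_def by (meson divide_pos_pos half_gt_zero)
 have "(LINT x|LM. \<bar>(\<phi> x - c n x) * 1\<bar>) \<le> l2norm X (\<lambda>x. \<phi> x - c n x) * ?o"
  by (rule integral_abs_mult_le[OF L2_diff[OF test_L2[OF \<phi>(1)] cL] L2_const[OF lmeas]])
 also have "\<dots> \<le> l2norm X (\<lambda>x. \<phi> x - c n x) * (?o + 1)" by (intro mult_left_mono) auto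
 also have "\<dots> < \<epsilon> / 2" using \<phi>(2) unfolding pos_less_divide_eq[OF o] .
 finally have 2: "(LINT x|LM. \<bar>\<phi> x - c n x\<bar>) < \<epsilon> / 2" by simp
 have ic: "integrable LM (c n)" and ip: "integrable LM \<phi>" using L2_imp_integrable[OF lmeas] cL test_L2[OF \<phi>(1)] by auto
 have "(LINT x|LM. \<bar>g x - \<phi> x\<bar>) \<le> (LINT x|LM. \<bar>g x - c n x\<bar> + \<bar>\<phi> x - c n x\<bar>)"
  by (rule integral_mono_AE) (use g ic ip in auto)
 also have "\<dots> < \<epsilon>" using n 2 g ic ip by simp
 finally show thesis using that \<phi>(1) by blast
qed

text \<open>A Riemann-Lebesgue argument: against test functions the oscillation is exchanged for its
  primitive of size \<open>\<epsilon> n\<close>, and the uniform bound on \<open>\<xi> n\<close>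
  extends the limit to all of L1 by density.\<close>

lemma oscillation_weak_star:
 fixes g :: "real^'d \<Rightarrow> real"
 assumes sp: "\<And>n. smooth_pair S (\<xi> n) (h n)" and S: "\<And>x. x \<in> X ==> \<bar>x \<bullet> e\<bar> \<le> S" and e: "norm e = 1"
  and b: "\<And>n s. \<bar>s\<bar> \<le> S ==> \<bar>h n s\<bar> \<le> \<epsilon> n" "\<epsilon> \<longlonglongrightarrow> 0" and x1: "\<And>n s. \<bar>s\<bar> \<le> S ==> \<bar>\<xi> n s\<bar> \<le> 1"
  and g: "integrable LM g"
 shows "(\<lambda>n. LINT x|LM. \<xi> n (x \<bullet> e) * g x) \<longlonglongrightarrow> 0"
proof (rule LIMSEQ_I)
 fix r :: real assume r: "r > 0"
 obtain \<phi> where \<phi>: "\<phi> \<in> test" "(LINT x|LM. \<bar>g x - \<phi> x\<bar>) < r / 2" using L1_approx[OF g, of "r/2"] r by auto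
 note m = oscillation_measurable[OF sp S]
 have ip: "integrable LM \<phi>" by (rule L2_imp_integrable[OF lmeas test_L2[OF \<phi>(1)]])
 have xi: "integrable LM (\<lambda>x. \<xi> n (x \<bullet> e) * f x)" if "integrable LM f" for f n
  by (rule L1_bound[OF that])
   (use m(2) that x1 S in \<open>auto simp: abs_mult intro!: AE_I2 mult_left_le_one_le\<close>)
 let ?K = "LINT x|LM. \<bar>grad \<phi> x \<bullet> e\<bar>"
 have "(\<lambda>n. \<epsilon> n * ?K) \<longlonglongrightarrow> 0 * ?K" by (intro tendsto_intros b)
 then have "(\<lambda>n. \<epsilon> n * ?K) \<longlonglongrightarrow> 0" by simp
 then obtain N where N: "\<And>n. n \<ge> N ==> \<epsilon> n * ?K < r / 2"
  using order_tendstoD(2)[of _ 0 sequentially "r / 2"] r by (auto simp: eventually_sequentially)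
 have "norm ((LINT x|LM. \<xi> n (x \<bullet> e) * g x) - 0) < r" if n: "n \<ge> N" for n
 proof -
  have "(LINT x|LM. \<xi> n (x \<bullet> e) * g x) = (LINT x|LM. \<xi> n (x \<bullet> e) * (g x - \<phi> x)) + (LINT x|LM. \<xi> n (x \<bullet> e) * \<phi> x)"
   using xi[OF g, of n] xi[OF ip, of n] by (simp add: right_diff_distrib)
  moreover have "\<bar>LINT x|LM. \<xi> n (x \<bullet> e) * (g x - \<phi> x)\<bar> \<le> 1 * (LINT x|LM. \<bar>g x - \<phi> x\<bar>)"
   by (rule integral_bounded_factor_le) (use g ip m(2) x1 S in auto)
  moreover have "\<bar>LINT x|LM. h n (x \<bullet> e) * (grad \<phi> x \<bullet> e)\<bar> \<le> \<epsilon> n * ?K"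
   by (rule integral_bounded_factor_le)
    (use L2_imp_integrable[OF lmeas test_L2[OF test_dir_deriv[OF \<phi>(1)]]] m(1) b(1) S in auto)
  moreover have "(LINT x|LM. \<xi> n (x \<bullet> e) * \<phi> x) = - (LINT x|LM. h n (x \<bullet> e) * (grad \<phi> x \<bullet> e))"
   by (rule oscillation_test[OF sp S e \<phi>(1)])
  ultimately show ?thesis using \<phi>(2) N[OF n] by simp
 qed
 then show "\<exists>N. \<forall>n\<ge>N. norm ((LINT x|LM. \<xi> n (x \<bullet> e) * g x) - 0) < r" by blast
qed

text \<open>The uniform bound on f n makes the error of replacing the limit g' by g m small
  uniformly in n.\<close>

lemma bounded_weak_closure:
 fixes f :: "nat \<Rightarrow> real^'d \<Rightarrow> 'b::euclidean_space"
 assumes f: "\<And>n. f n \<in> L2 X" "\<And>n. l2norm X (f n) \<le> K" and g: "l2_lim X g g'"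
  and l: "\<And>m. (\<lambda>n. LINT x|LM. f n x \<bullet> g m x) \<longlonglongrightarrow> 0"
 shows "(\<lambda>n. LINT x|LM. f n x \<bullet> g' x) \<longlonglongrightarrow> 0"
proof (rule LIMSEQ_I)
 fix r :: real assume r: "r > 0"
 note G = l2_lim_D[OF g]
 have K: "K \<ge> 0" using f(2)[of 0] l2norm_ge0 order_trans by blast
 obtain m where m: "l2norm X (\<lambda>x. g m x - g' x) < r / 2 / (K + 1)"
  using order_tendstoD(2)[OF G(3), of "r / 2 / (K + 1)"] r K by (auto simp: eventually_sequentially)
 obtain N where N: "\<And>n. n \<ge> N ==> \<bar>LINT x|LM. f n x \<bullet> g m x\<bar> < r / 2"
  using LIMSEQ_D[OF l, of "r / 2" m] r by auto
 have "norm ((LINT x|LM. f n x \<bullet> g' x) - 0) < r" if n: "n \<ge> N" for n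
 proof -
  have "(LINT x|LM. f n x \<bullet> g' x) = (LINT x|LM. f n x \<bullet> g m x) - (LINT x|LM. f n x \<bullet> (g m x - g' x))"
   using L2_inner_integrable[OF f(1) G(1)] L2_inner_integrable[OF f(1) G(2)] by (simp add: inner_diff_right)
  moreover have "\<bar>LINT x|LM. f n x \<bullet> (g m x - g' x)\<bar> \<le> l2norm X (f n) * l2norm X (\<lambda>x. g m x - g' x)"
   by (rule l2_cauchy_schwarz[OF f(1) L2_diff[OF G(1,2)]])
  moreover have "l2norm X (f n) * l2norm X (\<lambda>x. g m x - g' x) \<le> (K + 1) * l2norm X (\<lambda>x. g m x - g' x)"
   using f(2)[of n] by (intro mult_right_mono) auto
  moreover have "(K + 1) * l2norm X (\<lambda>x. g m x - g' x) < r / 2" proof -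
   have "0 < K + 1" using K by simp
   then show ?thesis using m by (simp only: pos_less_divide_eq mult.commute)
  qed
  ultimately show ?thesis using N[OF n] by simp
 qed
 then show "\<exists>N. \<forall>n\<ge>N. norm ((LINT x|LM. f n x \<bullet> g' x) - 0) < r" by blast
qed

lemma test_dense_seq:
 assumes "g \<in> L2 X"
 obtains \<phi> where "\<And>n::nat. \<phi> n \<in> test" "l2_lim X \<phi> g"
proof -
 have "\<exists>\<phi>\<in>test. l2norm X (\<lambda>x. \<phi> x - g x) < 1 / real (Suc n)" for n
  using test_dense[OF assms] by (auto simp: approximable_def)
 then obtain \<phi> where \<phi>: "\<And>n. \<phi> n \<in> test" "\<And>n. l2norm X (\<lambda>x. \<phi> n x - g x) < 1 / real (Suc n)" by metis
 have "(\<lambda>n. l2norm X (\<lambda>x. \<phi> n x - g x)) \<longlonglongrightarrow> 0"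
  by (rule Lim_null_comparison[OF always_eventually LIMSEQ_Suc[OF lim_1_over_n]])
   (use \<phi>(2) in \<open>auto simp: less_imp_le\<close>)
 then show thesis using that[of \<phi>] \<phi>(1) assms test_L2 by (auto simp: l2_lim_def)
qed

lemma weak_limit_from_test:
 fixes f :: "nat \<Rightarrow> real^'d \<Rightarrow> real^'d"
 assumes f: "\<And>n. f n \<in> L2 X" "\<And>n. l2norm X (f n) \<le> K" and g: "g \<in> L2 X"
  and l: "\<And>\<phi> i. \<phi> \<in> test ==> (\<lambda>n. LINT x|LM. (f n x \<bullet> axis i 1) * \<phi> x) \<longlonglongrightarrow> 0"
 shows "(\<lambda>n. LINT x|LM. f n x \<bullet> g x) \<longlonglongrightarrow> 0"
proof -
 have "(\<lambda>n. LINT x|LM. (f n x \<bullet> axis i 1) * (g x \<bullet> axis i 1)) \<longlonglongrightarrow> 0" for i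
 proof -
  obtain \<phi> where \<phi>: "\<And>n::nat. \<phi> n \<in> test" "l2_lim X \<phi> (\<lambda>x. g x \<bullet> axis i 1)"
   using test_dense_seq[OF L2_inner_const[OF g]] by blast
  have "l2norm X (\<lambda>x. f n x \<bullet> axis i 1) \<le> K" for n
  proof (rule order_trans[OF l2norm_mono[OF L2_inner_const[OF f(1)] f(1)] f(2)])
   show "AE x in LM. norm (f n x \<bullet> axis i 1) \<le> norm (f n x)"
    by (intro AE_I2) (simp add: inner_axis component_le_norm_cart)
  qed
  from bounded_weak_closure[OF L2_inner_const[OF f(1)] this \<phi>(2)] show ?thesis using l[OF \<phi>(1)] by simp
 qed
 then have "(\<lambda>n. \<Sum>i\<in>UNIV. LINT x|LM. (f n x \<bullet> axis i 1) * (g x \<bullet> axis i 1)) \<longlonglongrightarrow> (\<Sum>i\<in>(UNIV::'d set). 0)"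
  by (intro tendsto_sum)
 moreover have "(\<Sum>i\<in>UNIV. LINT x|LM. (f n x \<bullet> axis i 1) * (g x \<bullet> axis i 1)) = (LINT x|LM. f n x \<bullet> g x)" for n
 proof -
  have "(LINT x|LM. f n x \<bullet> g x) = (LINT x|LM. (\<Sum>i\<in>UNIV. (f n x \<bullet> axis i 1) * (g x \<bullet> axis i 1)))"
   unfolding inner_axis by (simp add: inner_vec_def)
  also have "\<dots> = (\<Sum>i\<in>UNIV. LINT x|LM. (f n x \<bullet> axis i 1) * (g x \<bullet> axis i 1))"
   by (rule lint_sum) (intro L2_mult_integrable L2_inner_const f g)
  finally show ?thesis by simp
 qed
 ultimately show ?thesis by simp
qed

lemma weakly_L2_I:
 fixes u :: "nat \<Rightarrow> real^'d \<Rightarrow> 'b::euclidean_space"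
 assumes u: "\<And>n. u n \<in> L2 X" and v: "v \<in> L2 X"
  and l: "\<And>g. g \<in> L2 X ==> (\<lambda>n. LINT x|LM. (u n x - v x) \<bullet> g x) \<longlonglongrightarrow> 0"
 shows "weakly_L2 X u v"
 unfolding weakly_L2_def
proof (intro conjI allI ballI u v)
 fix g :: "real^'d \<Rightarrow> 'b" assume g: "g \<in> L2 X"
 have eq: "(LINT x|LM. (u n x - v x) \<bullet> g x) = (LINT x|LM. u n x \<bullet> g x) - (LINT x|LM. v x \<bullet> g x)" for n
  unfolding inner_diff_left
  by (rule lint_diff) (intro L2_inner_integrable u v g)+
 show "(\<lambda>n. LINT x|LM. u n x \<bullet> g x) \<longlonglongrightarrow> (LINT x|LM. v x \<bullet> g x)"
  by (rule LIM_zero_cancel[OF l[OF g, unfolded eq]])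
qed

text \<open>Weak convergence of the gradients follows from convergence against \<open>B \<nabla>\<psi>\<close> alone, because
 \<open>div (B \<nabla>w) = div g\<close> is solvable; no compactness is involved.\<close>

lemma H_limit_weak:
 assumes B: "sym_elliptic \<alpha> B" and u: "\<And>n. h10 (u n) (G n)" "\<And>n. l2norm X (G n) \<le> K" and v: "h10 v F"
  and l: "\<And>\<psi>. \<psi> \<in> test ==> (\<lambda>n. LINT x|LM. (G n x - F x) \<bullet> (B x *v grad \<psi> x)) \<longlonglongrightarrow> 0"
 shows "weakly_L2 X u v" "weakly_L2 X G F"
proof -
 have BL: "B \<in> Linf X" using B by (simp add: sym_elliptic_def)
 note d = h10_diff[OF u(1) v]
 have dL: "(\<lambda>x. G n x - F x) \<in> L2 X" for n using h10_L2(2)[OF d] .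
 have dK: "l2norm X (\<lambda>x. G n x - F x) \<le> K + l2norm X F" for n
  using l2norm_triangle_diff[OF h10_L2(2)[OF u(1)] L2_zero h10_L2(2)[OF v], of n] u(2)[of n] by (simp add: l2norm_minus)
 have key: "(\<lambda>n. LINT x|LM. (G n x - F x) \<bullet> (B x *v W x)) \<longlonglongrightarrow> 0" if w: "h10 w W" for w W
 proof -
  obtain \<psi> where \<psi>: "\<And>n. \<psi> n \<in> test" "l2_lim X (\<lambda>n. grad (\<psi> n)) W" using w by (auto simp: h10_def)
  show ?thesis by (rule bounded_weak_closure[OF dL dK l2_lim_matrix_vector[OF BL \<psi>(2)] l[OF \<psi>(1)]])
 qed
 \<comment> \<open>Against gradients of \<open>H1_0\<close> functions, g may be replaced by B W with
   the same divergence; this reduces an arbitrary g to the fields covered by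
   \<open>key\<close>.\<close>
 have grad: "(\<lambda>n. LINT x|LM. (G n x - F x) \<bullet> g x) \<longlonglongrightarrow> 0" if g: "g \<in> L2 X" for g
 proof -
  obtain w W where w: "h10 w W" "neg_div_eq X (\<lambda>x. B x *v W x) (\<lambda>\<phi>. LINT x|LM. g x \<bullet> grad \<phi> x)"
   using dirichlet_exists[OF B H_minus_1_field[OF g]] unfolding dirichlet_solution_iff by blast
  have "(LINT x|LM. (B x *v W x) \<bullet> (G n x - F x)) = (LINT x|LM. g x \<bullet> (G n x - F x))" for n
   by (rule h10_ortho[OF d Linf_L2_matrix_vector[OF BL h10_L2(2)[OF w(1)]] _ g]) (use w(2) in \<open>auto simp: neg_div_eq_def\<close>)
  then show ?thesis using key[OF w(1)] by (simp add: inner_commute)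
 qed
 show "weakly_L2 X G F" by (rule weakly_L2_I[OF h10_L2(2)[OF u(1)] h10_L2(2)[OF v] grad])
 \<comment> \<open>Representing the functional f by a field W turns convergence of the functions
   into convergence of the gradients.\<close>
 have fn: "(\<lambda>n. LINT x|LM. (u n x - v x) * f x) \<longlonglongrightarrow> 0" if f: "f \<in> L2 X" for f
 proof -
  obtain W where W: "W \<in> L2 X" "\<And>\<phi>. \<phi> \<in> test ==> L2_functional X f \<phi> = (LINT x|LM. W x \<bullet> grad \<phi> x)"
   using H_minus_1_riesz[OF H_minus_1_function[OF f]] by blast
  have "(LINT x|LM. (u n x - v x) * f x) = (LINT x|LM. (G n x - F x) \<bullet> W x)" for n
  proof -
   obtain \<phi> where \<phi>: "\<And>k. \<phi> k \<in> test" "l2_lim X \<phi> (\<lambda>x. u n x - v x)" "l2_lim X (\<lambda>k. grad (\<phi> k)) (\<lambda>x. G n x - F x)"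
    using d[of n] by (auto simp: h10_def)
   have "(LINT x|LM. \<phi> k x * f x) = (LINT x|LM. grad (\<phi> k) x \<bullet> W x)" for k
    using W(2)[OF \<phi>(1)] by (simp add: L2_functional_def inner_commute mult.commute)
   then have "(\<lambda>k. LINT x|LM. grad (\<phi> k) x \<bullet> W x) \<longlonglongrightarrow> (LINT x|LM. (u n x - v x) * f x)"
    using l2_lim_inner_left(1)[OF \<phi>(2) f] by simp
   then show ?thesis by (rule LIMSEQ_unique[OF _ l2_lim_inner_left(1)[OF \<phi>(3) W(1)]])
  qed
  then show ?thesis using grad[OF W(1)] by simp
 qed
 show "weakly_L2 X u v"
 proof (rule weakly_L2_I[OF h10_L2(1)[OF u(1)] h10_L2(1)[OF v]])
  show "(\<lambda>n. LINT x|LM. (u n x - v x) \<bullet> f x) \<longlonglongrightarrow> 0" if "f \<in> L2 X" for f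
   using fn[OF that] by simp
 qed
qed

end

section \<open>The H-limit of a laminate\<close>

text \<open>The harmonic mean of the \<open>lam i\<close> along e and the arithmetic mean of the
  phases on its complement: when e is an eigenvector of \<open>P i\<close> for \<open>lam i\<close>,
  the rank-one correction removes the action of \<open>P i\<close> on e.\<close>

definition laminate_matrix :: "('N::finite \<Rightarrow> real^'d::finite^'d) \<Rightarrow> ('N \<Rightarrow> real) \<Rightarrow> real^'N \<Rightarrow> real^'d \<Rightarrow> real^'d^'d" where
 "laminate_matrix P lam t e = (1 / (\<Sum>i\<in>UNIV. t $ i / lam i)) *\<^sub>R tensor e e +
   (\<Sum>i\<in>UNIV. (t $ i) *\<^sub>R (P i - lam i *\<^sub>R tensor e e))"

locale laminate_phases =
 fixes P :: "'N::finite \<Rightarrow> real^'d::finite^'d" and lam :: "'N \<Rightarrow> real" and t :: "real^'N" and e :: "real^'d" and \<alpha> :: real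
 assumes t: "t \<in> proportions" and P_sym: "\<And>i. transpose (P i) = P i"
  and \<alpha>: "\<alpha> > 0" and P_low: "\<And>i v. \<alpha> * (norm v)^2 \<le> v \<bullet> (P i *v v)"
  and e: "norm e = 1" and ev: "\<And>i. P i *v e = lam i *\<^sub>R e"
begin

definition "B = laminate_matrix P lam t e"
definition "s = (\<Sum>i\<in>UNIV. t $ i / lam i)"

lemma ee: "e \<bullet> e = 1" using e by (simp add: norm_eq_1)

lemma lam_pos: "lam i > 0"
 using P_low[of e i] \<alpha> e ee by (simp add: ev)

lemma t0: "0 \<le> t $ i" and t1: "t $ i \<le> 1" and tsum: "(\<Sum>i\<in>UNIV. t $ i) = 1"
 using t by (auto simp: proportions_def)

lemma s_pos: "s > 0"
proof -
 have "0 \<le> s" unfolding s_def using t0 lam_pos by (intro sum_nonneg divide_nonneg_pos) auto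
 moreover have "s \<noteq> 0"
 proof
  assume "s = 0"
  then have "\<forall>i\<in>UNIV. t $ i / lam i = 0"
   unfolding s_def using t0 lam_pos by (subst (asm) sum_nonneg_eq_0_iff) (auto intro: divide_nonneg_pos)
  then have "\<And>i. t $ i = 0" using lam_pos by (metis UNIV_I divide_eq_0_iff less_irrefl)
  then show False using tsum by simp
 qed
 ultimately show ?thesis by simp
qed

lemma B_mult: "B *v g = ((e \<bullet> g) / s) *\<^sub>R e + (\<Sum>i\<in>UNIV. (t $ i) *\<^sub>R (P i *v (g - (g \<bullet> e) *\<^sub>R e)))"
 unfolding B_def laminate_matrix_def s_def[symmetric]
 by (simp add: matrix_vector_mult_add_rdistrib matrix_sum_mult scaleR_matrix_vector_assoc[symmetric] tensor_mult
   matrix_vector_mult_diff_rdistrib matrix_vector_mult_diff_distrib matrix_vector_mult_scaleR ev inner_commute mult.commute)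

text \<open>A symmetric matrix with eigenvector e preserves the orthogonal complement of e. These
  vectors are therefore admissible tangential directions in \<open>oscillation_curl\<close>.\<close>

lemma P_orth: "(P i *v (g - (g \<bullet> e) *\<^sub>R e)) \<bullet> e = 0"
 by (simp add: symmetric_inner[OF P_sym] ev inner_diff_left ee)

lemma B_sym: "transpose B = B"
proof -
 have P: "P i $ a $ b = P i $ b $ a" for i a b 
 proof -
  have "transpose (P i) $ b $ a = P i $ a $ b" by (simp add: transpose_def)
  then show ?thesis unfolding P_sym by simp
 qed
 have "B $ a $ b = B $ b $ a" for a b
  unfolding B_def laminate_matrix_def tensor_def by (simp add: P[of _ a b] mult.commute[of "e $ a" "e $ b"])
 then show ?thesis unfolding transpose_def by (simp only: vec_eq_iff vec_lambda_beta simp_thms)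
qed

text \<open>The splitting of v along e and its complement decouples the form: the factor is 1 / s on
  the line, and on the complement an average of the phases, each at least \<alpha>.\<close>

lemma B_low: "min (1 / s) \<alpha> * (norm v)^2 \<le> v \<bullet> (B *v v)"
proof -
 define w where "w = v - (v \<bullet> e) *\<^sub>R e"
 have we: "w \<bullet> e = 0" by (simp add: w_def inner_diff_left ee)
 have v: "v = (v \<bullet> e) *\<^sub>R e + w" by (simp add: w_def)
 have nv: "(norm v)^2 = (v \<bullet> e)^2 + (norm w)^2"
 proof -
  have "(norm (c *\<^sub>R e + w))^2 = c^2 + (norm w)^2" for c
   using we e by (simp add: norm_add_sq inner_commute power_mult_distrib)
  from this[of "v \<bullet> e"] show ?thesis using v by simp
 qed
 have "v \<bullet> (P i *v w) = w \<bullet> (P i *v w)" for i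
 proof -
  have "e \<bullet> (P i *v w) = 0" using P_orth[of i v] by (simp add: w_def inner_commute)
  then have "(c *\<^sub>R e + w) \<bullet> (P i *v w) = w \<bullet> (P i *v w)" for c by (simp add: inner_add_left)
  from this[of "v \<bullet> e"] show ?thesis using v by simp
 qed
 then have "v \<bullet> (B *v v) = (v \<bullet> e)^2 / s + (\<Sum>i\<in>UNIV. t $ i * (w \<bullet> (P i *v w)))"
  unfolding B_mult w_def[symmetric] by (simp add: inner_add_right inner_sum_right inner_commute power2_eq_square)
 moreover have "(\<Sum>i\<in>UNIV. t $ i * (\<alpha> * (norm w)^2)) \<le> (\<Sum>i\<in>UNIV. t $ i * (w \<bullet> (P i *v w)))"
  by (intro sum_mono mult_left_mono P_low t0)
 moreover have "(\<Sum>i\<in>UNIV. t $ i * (\<alpha> * (norm w)^2)) = \<alpha> * (norm w)^2"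
  by (simp only: sum_distrib_right[symmetric] tsum mult_1)
 moreover have "min (1 / s) \<alpha> * (v \<bullet> e)^2 \<le> 1 / s * (v \<bullet> e)^2" "min (1 / s) \<alpha> * (norm w)^2 \<le> \<alpha> * (norm w)^2"
  by (intro mult_right_mono; simp)+
 ultimately show ?thesis unfolding nv by (simp add: distrib_left)
qed

text \<open>The algebra behind the limit. The flux of phase j tested with g differs from G tested
  with B g by a combination of the deviations \<open>c i - t $ i\<close>, whose factors are only
  tangential components of G and the normal component of the flux. These are the quantities
  controlled by \<open>oscillation_curl\<close> and \<open>oscillation_div\<close>.\<close>

lemma pointwise:
 assumes "\<And>i. c i = (if i = j then 1 else 0)"
 shows "(P j *v G) \<bullet> g - G \<bullet> (B *v g) =
  (\<Sum>i\<in>UNIV. (c i - t $ i) * (G \<bullet> (P i *v (g - (g \<bullet> e) *\<^sub>R e)))) -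
  (\<Sum>i\<in>UNIV. (c i - t $ i) / lam i) * ((P j *v G) \<bullet> e) * (g \<bullet> e) / s"
proof -
 let ?g = "g - (g \<bullet> e) *\<^sub>R e"
 have \<sigma>: "(P j *v G) \<bullet> e = lam j * (G \<bullet> e)" by (simp add: symmetric_inner[OF P_sym] ev)
 have 1: "(P j *v G) \<bullet> g = G \<bullet> (P j *v ?g) + (g \<bullet> e) * ((P j *v G) \<bullet> e)"
  by (simp add: symmetric_inner[OF P_sym] matrix_vector_mult_diff_distrib inner_diff_right matrix_vector_mult_scaleR)
 have 2: "G \<bullet> (B *v g) = (g \<bullet> e) * (G \<bullet> e) / s + (\<Sum>i\<in>UNIV. t $ i * (G \<bullet> (P i *v ?g)))"
  unfolding B_mult by (simp add: inner_add_right inner_sum_right inner_commute)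
 have 3: "(\<Sum>i\<in>UNIV. (c i - t $ i) * (G \<bullet> (P i *v ?g))) = G \<bullet> (P j *v ?g) - (\<Sum>i\<in>UNIV. t $ i * (G \<bullet> (P i *v ?g)))"
  using assms by (simp add: left_diff_distrib sum_subtractf if_distrib[of "\<lambda>x. x * _"] cong: if_cong)
 have 4: "(\<Sum>i\<in>UNIV. (c i - t $ i) / lam i) = 1 / lam j - s"
  using assms by (simp add: diff_divide_distrib sum_subtractf s_def if_distrib[of "\<lambda>x. x / _"] cong: if_cong)
 have "(1 / lam j - s) * ((P j *v G) \<bullet> e) * (g \<bullet> e) / s = (G \<bullet> e) * (g \<bullet> e) / s - ((P j *v G) \<bullet> e) * (g \<bullet> e)"
  using s_pos lam_pos[of j] unfolding \<sigma> by (simp add: field_simps)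
 then show ?thesis unfolding 3 4 using 1 2 by (simp add: mult.commute)
qed

end

section \<open>Convergence of layered materials\<close>

context bounded_open
begin

lemma energy_bound:
 assumes A: "A \<in> Linf X" "\<alpha> > 0" "AE x in LM. \<forall>v. \<alpha> * (norm v)^2 \<le> v \<bullet> (A x *v v)"
  and u: "h10 u G" "\<And>\<phi>. \<phi> \<in> test ==> (LINT x|LM. (A x *v G x) \<bullet> grad \<phi> x) = (LINT x|LM. W x \<bullet> grad \<phi> x)" and W: "W \<in> L2 X"
 shows "l2norm X G \<le> l2norm X W / \<alpha>"
proof -
 note G = h10_L2(2)[OF u(1)]
 have "\<alpha> * (l2norm X G)^2 \<le> (LINT x|LM. G x \<bullet> (A x *v G x))" by (rule elliptic_lower[OF A(1,3) G])
 also have "\<dots> = (LINT x|LM. W x \<bullet> G x)"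
  using h10_ortho[OF u(1) Linf_L2_matrix_vector[OF A(1) G] u(2) W] by (simp add: inner_commute)
 also have "\<dots> \<le> l2norm X W * l2norm X G" using l2_cauchy_schwarz[OF W G] by linarith
 finally have "(\<alpha> * l2norm X G) * l2norm X G \<le> l2norm X W * l2norm X G" by (simp add: power2_eq_square)
 then have "\<alpha> * l2norm X G \<le> l2norm X W"
  by (cases "l2norm X G = 0") (auto simp: order_less_le)
 then show ?thesis using A(2) by (simp add: field_simps)
qed

text \<open>The phases alternate in thin slabs orthogonal to e. By \<open>pointwise\<close>, the
  flux minus B applied to the gradient is a sum of oscillations that tend weakly to 0 by the div and
  curl identities. Together with the equation this identifies the weak limit of the gradients, and
  then that of the fluxes.\<close>

lemma laminate_H_converges:
 fixes P :: "'N::finite \<Rightarrow> real^'d^'d"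
 assumes "laminate_phases P lam t e \<alpha>"
 obtains ph where "\<And>n::nat. ph n \<in> Linf_into X (range (\<lambda>i. axis i 1))" "\<And>n x. ph n x \<in> range (\<lambda>i. axis i 1)"
  "weakly_star_Linf X ph (\<lambda>x. t)"
  "H_converges X (\<lambda>n x. \<Sum>i\<in>UNIV. (ph n x $ i) *\<^sub>R P i) (\<lambda>x. laminate_matrix P lam t e)"
proof -
 interpret laminate_phases P lam t e \<alpha> by fact
 obtain lo where lo: "\<And>i. 0 \<le> lo i" "\<And>i. lo i + t $ i \<le> 1"
  "\<And>r. 0 < r ==> r \<le> 1 ==> \<exists>i. \<forall>j. (lo j < r \<and> r \<le> lo j + t $ j) \<longleftrightarrow> j = i"
  using periodic_selector[OF t] by blast
 define ch where "ch i r = (if lo i < r \<and> r \<le> lo i + t $ i then 1 else 0 :: real)" for i r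
 define \<xi> where "\<xi> n i y = ch i (upper_frac (real (Suc n) * y)) - t $ i" for n :: nat and i y
 define g where "g b y = min (upper_frac y) b - b * upper_frac y" for b y
 \<comment> \<open>The difference of two cell primitives is bounded by 1; dividing by the frequency
   makes the primitive of order 1 / n.\<close>
 define h where "h n i y = (g (lo i + t $ i) (real (Suc n) * y) + (-1) * g (lo i) (real (Suc n) * y)) / real (Suc n)" for n :: nat and i y
 obtain S where S: "S > 0" "\<And>x. x \<in> X ==> \<bar>x \<bullet> e\<bar> \<le> S" using inner_bound e by metis
 have sp: "smooth_pair S (\<xi> n i) (h n i)" for n i
 proof -
  have "smooth_pair (real (Suc n) * S)
   (\<lambda>y. ((if upper_frac y \<le> lo i + t $ i then 1 else 0) - (lo i + t $ i)) + (-1) * ((if upper_frac y \<le> lo i then 1 else 0) - lo i))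
   (\<lambda>y. g (lo i + t $ i) y + (-1) * g (lo i) y)"
   unfolding g_def using lo(1,2)[of i] t0[of i] by (intro smooth_pair_add smooth_pair_cmult smooth_pair_cell) auto
  moreover have "((if upper_frac y \<le> lo i + t $ i then 1 else 0) - (lo i + t $ i)) + (-1) * ((if upper_frac y \<le> lo i then 1 else 0) - lo i) = ch i (upper_frac y) - t $ i" for y
   using t0[of i] by (auto simp: ch_def)
  ultimately have "smooth_pair (real (Suc n) * S) (\<lambda>y. ch i (upper_frac y) - t $ i) (\<lambda>y. g (lo i + t $ i) y + (-1) * g (lo i) y)" by (simp only:)
  from smooth_pair_scale[OF this] show ?thesis unfolding \<xi>_def h_def by simp
 qed
 have gb: "0 \<le> g b y \<and> g b y \<le> 1" if "0 \<le> b" "b \<le> 1" for b y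
 proof -
  have r: "0 \<le> upper_frac y" "upper_frac y \<le> 1" using upper_frac_bounds[of y] by auto
  have "b * upper_frac y \<le> upper_frac y" "b * upper_frac y \<le> b" "0 \<le> b * upper_frac y"
   using r that by (auto intro: mult_left_le mult_left_le_one_le)
  then show ?thesis using r that unfolding g_def min_def by (cases "upper_frac y \<le> b"; simp only: if_True if_False; linarith)
 qed
 have hb: "\<bar>h n i y\<bar> \<le> 1 / real (Suc n)" for n i y
 proof -
  have "\<bar>g (lo i + t $ i) (real (Suc n) * y) + (-1) * g (lo i) (real (Suc n) * y)\<bar> \<le> 1"
   using gb[of "lo i + t $ i" "real (Suc n) * y"] gb[of "lo i" "real (Suc n) * y"] lo(1,2)[of i] t0[of i] by auto
  then show ?thesis unfolding h_def abs_divide abs_of_nat by (intro divide_right_mono) auto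
 qed
 have xb: "\<bar>\<xi> n i y\<bar> \<le> 1" for n i y using t0[of i] t1[of i] by (auto simp: \<xi>_def ch_def)
 have eps: "(\<lambda>n. 1 / real (Suc n)) \<longlonglongrightarrow> 0" by (rule LIMSEQ_Suc[OF lim_1_over_n])
 note om = oscillation_measurable[OF sp S(2)]
 have wstar: "(\<lambda>n. LINT x|LM. \<xi> n i (x \<bullet> e) * f x) \<longlonglongrightarrow> 0" if "integrable LM f" for i f
  by (rule oscillation_weak_star[OF sp S(2) e hb eps xb that])
 define ph where "ph n x = (\<chi> i. ch i (upper_frac (real (Suc n) * (x \<bullet> e))))" for n x
 have chx: "ph n x $ i = \<xi> n i (x \<bullet> e) + t $ i" for n x i by (simp add: ph_def \<xi>_def)
 \<comment> \<open>Exactly one phase is present at every point, not merely almost everywhere;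
   \<open>pointwise\<close> needs a definite j, and \<open>laminate_in_composites\<close> a definite
   rotation.\<close>
 have ex: "\<exists>j. \<forall>i. ph n x $ i = (if i = j then 1 else 0)" for n x
 proof -
  obtain j where j: "\<And>i. (lo i < upper_frac (real (Suc n) * (x \<bullet> e)) \<and> upper_frac (real (Suc n) * (x \<bullet> e)) \<le> lo i + t $ i) \<longleftrightarrow> i = j"
   using lo(3)[OF upper_frac_bounds] by blast
  show ?thesis unfolding ph_def ch_def vec_lambda_beta j by blast
 qed
 have r: "ph n x \<in> range (\<lambda>i. axis i 1)" for n x
 proof -
  obtain j where "\<forall>i. ph n x $ i = (if i = j then 1 else 0)" using ex by blast
  then have "ph n x = axis j 1" by (simp add: vec_eq_iff axis_def)
  then show ?thesis by blast
 qed
 have cim: "(\<lambda>x. ph n x $ i) \<in> borel_measurable LM" for n i unfolding chx using om(2) by measurable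
 have cm: "ph n \<in> borel_measurable LM" for n
 proof -
  have "ph n = (\<lambda>x. \<Sum>i\<in>UNIV. (ph n x $ i) *\<^sub>R axis i 1)"
   by (simp add: scalar_mult_eq_scaleR[symmetric] basis_expansion)
  moreover have "(\<lambda>x. \<Sum>i\<in>UNIV. (ph n x $ i) *\<^sub>R axis i (1::real)) \<in> borel_measurable LM"
   by (rule measurable_combination[OF cim])
  ultimately show ?thesis by simp
 qed
 have cn: "norm (ph n x) \<le> 1" for n x using r[of n x] by auto
 have cL: "ph n \<in> Linf X" for n unfolding Linf_def using cm cn by (auto intro!: exI[of _ 1])
 have L1: "weakly_star_Linf X ph (\<lambda>x. t)"
  unfolding weakly_star_Linf_def
 proof (intro conjI allI ballI cL)
  show "(\<lambda>x. t) \<in> Linf X" by (auto simp: Linf_def intro!: exI[of _ "norm t"])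
  fix f :: "real^'d \<Rightarrow> real^'N" assume "f \<in> L1 X"
  then have f: "integrable LM f" by (simp add: L1_def)
  have fi: "integrable LM (\<lambda>x. f x $ i)" for i
  proof (rule L1_bound[OF f])
   show "(\<lambda>x. f x $ i) \<in> borel_measurable LM" unfolding cart_eq_inner_axis using f by measurable
  qed (intro AE_I2, simp add: component_le_norm_cart)
  have xfi: "integrable LM (\<lambda>x. \<xi> n i (x \<bullet> e) * f x $ i)" for n i
   by (rule L1_bound[OF fi[of i]])
    (use om(2) xb fi[of i] in \<open>auto simp: abs_mult intro!: AE_I2 mult_left_le_one_le borel_measurable_times borel_measurable_integrable\<close>)
  have "(LINT x|LM. ph n x \<bullet> f x) = (\<Sum>i\<in>UNIV. LINT x|LM. \<xi> n i (x \<bullet> e) * f x $ i) + (LINT x|LM. t \<bullet> f x)" for n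
  proof -
   have "(LINT x|LM. ph n x \<bullet> f x) = (LINT x|LM. (\<Sum>i\<in>UNIV. \<xi> n i (x \<bullet> e) * f x $ i) + t \<bullet> f x)"
    by (simp add: inner_vec_def chx distrib_right sum.distrib)
   also have "\<dots> = (LINT x|LM. (\<Sum>i\<in>UNIV. \<xi> n i (x \<bullet> e) * f x $ i)) + (LINT x|LM. t \<bullet> f x)"
    by (rule lint_add) (use xfi f in auto)
   also have "(LINT x|LM. (\<Sum>i\<in>UNIV. \<xi> n i (x \<bullet> e) * f x $ i)) = (\<Sum>i\<in>UNIV. LINT x|LM. \<xi> n i (x \<bullet> e) * f x $ i)"
    by (rule lint_sum) (rule xfi)
   finally show ?thesis .
  qed
  moreover have "(\<lambda>n. (\<Sum>i\<in>UNIV. LINT x|LM. \<xi> n i (x \<bullet> e) * f x $ i) + (LINT x|LM. t \<bullet> f x)) \<longlonglongrightarrow> (\<Sum>i\<in>(UNIV::'N set). 0) + (LINT x|LM. t \<bullet> f x)"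
   by (intro tendsto_intros wstar fi)
  ultimately show "(\<lambda>n. LINT x|LM. ph n x \<bullet> f x) \<longlonglongrightarrow> (LINT x|LM. t \<bullet> f x)" by simp
 qed
 define A where "A n x = (\<Sum>i\<in>UNIV. (ph n x $ i) *\<^sub>R P i)" for n x
 define C where "C = (\<Sum>i\<in>UNIV. norm (P i)) + norm B + 1"
 have Aj: "\<exists>j. A n x = P j \<and> (\<forall>i. ph n x $ i = (if i = j then 1 else 0))" for n x
 proof -
  obtain j where j: "\<forall>i. ph n x $ i = (if i = j then 1 else 0)" using ex by blast
  then have "A n x = P j" unfolding A_def by (simp add: if_distrib[of "\<lambda>x. x *\<^sub>R _"] cong: if_cong)
  then show ?thesis using j by blast
 qed
 have PC: "norm (P j) \<le> C" for j
  using member_le_sum[of j UNIV "\<lambda>i. norm (P i)"] unfolding C_def by (simp add: add_increasing2)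
 have C0: "C > 0" unfolding C_def by (simp add: add_nonneg_pos sum_nonneg)
 have BC: "norm B \<le> C" unfolding C_def by (simp add: sum_nonneg)
 have AC: "norm (A n x) \<le> C" for n x using Aj[of n x] PC by auto
 have Am: "A n \<in> borel_measurable LM" for n unfolding A_def by (rule measurable_combination[OF cim])
 have AL: "A n \<in> Linf X" for n unfolding Linf_def using Am AC by (auto intro!: exI[of _ C])
 have Alow: "\<alpha> * (norm v)^2 \<le> v \<bullet> (A n x *v v)" for n x v using Aj[of n x] P_low by auto
 \<comment> \<open>A coercivity constant shared by the phases and the limit, since
   \<open>H_converges\<close> asks for one class containing all of them.\<close>
 define \<beta> where "\<beta> = min (1 / s) \<alpha>"
 have \<beta>: "\<beta> > 0" using s_pos \<alpha> by (simp add: \<beta>_def)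
 have Bell: "sym_elliptic \<beta> (\<lambda>x. B)"
  unfolding sym_elliptic_def using \<beta> B_sym B_low by (auto simp: Linf_def \<beta>_def)
 have BL: "(\<lambda>x. B) \<in> Linf X" using Bell by (simp add: sym_elliptic_def)
 have Alow': "\<beta> * (norm v)^2 \<le> v \<bullet> (A n x *v v)" for n x v
  by (rule order_trans[OF mult_right_mono Alow]) (auto simp: \<beta>_def)
 have H: "H_converges X A (\<lambda>x. B)"
  unfolding H_converges_def
 proof (intro conjI ballI allI impI)
  show "\<exists>\<alpha>>0. \<exists>\<beta>>0. (\<forall>n. A n \<in> coeff_class X \<alpha> \<beta>) \<and> (\<lambda>x. B) \<in> coeff_class X \<alpha> \<beta>"
   by (rule exI[of _ \<beta>], rule conjI[OF \<beta>], rule exI[of _ "C^2 / \<beta>"])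
    (use \<beta> C0 AL BL Alow' B_low BC AC in \<open>auto intro!: coeff_class_I simp: \<beta>_def[symmetric]\<close>)
  fix l u G assume l: "l \<in> H_minus_1 X" and sol: "\<forall>n. dirichlet_solution X (A n) l (u n) (G n)"
  have u: "h10 (u n) (G n)" and div: "\<And>\<phi>. \<phi> \<in> test ==> (LINT x|LM. (A n x *v G n x) \<bullet> grad \<phi> x) = l \<phi>" for n
   using sol by (auto simp: dirichlet_solution_iff neg_div_eq_def)
  obtain W where W: "W \<in> L2 X" "\<And>\<phi>. \<phi> \<in> test ==> l \<phi> = (LINT x|LM. W x \<bullet> grad \<phi> x)" using H_minus_1_riesz[OF l] by blast
  obtain v F where solB: "dirichlet_solution X (\<lambda>x. B) l v F" using dirichlet_exists[OF Bell l] by blast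
  have v: "h10 v F" and divB: "\<And>\<phi>. \<phi> \<in> test ==> (LINT x|LM. (B *v F x) \<bullet> grad \<phi> x) = l \<phi>"
   using solB by (auto simp: dirichlet_solution_iff neg_div_eq_def)
  note GL = h10_L2(2)[OF u] and FL = h10_L2(2)[OF v] and uL = h10_L2(1)[OF u]
  define K where "K = l2norm X W / \<alpha>"
  have GK: "l2norm X (G n) \<le> K" for n
   unfolding K_def by (rule energy_bound[OF AL \<alpha> _ u _ W(1)]) (use Alow div W(2) in auto)
  obtain Cp where Cp: "Cp > 0" "\<And>u G. h10 u G ==> l2norm X u \<le> Cp * l2norm X G" using h10_poincare by blast
  have uK: "l2norm X (u n) \<le> Cp * K" for n
   using Cp(2)[OF u[of n]] mult_left_mono[OF GK[of n], of Cp] Cp(1) by linarith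
  define \<sigma> where "\<sigma> n x = A n x *v G n x" for n x
  have \<sigma>L: "\<sigma> n \<in> L2 X" for n unfolding \<sigma>_def by (rule Linf_L2_matrix_vector[OF AL GL])
  have \<sigma>K: "l2norm X (\<sigma> n) \<le> C * K" for n
  proof -
   have "l2norm X (\<sigma> n) \<le> l2norm X (\<lambda>x. C *\<^sub>R G n x)"
    by (rule l2norm_mono[OF \<sigma>L L2_scaleR[OF GL]])
     (use C0 AC in \<open>auto simp: \<sigma>_def intro!: AE_I2 order_trans[OF norm_matrix_vector_le] mult_right_mono\<close>)
   also have "\<dots> \<le> C * K" unfolding l2norm_scaleR using C0 GK by (simp add: mult_left_mono)
   finally show ?thesis .
  qed
  \<comment> \<open>Both terms of the curl identity carry the primitive of order 1 / n and are
    otherwise bounded by the uniform energy estimates \<open>GK\<close> and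
    \<open>uK\<close>.\<close>
  have curl0: "(\<lambda>n. LINT x|LM. \<xi> n i (x \<bullet> e) * ((G n x \<bullet> \<tau>) * \<phi> x)) \<longlonglongrightarrow> 0" if \<tau>: "\<tau> \<bullet> e = 0" and t: "\<phi> \<in> test" for i \<tau> \<phi>
  proof -
   note t1 = test_dir_deriv[OF t, of \<tau>]
   note t2 = test_dir_deriv[OF t1, of e]
   let ?a = "l2norm X (\<lambda>x. grad \<phi> x \<bullet> \<tau>)" and ?b = "l2norm X (\<lambda>x. grad (\<lambda>x. grad \<phi> x \<bullet> \<tau>) x \<bullet> e)"
   define M where "M = K * ?a + Cp * K * ?b"
   have "\<bar>LINT x|LM. \<xi> n i (x \<bullet> e) * ((G n x \<bullet> \<tau>) * \<phi> x)\<bar> \<le> 1 / real (Suc n) * M" for n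
   proof -
    have GeL: "(\<lambda>x. G n x \<bullet> e) \<in> L2 X" by (rule L2_inner_const[OF GL])
    have Ge: "l2norm X (\<lambda>x. G n x \<bullet> e) \<le> K"
     by (rule order_trans[OF l2norm_mono[OF GeL GL] GK]) (use Cauchy_Schwarz_ineq2[of _ e] e in auto)
    have "\<bar>LINT x|LM. h n i (x \<bullet> e) * ((G n x \<bullet> e) * (grad \<phi> x \<bullet> \<tau>))\<bar> \<le> 1 / real (Suc n) * (LINT x|LM. \<bar>(G n x \<bullet> e) * (grad \<phi> x \<bullet> \<tau>)\<bar>)"
     by (rule integral_bounded_factor_le[OF L2_mult_integrable[OF GeL test_L2[OF t1]] om(1) hb])
    also have "\<dots> \<le> 1 / real (Suc n) * (K * ?a)"
     by (intro mult_left_mono order_trans[OF integral_abs_mult_le[OF GeL test_L2[OF t1]]] mult_right_mono Ge) auto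
    finally have 1: "\<bar>LINT x|LM. h n i (x \<bullet> e) * ((G n x \<bullet> e) * (grad \<phi> x \<bullet> \<tau>))\<bar> \<le> 1 / real (Suc n) * (K * ?a)" .
    have "\<bar>LINT x|LM. h n i (x \<bullet> e) * (u n x * (grad (\<lambda>x. grad \<phi> x \<bullet> \<tau>) x \<bullet> e))\<bar> \<le> 1 / real (Suc n) * (LINT x|LM. \<bar>u n x * (grad (\<lambda>x. grad \<phi> x \<bullet> \<tau>) x \<bullet> e)\<bar>)"
     by (rule integral_bounded_factor_le[OF L2_mult_integrable[OF uL test_L2[OF t2]] om(1) hb])
    also have "\<dots> \<le> 1 / real (Suc n) * (Cp * K * ?b)"
     by (intro mult_left_mono order_trans[OF integral_abs_mult_le[OF uL test_L2[OF t2]]] mult_right_mono uK) auto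
    finally have 2: "\<bar>LINT x|LM. h n i (x \<bullet> e) * (u n x * (grad (\<lambda>x. grad \<phi> x \<bullet> \<tau>) x \<bullet> e))\<bar> \<le> 1 / real (Suc n) * (Cp * K * ?b)" .
    have eq: "(LINT x|LM. \<xi> n i (x \<bullet> e) * ((G n x \<bullet> \<tau>) * \<phi> x)) =
     (LINT x|LM. h n i (x \<bullet> e) * ((G n x \<bullet> e) * (grad \<phi> x \<bullet> \<tau>))) + (LINT x|LM. h n i (x \<bullet> e) * (u n x * (grad (\<lambda>x. grad \<phi> x \<bullet> \<tau>) x \<bullet> e)))"
     by (rule oscillation_curl[OF sp S(2) h10_weak_gradient[OF u] \<tau> e t])
    show ?thesis
     unfolding eq M_def distrib_left
     by (rule order_trans[OF abs_triangle_ineq add_mono[OF 1 2]])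
   qed
   then have le: "norm (LINT x|LM. \<xi> n i (x \<bullet> e) * ((G n x \<bullet> \<tau>) * \<phi> x)) \<le> 1 / real (Suc n) * M" for n by simp
   have "(\<lambda>n. 1 / real (Suc n) * M) \<longlonglongrightarrow> 0 * M" by (intro tendsto_intros eps)
   then have z: "(\<lambda>n. 1 / real (Suc n) * M) \<longlonglongrightarrow> 0" by simp
   show ?thesis by (rule Lim_null_comparison[OF always_eventually z]) (use le in blast)
  qed
  \<comment> \<open>The flux becomes divergence-free only after subtracting the fixed field W that
    represents the load; the part with W tends to 0 because the phases converge weakly-star.\<close>
  have div0: "(\<lambda>n. LINT x|LM. \<xi> n i (x \<bullet> e) * ((\<sigma> n x \<bullet> e) * \<phi> x)) \<longlonglongrightarrow> 0" if t: "\<phi> \<in> test" for i \<phi>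
  proof -
   define M where "M = (C * K + l2norm X W) * l2norm X (grad \<phi>)"
   have dL: "(\<lambda>x. \<sigma> n x - W x) \<in> L2 X" for n using \<sigma>L W(1) by auto
   have le: "norm (LINT x|LM. \<xi> n i (x \<bullet> e) * (((\<sigma> n x - W x) \<bullet> e) * \<phi> x)) \<le> 1 / real (Suc n) * M" for n
   proof -
    have o: "(LINT x|LM. (\<sigma> n x - W x) \<bullet> grad \<phi> x) = 0" if "\<phi> \<in> test" for \<phi>
     using div[OF that, of n] W(2)[OF that] L2_inner_integrable[OF \<sigma>L grad_test_L2[OF that], of n] L2_inner_integrable[OF W(1) grad_test_L2[OF that]]
     by (simp add: \<sigma>_def inner_diff_left)
    have "\<bar>LINT x|LM. h n i (x \<bullet> e) * ((\<sigma> n x - W x) \<bullet> grad \<phi> x)\<bar> \<le> 1 / real (Suc n) * (LINT x|LM. \<bar>(\<sigma> n x - W x) \<bullet> grad \<phi> x\<bar>)"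
     by (rule integral_bounded_factor_le[OF L2_inner_integrable[OF dL grad_test_L2[OF t]] om(1) hb])
    also have "\<dots> \<le> 1 / real (Suc n) * M" unfolding M_def
    proof (intro mult_left_mono order_trans[OF integral_abs_inner_le[OF dL grad_test_L2[OF t]]] mult_right_mono)
     show "l2norm X (\<lambda>x. \<sigma> n x - W x) \<le> C * K + l2norm X W"
      using l2norm_triangle_diff[OF \<sigma>L L2_zero W(1), of n] \<sigma>K[of n] by (simp add: l2norm_minus)
    qed auto
    finally have "\<bar>LINT x|LM. h n i (x \<bullet> e) * ((\<sigma> n x - W x) \<bullet> grad \<phi> x)\<bar> \<le> 1 / real (Suc n) * M" .
    moreover have "(LINT x|LM. \<xi> n i (x \<bullet> e) * (((\<sigma> n x - W x) \<bullet> e) * \<phi> x)) = - (LINT x|LM. h n i (x \<bullet> e) * ((\<sigma> n x - W x) \<bullet> grad \<phi> x))"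
     by (rule oscillation_div[OF sp S(2) dL o t])
    ultimately show ?thesis unfolding real_norm_def by (simp only: abs_minus_cancel)
   qed
   have "(\<lambda>n. 1 / real (Suc n) * M) \<longlonglongrightarrow> 0 * M" by (intro tendsto_intros eps)
   then have z: "(\<lambda>n. 1 / real (Suc n) * M) \<longlonglongrightarrow> 0" by simp
   have 1: "(\<lambda>n. LINT x|LM. \<xi> n i (x \<bullet> e) * (((\<sigma> n x - W x) \<bullet> e) * \<phi> x)) \<longlonglongrightarrow> 0"
    by (rule Lim_null_comparison[OF always_eventually z]) (use le in blast)
   have Wi: "integrable LM (\<lambda>x. (W x \<bullet> e) * \<phi> x)" by (rule L2_mult_integrable[OF L2_inner_const[OF W(1)] test_L2[OF t]])
   have xi: "integrable LM (\<lambda>x. \<xi> n i (x \<bullet> e) * f x)" if "integrable LM f" for n f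
    by (rule L1_bound[OF that])
     (use om(2) xb that in \<open>auto simp: abs_mult intro!: AE_I2 mult_left_le_one_le\<close>)
   have "(LINT x|LM. \<xi> n i (x \<bullet> e) * ((\<sigma> n x \<bullet> e) * \<phi> x)) = (LINT x|LM. \<xi> n i (x \<bullet> e) * (((\<sigma> n x - W x) \<bullet> e) * \<phi> x)) + (LINT x|LM. \<xi> n i (x \<bullet> e) * ((W x \<bullet> e) * \<phi> x))" for n
    using xi[OF Wi, of n] xi[OF L2_mult_integrable[OF L2_inner_const[OF dL] test_L2[OF t]], of n n]
    by (subst lint_add[symmetric]) (auto simp: inner_diff_left algebra_simps)
   then show ?thesis using tendsto_add[OF 1 wstar[OF Wi]] by simp
  qed
  have xiL: "(\<lambda>x. \<xi> n i (x \<bullet> e) * f x) \<in> L2 X" if "f \<in> L2 X" for n i and f :: "real^'d \<Rightarrow> real"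
   using L2_bounded_mult[OF om(2) _ that, of n i 1] xb by simp
  \<comment> \<open>The pointwise identity times a test function, summed over the phases: every term
    is covered by \<open>curl0\<close> or \<open>div0\<close>.\<close>
  have main: "(\<lambda>n. LINT x|LM. (\<sigma> n x \<bullet> c - G n x \<bullet> (B *v c)) * \<phi> x) \<longlonglongrightarrow> 0" if t: "\<phi> \<in> test" for c \<phi>
  proof -
   let ?\<tau> = "\<lambda>i. P i *v (c - (c \<bullet> e) *\<^sub>R e)"
   have pw: "(\<sigma> n x \<bullet> c - G n x \<bullet> (B *v c)) * \<phi> x =
    (\<Sum>i\<in>UNIV. \<xi> n i (x \<bullet> e) * ((G n x \<bullet> ?\<tau> i) * \<phi> x) - (c \<bullet> e) / s / lam i * (\<xi> n i (x \<bullet> e) * ((\<sigma> n x \<bullet> e) * \<phi> x)))" for n x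
   proof -
    obtain j where j: "A n x = P j" "\<forall>i. ph n x $ i = (if i = j then 1 else 0)" using Aj by blast
    have "\<sigma> n x \<bullet> c - G n x \<bullet> (B *v c) = (\<Sum>i\<in>UNIV. (ph n x $ i - t $ i) * (G n x \<bullet> ?\<tau> i)) -
      (\<Sum>i\<in>UNIV. (ph n x $ i - t $ i) / lam i) * (\<sigma> n x \<bullet> e) * (c \<bullet> e) / s"
     unfolding \<sigma>_def j(1) by (rule pointwise) (use j(2) in blast)
    then have "\<sigma> n x \<bullet> c - G n x \<bullet> (B *v c) = (\<Sum>i\<in>UNIV. \<xi> n i (x \<bullet> e) * (G n x \<bullet> ?\<tau> i)) -
      (\<Sum>i\<in>UNIV. \<xi> n i (x \<bullet> e) / lam i) * (\<sigma> n x \<bullet> e) * (c \<bullet> e) / s" by (simp add: chx)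
    moreover have "(\<Sum>i\<in>UNIV. \<xi> n i (x \<bullet> e) * ((G n x \<bullet> ?\<tau> i) * \<phi> x)) = (\<Sum>i\<in>UNIV. \<xi> n i (x \<bullet> e) * (G n x \<bullet> ?\<tau> i)) * \<phi> x"
     by (simp add: sum_distrib_right mult.assoc)
    moreover have "(\<Sum>i\<in>UNIV. (c \<bullet> e) / s / lam i * (\<xi> n i (x \<bullet> e) * ((\<sigma> n x \<bullet> e) * \<phi> x))) = (\<Sum>i\<in>UNIV. \<xi> n i (x \<bullet> e) / lam i) * ((\<sigma> n x \<bullet> e) * (c \<bullet> e) / s * \<phi> x)"
     unfolding sum_distrib_right by (intro sum.cong refl) (simp add: mult_ac)
    ultimately show ?thesis by (simp add: sum_subtractf left_diff_distrib right_diff_distrib mult_ac)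
   qed
   have i1: "integrable LM (\<lambda>x. \<xi> n i (x \<bullet> e) * ((G n x \<bullet> ?\<tau> i) * \<phi> x))" for n i
    using L2_mult_integrable[OF xiL[OF L2_inner_const[OF GL]] test_L2[OF t]] by (simp add: mult.assoc)
   have i2: "integrable LM (\<lambda>x. \<xi> n i (x \<bullet> e) * ((\<sigma> n x \<bullet> e) * \<phi> x))" for n i
    using L2_mult_integrable[OF xiL[OF L2_inner_const[OF \<sigma>L]] test_L2[OF t]] by (simp add: mult.assoc)
   have "(LINT x|LM. (\<sigma> n x \<bullet> c - G n x \<bullet> (B *v c)) * \<phi> x) =
    (\<Sum>i\<in>UNIV. (LINT x|LM. \<xi> n i (x \<bullet> e) * ((G n x \<bullet> ?\<tau> i) * \<phi> x)) - (c \<bullet> e) / s / lam i * (LINT x|LM. \<xi> n i (x \<bullet> e) * ((\<sigma> n x \<bullet> e) * \<phi> x)))" for n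
    unfolding pw using i1[of n] i2[of n] by (subst lint_sum) auto
   moreover have "(\<lambda>n. \<Sum>i\<in>UNIV. (LINT x|LM. \<xi> n i (x \<bullet> e) * ((G n x \<bullet> ?\<tau> i) * \<phi> x)) - (c \<bullet> e) / s / lam i * (LINT x|LM. \<xi> n i (x \<bullet> e) * ((\<sigma> n x \<bullet> e) * \<phi> x)))
     \<longlonglongrightarrow> (\<Sum>i\<in>(UNIV::'N set). 0 - (c \<bullet> e) / s / lam i * 0)"
    by (intro tendsto_intros curl0 div0 t P_orth)
   ultimately show ?thesis by simp
  qed
  \<comment> \<open>Expanding the test gradient in coordinates reduces to \<open>main\<close>. The
    flux term equals l \<psi> for every n, and the limit problem has the same load.\<close>
  have lim: "(\<lambda>n. LINT x|LM. (G n x - F x) \<bullet> (B *v grad \<psi> x)) \<longlonglongrightarrow> 0" if t: "\<psi> \<in> test" for \<psi>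
  proof -
   note gL = grad_test_L2[OF t]
   have BgL: "(\<lambda>x. B *v grad \<psi> x) \<in> L2 X" by (rule Linf_L2_matrix_vector[OF BL gL])
   have pw: "\<sigma> n x \<bullet> grad \<psi> x - G n x \<bullet> (B *v grad \<psi> x) = (\<Sum>k\<in>UNIV. (\<sigma> n x \<bullet> axis k 1 - G n x \<bullet> (B *v axis k 1)) * (grad \<psi> x \<bullet> axis k 1))" for n x
   proof -
    have "grad \<psi> x = (\<Sum>k\<in>UNIV. (grad \<psi> x \<bullet> axis k 1) *\<^sub>R axis k 1)"
     by (simp add: inner_axis scalar_mult_eq_scaleR[symmetric] basis_expansion)
    then have "\<sigma> n x \<bullet> grad \<psi> x - G n x \<bullet> (B *v grad \<psi> x) = \<sigma> n x \<bullet> (\<Sum>k\<in>UNIV. (grad \<psi> x \<bullet> axis k 1) *\<^sub>R axis k 1) - G n x \<bullet> (B *v (\<Sum>k\<in>UNIV. (grad \<psi> x \<bullet> axis k 1) *\<^sub>R axis k 1))"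
     by presburger
    also have "\<dots> = (\<Sum>k\<in>UNIV. (\<sigma> n x \<bullet> axis k 1 - G n x \<bullet> (B *v axis k 1)) * (grad \<psi> x \<bullet> axis k 1))"
     by (simp add: inner_sum_right linear_sum[OF matrix_vector_mul_linear] matrix_vector_mult_scaleR sum_subtractf algebra_simps)
    finally show ?thesis .
   qed
   have int: "integrable LM (\<lambda>x. (\<sigma> n x \<bullet> axis k 1 - G n x \<bullet> (B *v axis k 1)) * (grad \<psi> x \<bullet> axis k 1))" for n k
    by (intro L2_mult_integrable L2_diff L2_inner_const \<sigma>L GL gL)
   have "(LINT x|LM. (G n x - F x) \<bullet> (B *v grad \<psi> x)) = - (\<Sum>k\<in>UNIV. LINT x|LM. (\<sigma> n x \<bullet> axis k 1 - G n x \<bullet> (B *v axis k 1)) * (grad \<psi> x \<bullet> axis k 1))" for n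
   proof -
    have "(\<Sum>k\<in>UNIV. LINT x|LM. (\<sigma> n x \<bullet> axis k 1 - G n x \<bullet> (B *v axis k 1)) * (grad \<psi> x \<bullet> axis k 1)) = (LINT x|LM. \<sigma> n x \<bullet> grad \<psi> x - G n x \<bullet> (B *v grad \<psi> x))"
     unfolding pw by (rule lint_sum[symmetric]) (rule int)
    also have "\<dots> = l \<psi> - (LINT x|LM. G n x \<bullet> (B *v grad \<psi> x))"
     using div[OF t, of n] L2_inner_integrable[OF \<sigma>L gL, of n] L2_inner_integrable[OF GL BgL, of n] by (simp add: \<sigma>_def)
    also have "l \<psi> = (LINT x|LM. F x \<bullet> (B *v grad \<psi> x))"
     using divB[OF t] by (simp add: symmetric_inner[OF B_sym])
    finally show ?thesis
     using L2_inner_integrable[OF GL BgL, of n] L2_inner_integrable[OF FL BgL] by (simp add: inner_diff_left)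
   qed
   moreover have "(\<lambda>n. - (\<Sum>k\<in>UNIV. LINT x|LM. (\<sigma> n x \<bullet> axis k 1 - G n x \<bullet> (B *v axis k 1)) * (grad \<psi> x \<bullet> axis k 1))) \<longlonglongrightarrow> - (\<Sum>k\<in>(UNIV::'d set). 0)"
    by (intro tendsto_intros main test_dir_deriv t)
   ultimately show ?thesis by simp
  qed
  have weak1: "weakly_L2 X u v" by (rule H_limit_weak(1)[OF Bell u GK v lim])
  have weak2: "weakly_L2 X G F" by (rule H_limit_weak(2)[OF Bell u GK v lim])
  have BF: "(\<lambda>x. B *v F x) \<in> L2 X" by (rule Linf_L2_matrix_vector[OF BL FL])
  \<comment> \<open>With the weak limit of the gradients known, \<open>main\<close> becomes a
    statement about the fluxes alone.\<close>
  have flux: "weakly_L2 X \<sigma> (\<lambda>x. B *v F x)"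
  proof (rule weakly_L2_I[OF \<sigma>L BF])
   fix f :: "real^'d \<Rightarrow> real^'d" assume f: "f \<in> L2 X"
   show "(\<lambda>n. LINT x|LM. (\<sigma> n x - B *v F x) \<bullet> f x) \<longlonglongrightarrow> 0"
   proof (rule weak_limit_from_test[OF L2_diff[OF \<sigma>L BF] _ f])
    show "l2norm X (\<lambda>x. \<sigma> n x - B *v F x) \<le> C * K + l2norm X (\<lambda>x. B *v F x)" for n
     using l2norm_triangle_diff[OF \<sigma>L L2_zero BF, of n] \<sigma>K[of n] by (simp add: l2norm_minus)
    fix \<phi> i assume t: "\<phi> \<in> test"
    let ?c = "axis i 1 :: real^'d"
    have cL: "(\<lambda>x. \<phi> x *\<^sub>R (B *v ?c)) \<in> L2 X"
     by (rule L2_bound[OF _ L2_scaleR[OF test_L2[OF t], of "norm (B *v ?c)"]]) (use L2_D(1)[OF test_L2[OF t]] in \<open>auto simp: mult.commute\<close>)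
    have w: "(\<lambda>n. LINT x|LM. G n x \<bullet> (\<phi> x *\<^sub>R (B *v ?c))) \<longlonglongrightarrow> (LINT x|LM. F x \<bullet> (\<phi> x *\<^sub>R (B *v ?c)))"
     by (rule weak2[unfolded weakly_L2_def, THEN conjunct2, THEN conjunct2, rule_format, OF cL])
    have "(LINT x|LM. ((\<sigma> n x - B *v F x) \<bullet> ?c) * \<phi> x) = (LINT x|LM. (\<sigma> n x \<bullet> ?c - G n x \<bullet> (B *v ?c)) * \<phi> x) + ((LINT x|LM. G n x \<bullet> (\<phi> x *\<^sub>R (B *v ?c))) - (LINT x|LM. F x \<bullet> (\<phi> x *\<^sub>R (B *v ?c))))" for n
    proof -
     have i: "integrable LM (\<lambda>x. (\<sigma> n x \<bullet> ?c - G n x \<bullet> (B *v ?c)) * \<phi> x)"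
      by (intro L2_mult_integrable L2_diff L2_inner_const \<sigma>L GL test_L2 t)
     have "((\<sigma> n x - B *v F x) \<bullet> ?c) * \<phi> x = (\<sigma> n x \<bullet> ?c - G n x \<bullet> (B *v ?c)) * \<phi> x + (G n x \<bullet> (\<phi> x *\<^sub>R (B *v ?c)) - F x \<bullet> (\<phi> x *\<^sub>R (B *v ?c)))" for x
      by (simp add: inner_diff_left symmetric_inner[OF B_sym] algebra_simps)
     then show ?thesis using i L2_inner_integrable[OF GL cL, of n] L2_inner_integrable[OF FL cL] by simp
    qed
    moreover have "(\<lambda>n. (LINT x|LM. (\<sigma> n x \<bullet> ?c - G n x \<bullet> (B *v ?c)) * \<phi> x) + ((LINT x|LM. G n x \<bullet> (\<phi> x *\<^sub>R (B *v ?c))) - (LINT x|LM. F x \<bullet> (\<phi> x *\<^sub>R (B *v ?c))))) \<longlonglongrightarrow>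
      0 + ((LINT x|LM. F x \<bullet> (\<phi> x *\<^sub>R (B *v ?c))) - (LINT x|LM. F x \<bullet> (\<phi> x *\<^sub>R (B *v ?c))))"
     by (intro tendsto_intros main t w)
    ultimately show "(\<lambda>n. LINT x|LM. ((\<sigma> n x - B *v F x) \<bullet> ?c) * \<phi> x) \<longlonglongrightarrow> 0" by simp
   qed
  qed
  show "\<exists>v F. dirichlet_solution X (\<lambda>x. B) l v F \<and> weakly_L2 X u v \<and> weakly_L2 X G F \<and>
      weakly_L2 X (\<lambda>n x. A n x *v G n x) (\<lambda>x. B *v F x)"
   using solB weak1 weak2 flux unfolding \<sigma>_def by blast
 qed
 show thesis
  by (rule that[of ph]) (use cL r L1 H in \<open>auto simp: Linf_into_def A_def[abs_def] B_def[symmetric]\<close>)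
qed

end

section \<open>Composite materials\<close>

lemma symmetric_min_eigenvector:
 fixes M :: "real^'d::finite^'d"
 assumes sym: "transpose M = M"
 obtains v c where "eigenvector M v c" "\<And>w. c * (norm w)^2 \<le> w \<bullet> (M *v w)"
proof -
 let ?S = "sphere (0::real^'d) 1"
 have "axis undefined 1 \<in> ?S" by simp
 then have ne: "?S \<noteq> {}" by blast
 have cont: "continuous_on ?S (\<lambda>w. w \<bullet> (M *v w))"
  by (intro continuous_intros bounded_linear.continuous_on[OF matrix_vector_mul_bounded_linear])
 obtain v where v: "v \<in> ?S" "\<And>w. w \<in> ?S ==> v \<bullet> (M *v v) \<le> w \<bullet> (M *v w)"
  using continuous_attains_inf[OF compact_sphere ne cont] by blast
 define c where "c = v \<bullet> (M *v v)"
 have nv: "norm v = 1" using v(1) by simp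
 have low: "c * (norm w)^2 \<le> w \<bullet> (M *v w)" for w
 proof (cases "w = 0")
  case False
  have "c \<le> ((1 / norm w) *\<^sub>R w) \<bullet> (M *v ((1 / norm w) *\<^sub>R w))" unfolding c_def by (rule v(2)) (use False in simp)
  also have "\<dots> = (w \<bullet> (M *v w)) / (norm w)^2" by (simp add: matrix_vector_mult_scaleR power2_eq_square)
  finally show ?thesis using False by (simp add: field_simps)
 qed simp
 \<comment> \<open>The residual of the minimizer v of the Rayleigh quotient. It is orthogonal to v,
   and moving along y with a small negative factor would lower the quotient unless y = 0.\<close>
 define y where "y = M *v v - c *\<^sub>R v"
 have vy: "v \<bullet> y = 0" using nv by (simp add: y_def inner_diff_right c_def norm_eq_1)
 have "y = 0"
 proof (rule ccontr)
  assume "y \<noteq> 0"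
  define b where "b = \<bar>y \<bullet> (M *v y) - c * (norm y)^2\<bar> + 1"
  have b: "b > 0" by (simp add: b_def)
  have q: "0 \<le> 2 * s * (norm y)^2 + s^2 * b" for s
  proof -
   have "c * (norm (v + s *\<^sub>R y))^2 \<le> (v + s *\<^sub>R y) \<bullet> (M *v (v + s *\<^sub>R y))" by (rule low)
   moreover have "(norm (v + s *\<^sub>R y))^2 = 1 + s^2 * (norm y)^2" using vy nv by (simp add: norm_add_sq power_mult_distrib)
   moreover have "(v + s *\<^sub>R y) \<bullet> (M *v (v + s *\<^sub>R y)) = c + 2 * s * (norm y)^2 + s^2 * (y \<bullet> (M *v y))"
   proof -
    have My: "y \<bullet> (M *v v) = (norm y)^2"
    proof -
     have "M *v v = y + c *\<^sub>R v" by (simp add: y_def)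
     then show ?thesis using vy by (simp add: inner_add_right inner_commute power2_norm_eq_inner)
    qed
    have "v \<bullet> (M *v y) = y \<bullet> (M *v v)" using symmetric_inner[OF sym, of v y] by (simp add: inner_commute)
    then show ?thesis using My
     by (simp add: matrix_vector_right_distrib matrix_vector_mult_scaleR inner_add c_def power2_eq_square algebra_simps)
   qed
   ultimately have "0 \<le> 2 * s * (norm y)^2 + s^2 * (y \<bullet> (M *v y) - c * (norm y)^2)" by (simp add: algebra_simps)
   moreover have "s^2 * (y \<bullet> (M *v y) - c * (norm y)^2) \<le> s^2 * b" unfolding b_def by (intro mult_left_mono) auto
   ultimately show ?thesis by linarith
  qed
  \<comment> \<open>This s minimizes the quadratic bound \<open>q\<close>; the minimum is - |y|^4 /
    b.\<close>
  have "0 \<le> 2 * (- (norm y)\<^sup>2 / b) * (norm y)\<^sup>2 + (- (norm y)\<^sup>2 / b)\<^sup>2 * b" by (rule q)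
  also have "\<dots> = - ((norm y)\<^sup>2)\<^sup>2 / b" using b by (simp add: field_simps power2_eq_square)
  finally have "((norm y)^2)^2 / b \<le> 0" by simp
  then have "((norm y)^2)^2 \<le> 0" using b by (simp only: divide_le_0_iff) auto
  then show False using \<open>y \<noteq> 0\<close> by simp
 qed
 then have "eigenvector M v c" using nv by (auto simp: eigenvector_def y_def)
 then show thesis using that low by blast
qed

text \<open>Eigenvectors for distinct eigenvalues are orthogonal, and pairwise orthogonal families
  are finite. Finiteness gives the \<open>Min\<close> and \<open>Max\<close> in the definitions of
  the extreme eigenvalues their meaning.\<close>

lemma finite_eigenvalues:
 fixes M :: "real^'d::finite^'d"
 assumes sym: "transpose M = M"
 shows "finite {c. \<exists>v. eigenvector M v c}"
proof -
 obtain f where f: "\<And>c. c \<in> {c. \<exists>v. eigenvector M v c} ==> eigenvector M (f c) c"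
  using bchoice[of "{c. \<exists>v. eigenvector M v c}" "\<lambda>c v. eigenvector M v c"] by blast
 have orth: "f c \<bullet> f d = 0" if "c \<in> {c. \<exists>v. eigenvector M v c}" "d \<in> {c. \<exists>v. eigenvector M v c}" "c \<noteq> d" for c d
 proof -
  have "c * (f c \<bullet> f d) = d * (f c \<bullet> f d)"
   using symmetric_inner[OF sym, of "f c" "f d"] f[OF that(1)] f[OF that(2)] by (simp add: eigenvector_def)
  then show ?thesis using that(3) by simp
 qed
 have inj: "inj_on f {c. \<exists>v. eigenvector M v c}"
 proof (rule inj_onI)
  fix c d assume a: "c \<in> {c. \<exists>v. eigenvector M v c}" "d \<in> {c. \<exists>v. eigenvector M v c}" "f c = f d"
  show "c = d"
  proof (rule ccontr)
   assume "c \<noteq> d"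
   then have "f c \<bullet> f c = 0" using orth[OF a(1,2)] a(3) by simp
   then show False using f[OF a(1)] by (simp add: eigenvector_def)
  qed
 qed
 have "pairwise orthogonal (f ` {c. \<exists>v. eigenvector M v c})"
  by (auto simp: pairwise_def orthogonal_def intro: orth)
 then have "finite (f ` {c. \<exists>v. eigenvector M v c})" by (rule pairwise_orthogonal_imp_finite)
 then show ?thesis using inj by (rule finite_imageD)
qed

lemma lambda_min_props:
 fixes M :: "real^'d::finite^'d"
 assumes sym: "transpose M = M"
 shows "\<exists>v. eigenvector M v (lambda_min M)" "lambda_min M * (norm w)^2 \<le> w \<bullet> (M *v w)"
proof -
 obtain v c where v: "eigenvector M v c" "\<And>w. c * (norm w)^2 \<le> w \<bullet> (M *v w)" using symmetric_min_eigenvector[OF sym] by blast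
 have "lambda_min M = c" unfolding lambda_min_def
 proof (rule Min_eqI[OF finite_eigenvalues[OF sym]])
  fix d assume "d \<in> {c. \<exists>v. eigenvector M v c}"
  then obtain w where w: "w \<noteq> 0" "M *v w = d *\<^sub>R w" by (auto simp: eigenvector_def)
  have "c * (norm w)^2 \<le> d * (norm w)^2" using v(2)[of w] w(2) by (simp add: power2_norm_eq_inner)
  then show "c \<le> d" using w(1) by simp
 qed (use v in blast)
 then show "\<exists>v. eigenvector M v (lambda_min M)" "lambda_min M * (norm w)^2 \<le> w \<bullet> (M *v w)" using v by auto
qed

text \<open>The largest eigenvalue is minus the smallest one of - M.\<close>

lemma lambda_max_upper:
 fixes M :: "real^'d::finite^'d"
 assumes sym: "transpose M = M"
 shows "w \<bullet> (M *v w) \<le> lambda_max M * (norm w)^2"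
proof -
 have neg: "(- M) *v w = - (M *v w)" for w by (simp add: matrix_vector_mult_def vec_eq_iff sum_negf)
 have "transpose (- M) = - M" using sym by (simp add: transpose_def vec_eq_iff)
 then obtain v c where v: "eigenvector (- M) v c" "\<And>w. c * (norm w)\<^sup>2 \<le> w \<bullet> ((- M) *v w)"
  using symmetric_min_eigenvector by blast
 have "lambda_max M = - c" unfolding lambda_max_def
 proof (rule Max_eqI[OF finite_eigenvalues[OF sym]])
  fix d assume "d \<in> {c. \<exists>v. eigenvector M v c}"
  then obtain w where w: "w \<noteq> 0" "M *v w = d *\<^sub>R w" by (auto simp: eigenvector_def)
  have "c * (norm w)\<^sup>2 \<le> - d * (norm w)\<^sup>2" using v(2)[of w] w(2) by (simp add: power2_norm_eq_inner neg)
  then have "(c + d) * (norm w)^2 \<le> 0" by (simp add: algebra_simps)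
  then show "d \<le> - c" using w(1) by (simp add: mult_le_0_iff)
 next
  have "M *v v = - c *\<^sub>R v" using v(1) unfolding eigenvector_def neg by (metis minus_equation_iff scaleR_minus_left)
  then show "- c \<in> {c. \<exists>v. eigenvector M v c}" using v(1) by (auto simp: eigenvector_def)
 qed
 then show ?thesis using v(2)[of w] by (simp add: neg)
qed

lemma lambda_min_pos:
 assumes "transpose M = M" "pos_def M" shows "lambda_min M > 0"
proof -
 obtain v where v: "eigenvector M v (lambda_min M)" using lambda_min_props(1)[OF assms(1)] by blast
 then have "0 < v \<bullet> (M *v v)" using assms(2) by (auto simp: pos_def_def eigenvector_def)
 then have "0 < lambda_min M * (norm v)^2" using v by (simp add: eigenvector_def power2_norm_eq_inner)
 then show ?thesis by (simp add: zero_less_mult_iff)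
qed

lemma lambda_min_le_max:
 assumes "transpose M = M" shows "lambda_min M \<le> lambda_max M"
 using lambda_min_props(2)[OF assms, of "axis undefined 1"] lambda_max_upper[OF assms, of "axis undefined 1"] by simp

lemma rotated_phase:
 fixes Q M :: "real^'d::finite^'d"
 assumes Q: "rotation_matrix Q" and M: "transpose M = M"
 shows "transpose (transpose Q ** M ** Q) = transpose Q ** M ** Q"
  and "v \<bullet> ((transpose Q ** M ** Q) *v v) = (Q *v v) \<bullet> (M *v (Q *v v))"
  and "norm (Q *v v) = norm v"
proof -
 show "transpose (transpose Q ** M ** Q) = transpose Q ** M ** Q"
  using M by (simp add: matrix_transpose_mul transpose_transpose matrix_mul_assoc)
 have "(transpose Q *v w) \<bullet> v = w \<bullet> (Q *v v)" for w
  by (metis dot_lmul_matrix transpose_matrix_vector)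
 then show "v \<bullet> ((transpose Q ** M ** Q) *v v) = (Q *v v) \<bullet> (M *v (Q *v v))"
  by (simp add: matrix_vector_mul_assoc[symmetric] inner_commute)
 have "orthogonal_transformation ((*v) Q)" using Q by (simp add: rotation_matrix_def orthogonal_transformation_matrix)
 then show "norm (Q *v v) = norm v" by (rule orthogonal_transformation_norm)
qed

text \<open>With this vector the reciprocal of \<open>lam_minus\<close> is the linear function t .
  \<open>inv_lam M\<close> of t, which passes to weak-star limits.\<close>

definition inv_lam :: "('N::finite \<Rightarrow> real^'d::finite^'d) \<Rightarrow> real^'N" where
 "inv_lam M = (\<chi> i. 1 / lambda_min (M i))"

lemma lam_minus_eq: "lam_minus M t = 1 / (t \<bullet> inv_lam M)"
 by (simp add: lam_minus_def inner_vec_def inv_lam_def)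

lemma inv_lam_bounds:
 fixes M :: "'N::finite \<Rightarrow> real^'d::finite^'d"
 assumes "\<And>i. lambda_min (M i) > 0"
 obtains k K where "0 < k" "\<And>t. t \<in> proportions ==> k \<le> t \<bullet> inv_lam M" "\<And>t. t \<in> proportions ==> t \<bullet> inv_lam M \<le> K"
proof -
 have pos: "0 < inv_lam M $ i" for i using assms by (simp add: inv_lam_def)
 define k where "k = Min (range (($) (inv_lam M)))"
 define K where "K = Max (range (($) (inv_lam M)))"
 have kK: "k \<le> inv_lam M $ i" "inv_lam M $ i \<le> K" for i unfolding k_def K_def by auto
 have k0: "0 < k" unfolding k_def using pos by (subst Min_gr_iff) auto
 have "k \<le> t \<bullet> inv_lam M \<and> t \<bullet> inv_lam M \<le> K" if "t \<in> proportions" for t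
 proof -
  have t: "\<And>i. 0 \<le> t $ i" "(\<Sum>i\<in>UNIV. t $ i) = 1" using that by (auto simp: proportions_def)
  have "(\<Sum>i\<in>UNIV. t $ i * k) \<le> t \<bullet> inv_lam M" "t \<bullet> inv_lam M \<le> (\<Sum>i\<in>UNIV. t $ i * K)"
   unfolding inner_vec_def inner_real_def by (intro sum_mono mult_left_mono kK t)+
  then show ?thesis using t(2) by (simp add: sum_distrib_right[symmetric])
 qed
 then show thesis using that k0 by blast
qed

section \<open>The lower bound for composites and the membership of laminates\<close>

context bounded_open
begin

lemma Linf_coeff_class: "A \<in> coeff_class X \<alpha> \<beta> ==> A \<in> Linf X"
 by (simp add: coeff_class_def)

text \<open>For the load -div (B grad \<phi>) the limit solution is \<phi> itself, and the energies
  converge because each equals the pairing of G n with a fixed field. If a is the smallest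
  eigenvalue of the local phase, the energy density is at least 2 c G n . grad \<phi> - c^2 |grad
  \<phi>|^2 / a. This is affine in G n and in 1 / a = ch n . \<open>inv_lam M\<close>, hence stable
  under weak limits.\<close>

lemma gradient_energy_lower:
 fixes M :: "'N::finite \<Rightarrow> real^'d^'d"
 assumes M: "\<And>i. transpose (M i) = M i" "\<And>i. lambda_min (M i) > 0"
  and ch: "\<And>n. ch n \<in> Linf_into X (range (\<lambda>i. axis i 1))" and R: "\<And>n. R n \<in> Linf_into X {Q. rotation_matrix Q}"
  and w: "weakly_star_Linf X ch \<theta>"
  and H: "H_converges X (\<lambda>n x. \<Sum>i\<in>UNIV. (ch n x $ i) *\<^sub>R (transpose (R n x) ** M i ** R n x)) B"
  and t: "\<phi> \<in> test"
 shows "2 * c * (LINT x|LM. (norm (grad \<phi> x))^2) - c^2 * (LINT x|LM. (\<theta> x \<bullet> inv_lam M) * (norm (grad \<phi> x))^2)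
  \<le> (LINT x|LM. grad \<phi> x \<bullet> (B x *v grad \<phi> x))"
proof -
 define A where "A n x = (\<Sum>i\<in>UNIV. (ch n x $ i) *\<^sub>R (transpose (R n x) ** M i ** R n x))" for n x
 note gL = grad_test_L2[OF t]
 obtain \<alpha> \<beta> where cc: "\<alpha> > 0" "\<And>n. A n \<in> coeff_class X \<alpha> \<beta>" "B \<in> coeff_class X \<alpha> \<beta>"
  using H unfolding H_converges_def A_def by blast
 have AL: "A n \<in> Linf X" for n by (rule Linf_coeff_class[OF cc(2)])
 have BL: "B \<in> Linf X" by (rule Linf_coeff_class[OF cc(3)])
 have Blow: "AE x in LM. \<forall>v. \<alpha> * (norm v)^2 \<le> v \<bullet> (B x *v v)"
  using cc(3) unfolding coeff_class_def by (auto elim: eventually_mono)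
 have pt: "AE x in LM. \<exists>j. A n x = transpose (R n x) ** M j ** R n x \<and> rotation_matrix (R n x) \<and> ch n x = axis j 1" for n
 proof -
  have 1: "AE x in LM. ch n x \<in> range (\<lambda>i. axis i 1)" and 2: "AE x in LM. rotation_matrix (R n x)"
   using ch[of n] R[of n] by (auto simp: Linf_into_def)
  show ?thesis using 1 2
  proof eventually_elim
   case (elim x)
   then obtain j where j: "ch n x = axis j 1" by blast
   then have "A n x = transpose (R n x) ** M j ** R n x"
    unfolding A_def by (simp add: axis_def if_distrib[of "\<lambda>x. x *\<^sub>R _"] cong: if_cong)
   then show ?case using j elim by blast
  qed
 qed
 have sq: "AE x in LM. transpose (A n x) = A n x \<and> (\<forall>v. \<alpha> * (norm v)^2 \<le> v \<bullet> (A n x *v v))" for n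
 proof -
  have "AE x in LM. \<forall>v. \<alpha> * (norm v)^2 \<le> v \<bullet> (A n x *v v)" using cc(2)[of n] unfolding coeff_class_def by (auto elim: eventually_mono)
  with pt[of n] show ?thesis
  proof eventually_elim
   case (elim x)
   then obtain j where j: "A n x = transpose (R n x) ** M j ** R n x" "rotation_matrix (R n x)" by blast
   show ?case using elim(2) rotated_phase(1)[OF j(2) M(1)[of j]] unfolding j(1) by blast
  qed
 qed
 have ell: "sym_elliptic \<alpha> (A n)" for n using cc(1) AL sq by (simp add: sym_elliptic_def)
 \<comment> \<open>The load is chosen backwards, from the flux that \<phi> has in the limit
   material.\<close>
 define W where "W x = B x *v grad \<phi> x" for x
 have WL: "W \<in> L2 X" unfolding W_def by (rule Linf_L2_matrix_vector[OF BL gL])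
 define l where "l \<psi> = (LINT x|LM. W x \<bullet> grad \<psi> x)" for \<psi>
 have lH: "l \<in> H_minus_1 X" using H_minus_1_field[OF WL] by (simp add: l_def[abs_def])
 have "\<exists>u G. dirichlet_solution X (A n) l u G" for n using dirichlet_exists[OF ell lH] by blast
 then obtain u G where sol: "\<And>n. dirichlet_solution X (A n) l (u n) (G n)" by metis
 obtain v F where vF: "dirichlet_solution X B l v F" "weakly_L2 X G F"
  using H lH sol unfolding H_converges_def A_def[symmetric] by blast
 have u: "h10 (u n) (G n)" "\<And>\<psi>. \<psi> \<in> test ==> (LINT x|LM. (A n x *v G n x) \<bullet> grad \<psi> x) = (LINT x|LM. W x \<bullet> grad \<psi> x)" for n
  using sol[of n] by (auto simp: dirichlet_solution_iff neg_div_eq_def l_def)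
 have v: "h10 v F" "\<And>\<psi>. \<psi> \<in> test ==> (LINT x|LM. (B x *v F x) \<bullet> grad \<psi> x) = (LINT x|LM. W x \<bullet> grad \<psi> x)"
  using vF(1) by (auto simp: dirichlet_solution_iff neg_div_eq_def l_def)
 note GL = h10_L2(2)[OF u(1)] and FL = h10_L2(2)[OF v(1)]
 \<comment> \<open>H-convergence only supplies some solution F for B; coercivity identifies it with
   the gradient of \<phi>.\<close>
 have F: "AE x in LM. F x = grad \<phi> x"
 proof -
  note d = h10_diff[OF v(1) h10_test[OF t]]
  note dL = h10_L2(2)[OF d]
  have BFL: "(\<lambda>x. B x *v F x) \<in> L2 X" by (rule Linf_L2_matrix_vector[OF BL FL])
  have "(LINT x|LM. (B x *v F x) \<bullet> (F x - grad \<phi> x)) = (LINT x|LM. W x \<bullet> (F x - grad \<phi> x))"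
   by (rule h10_ortho[OF d BFL v(2) WL])
  then have "(LINT x|LM. (F x - grad \<phi> x) \<bullet> (B x *v (F x - grad \<phi> x))) = 0"
   using L2_inner_integrable[OF BFL dL] L2_inner_integrable[OF WL dL]
   by (simp add: matrix_vector_mult_diff_distrib inner_diff_right inner_commute W_def inner_diff_left)
  then have "\<alpha> * (l2norm X (\<lambda>x. F x - grad \<phi> x))^2 \<le> 0" using elliptic_lower[OF BL Blow dL] by simp
  then have "l2norm X (\<lambda>x. F x - grad \<phi> x) = 0" using cc(1) by (simp add: mult_le_0_iff)
  then show ?thesis using l2norm_eq_0_iff[OF dL] by simp
 qed
 have Fc: "(LINT x|LM. F x \<bullet> f x) = (LINT x|LM. grad \<phi> x \<bullet> f x)" if "f \<in> L2 X" for f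
  by (rule integral_cong_AE)
   (use F L2_inner_integrable[OF FL that] L2_inner_integrable[OF gL that] in \<open>auto elim!: eventually_mono\<close>)
 have en: "(LINT x|LM. G n x \<bullet> (A n x *v G n x)) = (LINT x|LM. G n x \<bullet> W x)" for n
  using h10_ortho[OF u(1) Linf_L2_matrix_vector[OF AL GL] u(2) WL] by (simp add: inner_commute)
 define b where "b = inv_lam M"
 define f where "f x = (norm (grad \<phi> x))^2 *\<^sub>R b" for x
 have ng: "integrable LM (\<lambda>x. (norm (grad \<phi> x))^2)" by (rule L2_D(2)[OF gL])
 have f1: "f \<in> L1 X" unfolding f_def L1_def using ng by simp
 have chf: "integrable LM (\<lambda>x. ch n x \<bullet> f x)" for n
 proof -
  obtain C where C: "ch n \<in> borel_measurable LM" "C \<ge> 0" "AE x in LM. norm (ch n x) \<le> C"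
   using Linf_D[of "ch n"] ch[of n] by (auto simp: Linf_into_def)
  show ?thesis
  proof (rule L1_bound[of _ "\<lambda>x. C * norm (f x)"])
   show "integrable LM (\<lambda>x. C * norm (f x))" using f1 by (simp add: L1_def)
   show "(\<lambda>x. ch n x \<bullet> f x) \<in> borel_measurable LM" using C(1) f1 by (auto simp: L1_def)
   show "AE x in LM. norm (ch n x \<bullet> f x) \<le> norm (C * norm (f x))"
    using C(3) by eventually_elim (use C(2) in \<open>auto simp: abs_mult intro!: order_trans[OF Cauchy_Schwarz_ineq2] mult_right_mono\<close>)
  qed
 qed
 have "2 * c * (LINT x|LM. G n x \<bullet> grad \<phi> x) - c^2 * (LINT x|LM. ch n x \<bullet> f x) \<le> (LINT x|LM. G n x \<bullet> W x)" for n
 proof -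
  have "(LINT x|LM. 2 * c * (G n x \<bullet> grad \<phi> x) - c^2 * (ch n x \<bullet> f x)) \<le> (LINT x|LM. G n x \<bullet> (A n x *v G n x))"
  proof (rule integral_mono_AE)
   show "AE x in LM. 2 * c * (G n x \<bullet> grad \<phi> x) - c^2 * (ch n x \<bullet> f x) \<le> G n x \<bullet> (A n x *v G n x)"
    using pt[of n]
   proof eventually_elim
    case (elim x)
    then obtain j where j: "A n x = transpose (R n x) ** M j ** R n x" "rotation_matrix (R n x)" "ch n x = axis j 1" by blast
    define a where "a = lambda_min (M j)"
    have a: "a > 0" unfolding a_def by (rule M(2))
    have "a * (norm (G n x))^2 \<le> G n x \<bullet> (A n x *v G n x)"
     using lambda_min_props(2)[OF M(1), of j "R n x *v G n x"]
     unfolding j(1) rotated_phase(2)[OF j(2) M(1)] rotated_phase(3)[OF j(2) M(1)] a_def .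
    moreover have "ch n x \<bullet> f x = (norm (grad \<phi> x))^2 / a"
     by (simp add: f_def j(3) b_def inv_lam_def inner_axis' a_def)
    moreover have "2 * c * (G n x \<bullet> grad \<phi> x) - c^2 * ((norm (grad \<phi> x))^2 / a) \<le> a * (norm (G n x))^2"
    proof -
     have "0 \<le> (norm (a *\<^sub>R G n x + (- c) *\<^sub>R grad \<phi> x))\<^sup>2 / a" using a by simp
     also have "\<dots> = a * (norm (G n x))^2 - 2 * c * (G n x \<bullet> grad \<phi> x) + c^2 * ((norm (grad \<phi> x))^2 / a)"
      unfolding norm_add_sq using a by (simp add: power_mult_distrib field_simps power2_eq_square)
     finally show ?thesis by linarith
    qed
    ultimately show ?case by (simp only:)
   qed
  qed (intro L1_diff integrable_mult_right L2_inner_integrable GL gL chf Linf_L2_matrix_vector AL)+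
  then show ?thesis using en[of n] L2_inner_integrable[OF GL gL, of n] chf[of n] by simp
 qed
 moreover have "(\<lambda>n. 2 * c * (LINT x|LM. G n x \<bullet> grad \<phi> x) - c^2 * (LINT x|LM. ch n x \<bullet> f x)) \<longlonglongrightarrow>
   2 * c * (LINT x|LM. F x \<bullet> grad \<phi> x) - c^2 * (LINT x|LM. \<theta> x \<bullet> f x)"
  using vF(2) gL w f1 unfolding weakly_L2_def weakly_star_Linf_def by (intro tendsto_intros) auto
 moreover have "(\<lambda>n. LINT x|LM. G n x \<bullet> W x) \<longlonglongrightarrow> (LINT x|LM. F x \<bullet> W x)"
  using vF(2) WL unfolding weakly_L2_def by blast
 ultimately have "2 * c * (LINT x|LM. F x \<bullet> grad \<phi> x) - c^2 * (LINT x|LM. \<theta> x \<bullet> f x) \<le> (LINT x|LM. F x \<bullet> W x)"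
  by (intro LIMSEQ_le[of _ _ _ "LINT x|LM. F x \<bullet> W x"]) auto
 then show ?thesis unfolding Fc[OF gL] Fc[OF WL]
  by (simp add: f_def b_def W_def power2_norm_eq_inner mult.commute)
qed

text \<open>Highly oscillating test functions \<open>\<phi> sin (k x\<cdot>\<xi>) / k\<close> and \<open>\<phi> cos (k x\<cdot>\<xi>) / k\<close>: in the sum of their energies the
 terms of order \<open>1 / k\<close> cancel.\<close>

lemma quadratic_form_localize:
 assumes N: "N \<in> Linf X" and pos: "\<And>\<phi>. \<phi> \<in> test ==> 0 \<le> (LINT x|LM. grad \<phi> x \<bullet> (N x *v grad \<phi> x))"
  and t: "\<phi> \<in> test"
 shows "0 \<le> (LINT x|LM. (\<phi> x)^2 * (\<xi> \<bullet> (N x *v \<xi>)))"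
proof -
 note gL = grad_test_L2[OF t]
 have fL: "(\<lambda>x. \<phi> x *\<^sub>R \<xi>) \<in> L2 X"
  by (rule L2_bound[OF _ L2_scaleR[OF test_L2[OF t], of "norm \<xi>"]]) (use L2_D(1)[OF test_L2[OF t]] in \<open>auto simp: mult.commute\<close>)
 note i1 = L2_inner_integrable[OF fL Linf_L2_matrix_vector[OF N fL]] and i2 = L2_inner_integrable[OF gL Linf_L2_matrix_vector[OF N gL]]
 define P where "P k s = 1 / k * sin (k * s)" for k s :: real
 define Q where "Q k s = 1 / k * cos (k * s)" for k s :: real
 have "0 \<le> (LINT x|LM. (\<phi> x)^2 * (\<xi> \<bullet> (N x *v \<xi>))) + 1 / (real (Suc n))^2 * (LINT x|LM. grad \<phi> x \<bullet> (N x *v grad \<phi> x))" for n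
 proof -
  define k where "k = real (Suc n)"
  have k: "k > 0" by (simp add: k_def)
  have sP: "smooth_real (P k)" and sQ: "smooth_real (Q k)"
   unfolding P_def Q_def using smooth_real_affine[OF smooth_real_sin, of k 0] smooth_real_affine[OF smooth_real_cos, of k 0]
   by (simp_all only: add_0_right smooth_real_cmult)
  have dP: "(P k has_real_derivative cos (k * s)) (at s)" and dQ: "(Q k has_real_derivative - sin (k * s)) (at s)" for s
   unfolding P_def Q_def using k by (auto intro!: derivative_eq_intros)
  let ?p = "\<lambda>x. P k (x \<bullet> \<xi>) * \<phi> x" and ?q = "\<lambda>x. Q k (x \<bullet> \<xi>) * \<phi> x"
  have tp: "?p \<in> test" and tq: "?q \<in> test" using test_direction[OF sP t] test_direction[OF sQ t] by auto
  have gp: "grad ?p x = P k (x \<bullet> \<xi>) *\<^sub>R grad \<phi> x + (cos (k * (x \<bullet> \<xi>)) * \<phi> x) *\<^sub>R \<xi>" for x by (rule grad_direction[OF dP t])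
  have gq: "grad ?q x = Q k (x \<bullet> \<xi>) *\<^sub>R grad \<phi> x + (- sin (k * (x \<bullet> \<xi>)) * \<phi> x) *\<^sub>R \<xi>" for x by (rule grad_direction[OF dQ t])
  have eq: "grad ?p x \<bullet> (N x *v grad ?p x) + grad ?q x \<bullet> (N x *v grad ?q x)
    = (\<phi> x)^2 * (\<xi> \<bullet> (N x *v \<xi>)) + 1 / k^2 * (grad \<phi> x \<bullet> (N x *v grad \<phi> x))" for x
  proof -
   define S where "S = sin (k * (x \<bullet> \<xi>))" define C where "C = cos (k * (x \<bullet> \<xi>))"
   define a where "a = grad \<phi> x \<bullet> (N x *v grad \<phi> x)" define b where "b = grad \<phi> x \<bullet> (N x *v \<xi>)"
   define c where "c = \<xi> \<bullet> (N x *v grad \<phi> x)" define d where "d = \<xi> \<bullet> (N x *v \<xi>)"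
   have SC: "S^2 + C^2 = 1" by (simp add: S_def C_def)
   have gen: "(\<alpha> *\<^sub>R grad \<phi> x + \<beta> *\<^sub>R \<xi>) \<bullet> (N x *v (\<alpha> *\<^sub>R grad \<phi> x + \<beta> *\<^sub>R \<xi>)) = \<alpha>^2 * a + \<alpha> * \<beta> * (b + c) + \<beta>^2 * d" for \<alpha> \<beta>
    unfolding a_def b_def c_def d_def
    by (simp add: matrix_vector_right_distrib matrix_vector_mult_scaleR inner_add power2_eq_square algebra_simps)
   have "grad ?p x \<bullet> (N x *v grad ?p x) + grad ?q x \<bullet> (N x *v grad ?q x)
    = (1 / k * S)\<^sup>2 * a + (1 / k * S) * (C * \<phi> x) * (b + c) + (C * \<phi> x)\<^sup>2 * d + ((1 / k * C)\<^sup>2 * a + (1 / k * C) * (- S * \<phi> x) * (b + c) + (- S * \<phi> x)\<^sup>2 * d)"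
    unfolding gp gq gen by (simp add: P_def Q_def S_def C_def)
   also have "\<dots> = (S^2 + C^2) * (\<phi> x)^2 * d + (S^2 + C^2) / k^2 * a"
    using k by (simp add: power2_eq_square field_simps)
   finally show ?thesis unfolding SC a_def d_def by simp
  qed
  have ip: "integrable LM (\<lambda>x. grad ?p x \<bullet> (N x *v grad ?p x))" and iq: "integrable LM (\<lambda>x. grad ?q x \<bullet> (N x *v grad ?q x))"
   by (intro L2_inner_integrable Linf_L2_matrix_vector[OF N] grad_test_L2 tp tq)+
  have i1': "integrable LM (\<lambda>x. (\<phi> x)^2 * (\<xi> \<bullet> (N x *v \<xi>)))"
   using i1 by (simp add: matrix_vector_mult_scaleR power2_eq_square mult.assoc)
  have "0 \<le> (LINT x|LM. grad ?p x \<bullet> (N x *v grad ?p x)) + (LINT x|LM. grad ?q x \<bullet> (N x *v grad ?q x))"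
   using pos[OF tp] pos[OF tq] by linarith
  also have "\<dots> = (LINT x|LM. grad ?p x \<bullet> (N x *v grad ?p x) + grad ?q x \<bullet> (N x *v grad ?q x))"
   by (rule lint_add[OF ip iq, symmetric])
  also have "\<dots> = (LINT x|LM. (\<phi> x)^2 * (\<xi> \<bullet> (N x *v \<xi>))) + 1 / k^2 * (LINT x|LM. grad \<phi> x \<bullet> (N x *v grad \<phi> x))"
   unfolding eq using i1' i2 by simp
  finally show ?thesis by (simp add: k_def)
 qed
 moreover have "(\<lambda>n. (LINT x|LM. (\<phi> x)^2 * (\<xi> \<bullet> (N x *v \<xi>))) + 1 / (real (Suc n))^2 * (LINT x|LM. grad \<phi> x \<bullet> (N x *v grad \<phi> x)))
  \<longlonglongrightarrow> (LINT x|LM. (\<phi> x)^2 * (\<xi> \<bullet> (N x *v \<xi>))) + 0 * (LINT x|LM. grad \<phi> x \<bullet> (N x *v grad \<phi> x))"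
 proof (intro tendsto_intros)
  have "(\<lambda>n. (1 / real (Suc n))^2) \<longlonglongrightarrow> 0^2" by (intro tendsto_intros LIMSEQ_Suc[OF lim_1_over_n])
  then show "(\<lambda>n. 1 / (real (Suc n))^2) \<longlonglongrightarrow> 0" by (simp add: power_one_over)
 qed
 ultimately show ?thesis by (intro LIMSEQ_le_const) auto
qed

lemma Linf_diff_integrable:
 assumes k: "k \<in> Linf X"
 shows "integrable LM (\<lambda>x. norm (k x - y))"
proof -
 obtain K where K: "k \<in> borel_measurable LM" "K \<ge> 0" "AE x in LM. norm (k x) \<le> K" using Linf_D[OF k] by blast
 have "(\<lambda>x. k x - y) \<in> L2 X" by (intro L2_diff L2_bounded[OF lmeas K(1,3)] L2_const[OF lmeas])
 then show ?thesis using L2_imp_integrable[OF lmeas L2_norm] by blast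
qed

text \<open>Squares of test functions tending to the indicator of a small ball give a nonnegative
  average of f. By \<open>le\<close> this average is at most f z plus C times the mean oscillations
  of g and h, which vanish at a common Lebesgue point.\<close>

lemma nonneg_at_lebesgue_point:
 fixes f :: "real^'d \<Rightarrow> real" and g :: "real^'d \<Rightarrow> 'b::euclidean_space" and h :: "real^'d \<Rightarrow> 'c::euclidean_space"
 assumes f: "f \<in> Linf X" and pos: "\<And>\<phi>. \<phi> \<in> test ==> 0 \<le> (LINT x|LM. (\<phi> x)^2 * f x)"
  and g: "g \<in> Linf X" "lebesgue_point X g z" and h: "h \<in> Linf X" "lebesgue_point X h z"
  and le: "\<And>x. f x \<le> f z + C * (norm (g x - g z) + norm (h x - h z))"
 shows "0 \<le> f z"
proof -
 have z: "z \<in> X" using g(2) by (simp add: lebesgue_point_def)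
 obtain Cf where Cf: "f \<in> borel_measurable LM" "Cf \<ge> 0" "AE x in LM. norm (f x) \<le> Cf" using Linf_D[OF f] by blast
 have fi: "integrable LM f" by (rule L2_imp_integrable[OF lmeas L2_bounded[OF lmeas Cf(1,3)]])
 obtain r0 where r0: "r0 > 0" "ball z r0 \<subseteq> X" using open_dom z open_contains_ball by blast
 have sub: "integral\<^sup>L (lebesgue_on (X \<inter> ball z r)) k = (LINT x|LM. indicator (ball z r) x * k x)" 
  and isub: "integrable LM k ==> integrable LM (\<lambda>x. indicator (ball z r) x * k x)" for r and k :: "real^'d \<Rightarrow> real"
 proof -
  have "(\<lambda>x. indicator (X \<inter> ball z r) x * k x) = (\<lambda>x. indicator X x * (indicator (ball z r) x * k x))"
   by (auto simp: indicator_def)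
  then show "integral\<^sup>L (lebesgue_on (X \<inter> ball z r)) k = (LINT x|LM. indicator (ball z r) x * k x)"
   using open_dom by (simp add: integral_restrict_space)
  show "integrable LM (\<lambda>x. indicator (ball z r) x * k x)" if "integrable LM k"
  proof (rule L1_bound[OF that])
   have "(\<lambda>x. indicator (ball z r) x :: real) \<in> borel_measurable LM" by (intro measurable_borel_dom borel_measurable_indicator) simp
   then show "(\<lambda>x. indicator (ball z r) x * k x) \<in> borel_measurable LM" using that by measurable
  qed (auto simp: indicator_def)
 qed
 define m where "m r = measure lebesgue (ball z r)" for r
 have avg: "- f z \<le> C * ((LINT y|lebesgue_on (X \<inter> ball z r). norm (g y - g z)) / m r + (LINT y|lebesgue_on (X \<inter> ball z r). norm (h y - h z)) / m r)"
  if r: "0 < r" "r < r0" for r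
 proof -
  have br: "ball z r \<subseteq> X" using r r0(2) by (meson less_imp_le order_trans subset_ball)
  have m0: "m r > 0" unfolding m_def using r(1) by (simp add: content_ball_pos)
  obtain \<phi> where \<phi>: "\<And>n. \<phi> n \<in> test" "\<And>n x. \<bar>\<phi> n x\<bar> \<le> 1" "\<And>x. (\<lambda>n::nat. \<phi> n x) \<longlonglongrightarrow> indicator (ball z r) x"
   using open_indicator_approx[OF open_ball br] by blast
  have "(\<lambda>n. LINT x|LM. (\<phi> n x)^2 * f x) \<longlonglongrightarrow> (LINT x|LM. (indicator (ball z r) x)^2 * f x)"
  proof (rule integral_dominated_convergence[where w="\<lambda>x. norm (f x)"])
   have "(\<phi> n x)^2 \<le> 1" for n x using \<phi>(2)[of n x] by (simp add: abs_square_le_1)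
   then show "AE x in LM. norm ((\<phi> n x)^2 * f x) \<le> norm (f x)" for n
    by (intro AE_I2) (simp add: abs_mult mult_left_le_one_le)
   show "AE x in LM. (\<lambda>n. (\<phi> n x)^2 * f x) \<longlonglongrightarrow> (indicator (ball z r) x)^2 * f x"
    by (intro AE_I2 tendsto_intros \<phi>(3))
   show "(\<lambda>x. (\<phi> n x)^2 * f x) \<in> borel_measurable LM" for n
    using L2_D(1)[OF test_L2[OF \<phi>(1)]] fi by measurable
   have "(\<lambda>x. indicator (ball z r) x :: real) \<in> borel_measurable LM" by (intro measurable_borel_dom borel_measurable_indicator) simp
   then show "(\<lambda>x. (indicator (ball z r) x)^2 * f x) \<in> borel_measurable LM" using fi by measurable
  qed (use fi in auto)
  then have "0 \<le> (LINT x|LM. (indicator (ball z r) x)^2 * f x)"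
   by (rule LIMSEQ_le_const) (use pos[OF \<phi>(1)] in auto)
  also have "\<dots> = (LINT x|LM. indicator (ball z r) x * f x)"
   by (rule lint_cong) (auto simp: indicator_def)
  also have "\<dots> \<le> (LINT x|LM. f z * indicator (ball z r) x + C * (indicator (ball z r) x * norm (g x - g z) + indicator (ball z r) x * norm (h x - h z)))"
  proof (rule integral_mono_AE)
   show "AE x in LM. indicator (ball z r) x * f x \<le> f z * indicator (ball z r) x + C * (indicator (ball z r) x * norm (g x - g z) + indicator (ball z r) x * norm (h x - h z))"
    using le by (intro AE_I2) (auto simp: indicator_def)
   have "integrable LM (\<lambda>x. indicator (ball z r) x * (1::real))"
    by (rule isub) (rule L2_imp_integrable[OF lmeas L2_const[OF lmeas]])
   then show "integrable LM (\<lambda>x. f z * indicator (ball z r) x + C * (indicator (ball z r) x * norm (g x - g z) + indicator (ball z r) x * norm (h x - h z)))"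
    using isub[OF Linf_diff_integrable[OF g(1)]] isub[OF Linf_diff_integrable[OF h(1)]] by simp
  qed (rule isub[OF fi])
  also have "\<dots> = f z * (LINT x|LM. indicator (ball z r) x) + C * ((LINT x|LM. indicator (ball z r) x * norm (g x - g z)) + (LINT x|LM. indicator (ball z r) x * norm (h x - h z)))"
  proof -
   have "integrable LM (\<lambda>x. indicator (ball z r) x * (1::real))"
    by (rule isub) (rule L2_imp_integrable[OF lmeas L2_const[OF lmeas]])
   then show ?thesis using isub[OF Linf_diff_integrable[OF g(1)]] isub[OF Linf_diff_integrable[OF h(1)]] by simp
  qed
  also have "(LINT x|LM. indicator (ball z r) x) = m r"
  proof -
   have "(LINT x|LM. indicator (ball z r) x :: real) = integral\<^sup>L lebesgue (indicator (ball z r))"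
    using br by (intro integral_dom_eq) (auto simp: indicator_def)
   then show ?thesis by (simp add: m_def)
  qed
  finally have "0 \<le> f z * m r + C * ((LINT y|lebesgue_on (X \<inter> ball z r). norm (g y - g z)) + (LINT y|lebesgue_on (X \<inter> ball z r). norm (h y - h z)))"
   by (simp add: sub)
  then have "0 \<le> (f z * m r + C * ((LINT y|lebesgue_on (X \<inter> ball z r). norm (g y - g z)) + (LINT y|lebesgue_on (X \<inter> ball z r). norm (h y - h z)))) / m r"
   using m0 by simp
  also have "\<dots> = f z + C * ((LINT y|lebesgue_on (X \<inter> ball z r). norm (g y - g z)) / m r + (LINT y|lebesgue_on (X \<inter> ball z r). norm (h y - h z)) / m r)"
   using m0 by (simp add: field_simps)
  finally show ?thesis by linarith
 qed
 have "((\<lambda>r. C * ((LINT y|lebesgue_on (X \<inter> ball z r). norm (g y - g z)) / m r + (LINT y|lebesgue_on (X \<inter> ball z r). norm (h y - h z)) / m r)) \<longlongrightarrow> C * (0 + 0)) (at_right 0)"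
  using g(2) h(2) unfolding lebesgue_point_def m_def by (intro tendsto_intros) auto
 moreover have "\<forall>\<^sub>F r in at_right 0. - f z \<le> C * ((LINT y|lebesgue_on (X \<inter> ball z r). norm (g y - g z)) / m r + (LINT y|lebesgue_on (X \<inter> ball z r). norm (h y - h z)) / m r)"
  using eventually_at_right_real[OF r0(1)] by eventually_elim (use avg in auto)
 ultimately have "- f z \<le> C * (0 + 0)" by (intro tendsto_lowerbound[of _ _ "at_right 0"]) auto
 then show ?thesis by simp
qed

lemma lebesgue_point_const: "z \<in> X ==> lebesgue_point X (\<lambda>x. y) z"
 by (simp add: lebesgue_point_def)

text \<open>The energy inequality states that B - (2 c - c^2 (\<theta> . b)) I has nonnegative
  integrals over test gradients. Oscillating test functions extract a fixed direction \<xi>, and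
  Lebesgue points the value at z. The choice c = \<open>lam_minus M t\<close> maximizes 2 c - c^2 (t
  . b), and the maximum is c.\<close>

lemma composites_lower_bound:
 fixes M :: "'N::finite \<Rightarrow> real^'d^'d"
 assumes M: "\<And>i. transpose (M i) = M i" "\<And>i. lambda_min (M i) > 0"
  and A: "A \<in> composites X M t" and t: "t \<in> proportions"
 shows "lam_minus M t * (norm \<xi>)^2 \<le> \<xi> \<bullet> (A *v \<xi>)"
proof -
 obtain ch R \<theta> B z where ch: "\<And>n::nat. ch n \<in> Linf_into X (range (\<lambda>i. axis i 1))" "\<And>n. R n \<in> Linf_into X {Q. rotation_matrix Q}"
   "weakly_star_Linf X ch \<theta>"
   "H_converges X (\<lambda>n x. \<Sum>i\<in>UNIV. (ch n x $ i) *\<^sub>R (transpose (R n x) ** M i ** R n x)) B"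
   and lp: "lebesgue_point X B z" "lebesgue_point X \<theta> z" and Az: "A = B z" and tz: "t = \<theta> z"
  using A unfolding composites_def by blast
 define b where "b = inv_lam M"
 define c where "c = lam_minus M t"
 obtain k K where k: "0 < k" "\<And>t. t \<in> proportions ==> k \<le> t \<bullet> inv_lam M" "\<And>t. t \<in> proportions ==> t \<bullet> inv_lam M \<le> K"
  by (rule inv_lam_bounds[of M, OF M(2)]) blast
 have tb: "t \<bullet> b > 0" using k(1) k(2)[OF t] by (simp add: b_def)
 have c: "c = 1 / (t \<bullet> b)" by (simp add: c_def b_def lam_minus_eq)
 have BL: "B \<in> Linf X" using ch(4) unfolding H_converges_def by (auto simp: coeff_class_def)
 have \<theta>L: "\<theta> \<in> Linf X" using ch(3) by (simp add: weakly_star_Linf_def)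
 define N where "N x = B x - (2 * c - c^2 * (\<theta> x \<bullet> b)) *\<^sub>R mat 1" for x
 obtain C1 where C1: "B \<in> borel_measurable LM" "C1 \<ge> 0" "AE x in LM. norm (B x) \<le> C1" using Linf_D[OF BL] by blast
 obtain C2 where C2: "\<theta> \<in> borel_measurable LM" "C2 \<ge> 0" "AE x in LM. norm (\<theta> x) \<le> C2" using Linf_D[OF \<theta>L] by blast
 have Nm: "N \<in> borel_measurable LM" unfolding N_def using C1(1) C2(1) by measurable
 have NL: "N \<in> Linf X"
  unfolding Linf_def
 proof (safe intro!: Nm exI[of _ "C1 + (2 * \<bar>c\<bar> + c^2 * (C2 * norm b)) * norm (mat 1 :: real^'d^'d)"])
  show "AE x in LM. norm (N x) \<le> C1 + (2 * \<bar>c\<bar> + c^2 * (C2 * norm b)) * norm (mat 1 :: real^'d^'d)"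
   using C1(3) C2(3)
  proof eventually_elim
   case (elim x)
   have "\<bar>\<theta> x \<bullet> b\<bar> \<le> C2 * norm b"
    by (rule order_trans[OF Cauchy_Schwarz_ineq2]) (use elim in \<open>auto intro: mult_right_mono\<close>)
   then have "\<bar>c^2 * (\<theta> x \<bullet> b)\<bar> \<le> c^2 * (C2 * norm b)" unfolding abs_mult by (simp add: mult_left_mono)
   then have "\<bar>2 * c - c^2 * (\<theta> x \<bullet> b)\<bar> \<le> 2 * \<bar>c\<bar> + c^2 * (C2 * norm b)" by linarith
   then have "norm ((2 * c - c^2 * (\<theta> x \<bullet> b)) *\<^sub>R (mat 1 :: real^'d^'d)) \<le> (2 * \<bar>c\<bar> + c^2 * (C2 * norm b)) * norm (mat 1 :: real^'d^'d)"
    unfolding norm_scaleR by (intro mult_right_mono) auto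
   then show ?case unfolding N_def using elim(1) norm_triangle_ineq4[of "B x" "(2 * c - c^2 * (\<theta> x \<bullet> b)) *\<^sub>R (mat 1 :: real^'d^'d)"] by linarith
  qed
 qed
 have Nf: "v \<bullet> (N x *v v) = v \<bullet> (B x *v v) - (2 * c - c^2 * (\<theta> x \<bullet> b)) * (norm v)^2" for x v
  by (simp add: N_def matrix_vector_mult_diff_rdistrib scaleR_matrix_vector_assoc[symmetric] inner_diff_right power2_norm_eq_inner)
 have Npos: "0 \<le> (LINT x|LM. grad \<phi> x \<bullet> (N x *v grad \<phi> x))" if p: "\<phi> \<in> test" for \<phi>
 proof -
  note gL = grad_test_L2[OF p]
  have i1: "integrable LM (\<lambda>x. grad \<phi> x \<bullet> (B x *v grad \<phi> x))" by (intro L2_inner_integrable gL Linf_L2_matrix_vector BL)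
  have i2: "integrable LM (\<lambda>x. (norm (grad \<phi> x))^2)" by (rule L2_D(2)[OF gL])
  have i3: "integrable LM (\<lambda>x. (\<theta> x \<bullet> b) * (norm (grad \<phi> x))^2)"
  proof -
   have "(\<lambda>x. (\<theta> x \<bullet> b) *\<^sub>R grad \<phi> x) \<in> L2 X"
   proof (rule L2_bounded_mult[OF _ _ gL, of _ "C2 * norm b"])
    show "AE x in LM. \<bar>\<theta> x \<bullet> b\<bar> \<le> C2 * norm b"
     using C2(3) by eventually_elim (auto intro!: order_trans[OF Cauchy_Schwarz_ineq2] mult_right_mono)
    show "(\<lambda>x. \<theta> x \<bullet> b) \<in> borel_measurable LM" using C2(1) by measurable
   qed
   from L2_inner_integrable[OF this gL] show ?thesis by (simp add: power2_norm_eq_inner)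
  qed
  have "(LINT x|LM. grad \<phi> x \<bullet> (N x *v grad \<phi> x)) = (LINT x|LM. grad \<phi> x \<bullet> (B x *v grad \<phi> x)) - (2 * c * (LINT x|LM. (norm (grad \<phi> x))^2) - c^2 * (LINT x|LM. (\<theta> x \<bullet> b) * (norm (grad \<phi> x))^2))"
   unfolding Nf using i1 i2 i3 by (simp add: left_diff_distrib mult.assoc)
  then show ?thesis using gradient_energy_lower[OF M ch p, of c] by (simp add: b_def)
 qed
 define f where "f x = \<xi> \<bullet> (N x *v \<xi>)" for x
 have fL: "f \<in> Linf X"
 proof -
  obtain C where C: "N \<in> borel_measurable LM" "C \<ge> 0" "AE x in LM. norm (N x) \<le> C" using Linf_D[OF NL] by blast
  have "AE x in LM. norm (f x) \<le> norm \<xi> * (C * norm \<xi>)"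
   using C(3)
  proof eventually_elim
   case (elim x)
   show ?case unfolding f_def real_norm_def
    by (intro order_trans[OF Cauchy_Schwarz_ineq2] mult_left_mono order_trans[OF norm_matrix_vector_le] mult_right_mono elim) auto
  qed
  moreover have "f \<in> borel_measurable LM" unfolding f_def using C(1) by measurable
  ultimately show ?thesis by (auto simp: Linf_def)
 qed
 have "0 \<le> f z"
 proof (rule nonneg_at_lebesgue_point[OF fL _ BL lp(1) \<theta>L lp(2)])
  show "0 \<le> (LINT x|LM. (\<phi> x)^2 * f x)" if "\<phi> \<in> test" for \<phi>
   unfolding f_def by (rule quadratic_form_localize[OF NL Npos that])
  fix x
  define D where "D = max ((norm \<xi>)^2) (c^2 * norm b * (norm \<xi>)^2)"
  have "f x - f z = \<xi> \<bullet> ((B x - B z) *v \<xi>) + c^2 * ((\<theta> x - \<theta> z) \<bullet> b) * (norm \<xi>)^2"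
   unfolding f_def Nf by (simp add: matrix_vector_mult_diff_rdistrib inner_diff_left inner_diff_right algebra_simps)
  moreover have "\<xi> \<bullet> ((B x - B z) *v \<xi>) \<le> D * norm (B x - B z)"
  proof -
   have "\<xi> \<bullet> ((B x - B z) *v \<xi>) \<le> norm \<xi> * (norm (B x - B z) * norm \<xi>)"
    by (rule order_trans[OF norm_cauchy_schwarz mult_left_mono[OF norm_matrix_vector_le]]) simp
   also have "\<dots> = (norm \<xi>)^2 * norm (B x - B z)" by (simp add: power2_eq_square)
   also have "\<dots> \<le> D * norm (B x - B z)" by (intro mult_right_mono) (auto simp: D_def)
   finally show ?thesis .
  qed
  moreover have "c^2 * ((\<theta> x - \<theta> z) \<bullet> b) * (norm \<xi>)^2 \<le> D * norm (\<theta> x - \<theta> z)"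
  proof -
   have "c^2 * ((\<theta> x - \<theta> z) \<bullet> b) * (norm \<xi>)^2 \<le> c^2 * (norm (\<theta> x - \<theta> z) * norm b) * (norm \<xi>)^2"
    by (intro mult_right_mono mult_left_mono norm_cauchy_schwarz) auto
   also have "\<dots> = (c^2 * norm b * (norm \<xi>)^2) * norm (\<theta> x - \<theta> z)" by simp
   also have "\<dots> \<le> D * norm (\<theta> x - \<theta> z)" by (intro mult_right_mono) (auto simp: D_def)
   finally show ?thesis .
  qed
  ultimately show "f x \<le> f z + D * (norm (B x - B z) + norm (\<theta> x - \<theta> z))" by (simp add: distrib_left)
 qed
 moreover have "2 * c - c^2 * (\<theta> z \<bullet> b) = c" using tb unfolding tz[symmetric] c by (simp add: power2_eq_square)
 ultimately show ?thesis unfolding f_def Nf Az by (simp add: c_def)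
qed

text \<open>All data are frozen: the layering of the whole domain has fixed proportions, a fixed
  normal and a constant H-limit, so every point of X is a common Lebesgue point.\<close>

lemma laminate_in_composites:
 fixes M :: "'N::finite \<Rightarrow> real^'d^'d"
 assumes M: "\<And>i. transpose (M i) = M i" "\<And>i. lambda_min (M i) > 0" and ne: "X \<noteq> {}"
  and t: "t \<in> proportions" and e: "norm e = 1" and Q: "\<And>i. rotation_matrix (Q i)"
  and ev: "\<And>i. eigenvector (transpose (Q i) ** M i ** Q i) e (lambda_min (M i))"
 shows "laminate_matrix (\<lambda>i. transpose (Q i) ** M i ** Q i) (\<lambda>i. lambda_min (M i)) t e \<in> composites X M t"
proof -
 define P where "P i = transpose (Q i) ** M i ** Q i" for i
 define \<alpha> where "\<alpha> = Min (range (\<lambda>i. lambda_min (M i)))"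
 have a: "\<alpha> > 0" unfolding \<alpha>_def using M(2) by (subst Min_gr_iff) auto
 have ai: "\<alpha> \<le> lambda_min (M i)" for i unfolding \<alpha>_def by auto
 have ph: "laminate_phases P (\<lambda>i. lambda_min (M i)) t e \<alpha>"
 proof
  show "transpose (P i) = P i" for i unfolding P_def by (rule rotated_phase(1)[OF Q M(1)])
  show "\<alpha> * (norm v)^2 \<le> v \<bullet> (P i *v v)" for i v
  proof -
   have "\<alpha> * (norm v)^2 \<le> lambda_min (M i) * (norm (Q i *v v))^2"
    unfolding rotated_phase(3)[OF Q M(1)] by (intro mult_right_mono ai) auto
   also have "\<dots> \<le> (Q i *v v) \<bullet> (M i *v (Q i *v v))" by (rule lambda_min_props(2)[OF M(1)])
   finally show ?thesis unfolding P_def rotated_phase(2)[OF Q M(1)] .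
  qed
  show "P i *v e = lambda_min (M i) *\<^sub>R e" for i using ev[of i] by (simp add: P_def eigenvector_def)
 qed (use t a e in auto)
 obtain ch where ch: "\<And>n::nat. ch n \<in> Linf_into X (range (\<lambda>i. axis i 1))" "\<And>n x. ch n x \<in> range (\<lambda>i. axis i 1)"
  "weakly_star_Linf X ch (\<lambda>x. t)"
  "H_converges X (\<lambda>n x. \<Sum>i\<in>UNIV. (ch n x $ i) *\<^sub>R P i) (\<lambda>x. laminate_matrix P (\<lambda>i. lambda_min (M i)) t e)"
  using laminate_H_converges[OF ph] by blast
 \<comment> \<open>The definition of composites provides one rotation field for all phases; it
   switches to \<open>Q j\<close> wherever phase j is present.\<close>
 define R where "R n x = (\<Sum>i\<in>UNIV. (ch n x $ i) *\<^sub>R Q i)" for n x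
 have j: "\<exists>j. ch n x = axis j 1 \<and> R n x = Q j" for n x
 proof -
  obtain j where "ch n x = axis j 1" using ch(2) by blast
  then show ?thesis unfolding R_def by (intro exI[of _ j]) (simp add: axis_def if_distrib[of "\<lambda>x. x *\<^sub>R _"] cong: if_cong)
 qed
 have A: "(\<Sum>i\<in>UNIV. (ch n x $ i) *\<^sub>R (transpose (R n x) ** M i ** R n x)) = (\<Sum>i\<in>UNIV. (ch n x $ i) *\<^sub>R P i)" for n x
 proof -
  obtain j where "ch n x = axis j 1" "R n x = Q j" using j by blast
  then show ?thesis by (simp add: axis_def P_def if_distrib[of "\<lambda>x. x *\<^sub>R _"] cong: if_cong)
 qed
 have Rm: "R n \<in> Linf_into X {Q. rotation_matrix Q}" for n
 proof -
  have "ch n \<in> borel_measurable LM" using ch(1)[of n] by (simp add: Linf_into_def Linf_def)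
  then have "(\<lambda>x. ch n x $ i) \<in> borel_measurable LM" for i unfolding cart_eq_inner_axis by measurable
  then have m: "R n \<in> borel_measurable LM" unfolding R_def by (rule measurable_combination)
  have "norm (R n x) \<le> (\<Sum>i\<in>UNIV. norm (Q i))" for x
  proof -
   obtain j where "R n x = Q j" using j by blast
   then show ?thesis using member_le_sum[of j UNIV "\<lambda>i. norm (Q i)"] by simp
  qed
  moreover have "rotation_matrix (R n x)" for x using j[of n x] Q by auto
  ultimately show ?thesis using m by (auto simp: Linf_into_def Linf_def)
 qed
 obtain z where z: "z \<in> X" using ne by blast
 show ?thesis
  unfolding composites_def P_def[symmetric]
  by (intro CollectI exI[of _ ch] exI[of _ R] exI[of _ "\<lambda>x. t"] exI[of _ "\<lambda>x. laminate_matrix P (\<lambda>i. lambda_min (M i)) t e"] exI[of _ z])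
   (use ch Rm A in \<open>auto intro: lebesgue_point_const[OF z]\<close>)
qed

end

section \<open>Radial functions on a ball\<close>

locale ball_domain = bounded_open X for X :: "(real^'d::finite) set" +
 fixes rad :: real
 assumes rad: "rad > 0" and ball: "X = ball 0 rad"
begin

definition "dm = CARD('d)"
text \<open>The area of the unit sphere, so that \<open>dens\<close> is the density of |x| when x is
  distributed by Lebesgue measure on the ball.\<close>

definition "area = real dm * unit_ball_vol (real dm)"
definition "dens r = indicator {0<..<rad} r * (area * r ^ (dm - 1))"

lemma dm_pos: "dm > 0" by (simp add: dm_def)

lemma area_pos: "area > 0" using dm_pos by (simp add: area_def)

lemma dens_nonneg: "0 \<le> dens r" using area_pos by (simp add: dens_def indicator_def)

lemma dens_measurable [measurable]: "dens \<in> borel_measurable borel" unfolding dens_def by measurable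

lemma norm_measurable: "norm \<in> LM \<rightarrow>\<^sub>M borel" by (intro measurable_borel_dom) simp

lemma volume_ball: "0 \<le> r ==> emeasure lborel (ball (0::real^'d) r) = ennreal (unit_ball_vol (real dm) * r ^ dm)"
 "0 \<le> r ==> emeasure lborel (cball (0::real^'d) r) = ennreal (unit_ball_vol (real dm) * r ^ dm)"
 by (simp_all add: emeasure_ball emeasure_cball dm_def)

text \<open>Finite values on the tails {a<..} determine a Borel measure on the line, so they suffice
  for \<open>distr_norm\<close>. Clamping a to [0, rad] covers full and empty tails in one
  formula.\<close>

lemma emeasure_norm_greater:
 "emeasure LM {x\<in>X. a < norm x} = ennreal (unit_ball_vol (real dm) * (rad ^ dm - (min (max a 0) rad) ^ dm))"
proof -
 have sub: "{x\<in>X. a < norm x} \<in> sets lborel" "{x\<in>X. a < norm x} \<subseteq> X"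
 proof -
  have "{x\<in>X. a < norm x} = X \<inter> {x. a < norm x}" by auto
  moreover have "open {x::real^'d. a < norm x}" by (intro open_Collect_less continuous_intros)
  ultimately have "open {x\<in>X. a < norm x}" using open_dom by auto
  then show "{x\<in>X. a < norm x} \<in> sets lborel" by simp
 qed auto
 have e: "emeasure LM {x\<in>X. a < norm x} = emeasure lborel {x\<in>X. a < norm x}"
  using sub by (simp add: emeasure_restrict_space)
 consider "a < 0" | "0 \<le> a" "a \<le> rad" | "rad < a" by linarith
 then show ?thesis
 proof cases
  case 1
  have "a < norm x" for x :: "real^'d" using 1 norm_ge_zero[of x] by linarith
  then have "{x\<in>X. a < norm x} = ball 0 rad" by (auto simp: ball)
  then show ?thesis unfolding e using 1 rad volume_ball(1)[of rad] dm_pos by (simp add: zero_power)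
 next
  case 2
  have "{x\<in>X. a < norm x} = ball 0 rad - cball 0 a" by (auto simp: ball)
  moreover have "emeasure lborel (ball (0::real^'d) rad - cball 0 a) = emeasure lborel (ball (0::real^'d) rad) - emeasure lborel (ball (0::real^'d) rad \<inter> cball 0 a)"
  proof -
   have fin: "emeasure lborel (ball (0::real^'d) rad \<inter> cball 0 a) \<noteq> \<infinity>"
    using emeasure_mono[of "ball (0::real^'d) rad \<inter> cball 0 a" "ball 0 rad" lborel] volume_ball(1)[of rad] rad
    by (auto simp: top_unique)
   have "ball (0::real^'d) rad - cball 0 a = ball 0 rad - (ball 0 rad \<inter> cball 0 a)" by blast
   then show ?thesis using emeasure_Diff[OF fin, of "ball 0 rad"] by simp
  qed
  moreover have "emeasure lborel (ball (0::real^'d) rad \<inter> cball 0 a) = ennreal (unit_ball_vol (real dm) * a ^ dm)"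
  proof (cases "a = rad")
   case True
   then have "ball (0::real^'d) rad \<inter> cball 0 a = ball 0 rad" by auto
   then show ?thesis using volume_ball(1)[of rad] rad True by simp
  next
   case False
   then have "ball (0::real^'d) rad \<inter> cball 0 a = cball 0 a" using 2 by auto
   then show ?thesis using volume_ball(2)[of a] 2 by simp
  qed
  ultimately show ?thesis unfolding e using 2 rad volume_ball(1)[of rad]
   by (simp add: ennreal_minus min_absorb1 right_diff_distrib)
 next
  case 3
  then have "{x\<in>X. a < norm x} = {}" by (auto simp: ball)
  then have "emeasure lborel {x\<in>X. a < norm x} = 0" by (simp only: emeasure_empty)
  then show ?thesis unfolding e using 3 rad by (simp add: min_def max_def)
 qed
qed

text \<open>Polar coordinates for radial integrands, obtained from the volume of balls and the
  fundamental theorem of calculus.\<close>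

lemma distr_norm: "distr LM borel norm = density lborel (\<lambda>r. ennreal (dens r))"
proof (rule measure_eqI_lessThan)
 have D: "emeasure (distr LM borel norm) {a<..} = ennreal (unit_ball_vol (real dm) * (rad ^ dm - (min (max a 0) rad) ^ dm))" for a
 proof -
  have "norm -` {a<..} \<inter> space LM = {x\<in>X. a < norm x}" by auto
  then show ?thesis using norm_measurable by (subst emeasure_distr) (auto simp: emeasure_norm_greater)
 qed
 then show "emeasure (distr LM borel norm) {a<..} < \<infinity>" for a by simp
 show "emeasure (distr LM borel norm) {a<..} = emeasure (density lborel (\<lambda>r. ennreal (dens r))) {a<..}" for a
 proof -
  let ?b = "min (max a 0) rad"
  have "emeasure (density lborel (\<lambda>r. ennreal (dens r))) {a<..} = (\<integral>\<^sup>+ r. ennreal (dens r) * indicator {a<..} r \<partial>lborel)"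
   by (rule emeasure_density) auto
  also have "\<dots> = (\<integral>\<^sup>+ r. ennreal (area * r ^ (dm - 1)) * indicator {?b..rad} r \<partial>lborel)"
  proof (rule nn_integral_cong_AE)
   have "AE r in lborel. r \<notin> {?b, rad}" by (rule AE_not_in) (auto intro: finite_imp_null_set_lborel)
   then show "AE r in lborel. ennreal (dens r) * indicator {a<..} r = ennreal (area * r ^ (dm - 1)) * indicator {?b..rad} r"
    by eventually_elim (auto simp: dens_def indicator_def min_def max_def split: if_splits)
  qed
  also have "\<dots> = ennreal (unit_ball_vol (real dm) * rad ^ dm - unit_ball_vol (real dm) * ?b ^ dm)"
  proof (rule nn_integral_FTC_Icc)
   show "((\<lambda>r. unit_ball_vol (real dm) * r ^ dm) has_field_derivative area * r ^ (dm - 1)) (at r)" for r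
    unfolding area_def by (auto intro!: derivative_eq_intros simp: dm_pos)
   show "0 \<le> area * r ^ (dm - 1)" if "r \<in> {?b..rad}" for r
   proof -
    have "0 \<le> ?b" using rad by simp
    then have "0 \<le> r" using that by auto
    then show ?thesis using area_pos by simp
   qed
  qed auto
  finally show ?thesis unfolding D by (simp add: right_diff_distrib)
 qed
qed auto

lemma radial_integrable:
 fixes h :: "real \<Rightarrow> real"
 assumes "h \<in> borel_measurable borel"
 shows "integrable LM (\<lambda>x. h (norm x)) \<longleftrightarrow> integrable lborel (\<lambda>r. dens r * h r)"
proof -
 have "integrable LM (\<lambda>x. h (norm x)) \<longleftrightarrow> integrable (distr LM borel norm) h"
  by (rule integrable_distr_eq[symmetric, OF norm_measurable assms])
 also have "\<dots> \<longleftrightarrow> integrable lborel (\<lambda>r. dens r * h r)"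
  unfolding distr_norm using assms by (subst integrable_density) (auto simp: dens_nonneg)
 finally show ?thesis .
qed

lemma radial_integral:
 fixes h :: "real \<Rightarrow> real"
 assumes "h \<in> borel_measurable borel"
 shows "(LINT x|LM. h (norm x)) = (LINT r|lborel. dens r * h r)"
proof -
 have "(LINT x|LM. h (norm x)) = integral\<^sup>L (distr LM borel norm) h"
  by (rule integral_distr[symmetric, OF norm_measurable assms])
 also have "\<dots> = (LINT r|lborel. dens r * h r)"
  unfolding distr_norm using assms by (subst integral_density) (auto simp: dens_nonneg)
 finally show ?thesis .
qed

text \<open>The image of Lebesgue measure under the norm has a density, so exceptional radii of
  measure 0 give exceptional points of measure 0.\<close>

lemma AE_radial:
 assumes "AE r in lborel. r \<in> {0<..<rad} \<longrightarrow> Pr r"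
 shows "AE x in LM. Pr (norm x)"
proof -
 have "AE r in lborel. 0 < ennreal (dens r) \<longrightarrow> Pr r"
  using assms by eventually_elim (auto simp: dens_def indicator_def split: if_splits)
 then have "AE r in distr LM borel norm. Pr r" unfolding distr_norm by (subst AE_density) auto
 then show ?thesis by (rule AE_distrD[OF norm_measurable])
qed

lemma AE_norm_neq: "AE x in LM. norm x \<noteq> a"
proof (rule AE_radial)
 have "AE r in lborel. r \<notin> {a}" by (rule AE_not_in) (auto intro: finite_imp_null_set_lborel)
 then show "AE r in lborel. r \<in> {0<..<rad} \<longrightarrow> r \<noteq> a" by eventually_elim auto
qed

text \<open>A density annihilating all concentric balls annihilates every radial function: its positive and negative parts
 have the same image under the norm.\<close>

lemma radial_annihilator:
 fixes w :: "real^'d \<Rightarrow> real"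
 assumes w: "integrable LM w" and z: "\<And>s. 0 < s ==> s < rad ==> (LINT x|LM. indicator {..<s} (norm x) * w x) = 0"
  and h: "h \<in> borel_measurable borel" and hw: "integrable LM (\<lambda>x. h (norm x) * w x)"
 shows "(LINT x|LM. h (norm x) * w x) = 0"
proof -
 note nm = norm_measurable
 have iw: "integrable LM (\<lambda>x. indicator A (norm x) * w x)" if "A \<in> sets borel" for A
 proof (rule L1_bound[OF w])
  have "(\<lambda>x. indicator A (norm x) :: real) \<in> borel_measurable LM" by (rule measurable_compose[OF nm]) (use that in auto)
  then show "(\<lambda>x. indicator A (norm x) * w x) \<in> borel_measurable LM" using w by measurable
 qed (auto simp: indicator_def)
 \<comment> \<open>The hypothesis stops short of s = rad, so the integral over the whole ball is
   reached as a limit of smaller balls.\<close>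
 have tot: "(LINT x|LM. w x) = 0"
 proof -
  define s where "s n = rad * (real n + 1) / (real n + 2)" for n :: nat
  have s: "0 < s n" "s n < rad" for n
  proof -
   show "0 < s n" unfolding s_def using rad by (intro divide_pos_pos mult_pos_pos) auto
   show "s n < rad" unfolding s_def using rad by (simp add: field_simps)
  qed
  have sl: "s \<longlonglongrightarrow> rad"
  proof -
   have "(\<lambda>n. rad * (1 - inverse (real (n + 2)))) \<longlonglongrightarrow> rad * (1 - 0)"
    by (intro tendsto_intros LIMSEQ_ignore_initial_segment[OF lim_inverse_n])
   moreover have "s = (\<lambda>n. rad * (1 - inverse (real (n + 2))))" by (auto simp: s_def field_simps)
   ultimately show ?thesis by simp
  qed
  have "(\<lambda>n. LINT x|LM. indicator {..<s n} (norm x) * w x) \<longlonglongrightarrow> (LINT x|LM. w x)"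
  proof (rule integral_dominated_convergence[where w="\<lambda>x. norm (w x)"])
   show "AE x in LM. (\<lambda>n. indicator {..<s n} (norm x) * w x) \<longlonglongrightarrow> w x"
   proof (rule AE_I2)
    fix x assume "x \<in> space LM"
    then have "norm x < rad" by (simp add: ball)
    from order_tendstoD(1)[OF sl this] have "\<forall>\<^sub>F n in sequentially. indicator {..<s n} (norm x) * w x = w x"
     by eventually_elim simp
    then show "(\<lambda>n. indicator {..<s n} (norm x) * w x) \<longlonglongrightarrow> w x" by (rule tendsto_eventually)
   qed
   show "AE x in LM. norm (indicator {..<s n} (norm x) * w x) \<le> norm (w x)" for n by (auto simp: indicator_def)
  qed (use iw w in \<open>auto intro: borel_measurable_integrable\<close>)
  then show ?thesis using z[OF s] by (simp add: LIMSEQ_const_iff)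
 qed
 have gt: "(LINT x|LM. indicator {a<..} (norm x) * w x) = 0" for a
 proof -
  have lt: "(LINT x|LM. indicator {..<a} (norm x) * w x) = 0"
  proof -
   consider "a \<le> 0" | "0 < a" "a < rad" | "rad \<le> a" by linarith
   then show ?thesis
   proof cases
    case 1
    have "(\<lambda>x. indicator {..<a} (norm x) * w x) = (\<lambda>x. 0)"
    proof
     fix x :: "real^'d"
     have "\<not> norm x < a" using 1 norm_ge_zero[of x] by linarith
     then show "indicator {..<a} (norm x) * w x = 0" by simp
    qed
    then show ?thesis by simp
   next
    case 3
    have "(LINT x|LM. indicator {..<a} (norm x) * w x) = (LINT x|LM. w x)"
     by (rule lint_cong) (use 3 in \<open>auto simp: ball indicator_def\<close>)
    then show ?thesis using tot by simp
   qed (rule z)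
  qed
  have "(LINT x|LM. indicator {a<..} (norm x) * w x) = (LINT x|LM. w x - indicator {..<a} (norm x) * w x)"
  proof (rule integral_cong_AE)
   show "AE x in LM. indicator {a<..} (norm x) * w x = w x - indicator {..<a} (norm x) * w x"
    using AE_norm_neq[of a] by eventually_elim (auto simp: indicator_def)
  qed (intro borel_measurable_integrable iw L1_diff w; simp)+
  also have "\<dots> = 0" using tot lt w iw by simp
  finally show ?thesis .
 qed
 define P where "P = distr (density LM (\<lambda>x. ennreal (max (w x) 0))) borel norm"
 define N where "N = distr (density LM (\<lambda>x. ennreal (max (- w x) 0))) borel norm"
 have wm[measurable]: "w \<in> borel_measurable LM" using w by auto
 have ip: "integrable LM (\<lambda>x. max (w x) 0)" and in': "integrable LM (\<lambda>x. max (- w x) 0)" using w by auto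
 have em: "emeasure (distr (density LM (\<lambda>x. ennreal (v x))) borel norm) {a<..} = ennreal (LINT x|LM. indicator {a<..} (norm x) * v x)"
  if v: "integrable LM v" "\<And>x. 0 \<le> v x" for v a
 proof -
  have nd: "norm \<in> density LM (\<lambda>x. ennreal (v x)) \<rightarrow>\<^sub>M borel" using nm by simp
  have "emeasure (distr (density LM (\<lambda>x. ennreal (v x))) borel norm) {a<..} = (\<integral>\<^sup>+x. ennreal (v x) * indicator (norm -` {a<..} \<inter> space LM) x \<partial>LM)"
  proof -
   have "norm -` {a<..} \<inter> space LM \<in> sets LM" by (rule measurable_sets[OF nm]) auto
   then show ?thesis using v by (subst emeasure_distr[OF nd]) (auto intro!: emeasure_density)
  qed
  also have "\<dots> = (\<integral>\<^sup>+x. ennreal (indicator {a<..} (norm x) * v x) \<partial>LM)"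
   by (rule nn_integral_cong) (auto simp: indicator_def)
  also have "\<dots> = ennreal (LINT x|LM. indicator {a<..} (norm x) * v x)"
  proof (rule nn_integral_eq_integral)
   show "integrable LM (\<lambda>x. indicator {a<..} (norm x) * v x)"
   proof (rule L1_bound[OF v(1)])
    have "(\<lambda>x. indicator {a<..} (norm x) :: real) \<in> borel_measurable LM" by (rule measurable_compose[OF nm]) auto
    then show "(\<lambda>x. indicator {a<..} (norm x) * v x) \<in> borel_measurable LM" using v(1) by measurable
   qed (auto simp: indicator_def)
  qed (use v in auto)
  finally show ?thesis .
 qed
 have PN: "P = N" unfolding P_def N_def
 proof (rule measure_eqI_lessThan)
  fix a
  show "emeasure (distr (density LM (\<lambda>x. ennreal (max (w x) 0))) borel norm) {a<..} < \<infinity>" by (subst em[OF ip]) auto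
  have i1: "integrable LM (\<lambda>x. indicator {a<..} (norm x) * max (w x) 0)" "integrable LM (\<lambda>x. indicator {a<..} (norm x) * max (- w x) 0)"
  proof -
   have m: "(\<lambda>x. indicator {a<..} (norm x) :: real) \<in> borel_measurable LM" by (rule measurable_compose[OF nm]) auto
   show "integrable LM (\<lambda>x. indicator {a<..} (norm x) * max (w x) 0)"
    by (rule L1_bound[OF ip]) (use m in \<open>auto simp: indicator_def\<close>)
   show "integrable LM (\<lambda>x. indicator {a<..} (norm x) * max (- w x) 0)"
    by (rule L1_bound[OF in']) (use m in \<open>auto simp: indicator_def\<close>)
  qed
  have "(LINT x|LM. indicator {a<..} (norm x) * max (w x) 0) - (LINT x|LM. indicator {a<..} (norm x) * max (- w x) 0) = (LINT x|LM. indicator {a<..} (norm x) * w x)"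
   unfolding lint_diff[OF i1, symmetric]
   by (rule lint_cong) (auto simp: max_def)
  then have "(LINT x|LM. indicator {a<..} (norm x) * max (w x) 0) = (LINT x|LM. indicator {a<..} (norm x) * max (- w x) 0)" using gt[of a] by simp
  then show "emeasure (distr (density LM (\<lambda>x. ennreal (max (w x) 0))) borel norm) {a<..} =
    emeasure (distr (density LM (\<lambda>x. ennreal (max (- w x) 0))) borel norm) {a<..}"
   by (subst em[OF ip], simp, subst em[OF in'], auto)
 qed auto
 have int: "integral\<^sup>L (distr (density LM (\<lambda>x. ennreal (v x))) borel norm) h = (LINT x|LM. v x * h (norm x))"
  if v: "v \<in> borel_measurable LM" "\<And>x. 0 \<le> v x" for v
 proof -
  have nd: "norm \<in> density LM (\<lambda>x. ennreal (v x)) \<rightarrow>\<^sub>M borel" using nm by simp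
  have "(\<lambda>x. h (norm x)) \<in> borel_measurable LM" by (rule measurable_compose[OF nm h])
  then show ?thesis using v by (subst integral_distr[OF nd h]) (auto simp: integral_density)
 qed
 have hm: "(\<lambda>x. h (norm x)) \<in> borel_measurable LM" by (rule measurable_compose[OF nm h])
 have i2: "integrable LM (\<lambda>x. max (w x) 0 * h (norm x))" "integrable LM (\<lambda>x. max (- w x) 0 * h (norm x))"
 proof -
  have m: "\<bar>max y 0 * z\<bar> \<le> \<bar>z * y\<bar>" "\<bar>max (- y) 0 * z\<bar> \<le> \<bar>z * y\<bar>" for y z :: real
   by (auto simp: abs_mult max_def mult.commute mult_nonneg_nonpos2 intro: order_trans[OF mult_nonneg_nonpos2])
  show "integrable LM (\<lambda>x. max (w x) 0 * h (norm x))"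
   by (rule L1_bound[OF hw]) (use hm m in auto)
  show "integrable LM (\<lambda>x. max (- w x) 0 * h (norm x))"
   by (rule L1_bound[OF hw]) (use hm m in auto)
 qed
 have "(LINT x|LM. h (norm x) * w x) = (LINT x|LM. max (w x) 0 * h (norm x)) - (LINT x|LM. max (- w x) 0 * h (norm x))"
  unfolding lint_diff[OF i2, symmetric]
  by (rule lint_cong) (auto simp: max_def)
 also have "\<dots> = integral\<^sup>L P h - integral\<^sup>L N h"
  unfolding P_def N_def by (subst int, auto, subst int, auto)
 finally show ?thesis using PN by simp
qed

lemma e_r_norm: "norm (e_r (x::real^'d)) = (if x = 0 then 0 else 1)" by (simp add: e_r_def)

lemma e_r_measurable: "(e_r :: real^'d \<Rightarrow> real^'d) \<in> borel_measurable borel"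
 unfolding e_r_def by measurable

lemma C_k_norm_sq: "C_k k (\<lambda>x::real^'d. (norm x)^2)" using C_k_sqdist[of k 0] by simp

text \<open>The test functions P k (s^2 - |x|^2) have gradients - 2 p k (s^2 - |x|^2) x. As the
  derivatives of the smooth ramps tend to the indicator of the positive axis, x . \<tau> integrates
  to 0 over every concentric ball. The annihilator lemma with the profile h(r) / r then yields
  orthogonality to h(r) e_r.\<close>

lemma radial_div_free:
 fixes \<tau> :: "real^'d \<Rightarrow> real^'d"
 assumes \<tau>: "\<tau> \<in> L2 X" "\<And>\<phi>. \<phi> \<in> test ==> (LINT x|LM. \<tau> x \<bullet> grad \<phi> x) = 0"
  and h: "h \<in> borel_measurable borel" "(\<lambda>x. h (norm x)) \<in> L2 X"
 shows "(LINT x|LM. (h (norm x) *\<^sub>R e_r x) \<bullet> \<tau> x) = 0"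
proof -
 have i\<tau>: "integrable LM \<tau>" by (rule L2_imp_integrable[OF lmeas \<tau>(1)])
 have w: "integrable LM (\<lambda>x. x \<bullet> \<tau> x)"
 proof (rule L1_bound[of _ "\<lambda>x. rad * norm (\<tau> x)"])
  have "(\<lambda>x. x) \<in> borel_measurable LM" by (intro measurable_borel_dom) simp
  then show "(\<lambda>x. x \<bullet> \<tau> x) \<in> borel_measurable LM" using L2_D(1)[OF \<tau>(1)] by measurable
  show "AE x in LM. norm (x \<bullet> \<tau> x) \<le> norm (rad * norm (\<tau> x))"
   by (rule AE_I2) (use rad in \<open>auto simp: ball abs_mult intro!: order_trans[OF Cauchy_Schwarz_ineq2] mult_right_mono\<close>)
 qed (use i\<tau> in auto)
 obtain P p where P: "\<And>k::nat. smooth_real (P k)" "\<And>k s. (P k has_real_derivative p k s) (at s)"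
  "\<And>k s. s \<le> 0 ==> P k s = 0" "\<And>k s. \<bar>P k s\<bar> \<le> \<bar>s\<bar>" "\<And>k s. \<bar>p k s\<bar> \<le> 2"
  "\<And>s. (\<lambda>k. P k s) \<longlonglongrightarrow> max s 0" "\<And>s. (\<lambda>k. p k s) \<longlonglongrightarrow> (if s > 0 then 1 else 0)"
  by (rule smooth_ramp) blast
 have z: "(LINT x|LM. indicator {..<s} (norm x) * (x \<bullet> \<tau> x)) = 0" if s: "0 < s" "s < rad" for s
 proof -
  have zk: "(LINT x|LM. p k (s^2 - (norm x)^2) * (x \<bullet> \<tau> x)) = 0" for k
  proof -
   define \<phi> where "\<phi> x = P k (s\<^sup>2 + (- 1) * (norm x)\<^sup>2)" for x :: "real^'d"
   have "\<phi> \<in> test"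
   proof (rule test_functions_I[of _ "cball 0 s"])
    show "C_k j \<phi>" for j unfolding \<phi>_def
     by (rule C_k_compose[OF P(1) C_k_add[OF C_k_const C_k_mult[OF C_k_const C_k_norm_sq]]])
    show "cball 0 s \<subseteq> X" using s by (auto simp: ball)
    fix x :: "real^'d" assume "x \<notin> cball 0 s"
    then have "s^2 \<le> (norm x)^2" using s by (intro power_mono) auto
    then show "\<phi> x = 0" unfolding \<phi>_def by (intro P(3)) simp
   qed simp
   moreover have "grad \<phi> x = (- 2 * p k (s\<^sup>2 - (norm x)\<^sup>2)) *\<^sub>R x" for x
   proof (rule grad_eqI)
    have "((\<lambda>x. s\<^sup>2 + (- 1) * (norm x)\<^sup>2) has_derivative (\<lambda>v. - 2 * (x \<bullet> v))) (at x)"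
     unfolding power2_norm_eq_inner by (auto intro!: derivative_eq_intros simp: inner_commute)
    from has_derivative_compose[OF this P(2)[of k, unfolded has_field_derivative_def]]
    show "(\<phi> has_derivative (\<lambda>v. ((- 2 * p k (s\<^sup>2 - (norm x)\<^sup>2)) *\<^sub>R x) \<bullet> v)) (at x)"
     unfolding \<phi>_def by (simp add: mult_ac)
   qed
   ultimately have "(LINT x|LM. (- 2) * (p k (s\<^sup>2 - (norm x)\<^sup>2) * (x \<bullet> \<tau> x))) = 0"
    using \<tau>(2)[of \<phi>] by (simp add: inner_commute mult.assoc)
   then show ?thesis by simp
  qed
  have pm: "(\<lambda>x::real^'d. p k (s^2 - (norm x)^2)) \<in> borel_measurable LM" for k
  proof -
   have "smooth_real (p k)" by (rule smooth_real_deriv[OF P(1,2)])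
   from smooth_real_continuous_on[OF this]
   have "continuous_on UNIV (\<lambda>x::real^'d. p k (s^2 - (norm x)^2))"
    by (rule continuous_on_compose2) (auto intro!: continuous_intros)
   then show ?thesis by (rule continuous_measurable_dom)
  qed
  have "(\<lambda>k. LINT x|LM. p k (s^2 - (norm x)^2) * (x \<bullet> \<tau> x)) \<longlonglongrightarrow> (LINT x|LM. indicator {..<s} (norm x) * (x \<bullet> \<tau> x))"
  proof (rule integral_dominated_convergence[where w="\<lambda>x. 2 * norm (x \<bullet> \<tau> x)"])
   show "AE x in LM. (\<lambda>k. p k (s^2 - (norm x)^2) * (x \<bullet> \<tau> x)) \<longlonglongrightarrow> indicator {..<s} (norm x) * (x \<bullet> \<tau> x)"
   proof (intro AE_I2 tendsto_mult tendsto_const)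
    fix x :: "real^'d"
    have "0 < s^2 - (norm x)^2 \<longleftrightarrow> norm x < s" using s power2_less_imp_less[of "norm x" s] power_strict_mono[of "norm x" s 2] by auto
    then show "(\<lambda>k. p k (s^2 - (norm x)^2)) \<longlonglongrightarrow> indicator {..<s} (norm x)"
     using P(7)[of "s^2 - (norm x)^2"] by (simp add: indicator_def of_bool_def)
   qed
   show "AE x in LM. norm (p k (s^2 - (norm x)^2) * (x \<bullet> \<tau> x)) \<le> 2 * norm (x \<bullet> \<tau> x)" for k
    using P(5) by (intro AE_I2) (auto simp: abs_mult intro!: mult_right_mono)
   have "(\<lambda>x::real^'d. indicator {..<s} (norm x) :: real) \<in> borel_measurable LM" by (rule measurable_compose[OF norm_measurable]) auto
   then show "(\<lambda>x. indicator {..<s} (norm x) * (x \<bullet> \<tau> x)) \<in> borel_measurable LM" using w by measurable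
   show "(\<lambda>x. p k (s^2 - (norm x)^2) * (x \<bullet> \<tau> x)) \<in> borel_measurable LM" for k using pm w by measurable
  qed (use w in auto)
  then show ?thesis using zk by (simp add: LIMSEQ_const_iff)
 qed
 have eq: "(h (norm x) *\<^sub>R e_r x) \<bullet> \<tau> x = (h (norm x) / norm x) * (x \<bullet> \<tau> x)" for x by (simp add: e_r_def)
 have hL: "(\<lambda>x. h (norm x) *\<^sub>R e_r x) \<in> L2 X"
 proof (rule L2_bound[OF _ h(2)])
  show "(\<lambda>x. h (norm x) *\<^sub>R e_r x) \<in> borel_measurable LM" using L2_D(1)[OF h(2)] measurable_borel_dom[OF e_r_measurable] by measurable
 qed (auto simp: e_r_norm)
 have "(LINT x|LM. (\<lambda>r. h r / r) (norm x) * (x \<bullet> \<tau> x)) = 0"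
 proof (rule radial_annihilator[OF w z])
  show "(\<lambda>r. h r / r) \<in> borel_measurable borel" using h(1) by measurable
  show "integrable LM (\<lambda>x. h (norm x) / norm x * (x \<bullet> \<tau> x))" using L2_inner_integrable[OF hL \<tau>(1)] unfolding eq .
 qed
 then show ?thesis unfolding eq .
qed

end

section \<open>Fluxes of concentric balls\<close>

lemma lipschitz_mult_bounded:
 fixes f g :: "'a::metric_space \<Rightarrow> real"
 assumes f: "Lf-lipschitz_on UNIV f" "\<And>x. \<bar>f x\<bar> \<le> Cf" and g: "Lg-lipschitz_on UNIV g" "\<And>x. \<bar>g x\<bar> \<le> Cg"
 shows "(Cf * Lg + Cg * Lf)-lipschitz_on UNIV (\<lambda>x. f x * g x)"
proof (rule lipschitz_onI)
 fix x y
 have "f x * g x - f y * g y = f x * (g x - g y) + g y * (f x - f y)" by (simp add: algebra_simps)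
 then have "\<bar>f x * g x - f y * g y\<bar> \<le> \<bar>f x\<bar> * \<bar>g x - g y\<bar> + \<bar>g y\<bar> * \<bar>f x - f y\<bar>"
  using abs_triangle_ineq[of "f x * (g x - g y)" "g y * (f x - f y)"] by (simp only: abs_mult)
 also have "\<dots> \<le> Cf * (Lg * dist x y) + Cg * (Lf * dist x y)"
  using lipschitz_onD[OF f(1), of x y] lipschitz_onD[OF g(1), of x y] f(2) g(2) order_trans[OF abs_ge_zero f(2)] order_trans[OF abs_ge_zero g(2)]
  by (intro add_mono mult_mono) (auto simp: dist_real_def)
 finally show "dist (f x * g x) (f y * g y) \<le> (Cf * Lg + Cg * Lf) * dist x y" by (simp add: dist_real_def algebra_simps)
next
 have "0 \<le> Cf" "0 \<le> Cg" using order_trans[OF abs_ge_zero f(2)] order_trans[OF abs_ge_zero g(2)] by auto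
 then show "0 \<le> Cf * Lg + Cg * Lf" using lipschitz_on_nonneg[OF f(1)] lipschitz_on_nonneg[OF g(1)] by simp
qed

text \<open>The radial factor of the flux generated by the indicator function of \<open>(0, s)\<close>.\<close>

definition cutoff :: "nat \<Rightarrow> real \<Rightarrow> real^'d::finite \<Rightarrow> real" where
 "cutoff n s x = (s / max (norm x) s) ^ n"

lemma cutoff_bounds: "s > 0 ==> 0 \<le> cutoff n s x \<and> cutoff n s x \<le> 1"
 unfolding cutoff_def by (auto intro!: power_le_one)

text \<open>\<open>cutoff\<close> has a kink on the sphere of radius s, so the divergence
  computation rests on Lipschitz continuity and differentiability off the sphere. The constant
  combines |a^n - b^n| \<le> n |a - b| on [0, 1] with the Lipschitz constant 1 / s of the
  base.\<close>

lemma cutoff_lipschitz: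
 assumes s: "s > 0" shows "(real n / s)-lipschitz_on UNIV (cutoff n s)"
proof (rule lipschitz_onI)
 fix x y :: "real^'d"
 let ?a = "s / max (norm x) s" and ?b = "s / max (norm y) s"
 have ab: "0 \<le> ?a" "?a \<le> 1" "0 \<le> ?b" "?b \<le> 1" using s by auto
 have pw: "\<bar>a ^ n - b ^ n\<bar> \<le> real n * \<bar>a - b\<bar>" if "0 \<le> a" "a \<le> 1" "0 \<le> b" "b \<le> 1" for a b :: real
 proof (induction n)
  case (Suc n)
  have "a ^ Suc n - b ^ Suc n = a * (a ^ n - b ^ n) + b ^ n * (a - b)" by (simp add: algebra_simps)
  then have "\<bar>a ^ Suc n - b ^ Suc n\<bar> \<le> \<bar>a\<bar> * \<bar>a ^ n - b ^ n\<bar> + \<bar>b ^ n\<bar> * \<bar>a - b\<bar>"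
   using abs_triangle_ineq[of "a * (a ^ n - b ^ n)" "b ^ n * (a - b)"] by (simp only: abs_mult)
  also have "\<dots> \<le> 1 * (real n * \<bar>a - b\<bar>) + 1 * \<bar>a - b\<bar>"
   using Suc that by (intro add_mono mult_mono) (auto simp: power_abs[symmetric] power_le_one)
  finally show ?case by (simp add: algebra_simps)
 qed simp
 have "\<bar>?a - ?b\<bar> \<le> \<bar>norm x - norm y\<bar> / s"
 proof -
  let ?p = "max (norm x) s" and ?q = "max (norm y) s"
  have pq: "s \<le> ?p" "s \<le> ?q" "0 < ?p" "0 < ?q" using s by auto
  have "\<bar>?a - ?b\<bar> = s * \<bar>?q - ?p\<bar> / (?p * ?q)" 
  proof -
   have "?a - ?b = s * (?q - ?p) / (?p * ?q)" using pq by (simp add: diff_frac_eq right_diff_distrib mult.commute)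
   then have "\<bar>?a - ?b\<bar> = \<bar>s\<bar> * \<bar>?q - ?p\<bar> / (\<bar>?p\<bar> * \<bar>?q\<bar>)" by (simp only: abs_mult abs_divide)
   then show ?thesis using pq(3,4) s by (simp only: abs_of_pos)
  qed
  also have "\<dots> \<le> s * \<bar>?q - ?p\<bar> / (s * s)" using pq s by (intro divide_left_mono mult_mono) auto
  also have "\<dots> = \<bar>?q - ?p\<bar> / s" using s by simp
  also have "\<dots> \<le> \<bar>norm x - norm y\<bar> / s" using s by (intro divide_right_mono) auto
  finally show ?thesis .
 qed
 also have "\<dots> \<le> dist x y / s" using s by (intro divide_right_mono) (auto simp: dist_norm norm_triangle_ineq3)
 finally have "real n * \<bar>?a - ?b\<bar> \<le> real n * (dist x y / s)" by (intro mult_left_mono) auto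
 then show "dist (cutoff n s x) (cutoff n s y) \<le> real n / s * dist x y"
  using pw[OF ab] by (simp add: cutoff_def dist_real_def)
qed (use s in simp)

context ball_domain
begin

text \<open>The divergence of \<open>x \<mapsto> cutoff s x *\<^sub>R x\<close> is \<open>dm\<close> inside the ball of radius \<open>s\<close> and vanishes outside.\<close>

lemma cutoff_divergence:
 assumes s: "0 < s" and t: "\<phi> \<in> test"
 shows "(LINT x|LM. cutoff dm s x * (x \<bullet> grad \<phi> x)) = - real dm * (LINT x|LM. indicator {..<s} (norm x) * \<phi> x)"
proof -
 \<comment> \<open>Almost everywhere the i-th partial derivative of cutoff(x) x_i \<phi>(x); the
   last term comes from differentiating (s / |x|)^dm outside the ball of radius s.\<close>
 define D where "D i x = cutoff dm s x * (grad \<phi> x \<bullet> axis i 1 * (x $ i) + \<phi> x) +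
   (if s < norm x then - real dm * (s / norm x) ^ dm * (x $ i)\<^sup>2 / (norm x)\<^sup>2 * \<phi> x else 0)" for i :: 'd and x
 have cm: "(cutoff dm s :: real^'d \<Rightarrow> real) \<in> borel_measurable borel"
  by (intro borel_measurable_continuous_onI lipschitz_on_continuous_on[OF cutoff_lipschitz[OF s]])
 have \<phi>m: "\<phi> \<in> borel_measurable borel" by (intro borel_measurable_continuous_onI test_continuous[OF t])
 have gm: "(\<lambda>x. grad \<phi> x \<bullet> c) \<in> borel_measurable borel" for c by (intro borel_measurable_continuous_onI test_continuous[OF test_dir_deriv[OF t]])
 have xm: "(\<lambda>x::real^'d. x $ i) \<in> borel_measurable borel" for i
  by (intro borel_measurable_continuous_onI) (auto intro!: continuous_intros)
 have xgm: "(\<lambda>x. x \<bullet> grad \<phi> x) \<in> borel_measurable borel"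
  by (intro borel_measurable_continuous_onI continuous_on_inner continuous_on_id test_grad_continuous[OF t])
 have Dm: "D i \<in> borel_measurable borel" for i
  unfolding D_def using cm \<phi>m gm xm by measurable
 have zero: "integral\<^sup>L lebesgue (D i) = 0" for i
 proof -
  have t1: "(\<lambda>x. (x \<bullet> axis i 1) * \<phi> x) \<in> test" by (rule test_mult_smooth[OF t C_k_inner])
  obtain L where L: "L-lipschitz_on UNIV (\<lambda>x. (x \<bullet> axis i 1) * \<phi> x)" using test_lipschitz[OF t1] .
  obtain C where C: "C > 0" "\<And>x. \<bar>(x \<bullet> axis i 1) * \<phi> x\<bar> \<le> C" using test_bounded[OF t1] by metis
  obtain r where r: "\<And>x. norm x \<ge> r ==> (x \<bullet> axis i 1) * \<phi> x = 0" using test_support_bounded t1 by metis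
  have lip: "(1 * L + C * (real dm / s))-lipschitz_on UNIV (\<lambda>x. cutoff dm s x * ((x \<bullet> axis i 1) * \<phi> x))"
  proof (rule lipschitz_mult_bounded[OF cutoff_lipschitz[OF s] _ L C(2)])
   show "\<bar>cutoff dm s x\<bar> \<le> 1" for x :: "real^'d" using cutoff_bounds[OF s, of dm x] by linarith
  qed
  show ?thesis
  proof (rule integral_directional_derivative_eq_0[OF lip, of r _ "axis i 1"])
   show "D i \<in> borel_measurable lebesgue" using Dm by (simp add: measurable_completion)
   show "cutoff dm s x * ((x \<bullet> axis i 1) * \<phi> x) = 0" if "norm x \<ge> r" for x using r[OF that] by simp
   have "AE x in lebesgue. x \<notin> sphere (0::real^'d) s"
    using negligible_sphere[of "0::real^'d" s] by (intro AE_not_in) (simp add: negligible_iff_null_sets)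
   then show "AE x in lebesgue. (\<lambda>n. real (Suc n) * (cutoff dm s (x + (1 / real (Suc n)) *\<^sub>R axis i 1) * ((x + (1 / real (Suc n)) *\<^sub>R axis i 1) \<bullet> axis i 1 * \<phi> (x + (1 / real (Suc n)) *\<^sub>R axis i 1)) - cutoff dm s x * (x \<bullet> axis i 1 * \<phi> x))) \<longlonglongrightarrow> D i x"
   proof eventually_elim
    case (elim x)
    have xd: "((\<lambda>x. (x \<bullet> axis i 1) * \<phi> x) has_derivative (\<lambda>v. (v \<bullet> axis i 1) * \<phi> x + (x \<bullet> axis i 1) * (grad \<phi> x \<bullet> v))) (at x)"
     by (auto intro!: derivative_eq_intros test_has_derivative[OF t])
    have "(cutoff dm s has_derivative (\<lambda>v. if s < norm x then - real dm * (s / norm x) ^ dm * (x \<bullet> v) / (norm x)\<^sup>2 else 0)) (at x)"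
    proof (cases "s < norm x")
     case True
     then have x0: "x \<noteq> 0" using s by auto
     obtain m where m: "dm = Suc m" using dm_pos gr0_implies_Suc by blast
     have nd: "(norm has_derivative (\<lambda>v. v \<bullet> sgn x)) (at x)" using GDERIV_norm[OF x0] by (simp add: gderiv_def)
     have "((\<lambda>\<rho>. s / \<rho>) has_real_derivative - s / (norm x)^2) (at (norm x))"
      using x0 by (auto intro!: derivative_eq_intros simp: power2_eq_square)
     from DERIV_power[OF this, of dm]
     have "((\<lambda>\<rho>. (s / \<rho>) ^ dm) has_real_derivative real dm * (s / norm x) ^ (dm - 1) * (- s / (norm x)\<^sup>2)) (at (norm x))"
      by (simp add: mult_ac)
     from has_derivative_compose[OF nd this[unfolded has_field_derivative_def]]
     have "((\<lambda>x::real^'d. (s / norm x) ^ dm) has_derivative (\<lambda>v. real dm * (s / norm x) ^ (dm - 1) * (- s * (sgn x \<bullet> v) / (norm x)\<^sup>2))) (at x)"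
      by (simp add: mult_ac inner_commute)
     moreover have "real dm * (s / norm x) ^ (dm - 1) * (- s * (sgn x \<bullet> v) / (norm x)\<^sup>2) = - real dm * (s / norm x) ^ dm * (x \<bullet> v) / (norm x)\<^sup>2" for v
      unfolding m by (simp add: sgn_div_norm divide_inverse mult_ac del: of_nat_Suc)
     ultimately have "((\<lambda>x::real^'d. (s / norm x) ^ dm) has_derivative (\<lambda>v. - real dm * (s / norm x) ^ dm * (x \<bullet> v) / (norm x)\<^sup>2)) (at x)" by (simp only:)
     then have "(cutoff dm s has_derivative (\<lambda>v. - real dm * (s / norm x) ^ dm * (x \<bullet> v) / (norm x)\<^sup>2)) (at x)"
      by (rule has_derivative_transform_within_open[of _ _ _ _ "{y. s < norm y}"])
       (use True in \<open>auto simp: cutoff_def max_def intro!: open_Collect_less continuous_intros\<close>)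
     then show ?thesis using True by simp
    next
     case False
     then have "norm x < s" using elim by auto
     have "((\<lambda>x::real^'d. 1) has_derivative (\<lambda>v. 0)) (at x)" by simp
     then have "(cutoff dm s has_derivative (\<lambda>v. 0)) (at x)"
      by (rule has_derivative_transform_within_open[of _ _ _ _ "{y. norm y < s}"])
       (use \<open>norm x < s\<close> s in \<open>auto simp: cutoff_def max_def intro!: open_Collect_less continuous_intros\<close>)
     then show ?thesis using False by simp
    qed
    from has_derivative_mult[OF this xd]
    have "((\<lambda>x. cutoff dm s x * ((x \<bullet> axis i 1) * \<phi> x)) has_derivative (\<lambda>v. cutoff dm s x * ((v \<bullet> axis i 1) * \<phi> x + (x \<bullet> axis i 1) * (grad \<phi> x \<bullet> v)) +
     (if s < norm x then - real dm * (s / norm x) ^ dm * (x \<bullet> v) / (norm x)\<^sup>2 else 0) * ((x \<bullet> axis i 1) * \<phi> x))) (at x)" .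
    note l = difference_quotient_tendsto[OF this, of "axis i 1"]
    have aa: "axis i 1 \<bullet> (axis i 1 :: real^'d) = 1" by (simp add: inner_axis axis_nth)
    have eq: "cutoff dm s x * ((axis i 1 \<bullet> (axis i 1 :: real^'d)) * \<phi> x + (x \<bullet> axis i 1) * (grad \<phi> x \<bullet> axis i 1)) +
     (if s < norm x then - real dm * (s / norm x) ^ dm * (x \<bullet> axis i 1) / (norm x)\<^sup>2 else 0) * ((x \<bullet> axis i 1) * \<phi> x) = D i x"
     unfolding D_def aa by (simp add: inner_axis power2_eq_square mult_ac)
    show ?case using l unfolding eq .
   qed
  qed
 qed
 have Di: "integrable LM (D i)" for i
 proof -
  obtain C where C: "C > 0" "\<And>x. \<bar>\<phi> x\<bar> \<le> C" "\<And>x. norm (grad \<phi> x) \<le> C" using test_bounded[OF t] by blast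
  have "\<bar>D i x\<bar> \<le> (C * rad + C) + real dm * C" if x: "x \<in> X" for x
  proof -
   have xr: "\<bar>x $ i\<bar> \<le> rad" using x component_le_norm_cart[of x i] by (simp add: ball)
   have g: "\<bar>grad \<phi> x \<bullet> axis i 1\<bar> \<le> C" using C(3)[of x] component_le_norm_cart[of "grad \<phi> x" i] by (simp add: inner_axis)
   have "\<bar>grad \<phi> x \<bullet> axis i 1 * (x $ i) + \<phi> x\<bar> \<le> C * rad + C"
    by (rule order_trans[OF abs_triangle_ineq]) (use xr g C in \<open>auto simp: abs_mult intro!: add_mono mult_mono\<close>)
   then have 1: "\<bar>cutoff dm s x * (grad \<phi> x \<bullet> axis i 1 * (x $ i) + \<phi> x)\<bar> \<le> 1 * (C * rad + C)"
    unfolding abs_mult using cutoff_bounds[OF s, of dm x] by (intro mult_mono) auto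
   have 2: "\<bar>if s < norm x then - real dm * (s / norm x) ^ dm * (x $ i)\<^sup>2 / (norm x)\<^sup>2 * \<phi> x else 0\<bar> \<le> real dm * C"
   proof (cases "s < norm x")
    case True
    have nx: "0 < norm x" using True s by linarith
    then have "s / norm x \<le> 1" using True by (simp add: divide_le_eq_1)
    then have "(s / norm x) ^ dm \<le> 1" using nx s by (intro power_le_one) auto
    moreover have "(x $ i)^2 / (norm x)^2 \<le> 1" using component_le_norm_cart[of x i] True s
     using abs_le_square_iff[of "x $ i" "norm x"] by (auto simp: divide_le_eq_1)
    ultimately have "(s / norm x) ^ dm * ((x $ i)^2 / (norm x)^2) * \<bar>\<phi> x\<bar> \<le> 1 * 1 * C"
     using C True s by (intro mult_mono) auto
    then have "real dm * ((s / norm x) ^ dm * ((x $ i)^2 / (norm x)^2) * \<bar>\<phi> x\<bar>) \<le> real dm * C" by (intro mult_left_mono) auto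
    then show ?thesis using True s by (simp add: abs_mult abs_divide mult.assoc)
   qed (use C in simp)
   show ?thesis unfolding D_def using abs_triangle_ineq order_trans add_mono[OF 1 2] by fastforce
  qed
  then have "D i \<in> L2 X" by (intro L2_bounded[OF lmeas measurable_borel_dom[OF Dm], of _ "(C * rad + C) + real dm * C"]) auto
  then show ?thesis by (rule L2_imp_integrable[OF lmeas])
 qed
 have "(LINT x|LM. D i x) = 0" for i
 proof -
  have "D i x = 0" if "x \<notin> X" for x
   using test_functions_D(5)[OF t that] test_functions_D(5)[OF test_dir_deriv[OF t] that] by (simp add: D_def)
  then show ?thesis using zero[of i] by (subst integral_dom_eq) auto
 qed
 then have "0 = (\<Sum>i\<in>UNIV. LINT x|LM. D i x)" by simp
 also have "\<dots> = (LINT x|LM. (\<Sum>i\<in>UNIV. D i x))" by (rule lint_sum[symmetric]) (rule Di)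
 also have "\<dots> = (LINT x|LM. cutoff dm s x * (x \<bullet> grad \<phi> x) + real dm * (indicator {..<s} (norm x) * \<phi> x))"
 proof (rule integral_cong_AE)
  \<comment> \<open>Outside the ball of radius s the two terms with the factor dm cancel, because
    the squares of the coordinates add up to |x|^2; inside, \<open>cutoff\<close> is 1.\<close>
  show "AE x in LM. (\<Sum>i\<in>UNIV. D i x) = cutoff dm s x * (x \<bullet> grad \<phi> x) + real dm * (indicator {..<s} (norm x) * \<phi> x)"
   using AE_norm_neq[of s]
  proof eventually_elim
   case (elim x)
   have 1: "(\<Sum>i\<in>UNIV. grad \<phi> x \<bullet> axis i 1 * (x $ i)) = x \<bullet> grad \<phi> x" unfolding inner_axis by (simp add: inner_vec_def mult.commute)
   have 2: "(\<Sum>i\<in>UNIV. (x $ i)^2) = (norm x)^2" unfolding power2_norm_eq_inner by (simp add: inner_vec_def power2_eq_square)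
   have S: "(\<Sum>i\<in>UNIV. D i x) = cutoff dm s x * ((\<Sum>i\<in>UNIV. grad \<phi> x \<bullet> axis i 1 * (x $ i)) + real dm * \<phi> x) +
     (if s < norm x then - real dm * (s / norm x) ^ dm * (\<Sum>i\<in>UNIV. (x $ i)\<^sup>2) / (norm x)\<^sup>2 * \<phi> x else 0)"
    unfolding D_def by (simp add: sum.distrib sum_distrib_left sum_distrib_right sum_divide_distrib sum_negf dm_def distrib_left mult_ac)
   show ?case
   proof (cases "s < norm x")
    case True
    then have "x \<noteq> 0" using s by auto
    then show ?thesis using True s unfolding S 1 2 by (simp add: cutoff_def max_def algebra_simps)
   next
    case False
    then have "norm x < s" using elim by simp
    then show ?thesis using s unfolding S 1 2 by (simp add: cutoff_def max_def algebra_simps)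
   qed
  qed
  have i: "(\<lambda>x. indicator {..<s} (norm x) :: real) \<in> borel_measurable borel" by measurable
  show "(\<lambda>x. cutoff dm s x * (x \<bullet> grad \<phi> x) + real dm * (indicator {..<s} (norm x) * \<phi> x)) \<in> borel_measurable LM"
   by (intro measurable_borel_dom borel_measurable_add borel_measurable_times borel_measurable_const cm \<phi>m i xgm)
  show "(\<lambda>x. \<Sum>i\<in>UNIV. D i x) \<in> borel_measurable LM" using Dm by (intro measurable_borel_dom) measurable
 qed
 also have "\<dots> = (LINT x|LM. cutoff dm s x * (x \<bullet> grad \<phi> x)) + real dm * (LINT x|LM. indicator {..<s} (norm x) * \<phi> x)"
 proof -
  have i1: "integrable LM (\<lambda>x. indicator {..<s} (norm x) * \<phi> x)"
  proof (rule L1_bound[OF L2_imp_integrable[OF lmeas test_L2[OF t]]])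
   have "(\<lambda>x. indicator {..<s} (norm x) :: real) \<in> borel_measurable borel" by measurable
   then show "(\<lambda>x. indicator {..<s} (norm x) * \<phi> x) \<in> borel_measurable LM" using \<phi>m by (intro measurable_borel_dom) measurable
  qed (auto simp: indicator_def)
  have i2: "integrable LM (\<lambda>x. cutoff dm s x * (x \<bullet> grad \<phi> x))"
  proof (rule L1_bound[of _ "\<lambda>x. rad * norm (grad \<phi> x)"])
   show "(\<lambda>x. cutoff dm s x * (x \<bullet> grad \<phi> x)) \<in> borel_measurable LM"
    by (intro measurable_borel_dom borel_measurable_times cm xgm)
   show "AE x in LM. norm (cutoff dm s x * (x \<bullet> grad \<phi> x)) \<le> norm (rad * norm (grad \<phi> x))"
   proof (rule AE_I2)
    fix x assume "x \<in> space LM"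
    then have "\<bar>x \<bullet> grad \<phi> x\<bar> \<le> rad * norm (grad \<phi> x)"
     by (intro order_trans[OF Cauchy_Schwarz_ineq2] mult_right_mono) (auto simp: ball)
    then have "\<bar>cutoff dm s x\<bar> * \<bar>x \<bullet> grad \<phi> x\<bar> \<le> 1 * (rad * norm (grad \<phi> x))"
     using cutoff_bounds[OF s, of dm x] by (intro mult_mono) auto
    then show "norm (cutoff dm s x * (x \<bullet> grad \<phi> x)) \<le> norm (rad * norm (grad \<phi> x))" using rad by (simp add: abs_mult)
   qed
  qed (use L2_imp_integrable[OF lmeas grad_test_L2[OF t]] in auto)
  show ?thesis using i1 i2 by simp
 qed
 finally show ?thesis by simp
qed

end

section \<open>Radial fluxes\<close>

context ball_domain
begin

lemma finite_LM: "finite_measure LM" by (rule finite_measure_lebesgue_on[OF lmeas])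

text \<open>For s up to \<open>rad\<close> this is \<open>area\<close> times the integral of
  \<rho>^(dm - 1) k(\<rho>) over (0, s), and \<open>flux\<close> is \<open>radial_flux\<close> in
  this normalization. As an integral over the ball it is open to Fubini's theorem for pairs of
  points.\<close>

definition "cum k s = (LINT y|LM. indicator {..<s} (norm y) * k (norm y))" for k :: "real \<Rightarrow> real"

definition flux :: "(real \<Rightarrow> real) \<Rightarrow> real^'d \<Rightarrow> real^'d" where
 "flux k x = (- cum k (norm x) / (area * norm x ^ (dm - 1))) *\<^sub>R e_r x"

lemma radial_measurable: "k \<in> borel_measurable borel ==> (\<lambda>x. k (norm x)) \<in> borel_measurable LM"
 by (rule measurable_compose[OF norm_measurable])

lemma pair_norm_less: "(\<lambda>p. indicator {..<fst p} (norm (snd p)) :: real) \<in> borel_measurable (borel \<Otimes>\<^sub>M LM)"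
proof -
 note [measurable] = norm_measurable
 have "(\<lambda>p::real \<times> (real^'d). if norm (snd p) < fst p then 1 else 0 :: real) \<in> borel_measurable (borel \<Otimes>\<^sub>M LM)"
  by measurable
 then show ?thesis by (simp add: indicator_def of_bool_def)
qed

lemma cum_measurable:
 assumes "k \<in> borel_measurable borel" shows "cum k \<in> borel_measurable borel"
proof -
 interpret finite_measure LM by (rule finite_LM)
 have km: "(\<lambda>p. k (norm (snd p))) \<in> borel_measurable (borel \<Otimes>\<^sub>M LM)"
  by (rule measurable_compose[OF measurable_snd radial_measurable[OF assms]])
 have "(\<lambda>(s, y). indicator {..<s} (norm y) * k (norm y)) \<in> borel_measurable (borel \<Otimes>\<^sub>M LM)"
  using borel_measurable_times[OF pair_norm_less km] by (simp add: case_prod_beta')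
 then show ?thesis unfolding cum_def[abs_def] by (rule borel_measurable_lebesgue_integral)
qed

lemma indicator_ball_integrable:
 assumes "integrable LM f" shows "integrable LM (\<lambda>x. indicator {..<s} (norm x) * f x :: real)" "integrable LM (\<lambda>x. indicator {s<..} (norm x) * f x :: real)"
proof -
 have m: "(\<lambda>x. indicator {..<s} (norm x) :: real) \<in> borel_measurable LM" "(\<lambda>x. indicator {s<..} (norm x) :: real) \<in> borel_measurable LM"
  by (rule radial_measurable, simp)+
 show "integrable LM (\<lambda>x. indicator {..<s} (norm x) * f x)"
  by (rule L1_bound[OF assms]) (use m assms in \<open>auto simp: indicator_def\<close>)
 show "integrable LM (\<lambda>x. indicator {s<..} (norm x) * f x)"
  by (rule L1_bound[OF assms]) (use m assms in \<open>auto simp: indicator_def\<close>)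
qed

lemma volume_inner_ball:
 assumes "0 \<le> s" "s \<le> rad" shows "(LINT x|LM. indicator {..<s} (norm x)) = unit_ball_vol (real dm) * s ^ dm"
proof -
 have "(LINT x|LM. indicator {..<s} (norm x) :: real) = integral\<^sup>L lebesgue (\<lambda>x::real^'d. indicator {..<s} (norm x))"
  by (rule integral_dom_eq) (use assms in \<open>auto simp: ball indicator_def\<close>)
 also have "\<dots> = integral\<^sup>L lebesgue (indicator (ball (0::real^'d) s))"
  by (rule lint_cong) (auto simp: indicator_def)
 also have "\<dots> = measure lebesgue (ball (0::real^'d) s)" by simp
 also have "\<dots> = unit_ball_vol (real dm) * s ^ dm" using content_ball[OF assms(1), of "0::real^'d"] by (simp add: dm_def)
 finally show ?thesis .
qed

text \<open>Cauchy-Schwarz on the ball of radius s. The volume factor s^dm makes the squared flux of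
  order r^(2 - dm), which is integrable at the origin.\<close>

lemma cum_bound:
 assumes k: "k \<in> borel_measurable borel" "(\<lambda>x. k (norm x)) \<in> L2 X" and s: "0 \<le> s" "s \<le> rad"
 shows "(cum k s)^2 \<le> unit_ball_vol (real dm) * s ^ dm * (l2norm X (\<lambda>x. k (norm x)))^2"
proof -
 have iL: "(\<lambda>x. indicator {..<s} (norm x) :: real) \<in> L2 X"
  by (rule L2_bounded[OF lmeas radial_measurable, of _ 1]) (auto simp: indicator_def)
 have "(l2norm X (\<lambda>x. indicator {..<s} (norm x) :: real))^2 = (LINT x|LM. indicator {..<s} (norm x))"
  unfolding l2norm_sq by (rule lint_cong) (auto simp: indicator_def)
 then have n: "(l2norm X (\<lambda>x. indicator {..<s} (norm x) :: real))^2 = unit_ball_vol (real dm) * s ^ dm" using volume_inner_ball[OF s] by simp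
 have "\<bar>cum k s\<bar> \<le> l2norm X (\<lambda>x. indicator {..<s} (norm x) :: real) * l2norm X (\<lambda>x. k (norm x))"
  unfolding cum_def by (rule l2_cauchy_schwarz_mult[OF iL k(2)])
 then have "\<bar>cum k s\<bar>^2 \<le> (l2norm X (\<lambda>x. indicator {..<s} (norm x) :: real) * l2norm X (\<lambda>x. k (norm x)))^2" by (intro power_mono) auto
 then show ?thesis by (simp add: power_mult_distrib n)
qed

text \<open>The power cancels the radial density, so the integrand on the line is constant on (0,
  rad).\<close>

lemma inverse_norm_integrable: "integrable LM (\<lambda>x. 1 / norm x ^ (dm - 1))"
proof -
 have "integrable lborel (\<lambda>r. dens r * (1 / r ^ (dm - 1)))"
 proof -
  have eq: "dens r * (1 / r ^ (dm - 1)) = area * indicator {0<..<rad} r" for r by (auto simp: dens_def indicator_def)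
  show ?thesis unfolding eq by (intro integrable_mult_right integrable_real_indicator) (use rad in auto)
 qed
 then show ?thesis by (subst radial_integrable) auto
qed

lemma flux_norm:
 assumes "x \<noteq> 0" shows "norm (flux k x) = \<bar>cum k (norm x)\<bar> / (area * norm x ^ (dm - 1))"
 using assms area_pos by (simp add: flux_def e_r_norm)

lemma flux_L2:
 assumes k: "k \<in> borel_measurable borel" "(\<lambda>x. k (norm x)) \<in> L2 X"
 shows "flux k \<in> L2 X"
proof -
 define K where "K = (l2norm X (\<lambda>x. k (norm x)))^2"
 define C where "C = unit_ball_vol (real dm) * K / area^2 * rad"
 have C0: "0 \<le> C" unfolding C_def using rad by (simp add: K_def)
 have m: "flux k \<in> borel_measurable LM"
  unfolding flux_def[abs_def]
  using radial_measurable[OF cum_measurable[OF k(1)]] norm_measurable measurable_borel_dom[OF e_r_measurable] by measurable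
 have "integrable LM (\<lambda>x. (norm (flux k x))^2)"
 proof (rule L1_bound[OF integrable_mult_right[of C, OF inverse_norm_integrable]])
  show "AE x in LM. norm ((norm (flux k x))^2) \<le> norm (C * (1 / norm x ^ (dm - 1)))"
   using AE_norm_neq[of 0]
  proof (rule AE_mp, intro AE_I2 impI)
   fix x assume x: "x \<in> space LM" "norm x \<noteq> 0"
   let ?r = "norm x"
   have r: "0 < ?r" "?r < rad" using x by (auto simp: ball)
   have "(norm (flux k x))^2 = (cum k ?r)^2 / (area^2 * (?r ^ (dm - 1))^2)"
    using x by (subst flux_norm) (auto simp: power_divide power_mult_distrib)
   also have "\<dots> \<le> (unit_ball_vol (real dm) * ?r ^ dm * K) / (area^2 * (?r ^ (dm - 1))^2)"
    unfolding K_def using r by (intro divide_right_mono cum_bound[OF k]) auto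
   also have "\<dots> = unit_ball_vol (real dm) * K / area^2 * ?r * (1 / ?r ^ (dm - 1))"
   proof -
    obtain j where "dm = Suc j" using dm_pos gr0_implies_Suc by blast
    then show ?thesis using r area_pos by (simp add: power2_eq_square field_simps)
   qed
   also have "\<dots> \<le> C * (1 / ?r ^ (dm - 1))"
    unfolding C_def using r by (intro mult_right_mono mult_left_mono) (auto simp: K_def)
   finally show "norm ((norm (flux k x))^2) \<le> norm (C * (1 / ?r ^ (dm - 1)))" using C0 by simp
  qed
 qed (use m in measurable)
 then show ?thesis using m by (simp add: L2_def)
qed

text \<open>Fubini on the pairs with |y| < |x|. It frees k from the inner integral, so that the
  right-hand side tests k(|y|) against a fixed function of |y|.\<close>

lemma radial_fubini:
 assumes k: "k \<in> borel_measurable borel" "integrable LM (\<lambda>x. k (norm x))" and H: "integrable LM H"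
 shows "(LINT x|LM. cum k (norm x) * H x) = (LINT y|LM. k (norm y) * (LINT x|LM. indicator {norm y<..} (norm x) * H x))"
proof -
 interpret finite_measure LM by (rule finite_LM)
 interpret PP: pair_sigma_finite LM LM ..
 define f where "f x y = indicator {..<norm x} (norm y) * k (norm y) * H x" for x y :: "real^'d"
 have c: "(\<lambda>p. (norm (fst p), snd p)) \<in> (LM \<Otimes>\<^sub>M LM) \<rightarrow>\<^sub>M (borel \<Otimes>\<^sub>M LM)"
  using measurable_compose[OF measurable_fst norm_measurable] by measurable
 have fm: "case_prod f \<in> borel_measurable (LM \<Otimes>\<^sub>M LM)"
 proof -
  have 1: "(\<lambda>p. indicator {..<norm (fst p)} (norm (snd p)) :: real) \<in> borel_measurable (LM \<Otimes>\<^sub>M LM)"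
   using measurable_compose[OF c pair_norm_less] by simp
  have 2: "(\<lambda>p. k (norm (snd p))) \<in> borel_measurable (LM \<Otimes>\<^sub>M LM)" by (rule measurable_compose[OF measurable_snd radial_measurable[OF k(1)]])
  have 3: "(\<lambda>p. H (fst p)) \<in> borel_measurable (LM \<Otimes>\<^sub>M LM)" by (rule measurable_compose[OF measurable_fst borel_measurable_integrable[OF H]])
  show ?thesis unfolding f_def case_prod_beta' by (intro borel_measurable_times 1 2 3)
 qed
 have fi: "integrable (LM \<Otimes>\<^sub>M LM) (case_prod f)"
 proof (rule PP.Fubini_integrable[OF fm])
  have ak: "(\<lambda>r. \<bar>k r\<bar>) \<in> borel_measurable borel" using k(1) by measurable
  have eq: "(LINT y|LM. norm (case_prod f (x, y))) = cum (\<lambda>r. \<bar>k r\<bar>) (norm x) * \<bar>H x\<bar>" for x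
   unfolding cum_def f_def by (simp add: abs_mult)
  let ?K = "LINT y|LM. \<bar>k (norm y)\<bar>"
  show "integrable LM (\<lambda>x. LINT y|LM. norm (case_prod f (x, y)))"
   unfolding eq
  proof (rule L1_bound[of _ "\<lambda>x. ?K * \<bar>H x\<bar>"])
   show "(\<lambda>x. cum (\<lambda>r. \<bar>k r\<bar>) (norm x) * \<bar>H x\<bar>) \<in> borel_measurable LM"
    using radial_measurable[OF cum_measurable[OF ak]] H by measurable
   have ak': "integrable LM (\<lambda>y. \<bar>k (norm y)\<bar>)" using k(2) by simp
   have cb: "\<bar>cum (\<lambda>r. \<bar>k r\<bar>) s\<bar> \<le> \<bar>?K\<bar>" for s
   proof -
    have "0 \<le> cum (\<lambda>r. \<bar>k r\<bar>) s" unfolding cum_def by (rule lint_nonneg) auto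
    moreover have "cum (\<lambda>r. \<bar>k r\<bar>) s \<le> ?K"
     unfolding cum_def by (rule integral_mono_AE[OF indicator_ball_integrable(1)[OF ak'] ak']) (auto simp: indicator_def)
    ultimately show ?thesis by simp
   qed
   show "AE x in LM. norm (cum (\<lambda>r. \<bar>k r\<bar>) (norm x) * \<bar>H x\<bar>) \<le> norm (?K * \<bar>H x\<bar>)"
    unfolding real_norm_def abs_mult abs_abs by (intro AE_I2 mult_right_mono cb) simp
  qed (use H in auto)
  show "AE x in LM. integrable LM (\<lambda>y. case_prod f (x, y))"
   unfolding f_def by (auto intro!: integrable_mult_left indicator_ball_integrable(1) k(2))
 qed
 have "(LINT x|LM. cum k (norm x) * H x) = (LINT x|LM. LINT y|LM. f x y)" by (simp add: cum_def f_def)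
 also have "\<dots> = (LINT y|LM. LINT x|LM. f x y)" by (rule PP.Fubini_integral[OF fi, symmetric])
 also have "\<dots> = (LINT y|LM. k (norm y) * (LINT x|LM. indicator {norm y<..} (norm x) * H x))"
 proof (rule lint_cong[OF refl])
  fix y
  have "(LINT x|LM. f x y) = (LINT x|LM. k (norm y) * (indicator {norm y<..} (norm x) * H x))"
   unfolding f_def by (rule lint_cong) (auto simp: indicator_def)
  then show "(LINT x|LM. f x y) = k (norm y) * (LINT x|LM. indicator {norm y<..} (norm x) * H x)" by simp
 qed
 finally show ?thesis .
qed

text \<open>After \<open>radial_fubini\<close> both sides test k(|y|) against fixed densities, and w
  is the difference of these densities. For the indicator of (0, s) the flux is a multiple of
  cutoff(x) x, so \<open>cutoff_divergence\<close> shows that w annihilates concentric balls, hence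
  all radial functions for which the product is integrable.\<close>

lemma flux_div:
 assumes k: "k \<in> borel_measurable borel" "(\<lambda>x. k (norm x)) \<in> L2 X" and t: "\<phi> \<in> test"
 shows "(LINT x|LM. flux k x \<bullet> grad \<phi> x) = (LINT x|LM. k (norm x) * \<phi> x)"
proof -
 obtain C where C: "C > 0" "\<And>x. \<bar>\<phi> x\<bar> \<le> C" "\<And>x. norm (grad \<phi> x) \<le> C" using test_bounded[OF t] by blast
 define H where "H x = (e_r x \<bullet> grad \<phi> x) / norm x ^ (dm - 1)" for x
 have gm: "grad \<phi> \<in> borel_measurable LM" by (rule L2_D(1)[OF grad_test_L2[OF t]])
 have Hm: "H \<in> borel_measurable LM" unfolding H_def
  using gm norm_measurable measurable_borel_dom[OF e_r_measurable] by measurable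
 have Hi: "integrable LM H"
 proof (rule L1_bound[OF integrable_mult_right[of C, OF inverse_norm_integrable] Hm])
  have "\<bar>e_r x \<bullet> grad \<phi> x\<bar> \<le> 1 * C" for x
   by (rule order_trans[OF Cauchy_Schwarz_ineq2 mult_mono]) (use C in \<open>auto simp: e_r_norm\<close>)
  then show "AE x in LM. norm (H x) \<le> norm (C * (1 / norm x ^ (dm - 1)))"
   using C(1) by (intro AE_I2) (auto simp: H_def abs_mult intro!: divide_right_mono)
 qed
 define \<Phi> where "\<Phi> s = (LINT x|LM. indicator {s<..} (norm x) * H x)" for s
 have \<Phi>b: "\<bar>\<Phi> s\<bar> \<le> (LINT x|LM. \<bar>H x\<bar>)" for s
 proof -
  have "\<bar>\<Phi> s\<bar> \<le> (LINT x|LM. \<bar>indicator {s<..} (norm x) * H x\<bar>)" unfolding \<Phi>_def by (rule integral_abs_bound)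
  also have "\<dots> \<le> (LINT x|LM. \<bar>H x\<bar>)"
   by (rule integral_mono_AE) (use Hi indicator_ball_integrable(2)[OF Hi] in \<open>auto simp: indicator_def\<close>)
  finally show ?thesis .
 qed
 have \<Phi>m: "\<Phi> \<in> borel_measurable borel"
 proof -
  interpret finite_measure LM by (rule finite_LM)
  note [measurable] = norm_measurable Hm
  have "(\<lambda>p::real \<times> (real^'d). (if fst p < norm (snd p) then 1 else 0 :: real) * H (snd p)) \<in> borel_measurable (borel \<Otimes>\<^sub>M LM)"
   by measurable
  then have "(\<lambda>(s, x). indicator {s<..} (norm x) * H x) \<in> borel_measurable (borel \<Otimes>\<^sub>M LM)"
   by (simp add: case_prod_beta' indicator_def of_bool_def)
  then show ?thesis unfolding \<Phi>_def[abs_def] by (rule borel_measurable_lebesgue_integral)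
 qed
 define w where "w y = - \<Phi> (norm y) / area - \<phi> y" for y
 have \<phi>i: "integrable LM \<phi>" by (rule L2_imp_integrable[OF lmeas test_L2[OF t]])
 have \<Phi>i: "integrable LM (\<lambda>y. \<Phi> (norm y))"
  by (rule L2_imp_integrable[OF lmeas L2_bounded[OF lmeas radial_measurable[OF \<Phi>m]]]) (use \<Phi>b in auto)
 have wi: "integrable LM w" unfolding w_def using \<Phi>i \<phi>i by auto
 have ki: "integrable LM (\<lambda>x. k (norm x))" by (rule L2_imp_integrable[OF lmeas k(2)])
 have kw: "integrable LM (\<lambda>y. f (norm y) * \<Phi> (norm y))" if "integrable LM (\<lambda>x. f (norm x))" for f
  by (rule L1_bound[OF integrable_mult_left[OF that, of "LINT x|LM. \<bar>H x\<bar>"]])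
   (use that radial_measurable[OF \<Phi>m] \<Phi>b in \<open>auto simp: abs_mult intro!: mult_left_mono order_trans[OF \<Phi>b abs_ge_self]\<close>)
 have k\<phi>: "integrable LM (\<lambda>y. f (norm y) * \<phi> y)" if "integrable LM (\<lambda>x. f (norm x))" for f
  by (rule L1_bound[OF integrable_mult_left[OF that, of C]])
   (use that \<phi>i C in \<open>auto simp: abs_mult intro!: mult_left_mono\<close>)
 have split: "(LINT y|LM. f (norm y) * w y) = - (1 / area) * (LINT y|LM. f (norm y) * \<Phi> (norm y)) - (LINT y|LM. f (norm y) * \<phi> y)"
  if "integrable LM (\<lambda>x. f (norm x))" for f
 proof -
  have "(LINT y|LM. f (norm y) * w y) = (LINT y|LM. - (1 / area) * (f (norm y) * \<Phi> (norm y)) - f (norm y) * \<phi> y)"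
   by (rule lint_cong) (auto simp: w_def algebra_simps)
  also have "\<dots> = - (1 / area) * (LINT y|LM. f (norm y) * \<Phi> (norm y)) - (LINT y|LM. f (norm y) * \<phi> y)"
   using kw[OF that] k\<phi>[OF that] by (subst lint_diff) auto
  finally show ?thesis .
 qed
 have z: "(LINT x|LM. indicator {..<s} (norm x) * w x) = 0" if s: "0 < s" "s < rad" for s
 proof -
  let ?f = "indicator {..<s} :: real \<Rightarrow> real"
  have fm: "?f \<in> borel_measurable borel" by simp
  have fi: "integrable LM (\<lambda>x. ?f (norm x))"
   by (rule L2_imp_integrable[OF lmeas L2_bounded[OF lmeas radial_measurable[OF fm], of 1]]) (auto simp: indicator_def)
  have "(LINT y|LM. ?f (norm y) * \<Phi> (norm y)) = (LINT x|LM. cum ?f (norm x) * H x)"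
   unfolding \<Phi>_def by (rule radial_fubini[OF fm fi Hi, symmetric])
  also have "\<dots> = (LINT x|LM. (area / real dm) * (cutoff dm s x * (x \<bullet> grad \<phi> x) / real dm * real dm))"
  proof (rule integral_cong_AE)
   \<comment> \<open>For the indicator, \<open>cum\<close> is the volume of the smaller ball, and H
     x is x . grad \<phi> / |x|^dm; the quotient of the unit-ball volume by \<open>area\<close>
     explains the factor.\<close>
   show "AE x in LM. cum ?f (norm x) * H x = (area / real dm) * (cutoff dm s x * (x \<bullet> grad \<phi> x) / real dm * real dm)"
    using AE_norm_neq[of 0]
   proof (rule AE_mp, intro AE_I2 impI)
    fix x assume x: "x \<in> space LM" "norm x \<noteq> 0"
    let ?r = "norm x"
    have r: "0 < ?r" "?r < rad" using x by (auto simp: ball)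
    have "cum ?f ?r = (LINT y|LM. indicator {..<min s ?r} (norm y))"
     unfolding cum_def by (rule lint_cong) (auto simp: indicator_def)
    also have "\<dots> = unit_ball_vol (real dm) * (min s ?r) ^ dm" using s r by (intro volume_inner_ball) auto
    finally have c: "cum ?f ?r = unit_ball_vol (real dm) * (min s ?r) ^ dm" .
    have "H x = (x \<bullet> grad \<phi> x) / ?r ^ dm"
    proof -
     obtain j where "dm = Suc j" using dm_pos gr0_implies_Suc by blast
     then show ?thesis using r by (simp add: H_def e_r_def)
    qed
    moreover have "cutoff dm s x = (min s ?r) ^ dm / ?r ^ dm"
     unfolding cutoff_def power_divide[symmetric] using r s by (auto simp: min_def max_def)
    ultimately show "cum ?f ?r * H x = (area / real dm) * (cutoff dm s x * (x \<bullet> grad \<phi> x) / real dm * real dm)"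
     unfolding c using dm_pos by (simp add: area_def)
   qed
   show "(\<lambda>x. cum ?f (norm x) * H x) \<in> borel_measurable LM" using radial_measurable[OF cum_measurable[OF fm]] Hm by measurable
   have "(cutoff dm s :: real^'d \<Rightarrow> real) \<in> borel_measurable LM"
    by (intro continuous_measurable_dom lipschitz_on_continuous_on[OF cutoff_lipschitz[OF s(1)]])
   moreover have "(\<lambda>x. x \<bullet> grad \<phi> x) \<in> borel_measurable LM"
    by (intro continuous_measurable_dom continuous_on_inner continuous_on_id test_grad_continuous[OF t])
   ultimately show "(\<lambda>x. (area / real dm) * (cutoff dm s x * (x \<bullet> grad \<phi> x) / real dm * real dm)) \<in> borel_measurable LM" by measurable
  qed
  also have "\<dots> = (area / real dm) * (LINT x|LM. cutoff dm s x * (x \<bullet> grad \<phi> x))" using dm_pos by simp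
  also have "\<dots> = - area * (LINT x|LM. indicator {..<s} (norm x) * \<phi> x)"
   unfolding cutoff_divergence[OF s(1) t] using dm_pos by simp
  finally show ?thesis unfolding split[OF fi] using area_pos by simp
 qed
 have kwi: "integrable LM (\<lambda>x. k (norm x) * w x)"
 proof -
  have "integrable LM (\<lambda>y. - (1 / area) * (k (norm y) * \<Phi> (norm y)) - k (norm y) * \<phi> y)" using kw[OF ki] k\<phi>[OF ki] by auto
  moreover have "(\<lambda>y. - (1 / area) * (k (norm y) * \<Phi> (norm y)) - k (norm y) * \<phi> y) = (\<lambda>x. k (norm x) * w x)"
   by (auto simp: w_def algebra_simps)
  ultimately show ?thesis by simp
 qed
 have "(LINT x|LM. k (norm x) * w x) = 0" by (rule radial_annihilator[OF wi z k(1) kwi])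
 then have "- (1 / area) * (LINT y|LM. k (norm y) * \<Phi> (norm y)) = (LINT y|LM. k (norm y) * \<phi> y)" unfolding split[OF ki] by simp
 moreover have "(LINT x|LM. flux k x \<bullet> grad \<phi> x) = - (1 / area) * (LINT x|LM. cum k (norm x) * H x)"
 proof -
  have "flux k x \<bullet> grad \<phi> x = - (1 / area) * (cum k (norm x) * H x)" for x by (simp add: flux_def H_def)
  then show ?thesis by simp
 qed
 ultimately show ?thesis using radial_fubini[OF k(1) ki Hi] by (simp add: \<Phi>_def)
qed

text \<open>\<open>radial_on\<close> admits an arbitrary profile, so measurability on the line must
  be recovered from that in space. Compact subsets of a radial set have compact images under the
  norm. Applied to the set and to its complement, this traps T between Borel sets whose gap is null
  in space; since \<open>dens\<close> is positive on (0, rad), the gap is null on the line.\<close>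

lemma radial_profile_set:
 assumes T: "T \<subseteq> {0<..<rad}" and m: "{x\<in>X. norm x \<in> T} \<in> sets lebesgue"
 shows "T \<in> sets lebesgue"
proof -
 have inner: "\<exists>B. B \<in> sets borel \<and> B \<subseteq> U \<and> {x\<in>X. norm x \<in> U} - {x\<in>X. norm x \<in> B} \<in> null_sets lebesgue"
  if U: "U \<subseteq> {0<..<rad}" "{x\<in>X. norm x \<in> U} \<in> sets lebesgue" for U
 proof -
  let ?S = "{x\<in>X. norm x \<in> U}"
  have "\<exists>C. closed C \<and> C \<subseteq> ?S \<and> ?S - C \<in> lmeasurable \<and> emeasure lebesgue (?S - C) < ennreal (1 / real (Suc n))" for n
   by (rule sets_lebesgue_inner_closed[OF U(2), of "1 / real (Suc n)"]) (simp, blast)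
  from choice[OF allI[OF this]] obtain C where CC: "\<forall>n. closed (C n) \<and> C n \<subseteq> ?S \<and> ?S - C n \<in> lmeasurable \<and> emeasure lebesgue (?S - C n) < ennreal (1 / real (Suc n))"
   by (rule exE)
  have C: "closed (C n)" "C n \<subseteq> ?S" "?S - C n \<in> lmeasurable" "emeasure lebesgue (?S - C n) < ennreal (1 / real (Suc n))" for n
   by (rule CC[rule_format, THEN conjunct1] CC[rule_format, THEN conjunct2, THEN conjunct1] CC[rule_format, THEN conjunct2, THEN conjunct2, THEN conjunct1] CC[rule_format, THEN conjunct2, THEN conjunct2, THEN conjunct2])+
  have comp: "compact (C n)" for n
   using C(1,2)[of n] bounded_dom by (auto simp: compact_eq_bounded_closed intro: bounded_subset)
  define B where "B = (\<Union>n. norm ` C n)"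
  have Bb: "B \<in> sets borel"
   unfolding B_def by (intro sets.countable_UN) (auto intro!: borel_compact compact_continuous_image comp continuous_intros)
  have BU: "B \<subseteq> U" using C(2) by (auto simp: B_def)
  have sub: "?S - {x\<in>X. norm x \<in> B} \<subseteq> ?S - C n" for n using C(2)[of n] by (auto simp: B_def)
  have Bm: "{x\<in>X. norm x \<in> B} \<in> sets lebesgue"
  proof -
   have "norm -` B \<inter> space LM \<in> sets LM" by (rule measurable_sets[OF norm_measurable Bb])
   moreover have "norm -` B \<inter> space LM = {x\<in>X. norm x \<in> B}" by auto
   ultimately have "{x\<in>X. norm x \<in> B} \<in> sets LM" by simp
   then show ?thesis using sets_restrict_space_iff[of X lebesgue] by simp
  qed
  have "emeasure lebesgue (?S - {x\<in>X. norm x \<in> B}) \<le> ennreal (1 / real (Suc n))" for n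
   using emeasure_mono[OF sub[of n], of lebesgue] C(3,4)[of n] by (meson fmeasurableD less_imp_le order_trans)
  moreover have "(\<lambda>n. ennreal (1 / real (Suc n))) \<longlonglongrightarrow> ennreal 0"
   by (intro tendsto_ennrealI LIMSEQ_Suc[OF lim_1_over_n])
  ultimately have "emeasure lebesgue (?S - {x\<in>X. norm x \<in> B}) \<le> ennreal 0"
   by (intro LIMSEQ_le_const[of "\<lambda>n. ennreal (1 / real (Suc n))"]) auto
  then have "?S - {x\<in>X. norm x \<in> B} \<in> null_sets lebesgue" using U(2) Bm by (auto simp: null_sets_def)
  then show ?thesis using Bb BU by blast
 qed
 obtain B1 where B1: "B1 \<in> sets borel" "B1 \<subseteq> T" "{x\<in>X. norm x \<in> T} - {x\<in>X. norm x \<in> B1} \<in> null_sets lebesgue" using inner[OF T m] by blast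
 have m2: "{x\<in>X. norm x \<in> {0<..<rad} - T} \<in> sets lebesgue"
 proof -
  have "{x\<in>X. norm x \<in> {0<..<rad} - T} = (X - {0}) - {x\<in>X. norm x \<in> T}" by (auto simp: ball)
  moreover have "(X - {0}) - {x\<in>X. norm x \<in> T} \<in> sets lebesgue" by (intro sets.Diff m lmeas[THEN fmeasurableD]) simp
  ultimately show ?thesis by simp
 qed
 obtain B2 where B2: "B2 \<in> sets borel" "B2 \<subseteq> {0<..<rad} - T" "{x\<in>X. norm x \<in> {0<..<rad} - T} - {x\<in>X. norm x \<in> B2} \<in> null_sets lebesgue"
  using inner[OF _ m2] by blast
 define G where "G = {0<..<rad} - B1 - B2"
 have Gb: "G \<in> sets borel" using B1 B2 by (auto simp: G_def)
 have "{x\<in>X. norm x \<in> G} \<subseteq> ({x\<in>X. norm x \<in> T} - {x\<in>X. norm x \<in> B1}) \<union> ({x\<in>X. norm x \<in> {0<..<rad} - T} - {x\<in>X. norm x \<in> B2})"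
  by (auto simp: G_def)
 then have Gn: "{x\<in>X. norm x \<in> G} \<in> null_sets lebesgue"
  using null_sets.Un[OF B1(3) B2(3)] by (meson null_sets_completion_subset)
 have "G \<in> null_sets lborel"
 proof -
  have "emeasure (distr LM borel norm) G = emeasure LM (norm -` G \<inter> space LM)" by (rule emeasure_distr[OF norm_measurable Gb])
  also have "norm -` G \<inter> space LM = {x\<in>X. norm x \<in> G}" by auto
  also have "emeasure LM {x\<in>X. norm x \<in> G} = emeasure lebesgue {x\<in>X. norm x \<in> G}" by (subst emeasure_restrict_space) auto
  also have "\<dots> = 0" using Gn by auto
  finally have "G \<in> null_sets (density lborel (\<lambda>r. ennreal (dens r)))" using Gb unfolding distr_norm by (auto simp: null_sets_def)
  then have "AE r in lborel. r \<in> G \<longrightarrow> ennreal (dens r) = 0" by (subst (asm) null_sets_density_iff) auto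
  then have "AE r in lborel. r \<notin> G"
   by eventually_elim (use area_pos in \<open>auto simp: G_def dens_def indicator_def\<close>)
  then show ?thesis using Gb by (subst AE_iff_null_sets) auto
 qed
 then have "T \<inter> G \<in> sets lebesgue" by (meson inf_le2 null_setsD2 null_sets_completion_subset null_sets_completionI)
 moreover have "T = B1 \<union> (T \<inter> G)" using T B1(2) B2(2) by (auto simp: G_def)
 moreover have "B1 \<in> sets lebesgue" using B1(1) by simp
 ultimately show ?thesis by (metis sets.Un)
qed

text \<open>A Lebesgue measurable profile is changed on a null set of radii, which
  \<open>AE_radial\<close> turns into a null set of points.\<close>

lemma borel_version:
 fixes p :: "real \<Rightarrow> real"
 assumes "(\<lambda>r. indicator {0<..<rad} r * p r) \<in> borel_measurable lebesgue"
 obtains p0 where "p0 \<in> borel_measurable borel" "AE r in lborel. r \<in> {0<..<rad} \<longrightarrow> p r = p0 r" "AE x in LM. p (norm x) = p0 (norm x)"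
proof -
 obtain p0 where p0: "p0 \<in> borel_measurable lborel" "AE r in lborel. indicator {0<..<rad} r * p r = p0 r"
  using completion_ex_borel_measurable_real[OF assms] by blast
 have ae: "AE r in lborel. r \<in> {0<..<rad} \<longrightarrow> p r = p0 r" using p0(2) by eventually_elim auto
 show thesis using that[of p0] p0(1) ae AE_radial[OF ae] by simp
qed

lemma radial_profile:
 fixes F :: "real^'d \<Rightarrow> real"
 assumes F: "F \<in> borel_measurable LM" "AE x in LM. F x = p (norm x)"
 obtains p0 where "p0 \<in> borel_measurable borel" "AE x in LM. F x = p0 (norm x)"
proof -
 have "(\<lambda>r. indicator {0<..<rad} r * p r) \<in> borel_measurable lebesgue"
  unfolding borel_measurable_iff_greater
 proof
  fix c
  have T: "{r \<in> {0<..<rad}. c < p r} \<in> sets lebesgue"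
  proof (rule radial_profile_set)
   have 1: "{x\<in>space LM. c < F x} \<in> sets LM" using F(1) by (simp add: borel_measurable_iff_greater)
   then have 1: "{x\<in>X. c < F x} \<in> sets lebesgue" using sets_restrict_space_iff[of X lebesgue] by simp
   have "AE x in lebesgue. x \<in> X \<longrightarrow> F x = p (norm x)" using F(2) by (simp add: AE_restrict_space_iff)
   then obtain N where "{x\<in>space lebesgue. \<not> (x \<in> X \<longrightarrow> F x = p (norm x))} \<subseteq> N" "emeasure lebesgue N = 0" "N \<in> sets lebesgue"
    by (rule AE_E)
   then have N: "N \<in> null_sets lebesgue" "{x. \<not> (x \<in> X \<longrightarrow> F x = p (norm x))} \<subseteq> N" by (auto simp: null_sets_def)
   let ?A = "{x\<in>X. c < F x}" let ?B = "{x\<in>X. norm x \<in> {r \<in> {0<..<rad}. c < p r}}"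
   \<comment> \<open>The origin is discarded along with N because the profile set lies in the open
     interval (0, rad).\<close>
   have N0: "N \<union> {0} \<in> null_sets lebesgue" using N(1) by auto
   have sub: "?A \<inter> (N \<union> {0}) \<in> sets lebesgue" "?B \<inter> (N \<union> {0}) \<in> sets lebesgue"
    by (meson N0 inf_le2 null_setsD2 null_sets_completion_subset)+
   have "?B = (?A - (N \<union> {0})) \<union> (?B \<inter> (N \<union> {0}))" using N(2) by (auto simp: ball)
   moreover have "(?A - (N \<union> {0})) \<union> (?B \<inter> (N \<union> {0})) \<in> sets lebesgue"
    by (intro sets.Un sets.Diff 1 sub null_setsD2[OF N0])
   ultimately show "?B \<in> sets lebesgue" by simp
  qed auto
  have eq: "{r \<in> space lebesgue. c < indicator {0<..<rad} r * p r} = {r \<in> {0<..<rad}. c < p r} \<union> (if c < 0 then - {0<..<rad} else {})"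
   by (auto simp: indicator_def)
  have "(if c < 0 then - {0<..<rad} else {}) \<in> sets lebesgue" by simp
  then show "{r \<in> space lebesgue. c < indicator {0<..<rad} r * p r} \<in> sets lebesgue" unfolding eq by (rule sets.Un[OF T])
 qed
 then obtain p0 where p0: "p0 \<in> borel_measurable borel" "AE x in LM. p (norm x) = p0 (norm x)" by (rule borel_version)
 have "AE x in LM. F x = p0 (norm x)" using F(2) p0(2) by eventually_elim simp
 then show thesis using that p0(1) by blast
qed

text \<open>Up to a constant the weight is the square root of the volume density, so the hypothesis
  amounts to square integrability of g(|x|) on the ball. \<open>radial_flux\<close> sees g only
  through integrals over (0, |x|), so a Borel version of g gives the same flux at every point of the
  ball.\<close>

lemma radial_data:
 assumes g: "(\<lambda>r. r powr ((real dm - 1) / 2) * g r) \<in> L2 {0<..<rad}"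
 obtains k where "k \<in> borel_measurable borel" "(\<lambda>x. k (norm x)) \<in> L2 X" "AE x in LM. g (norm x) = k (norm x)"
  "\<And>x. x \<in> X ==> radial_flux g x = flux k x"
proof -
 let ?I = "{0<..<rad}" let ?h = "\<lambda>r. r powr ((real dm - 1) / 2) * g r"
 have hm: "(\<lambda>r. indicator ?I r *\<^sub>R ?h r) \<in> borel_measurable lebesgue"
  using L2_D(1)[OF g] by (subst (asm) borel_measurable_restrict_space_iff) auto
 have gm: "(\<lambda>r. indicator ?I r * g r) \<in> borel_measurable lebesgue"
 proof -
  have "(\<lambda>r. r powr (- ((real dm - 1) / 2))) \<in> borel_measurable lebesgue" by (intro measurable_completion) simp
  then have "(\<lambda>r. r powr (- ((real dm - 1) / 2)) * (indicator ?I r *\<^sub>R ?h r)) \<in> borel_measurable lebesgue" using hm by measurable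
  moreover have "(\<lambda>r. r powr (- ((real dm - 1) / 2)) * (indicator ?I r *\<^sub>R ?h r)) = (\<lambda>r. indicator ?I r * g r)"
   by (auto simp: indicator_def powr_minus)
  ultimately show ?thesis by simp
 qed
 obtain k where k: "k \<in> borel_measurable borel" "AE r in lborel. r \<in> ?I \<longrightarrow> g r = k r" "AE x in LM. g (norm x) = k (norm x)"
  using borel_version[OF gm] by blast
 have k2: "(\<lambda>r. (k r)^2) \<in> borel_measurable borel" using k(1) by measurable
 have "integrable lborel (\<lambda>r. dens r * (k r)^2)"
 proof -
  have "integrable lebesgue (\<lambda>r. indicator ?I r *\<^sub>R (norm (?h r))^2)"
   using L2_D(2)[OF g] by (subst (asm) integrable_restrict_space) auto
  then have 1: "integrable lebesgue (\<lambda>r. area * (indicator ?I r *\<^sub>R (norm (?h r))^2))" by simp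
  have "integrable lebesgue (\<lambda>r. dens r * (k r)^2)"
  proof (rule integrable_cong_AE_imp[OF 1])
   show "(\<lambda>r. dens r * (k r)^2) \<in> borel_measurable lebesgue" using k2 by (intro measurable_completion) simp
   have "AE r in lebesgue. r \<in> ?I \<longrightarrow> g r = k r" using k(2) by (simp add: AE_completion_iff)
   then show "AE r in lebesgue. area * (indicator ?I r *\<^sub>R (norm (?h r))^2) = dens r * (k r)^2"
   proof eventually_elim
    case (elim r)
    show ?case
    proof (cases "r \<in> ?I")
     case True
     have "(r powr ((real dm - 1) / 2))^2 = r powr (real (dm - 1))"
      using True dm_pos by (simp add: powr_powr[symmetric] power2_eq_square powr_add[symmetric] of_nat_diff)
     also have "\<dots> = r ^ (dm - 1)" using True by (simp add: powr_realpow)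
     finally show ?thesis using True elim by (simp add: dens_def power_mult_distrib)
    qed (simp add: dens_def)
   qed
  qed
  then show ?thesis using k2 by (subst (asm) integrable_completion) simp_all
 qed
 then have "integrable LM (\<lambda>x. (k (norm x))^2)" by (subst radial_integrable[OF k2])
 then have kL: "(\<lambda>x. k (norm x)) \<in> L2 X" using radial_measurable[OF k(1)] by (simp add: L2_def)
 have "radial_flux g x = flux k x" if x: "x \<in> X" for x
 proof -
  let ?s = "norm x"
  have s: "?s < rad" using x by (simp add: ball)
  let ?f = "\<lambda>r. indicator {0<..<?s} r * (r ^ (dm - 1) * k r)"
  have fm: "?f \<in> borel_measurable borel" using k(1) by measurable
  have "(LINT \<rho>|lebesgue_on {0<..<?s}. \<rho> ^ (dm - 1) * g \<rho>) = (LINT r|lebesgue. indicator {0<..<?s} r *\<^sub>R (r ^ (dm - 1) * g r))"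
   by (subst integral_restrict_space) auto
  also have "\<dots> = (LINT r|lebesgue. ?f r)"
  proof (rule integral_cong_AE)
   have "AE r in lebesgue. r \<in> ?I \<longrightarrow> g r = k r" using k(2) by (simp add: AE_completion_iff)
   then show "AE r in lebesgue. indicator {0<..<?s} r *\<^sub>R (r ^ (dm - 1) * g r) = ?f r"
    by eventually_elim (use s in \<open>auto simp: indicator_def\<close>)
   show "?f \<in> borel_measurable lebesgue" using fm by (intro measurable_completion) simp
   have "(\<lambda>r. indicator {0<..<?s} r * r ^ (dm - 1) :: real) \<in> borel_measurable lebesgue" by (intro measurable_completion) simp
   then have "(\<lambda>r. (indicator {0<..<?s} r * r ^ (dm - 1)) * (indicator ?I r * g r)) \<in> borel_measurable lebesgue" using gm by measurable
   moreover have "(\<lambda>r. (indicator {0<..<?s} r * r ^ (dm - 1)) * (indicator ?I r * g r)) = (\<lambda>r. indicator {0<..<?s} r *\<^sub>R (r ^ (dm - 1) * g r))"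
    using s by (auto simp: indicator_def)
   ultimately show "(\<lambda>r. indicator {0<..<?s} r *\<^sub>R (r ^ (dm - 1) * g r)) \<in> borel_measurable lebesgue" by simp
  qed
  also have "\<dots> = (LINT r|lborel. ?f r)" by (rule integral_completion) (use fm in simp)
  finally have 1: "(LINT \<rho>|lebesgue_on {0<..<?s}. \<rho> ^ (dm - 1) * g \<rho>) = (LINT r|lborel. ?f r)" .
  have "cum k ?s = (LINT r|lborel. dens r * (indicator {..<?s} r * k r))"
   unfolding cum_def using k(1) by (intro radial_integral) measurable
  also have "\<dots> = (LINT r|lborel. area * ?f r)"
   by (rule lint_cong) (use s in \<open>auto simp: dens_def indicator_def\<close>)
  finally have "cum k ?s = area * (LINT r|lborel. ?f r)" by simp
  then show ?thesis unfolding radial_flux_def flux_def dm_def[symmetric] 1 using area_pos by simp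
 qed
 then show thesis using that k kL by blast
qed

end

section \<open>The bathtub principle\<close>

lemma borel_measurable_vec_nth:
 fixes f :: "'a \<Rightarrow> 'b::euclidean_space^'n"
 assumes "f \<in> borel_measurable M" shows "(\<lambda>x. f x $ i) \<in> borel_measurable M"
 by (rule borel_measurable_continuous_on[OF _ assms]) (intro continuous_intros)

lemma borel_measurable_vecI:
 fixes f :: "'a \<Rightarrow> 'b::euclidean_space^'n"
 assumes "\<And>i. (\<lambda>x. f x $ i) \<in> borel_measurable M" shows "f \<in> borel_measurable M"
proof (subst borel_measurable_euclidean_space, rule ballI)
 fix b :: "'b^'n" assume "b \<in> Basis"
 then obtain i u where "b = axis i u" by (auto simp: Basis_vec_def)
 then show "(\<lambda>x. f x \<bullet> b) \<in> borel_measurable M"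
  using assms[of i] by (simp add: inner_axis borel_measurable_inner)
qed

text \<open>The indicator of an upper half-line with an arbitrary value at the jump. No level is
  named, so that the constants 0 and 1, whose level is infinite, are included.\<close>

definition threshold :: "(real \<Rightarrow> real) \<Rightarrow> bool" where
 "threshold p \<longleftrightarrow> (\<forall>s. 0 \<le> p s \<and> p s \<le> 1) \<and> (\<forall>s s'. s < s' \<longrightarrow> 0 < p s \<longrightarrow> p s' = 1)"

lemma threshold_bounds: "threshold p ==> 0 \<le> p s \<and> p s \<le> 1" by (auto simp: threshold_def)

lemma threshold_measurable [measurable_dest]:
 assumes "threshold p" shows "p \<in> borel_measurable borel"
proof (rule borel_measurable_mono)
 show "mono p"
 proof
  fix s s' :: real assume "s \<le> s'"
  then consider "s = s'" | "s < s'" "0 < p s" | "p s \<le> 0" by linarith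
  then show "p s \<le> p s'" 
  proof cases
   case 2
   then have "p s' = 1" using assms by (auto simp: threshold_def)
   then show ?thesis using assms by (simp add: threshold_def)
  next
   case 3
   then show ?thesis using assms order_trans unfolding threshold_def by blast
  qed simp
 qed
qed

text \<open>If the graphs crossed, there would be two points with opposite strict inequalities; the
  function that is larger at the left point is positive there, hence already 1 at the right
  point.\<close>

lemma threshold_comparable:
 assumes "threshold p" "threshold p'" shows "(\<forall>s. p s \<le> p' s) \<or> (\<forall>s. p' s \<le> p s)"
proof (rule ccontr)
 assume "\<not> ?thesis"
 then obtain s r where sr: "p' s < p s" "p r < p' r" by (auto simp: not_le)
 have b: "0 \<le> p' s" "p' r \<le> 1" "0 \<le> p r" "p s \<le> 1" using assms threshold_bounds by auto
 consider "s < r" | "r < s" | "s = r" by linarith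
 then show False
 proof cases
  case 1
  then have "p r = 1" using assms(1) sr b unfolding threshold_def by (metis le_less_trans)
  then show False using sr b by simp
 next
  case 2
  then have "p' s = 1" using assms(2) sr b unfolding threshold_def by (metis le_less_trans)
  then show False using sr b by simp
 qed (use sr in auto)
qed

context finite_measure
begin

lemma integrable_bounded_mult:
 fixes \<psi> h :: "'a \<Rightarrow> real"
 assumes "integrable M \<psi>" "h \<in> borel_measurable M" "AE x in M. \<bar>h x\<bar> \<le> C"
 shows "integrable M (\<lambda>x. h x * \<psi> x)"
proof (rule L1_bound[OF integrable_mult_right[of C, OF assms(1)]])
 show "(\<lambda>x. h x * \<psi> x) \<in> borel_measurable M" using assms by measurable
 show "AE x in M. norm (h x * \<psi> x) \<le> norm (C * \<psi> x)" using assms(3)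
  by eventually_elim (auto simp: abs_mult intro!: mult_right_mono)
qed

lemma threshold_integrable:
 assumes "threshold p" "\<psi> \<in> borel_measurable M" shows "integrable M (\<lambda>x. p (\<psi> x))"
 by (rule integrable_const_bound[of _ 1])
  (use threshold_bounds[OF assms(1)] measurable_compose[OF assms(2) threshold_measurable[OF assms(1)]] in auto)

text \<open>The level t is the infimum of those whose strict super-level set has measure at most Q.
  Then Q lies between the measures of the strict and the non-strict super-level set of t, and a
  fraction \<alpha> of the level set fills the gap.\<close>

lemma threshold_exists:
 assumes \<psi>: "\<psi> \<in> borel_measurable M" and Q: "0 \<le> Q" "Q \<le> measure M (space M)"
 obtains p where "threshold p" "(LINT x|M. p (\<psi> x)) = Q"
proof -
 consider "Q = 0" | "Q = measure M (space M)" | "0 < Q" "Q < measure M (space M)" using Q by linarith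
 then show thesis
 proof cases
  case 1 then show thesis using that[of "\<lambda>_. 0"] by (simp add: threshold_def)
 next
  case 2 then show thesis using that[of "\<lambda>_. 1"] by (simp add: threshold_def)
 next
  case 3
  define E where "E s = {x\<in>space M. s < \<psi> x}" for s :: real
  have Em: "E s \<in> sets M" for s unfolding E_def using \<psi> by measurable
  have mono: "measure M (E s') \<le> measure M (E s)" if "s \<le> s'" for s s'
   by (rule finite_measure_mono[OF _ Em]) (use that in \<open>auto simp: E_def\<close>)
  define S where "S = {s. measure M (E s) \<le> Q}"
  have "(\<lambda>n. measure M (E (real n))) \<longlonglongrightarrow> measure M (\<Inter>n. E (real n))"
   by (rule finite_Lim_measure_decseq) (use Em in \<open>auto simp: decseq_def E_def image_subset_iff\<close>)
  moreover have "(\<Inter>n. E (real n)) = {}"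
  proof -
   have "\<exists>n. \<not> real n < \<psi> x" for x using real_arch_simple[of "\<psi> x"] by (auto simp: not_less)
   then show ?thesis by (auto simp: E_def)
  qed
  ultimately have "(\<lambda>n. measure M (E (real n))) \<longlonglongrightarrow> 0" by simp
  from order_tendstoD(2)[OF this 3(1)] obtain n0 where "measure M (E (real n0)) < Q" by (auto simp: eventually_sequentially)
  then have S0: "S \<noteq> {}" by (auto simp: S_def intro: less_imp_le)
  have "(\<lambda>n. measure M (E (- real n))) \<longlonglongrightarrow> measure M (\<Union>n. E (- real n))"
   by (rule finite_Lim_measure_incseq) (use Em in \<open>auto simp: incseq_def E_def image_subset_iff\<close>)
  moreover have "(\<Union>n. E (- real n)) = space M"
  proof -
   have "\<exists>n. - real n < \<psi> x" for x using reals_Archimedean2[of "- \<psi> x"] by (auto simp: minus_less_iff)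
   then show ?thesis by (auto simp: E_def)
  qed
  ultimately have "(\<lambda>n. measure M (E (- real n))) \<longlonglongrightarrow> measure M (space M)" by simp
  from order_tendstoD(1)[OF this 3(2)] obtain n1 where n1: "Q < measure M (E (- real n1))" by (auto simp: eventually_sequentially)
  have lb: "- real n1 \<le> s" if "s \<in> S" for s
  proof (rule ccontr)
   assume "\<not> ?thesis"
   then have "measure M (E (- real n1)) \<le> measure M (E s)" by (intro mono) simp
   then show False using n1 that by (simp add: S_def)
  qed
  then have bdd: "bdd_below S" by (auto simp: bdd_below_def)
  define t where "t = Inf S"
  have up: "measure M (E s) \<le> Q" if "t < s" for s
  proof -
   obtain s' where "s' \<in> S" "s' < s" using \<open>t < s\<close> cInf_less_iff[OF S0 bdd] by (auto simp: t_def)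
   then show ?thesis using mono[of s' s] by (auto simp: S_def)
  qed
  have lo: "Q \<le> measure M (E s)" if "s < t" for s
  proof (rule ccontr)
   assume "\<not> ?thesis"
   then have "t \<le> s" unfolding t_def by (intro cInf_lower[OF _ bdd]) (auto simp: S_def)
   then show False using \<open>s < t\<close> by simp
  qed
  let ?d = "\<lambda>n. 1 / real (Suc n)"
  have dd: "?d n \<le> ?d m" if "m \<le> n" for m n using that by (simp add: frac_le)
  have ex: "\<exists>n. ?d n < e" if "0 < e" for e using reals_Archimedean[OF that] by (simp add: inverse_eq_divide)
  have "(\<lambda>n. measure M (E (t + ?d n))) \<longlonglongrightarrow> measure M (\<Union>n. E (t + ?d n))"
  proof (rule finite_Lim_measure_incseq)
   show "incseq (\<lambda>n. E (t + ?d n))" unfolding incseq_def E_def using dd by (fastforce intro: le_less_trans add_left_mono)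
  qed (use Em in auto)
  moreover have "(\<Union>n. E (t + ?d n)) = E t"
  proof (intro equalityI subsetI)
   fix x assume "x \<in> (\<Union>n. E (t + ?d n))"
   then obtain n where n: "x \<in> space M" "t + ?d n < \<psi> x" by (auto simp: E_def)
   have "0 < ?d n" by simp
   then have "t < \<psi> x" using n(2) by linarith
   then show "x \<in> E t" using n(1) by (simp add: E_def)
  next
   fix x assume x: "x \<in> E t"
   then obtain n where "?d n < \<psi> x - t" using ex[of "\<psi> x - t"] by (auto simp: E_def)
   then have "t + ?d n < \<psi> x" by linarith
   then show "x \<in> (\<Union>n. E (t + ?d n))" using x by (auto simp: E_def)
  qed
  ultimately have "(\<lambda>n. measure M (E (t + ?d n))) \<longlonglongrightarrow> measure M (E t)" by simp
  then have m1: "measure M (E t) \<le> Q" by (rule LIMSEQ_le_const2) (use up in auto)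
  define G where "G = {x\<in>space M. \<psi> x = t}"
  have Gm: "G \<in> sets M" unfolding G_def using \<psi> by measurable
  have "(\<lambda>n. measure M (E (t - ?d n))) \<longlonglongrightarrow> measure M (\<Inter>n. E (t - ?d n))"
  proof (rule finite_Lim_measure_decseq)
   show "decseq (\<lambda>n. E (t - ?d n))" unfolding decseq_def E_def using dd by (fastforce intro: le_less_trans diff_left_mono)
  qed (use Em in auto)
  moreover have "(\<Inter>n. E (t - ?d n)) = E t \<union> G"
  proof (intro equalityI subsetI)
   fix x assume x: "x \<in> (\<Inter>n. E (t - ?d n))"
   have "t \<le> \<psi> x"
   proof (rule ccontr)
    assume "\<not> ?thesis"
    then obtain n where "?d n < t - \<psi> x" using ex[of "t - \<psi> x"] by auto
    moreover have "t - ?d n < \<psi> x" using x by (auto simp: E_def)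
    ultimately show False by linarith
   qed
   then show "x \<in> E t \<union> G" using x by (auto simp: E_def G_def)
  next
   fix x assume x: "x \<in> E t \<union> G"
   have "t - ?d n < \<psi> x" for n
   proof -
    have "0 < ?d n" by simp
    moreover have "t \<le> \<psi> x" using x by (auto simp: E_def G_def)
    ultimately show ?thesis by linarith
   qed
   then show "x \<in> (\<Inter>n. E (t - ?d n))" using x by (auto simp: E_def G_def)
  qed
  ultimately have "(\<lambda>n. measure M (E (t - ?d n))) \<longlonglongrightarrow> measure M (E t \<union> G)" by simp
  then have "Q \<le> measure M (E t \<union> G)" by (rule LIMSEQ_le_const) (use lo in auto)
  also have "\<dots> = measure M (E t) + measure M G"
   by (rule finite_measure_Union[OF Em Gm]) (auto simp: E_def G_def)
  finally have m2: "Q \<le> measure M (E t) + measure M G" .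
  \<comment> \<open>If the level set is null, both super-level sets have measure Q, and the value at
    the jump does not affect the integral.\<close>
  define \<alpha> where "\<alpha> = (if measure M G = 0 then 0 else (Q - measure M (E t)) / measure M G)"
  have G0: "0 \<le> measure M G" by simp
  have \<alpha>: "0 \<le> \<alpha>" "\<alpha> \<le> 1" "measure M (E t) + \<alpha> * measure M G = Q"
   using m1 m2 G0 by (auto simp: \<alpha>_def divide_le_eq)
  define p where "p s = (if t < s then 1 else if s = t then \<alpha> else 0)" for s
  have "threshold p" using \<alpha>(1,2) by (auto simp: threshold_def p_def)
  moreover have "(LINT x|M. p (\<psi> x)) = (LINT x|M. indicator (E t) x + \<alpha> * indicator G x)"
   by (rule lint_cong) (auto simp: p_def E_def G_def indicator_def)
  then have "(LINT x|M. p (\<psi> x)) = Q"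
   using Em Gm \<alpha>(3) by (subst (asm) lint_add)
    (auto intro!: integrable_mult_right integrable_real_indicator simp: emeasure_eq_measure)
  ultimately show thesis using that by blast
 qed
qed

text \<open>Thresholds are comparable everywhere; if the order is the opposite one, the integrals
  force equality almost everywhere.\<close>

lemma threshold_mono_AE:
 assumes p: "threshold p" "threshold p'" and \<psi>: "\<psi> \<in> borel_measurable M"
  and le: "(LINT x|M. p (\<psi> x)) \<le> (LINT x|M. p' (\<psi> x))"
 shows "AE x in M. p (\<psi> x) \<le> p' (\<psi> x)"
 using threshold_comparable[OF p]
proof
 assume ge: "\<forall>s. p' s \<le> p s"
 note i = threshold_integrable[OF p(1) \<psi>] threshold_integrable[OF p(2) \<psi>]
 have "(LINT x|M. p (\<psi> x) - p' (\<psi> x)) = (LINT x|M. p (\<psi> x)) - (LINT x|M. p' (\<psi> x))"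
  by (rule lint_diff[OF i])
 moreover have "0 \<le> (LINT x|M. p (\<psi> x) - p' (\<psi> x))" using ge by (intro lint_nonneg) auto
 ultimately have "(LINT x|M. p (\<psi> x) - p' (\<psi> x)) = 0" using le by linarith
 then have "AE x in M. p (\<psi> x) - p' (\<psi> x) = 0"
  using ge by (subst (asm) integral_nonneg_eq_0_iff_AE) (auto intro!: L1_diff i)
 then show ?thesis by eventually_elim simp
qed auto

text \<open>At a level t of the threshold, (\<psi> - t) (p(\<psi>) - \<Theta>) is nonnegative almost
  everywhere. On integration the multiple of t drops out because \<Theta> and p(\<psi>) have equal
  integrals.\<close>

lemma bathtub:
 assumes p: "threshold p" and \<psi>: "integrable M \<psi>" and \<Theta>: "\<Theta> \<in> borel_measurable M" "AE x in M. 0 \<le> \<Theta> x \<and> \<Theta> x \<le> 1"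
  and eq: "(LINT x|M. \<Theta> x) = (LINT x|M. p (\<psi> x))"
 shows "(LINT x|M. \<Theta> x * \<psi> x) \<le> (LINT x|M. p (\<psi> x) * \<psi> x)"
proof -
 have \<psi>m: "\<psi> \<in> borel_measurable M" using \<psi> by simp
 note ip = threshold_integrable[OF p \<psi>m]
 have i\<Theta>: "integrable M \<Theta>" by (rule integrable_const_bound[of _ 1, OF _ \<Theta>(1)]) (use \<Theta>(2) in \<open>eventually_elim, simp\<close>)
 have bp: "AE x in M. \<bar>p (\<psi> x)\<bar> \<le> 1" using threshold_bounds[OF p] by (auto simp: abs_le_iff intro: order_trans[of _ 0])
 have b\<Theta>: "AE x in M. \<bar>\<Theta> x\<bar> \<le> 1" using \<Theta>(2) by eventually_elim auto
 note ip\<psi> = integrable_bounded_mult[OF \<psi> borel_measurable_integrable[OF ip] bp]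
 note i\<Theta>\<psi> = integrable_bounded_mult[OF \<psi> \<Theta>(1) b\<Theta>]
 have "\<exists>t. AE x in M. 0 \<le> (\<psi> x - t) * (p (\<psi> x) - \<Theta> x)"
 proof -
  define S where "S = {s. 0 < p s}"
  \<comment> \<open>In the first two cases the level is infinite; then \<Theta> agrees with the
    constant threshold almost everywhere, and t = 0 serves.\<close>
  consider "S = {}" | "S = UNIV" | "S \<noteq> {}" "S \<noteq> UNIV" by blast
  then show ?thesis
  proof cases
   case 1
   have p0: "p s = 0" for s using threshold_bounds[OF p, of s] 1 unfolding S_def by (metis empty_Collect_eq antisym not_le)
   then have "(LINT x|M. \<Theta> x) = 0" using eq by simp
   moreover have "AE x in M. 0 \<le> \<Theta> x" using \<Theta>(2) by eventually_elim auto
   ultimately have "AE x in M. \<Theta> x = 0" using i\<Theta> by (simp add: integral_nonneg_eq_0_iff_AE)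
   then have "AE x in M. 0 \<le> (\<psi> x - 0) * (p (\<psi> x) - \<Theta> x)" by eventually_elim (simp add: p0)
   then show ?thesis by blast
  next
   case 2
   then have "0 < p (s - 1)" for s by (auto simp: S_def)
   then have p1: "p s = 1" for s using p unfolding threshold_def by (metis diff_less zero_less_one less_add_one diff_add_cancel)
   have "(LINT x|M. 1 - \<Theta> x) = (LINT x|M. 1) - (LINT x|M. \<Theta> x)" by (rule lint_diff) (use i\<Theta> in auto)
   then have "(LINT x|M. 1 - \<Theta> x) = 0" using eq by (simp add: p1)
   moreover have "AE x in M. 0 \<le> 1 - \<Theta> x" using \<Theta>(2) by eventually_elim auto
   ultimately have "AE x in M. 1 - \<Theta> x = 0"
    using i\<Theta> by (subst (asm) integral_nonneg_eq_0_iff_AE) auto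
   then have "AE x in M. 0 \<le> (\<psi> x - 0) * (p (\<psi> x) - \<Theta> x)" by eventually_elim (simp add: p1)
   then show ?thesis by blast
  next
   case 3
   then obtain r where "r \<notin> S" by blast
   then have r: "p r \<le> 0" by (simp add: S_def)
   have lb: "r \<le> s" if "s \<in> S" for s
   proof (rule ccontr)
    assume "\<not> r \<le> s"
    then have "p r = 1" using p \<open>s \<in> S\<close> \<open>\<not> r \<le> s\<close> by (auto simp: threshold_def S_def not_le)
    then show False using r by simp
   qed
   then have bdd: "bdd_below S" by (auto simp: bdd_below_def)
   have 1: "p s = 1" if gt: "Inf S < s" for s
   proof -
    obtain s' where "s' \<in> S" "s' < s" using gt cInf_less_iff[OF 3(1) bdd] by auto
    then show ?thesis using p by (auto simp: threshold_def S_def)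
   qed
   have 2: "p s = 0" if lt: "s < Inf S" for s
   proof -
    have "s \<notin> S" using lt cInf_lower[OF _ bdd, of s] by auto
    then show ?thesis using threshold_bounds[OF p, of s] by (auto simp: S_def not_less intro: antisym)
   qed
   have "AE x in M. 0 \<le> (\<psi> x - Inf S) * (p (\<psi> x) - \<Theta> x)"
    using \<Theta>(2)
   proof eventually_elim
    case (elim x)
    consider "Inf S < \<psi> x" | "\<psi> x < Inf S" | "\<psi> x = Inf S" by linarith
    then show ?case by cases (use elim 1 2 in \<open>auto intro: mult_nonpos_nonneg mult_nonpos_nonpos simp: mult_nonpos_nonneg mult_le_0_iff zero_le_mult_iff\<close>)
   qed
   then show ?thesis by blast
  qed
 qed
 then obtain t where t: "AE x in M. 0 \<le> (\<psi> x - t) * (p (\<psi> x) - \<Theta> x)" by blast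
 have "0 \<le> (LINT x|M. (\<psi> x - t) * (p (\<psi> x) - \<Theta> x))" by (rule integral_nonneg_AE[OF t])
 also have "\<dots> = (LINT x|M. (p (\<psi> x) * \<psi> x - \<Theta> x * \<psi> x) - t * (p (\<psi> x) - \<Theta> x))"
  by (rule lint_cong) (auto simp: algebra_simps)
 also have "\<dots> = (LINT x|M. p (\<psi> x) * \<psi> x - \<Theta> x * \<psi> x) - (LINT x|M. t * (p (\<psi> x) - \<Theta> x))"
  using ip i\<Theta> ip\<psi> i\<Theta>\<psi> by (intro lint_diff) auto
 also have "\<dots> = (LINT x|M. p (\<psi> x) * \<psi> x) - (LINT x|M. \<Theta> x * \<psi> x)"
  using ip i\<Theta> ip\<psi> i\<Theta>\<psi> eq by simp
 finally show ?thesis by simp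
qed

end

text \<open>Summation by parts with decreasing weights: for 0 < k < n the term D k enters with the
  coefficient C (k - 1) - C k, which is nonnegative.\<close>

lemma abel_summation_le:
 fixes C D :: "nat \<Rightarrow> real"
 assumes "D 0 = 0" "\<And>k. k < n ==> 0 \<le> D k" "\<And>k. Suc k < n ==> C (Suc k) \<le> C k"
 shows "C (n - 1) * D n \<le> (\<Sum>k<n. C k * (D (Suc k) - D k))"
 using assms
proof (induction n)
 case (Suc n)
 have IH: "C (n - 1) * D n \<le> (\<Sum>k<n. C k * (D (Suc k) - D k))" by (rule Suc.IH) (use Suc.prems in auto)
 have "C n * D n \<le> C (n - 1) * D n"
 proof (cases n)
  case (Suc m)
  then show ?thesis using Suc.prems(2)[of n] Suc.prems(3)[of m] by (auto intro: mult_right_mono)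
 qed simp
 then show ?case using IH by (simp add: algebra_simps)
qed simp

context finite_measure
begin

text \<open>The phases are ordered by decreasing \<open>c\<close>; the optimal partial sums are super-level sets of \<open>\<psi>\<close>.\<close>

lemma bathtub_proportions:
 fixes c q :: "'N::finite \<Rightarrow> real"
 assumes \<psi>: "integrable M \<psi>" and q: "\<And>i. 0 \<le> q i" "(\<Sum>i\<in>UNIV. q i) = measure M (space M)"
 obtains \<Phi> :: "real \<Rightarrow> real^'N" where "\<Phi> \<in> borel_measurable borel" "AE x in M. \<Phi> (\<psi> x) \<in> proportions"
  "\<And>i. (LINT x|M. \<Phi> (\<psi> x) $ i) = q i"
  "\<And>\<theta>. \<theta> \<in> borel_measurable M ==> AE x in M. \<theta> x \<in> proportions ==> (\<And>i. (LINT x|M. \<theta> x $ i) = q i) ==>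
   (LINT x|M. (\<Sum>j\<in>UNIV. \<theta> x $ j * c j) * \<psi> x) \<le> (LINT x|M. (\<Sum>j\<in>UNIV. \<Phi> (\<psi> x) $ j * c j) * \<psi> x)"
proof -
 have \<psi>m: "\<psi> \<in> borel_measurable M" using \<psi> by simp
 obtain ys :: "'N list" where ys: "set ys = UNIV" "distinct ys" using finite_distinct_list[of "UNIV :: 'N set"] by auto
 define xs where "xs = sort_key (\<lambda>i. - c i) ys"
 have xs: "set xs = UNIV" "distinct xs" "sorted (map (\<lambda>i. - c i) xs)" using ys by (auto simp: xs_def)
 define n where "n = length xs"
 define b where "b k = xs ! k" for k
 have bij: "bij_betw b {..<n} UNIV" unfolding b_def n_def using bij_betw_nth[OF xs(2) refl, of UNIV] xs(1) by (simp add: bij_betw_nth)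
 have reindex: "(\<Sum>i\<in>UNIV. F i) = (\<Sum>k<n. F (b k))" for F :: "'N \<Rightarrow> real"
  by (rule sum.reindex_bij_betw[OF bij, symmetric])
 have mono: "c (b (Suc k)) \<le> c (b k)" if "Suc k < n" for k
  using sorted_nth_mono[OF xs(3), of k "Suc k"] that by (simp add: b_def n_def)
 define Q where "Q k = (\<Sum>l<k. q (b l))" for k
 have Q0: "0 \<le> Q k" for k unfolding Q_def using q(1) by (intro sum_nonneg) auto
 have Qn: "Q n = measure M (space M)" using q(2) reindex[of q] by (simp add: Q_def)
 have Qmono: "Q k \<le> Q l" if "k \<le> l" for k l unfolding Q_def using that q(1) by (intro sum_mono2) auto
 have "\<exists>p. threshold p \<and> (LINT x|M. p (\<psi> x)) = Q k" if "k \<le> n" for k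
  using threshold_exists[OF \<psi>m Q0, of k] Qmono[OF that] Qn by (metis (no_types))
 then obtain p where p: "\<And>k. k \<le> n ==> threshold (p k)" "\<And>k. k \<le> n ==> (LINT x|M. p k (\<psi> x)) = Q k" by metis
 \<comment> \<open>The two ends are fixed pointwise, not only almost everywhere, so that the
   increments that define \<Phi> add up to exactly 1.\<close>
 define P where "P k s = (if k = 0 then 0 else if k = n then 1 else p k s)" for k s
 have n0: "n \<noteq> 0" using xs(1) by (auto simp: n_def)
 have P: "threshold (P k)" "(LINT x|M. P k (\<psi> x)) = Q k" if "k \<le> n" for k
  using p that Qn by (cases "k = 0"; cases "k = n"; auto simp: P_def[abs_def] threshold_def Q_def)+
 have Pm: "P k \<in> borel_measurable borel" if "k \<le> n" for k by (rule threshold_measurable[OF P(1)[OF that]])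
 have Pi: "integrable M (\<lambda>x. P k (\<psi> x))" if "k \<le> n" for k by (rule threshold_integrable[OF P(1)[OF that] \<psi>m])
 have Ple: "AE x in M. P k (\<psi> x) \<le> P (Suc k) (\<psi> x)" if "k < n" for k
  by (rule threshold_mono_AE[OF P(1) P(1) \<psi>m]) (use that P(2) Qmono in auto)
 define ix where "ix = inv_into {..<n} b"
 have ix: "ix i < n" "b (ix i) = i" for i
  using bij inv_into_into[of i b "{..<n}"] f_inv_into_f[of i b "{..<n}"] by (auto simp: ix_def bij_betw_def)
 have ixb: "ix (b k) = k" if "k < n" for k using bij that by (auto simp: ix_def bij_betw_def inv_into_f_f)
 \<comment> \<open>Increments of nested thresholds: the first k phases in the order of decreasing c
   together fill the super-level set of mass Q k.\<close>
 define \<Phi> :: "real \<Rightarrow> real^'N" where "\<Phi> s = (\<chi> i. P (Suc (ix i)) s - P (ix i) s)" for s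
 have \<Phi>b: "\<Phi> s $ b k = P (Suc k) s - P k s" if "k < n" for k s using ixb[OF that] by (simp add: \<Phi>_def)
 have \<Phi>m: "\<Phi> \<in> borel_measurable borel"
 proof (rule borel_measurable_vecI)
  fix i
  show "(\<lambda>s. \<Phi> s $ i) \<in> borel_measurable borel"
   unfolding \<Phi>_def using Pm[of "ix i"] Pm[of "Suc (ix i)"] ix(1)[of i] by simp
 qed
 have "AE x in M. \<forall>k\<in>{..<n}. P k (\<psi> x) \<le> P (Suc k) (\<psi> x)" using Ple by (intro AE_finite_allI) auto
 then have \<Phi>p: "AE x in M. \<Phi> (\<psi> x) \<in> proportions"
 proof eventually_elim
  case (elim x)
  have "0 \<le> \<Phi> (\<psi> x) $ i \<and> \<Phi> (\<psi> x) $ i \<le> 1" for i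
   using elim ix(1)[of i] threshold_bounds[OF P(1), of "Suc (ix i)" "\<psi> x"] threshold_bounds[OF P(1), of "ix i" "\<psi> x"]
   by (auto simp: \<Phi>_def)
  note b01 = this
  have "(\<Sum>i\<in>UNIV. \<Phi> (\<psi> x) $ i) = (\<Sum>k<n. P (Suc k) (\<psi> x) - P k (\<psi> x))"
   unfolding reindex by (intro sum.cong refl \<Phi>b) simp
  moreover have "P n (\<psi> x) = 1" "P 0 (\<psi> x) = 0" using n0 by (simp_all add: P_def)
  ultimately have "(\<Sum>i\<in>UNIV. \<Phi> (\<psi> x) $ i) = 1"
   using sum_lessThan_telescope[of "\<lambda>k. P k (\<psi> x)" n] by linarith
  then show ?case using b01 by (simp add: proportions_def)
 qed
 have \<Phi>q: "(LINT x|M. \<Phi> (\<psi> x) $ i) = q i" for i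
 proof -
  let ?k = "ix i"
  have "(LINT x|M. \<Phi> (\<psi> x) $ i) = (LINT x|M. P (Suc ?k) (\<psi> x)) - (LINT x|M. P ?k (\<psi> x))"
   unfolding \<Phi>_def using ix(1)[of i] by (simp add: Pi)
  also have "\<dots> = q i" using P(2)[of "Suc ?k"] P(2)[of ?k] ix[of i] by (simp add: Q_def)
  finally show ?thesis .
 qed
 have comp: "AE x in M. \<bar>\<theta> x $ i\<bar> \<le> 1" if "AE x in M. \<theta> x \<in> proportions" for \<theta> :: "'a \<Rightarrow> real^'N" and i
  using that by eventually_elim (auto simp: proportions_def)
 have obj: "(LINT x|M. (\<Sum>j\<in>UNIV. \<theta> x $ j * c j) * \<psi> x) = (\<Sum>k<n. c (b k) * (LINT x|M. \<theta> x $ b k * \<psi> x))"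
  and int: "integrable M (\<lambda>x. \<theta> x $ i * \<psi> x)" "integrable M (\<lambda>x. \<theta> x $ i)"
  if \<theta>: "\<theta> \<in> borel_measurable M" "AE x in M. \<theta> x \<in> proportions" for \<theta> :: "'a \<Rightarrow> real^'N" and i
 proof -
  have m: "(\<lambda>x. \<theta> x $ i) \<in> borel_measurable M" for i using \<theta>(1) by (simp add: borel_measurable_vec_nth)
  have int': "integrable M (\<lambda>x. \<theta> x $ i * \<psi> x)" for i by (rule integrable_bounded_mult[OF \<psi> m comp[OF \<theta>(2)]])
  show "integrable M (\<lambda>x. \<theta> x $ i * \<psi> x)" by (rule int')
  show "integrable M (\<lambda>x. \<theta> x $ i)" by (rule integrable_const_bound[of _ 1]) (use m comp[OF \<theta>(2)] in auto)
  have "(LINT x|M. (\<Sum>j\<in>UNIV. \<theta> x $ j * c j) * \<psi> x) = (LINT x|M. (\<Sum>j\<in>UNIV. c j * (\<theta> x $ j * \<psi> x)))"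
   by (rule lint_cong) (auto simp: sum_distrib_right sum_distrib_left mult_ac)
  also have "\<dots> = (\<Sum>j\<in>UNIV. LINT x|M. c j * (\<theta> x $ j * \<psi> x))"
   by (rule lint_sum) (use int' in auto)
  also have "\<dots> = (\<Sum>j\<in>UNIV. c j * (LINT x|M. \<theta> x $ j * \<psi> x))" by simp
  finally show "(LINT x|M. (\<Sum>j\<in>UNIV. \<theta> x $ j * c j) * \<psi> x) = (\<Sum>k<n. c (b k) * (LINT x|M. \<theta> x $ b k * \<psi> x))"
   unfolding reindex .
 qed
 have "(LINT x|M. (\<Sum>j\<in>UNIV. \<theta> x $ j * c j) * \<psi> x) \<le> (LINT x|M. (\<Sum>j\<in>UNIV. \<Phi> (\<psi> x) $ j * c j) * \<psi> x)"
  if \<theta>: "\<theta> \<in> borel_measurable M" "AE x in M. \<theta> x \<in> proportions" "\<And>i. (LINT x|M. \<theta> x $ i) = q i" for \<theta>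
 proof -
  have \<Phi>\<psi>: "(\<lambda>x. \<Phi> (\<psi> x)) \<in> borel_measurable M" by (rule measurable_compose[OF \<psi>m \<Phi>m])
  define \<Theta> where "\<Theta> k x = (\<Sum>l<k. \<theta> x $ b l)" for k x
  \<comment> \<open>The advantage of \<Phi> in the first k phases taken together. It is nonnegative
    by \<open>bathtub\<close>, and it vanishes for k = n, where both sums are 1.\<close>
  define D where "D k = (LINT x|M. P k (\<psi> x) * \<psi> x) - (LINT x|M. \<Theta> k x * \<psi> x)" for k
  have bP: "AE x in M. \<bar>P k (\<psi> x)\<bar> \<le> 1" if "k \<le> n" for k
   using threshold_bounds[OF P(1)[OF that]] by (auto simp: abs_le_iff intro: order_trans[of _ 0])
  have P\<psi>: "integrable M (\<lambda>x. P k (\<psi> x) * \<psi> x)" if "k \<le> n" for k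
   by (rule integrable_bounded_mult[OF \<psi> borel_measurable_integrable[OF Pi[OF that]] bP[OF that]])
  have \<Theta>\<psi>: "(LINT x|M. \<Theta> k x * \<psi> x) = (\<Sum>l<k. LINT x|M. \<theta> x $ b l * \<psi> x)" for k
   unfolding \<Theta>_def sum_distrib_right by (rule lint_sum) (rule int(1)[OF \<theta>(1,2)])
  have \<Theta>i: "(LINT x|M. \<Theta> k x) = Q k" for k
   unfolding \<Theta>_def Q_def using \<theta>(3) by (subst lint_sum) (auto intro: int(2)[OF \<theta>(1,2)])
  have \<Theta>m: "\<Theta> k \<in> borel_measurable M" for k
   unfolding \<Theta>_def[abs_def] using \<theta>(1) by (intro borel_measurable_sum) (simp add: borel_measurable_vec_nth)
  have \<Theta>b: "AE x in M. 0 \<le> \<Theta> k x \<and> \<Theta> k x \<le> 1" if k: "k \<le> n" for k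
   using \<theta>(2)
  proof eventually_elim
   case (elim x)
   have "\<Theta> k x \<le> (\<Sum>l<n. \<theta> x $ b l)" unfolding \<Theta>_def using elim k by (intro sum_mono2) (auto simp: proportions_def)
   also have "\<dots> = 1" using elim reindex[of "\<lambda>i. \<theta> x $ i"] by (simp add: proportions_def)
   finally show ?case using elim by (auto simp: \<Theta>_def proportions_def intro!: sum_nonneg)
  qed
  have D: "0 \<le> D k" if k: "k \<le> n" for k
   using bathtub[OF P(1)[OF k] \<psi> \<Theta>m \<Theta>b[OF k]] P(2)[OF k] \<Theta>i by (simp add: D_def)
  have "0 \<le> c (b (n - 1)) * D n"
  proof -
   have "AE x in M. \<Theta> n x * \<psi> x = P n (\<psi> x) * \<psi> x" using \<theta>(2)
   proof eventually_elim
    case (elim x)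
    then show ?case using reindex[of "\<lambda>i. \<theta> x $ i"] n0 by (simp add: \<Theta>_def P_def proportions_def)
   qed
   then have "(LINT x|M. \<Theta> n x * \<psi> x) = (LINT x|M. P n (\<psi> x) * \<psi> x)"
    by (intro integral_cong_AE) (use \<Theta>m \<psi>m P\<psi>[of n] in \<open>auto intro!: borel_measurable_times borel_measurable_integrable\<close>)
   then show ?thesis by (simp add: D_def)
  qed
  also have "\<dots> \<le> (\<Sum>k<n. c (b k) * (D (Suc k) - D k))"
   by (rule abel_summation_le) (use D mono in \<open>auto simp: D_def P_def \<Theta>_def\<close>)
  also have "\<dots> = (\<Sum>k<n. c (b k) * (LINT x|M. \<Phi> (\<psi> x) $ b k * \<psi> x) - c (b k) * (LINT x|M. \<theta> x $ b k * \<psi> x))"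
  proof (rule sum.cong[OF refl])
   fix k assume "k \<in> {..<n}"
   then have k: "k < n" by simp
   have "(LINT x|M. \<Phi> (\<psi> x) $ b k * \<psi> x) = (LINT x|M. P (Suc k) (\<psi> x) * \<psi> x - P k (\<psi> x) * \<psi> x)"
    unfolding \<Phi>b[OF k] left_diff_distrib ..
   also have "\<dots> = (LINT x|M. P (Suc k) (\<psi> x) * \<psi> x) - (LINT x|M. P k (\<psi> x) * \<psi> x)"
    by (rule lint_diff) (use k P\<psi> in auto)
   finally have "D (Suc k) - D k = (LINT x|M. \<Phi> (\<psi> x) $ b k * \<psi> x) - (LINT x|M. \<theta> x $ b k * \<psi> x)"
    unfolding D_def \<Theta>\<psi> by simp
   then show "c (b k) * (D (Suc k) - D k) = c (b k) * (LINT x|M. \<Phi> (\<psi> x) $ b k * \<psi> x) - c (b k) * (LINT x|M. \<theta> x $ b k * \<psi> x)"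
    by (simp only: right_diff_distrib)
  qed
  finally show ?thesis unfolding obj[OF \<theta>(1,2)] obj[OF \<Phi>\<psi> \<Phi>p] by (simp add: sum_subtractf)
 qed
 then show thesis using that[OF \<Phi>m \<Phi>p \<Phi>q] by blast
qed

end

section \<open>Saddle points and maximizers\<close>

lemma measurable_cong_AE_lebesgue_on:
 fixes f g :: "'a::euclidean_space \<Rightarrow> 'b::euclidean_space"
 assumes S: "S \<in> sets lebesgue" and f: "f \<in> borel_measurable (lebesgue_on S)" and ae: "AE x in lebesgue_on S. f x = g x"
 shows "g \<in> borel_measurable (lebesgue_on S)"
proof -
 have S': "S \<inter> space lebesgue \<in> sets lebesgue" using S by simp
 have "(\<lambda>x. indicator S x *\<^sub>R f x) \<in> borel_measurable lebesgue"
  using f by (subst (asm) borel_measurable_restrict_space_iff[OF S'])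
 moreover have "AE x in lebesgue. x \<in> S \<longrightarrow> f x = g x" using ae by (subst (asm) AE_restrict_space_iff[OF S'])
 then have "AE x in lebesgue. indicator S x *\<^sub>R f x = indicator S x *\<^sub>R g x" by eventually_elim (auto simp: indicator_def)
 ultimately have "(\<lambda>x. indicator S x *\<^sub>R g x) \<in> borel_measurable lebesgue" by (rule borel_measurable_AE)
 then show ?thesis by (subst borel_measurable_restrict_space_iff[OF S'])
qed

lemma L2_cong_AE:
 assumes S: "S \<in> sets lebesgue" and f: "f \<in> L2 S" and ae: "AE x in lebesgue_on S. f x = g x"
 shows "g \<in> L2 S"
proof (rule L2_bound[OF measurable_cong_AE_lebesgue_on[OF S L2_D(1)[OF f] ae] f])
 show "AE x in lebesgue_on S. norm (g x) \<le> norm (f x)" using ae by eventually_elim simp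
qed

lemma Linf_continuous:
 fixes f :: "'a::euclidean_space \<Rightarrow> 'b::euclidean_space" and g :: "'b \<Rightarrow> 'c::euclidean_space"
 assumes f: "f \<in> Linf X" and g: "continuous_on UNIV g"
 shows "(\<lambda>x. g (f x)) \<in> Linf X"
proof -
 obtain C where C: "f \<in> borel_measurable (lebesgue_on X)" "C \<ge> 0" "AE x in lebesgue_on X. norm (f x) \<le> C"
  using Linf_D[OF f] .
 have "compact (g ` cball 0 C)" by (intro compact_continuous_image continuous_on_subset[OF g]) auto
 then have "bounded (g ` cball 0 C)" by (rule compact_imp_bounded)
 then obtain B where B: "\<forall>y\<in>g ` cball 0 C. norm y \<le> B" unfolding bounded_iff by blast
 have "AE x in lebesgue_on X. norm (g (f x)) \<le> B" using C(3) by eventually_elim (rule B[rule_format], simp)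
 then show ?thesis using borel_measurable_continuous_on[OF g C(1)] by (auto simp: Linf_def)
qed

lemma Linf_add: "f \<in> Linf X ==> g \<in> Linf X ==> (\<lambda>x. f x + g x) \<in> Linf X"
proof -
 assume f: "f \<in> Linf X" and g: "g \<in> Linf X"
 obtain C where C: "AE x in lebesgue_on X. norm (f x) \<le> C" using f by (auto simp: Linf_def)
 obtain D where D: "AE x in lebesgue_on X. norm (g x) \<le> D" using g by (auto simp: Linf_def)
 have "AE x in lebesgue_on X. norm (f x + g x) \<le> C + D" using C D by eventually_elim (rule norm_triangle_mono)
 then show ?thesis using f g by (auto simp: Linf_def)
qed

lemma Linf_scaleR:
 fixes f :: "'a::euclidean_space \<Rightarrow> real"
 assumes f: "f \<in> Linf X" and g: "g \<in> Linf X" shows "(\<lambda>x. f x *\<^sub>R g x) \<in> Linf X"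
proof -
 obtain C where C: "C \<ge> 0" "AE x in lebesgue_on X. norm (f x) \<le> C" using Linf_D[OF f] .
 obtain D where D: "AE x in lebesgue_on X. norm (g x) \<le> D" using g by (auto simp: Linf_def)
 have "AE x in lebesgue_on X. norm (f x *\<^sub>R g x) \<le> C * D"
  using C(2) D by eventually_elim (use C(1) in \<open>auto intro: mult_mono\<close>)
 then show ?thesis using f g by (auto simp: Linf_def)
qed

lemma Linf_sum:
 assumes "finite I" "\<And>i. i \<in> I ==> f i \<in> Linf X" shows "(\<lambda>x. \<Sum>i\<in>I. f i x) \<in> Linf X"
 using assms
proof (induction I)
 case empty
 show ?case by (auto simp: Linf_def)
next
 case (insert i I)
 then show ?case using Linf_add[of "f i" X] by simp
qed

lemma continuous_tensor: "continuous_on UNIV (\<lambda>e::real^'d::finite. tensor e e)"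
 unfolding tensor_def by (intro continuous_on_vec_lambda continuous_intros)

lemma continuous_conjugate:
 "continuous_on UNIV (\<lambda>Q::real^'d::finite^'d. transpose Q ** P ** Q)"
 unfolding matrix_matrix_mult_def transpose_def by (intro continuous_on_vec_lambda continuous_intros)

lemma mat_1_mult: "(c *\<^sub>R mat 1) *v v = c *\<^sub>R (v::real^'d::finite)"
 by (simp add: scaleR_matrix_vector_assoc[symmetric])

text \<open>Let h be the harmonic mean. Averaging 2 h - h^2 / \<lambda> \<le> \<lambda> over the
  phases with the weights t leaves h on the left and the arithmetic mean on the right.\<close>

lemma lam_minus_le_sum:
 assumes t: "t \<in> proportions" and pos: "\<And>i. lambda_min (M i) > 0" and s: "t \<bullet> inv_lam M > 0"
 shows "lam_minus M t \<le> (\<Sum>i\<in>UNIV. t $ i * lambda_min (M i))"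
proof -
 define h where "h = lam_minus M t"
 have h: "h * (t \<bullet> inv_lam M) = 1" using s by (simp add: h_def lam_minus_eq)
 have "2 * h - h^2 / lambda_min (M i) \<le> lambda_min (M i)" for i
 proof -
  have "0 \<le> (lambda_min (M i) - h)^2 / lambda_min (M i)" using pos[of i] by simp
  also have "\<dots> = lambda_min (M i) - 2 * h + h^2 / lambda_min (M i)" using pos[of i]
   by (simp add: power2_eq_square field_simps)
  finally show ?thesis by simp
 qed
 then have "(\<Sum>i\<in>UNIV. t $ i * (2 * h - h^2 / lambda_min (M i))) \<le> (\<Sum>i\<in>UNIV. t $ i * lambda_min (M i))"
  using t by (intro sum_mono mult_left_mono) (auto simp: proportions_def)
 moreover have "(\<Sum>i\<in>UNIV. t $ i * (2 * h - h^2 / lambda_min (M i))) = 2 * h * (\<Sum>i\<in>UNIV. t $ i) - h^2 * (t \<bullet> inv_lam M)"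
  by (simp add: inv_lam_def inner_vec_def sum_distrib_left sum_subtractf[symmetric] algebra_simps)
 moreover have "h^2 * (t \<bullet> inv_lam M) = h" using h by (simp add: power2_eq_square mult.assoc)
 ultimately show ?thesis using t by (simp add: h_def proportions_def)
qed

lemma laminate_matrix_mult:
 "laminate_matrix P lam t e *v v = ((e \<bullet> v) / (\<Sum>i\<in>UNIV. t $ i / lam i)) *\<^sub>R e + (\<Sum>i\<in>UNIV. (t $ i) *\<^sub>R (P i *v v - (lam i * (e \<bullet> v)) *\<^sub>R e))"
 by (simp add: laminate_matrix_def matrix_vector_mult_add_rdistrib matrix_sum_mult scaleR_matrix_vector_assoc[symmetric]
   matrix_vector_mult_diff_rdistrib tensor_mult)

text \<open>Splitting v along e and its complement decouples the form. The harmonic mean along e is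
  absorbed by the hypothesis \<open>h\<close>, the tangential part by the bounds on the
  phases.\<close>

lemma laminate_matrix_upper:
 fixes P :: "'N::finite \<Rightarrow> real^'d::finite^'d"
 assumes t: "t \<in> proportions" and P: "\<And>i. transpose (P i) = P i" and e: "norm e = 1" and ev: "\<And>i. P i *v e = lam i *\<^sub>R e"
  and up: "\<And>i v. v \<bullet> (P i *v v) \<le> L i * (norm v)^2" and h: "1 / (\<Sum>i\<in>UNIV. t $ i / lam i) \<le> (\<Sum>i\<in>UNIV. t $ i * L i)"
 shows "v \<bullet> (laminate_matrix P lam t e *v v) \<le> (\<Sum>i\<in>UNIV. t $ i * L i) * (norm v)^2"
proof -
 define a where "a = e \<bullet> v"
 define w where "w = v - a *\<^sub>R e"
 have ee: "e \<bullet> e = 1" using e by (simp add: norm_eq_1)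
 have ew: "e \<bullet> w = 0" by (simp add: w_def a_def inner_diff_right ee)
 have v: "v = a *\<^sub>R e + w" by (simp add: w_def)
 have nv: "(norm v)^2 = a^2 + (norm w)^2"
  unfolding v power2_norm_eq_inner using ew ee by (simp add: inner_add_left inner_add_right inner_commute power2_eq_square)
 have "v \<bullet> (P i *v v) = lam i * a^2 + w \<bullet> (P i *v w)" for i
 proof -
  have "e \<bullet> (P i *v w) = 0" using symmetric_inner[OF P[of i], of e w] ew by (simp add: ev)
  then show ?thesis unfolding v using ew ee
   by (simp add: matrix_vector_right_distrib matrix_vector_mult_scaleR ev inner_add_left inner_add_right inner_commute power2_eq_square)
 qed
 then have "v \<bullet> (laminate_matrix P lam t e *v v) = a^2 * (1 / (\<Sum>i\<in>UNIV. t $ i / lam i)) + (\<Sum>i\<in>UNIV. t $ i * (w \<bullet> (P i *v w)))"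
  by (simp add: laminate_matrix_mult inner_add_right inner_sum_right inner_diff_right a_def[symmetric] inner_commute[of v e] power2_eq_square)
 also have "\<dots> \<le> a^2 * (\<Sum>i\<in>UNIV. t $ i * L i) + (\<Sum>i\<in>UNIV. t $ i * (L i * (norm w)^2))"
  using t by (intro add_mono mult_left_mono[OF h] sum_mono mult_left_mono[OF up]) (auto simp: proportions_def)
 also have "\<dots> = (\<Sum>i\<in>UNIV. t $ i * L i) * (norm v)^2" unfolding nv
  by (simp add: sum_distrib_right sum_distrib_left sum.distrib[symmetric] algebra_simps)
 finally show ?thesis .
qed

lemma laminate_matrix_sym:
 assumes "\<And>i. transpose (P i) = P i" shows "transpose (laminate_matrix P lam t e) = laminate_matrix P lam t e"
proof -
 have "P i $ a $ b = P i $ b $ a" for i a b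
 proof -
  have "P i $ a $ b = transpose (P i) $ b $ a" by (simp add: transpose_def)
  also have "\<dots> = P i $ b $ a" unfolding assms ..
  finally show ?thesis .
 qed
 then show ?thesis by (simp add: laminate_matrix_def transpose_def tensor_def vec_eq_iff mult.commute)
qed

lemma simple_laminate_eq:
 "simple_laminate M R \<theta> x = laminate_matrix (\<lambda>i. transpose (R i x) ** M i ** R i x) (\<lambda>i. lambda_min (M i)) (\<theta> x) (e_r x)"
 by (simp add: simple_laminate_def laminate_matrix_def lam_minus_def)

text \<open>The profiles k are Borel versions of the data. The flux \<sigma>s is prescribed only on
  the ball, since \<open>flux\<close> and \<open>radial_flux\<close> may differ outside.\<close>

locale radial_problem = ball_domain X rad for X :: "(real^'d::finite) set" and rad +
 fixes M :: "'N::finite \<Rightarrow> real^'d^'d" and q :: "'N \<Rightarrow> real" and \<mu> :: "'m::finite \<Rightarrow> real"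
  and f :: "'m \<Rightarrow> real^'d \<Rightarrow> real" and k :: "'m \<Rightarrow> real \<Rightarrow> real" and \<sigma>s :: "'m \<Rightarrow> real^'d \<Rightarrow> real^'d"
 assumes sym: "\<And>i. transpose (M i) = M i" and pos: "\<And>i. lambda_min (M i) > 0"
  and q: "\<And>i. 0 \<le> q i" "(\<Sum>i\<in>UNIV. q i) = measure lebesgue X" and weights: "\<And>i. \<mu> i > 0"
  and k: "\<And>i. k i \<in> borel_measurable borel" "\<And>i. (\<lambda>x. k i (norm x)) \<in> L2 X"
  and fk: "\<And>i. AE x in LM. f i x = k i (norm x)" and \<sigma>s: "\<And>i x. x \<in> X ==> \<sigma>s i x = flux (k i) x"
begin

definition "energy_density x = (\<Sum>i\<in>UNIV. \<mu> i * (norm (\<sigma>s i x))^2)"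

definition "reward \<theta> = (LINT x|LM. (\<Sum>j\<in>UNIV. \<theta> x $ j / lambda_min (M j)) * energy_density x)"

lemma inner_inv_lam: "(\<Sum>j\<in>UNIV. t $ j / lambda_min (M j)) = t \<bullet> inv_lam M"
 by (simp add: inner_vec_def inv_lam_def)

section \<open>The explicit flux and the cost H\<close>

lemma f_L2: "f i \<in> L2 X"
proof (rule L2_cong_AE[OF setsl k(2)[of i]])
 show "AE x in LM. k i (norm x) = f i x" using fk[of i] by eventually_elim simp
qed

lemma \<sigma>s_L2: "\<sigma>s i \<in> L2 X"
 by (rule L2_cong_AE[OF setsl flux_L2[OF k(1,2)[of i]]], rule AE_I2) (simp add: \<sigma>s)

lemma \<sigma>s_div: assumes "\<phi> \<in> test" shows "(LINT x|LM. \<sigma>s i x \<bullet> grad \<phi> x) = (LINT x|LM. f i x * \<phi> x)"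
proof -
 have "(LINT x|LM. \<sigma>s i x \<bullet> grad \<phi> x) = (LINT x|LM. flux (k i) x \<bullet> grad \<phi> x)"
  by (rule lint_cong) (auto simp: \<sigma>s)
 also have "\<dots> = (LINT x|LM. k i (norm x) * \<phi> x)" by (rule flux_div[OF k assms])
 also have "\<dots> = (LINT x|LM. f i x * \<phi> x)"
  by (rule integral_cong_AE)
   (use fk[of i] in \<open>auto intro!: borel_measurable_integrable L2_mult_integrable k f_L2 test_L2[OF assms] elim: eventually_mono\<close>)
 finally show ?thesis .
qed

lemma \<sigma>s_fluxes: "\<sigma>s \<in> fluxes X f"
 by (simp add: fluxes_def neg_div_eq_def L2_functional_def \<sigma>s_L2 \<sigma>s_div)

lemma energy_density_integrable: "integrable LM energy_density"
 unfolding energy_density_def[abs_def] by (intro L1_sum integrable_mult_right L2_D(2) \<sigma>s_L2)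

lemma admissible_D:
 assumes "\<theta> \<in> admissible X q"
 shows "\<theta> \<in> borel_measurable LM" "AE x in LM. \<theta> x \<in> proportions" "(\<lambda>x. \<theta> x \<bullet> inv_lam M) \<in> borel_measurable LM"
 using assms by (auto simp: admissible_def Linf_into_def Linf_def)

lemma admissible_bounds:
 assumes "\<theta> \<in> admissible X q"
 obtains c C where "0 < c" "0 < C" "AE x in LM. c \<le> \<theta> x \<bullet> inv_lam M" "AE x in LM. \<theta> x \<bullet> inv_lam M \<le> C"
proof -
 obtain c C where c: "0 < c" "\<And>t. t \<in> proportions ==> c \<le> t \<bullet> inv_lam M" "\<And>t. t \<in> proportions ==> t \<bullet> inv_lam M \<le> C"
  by (rule inv_lam_bounds[of M, OF pos]) blast
 have "AE x in LM. c \<le> \<theta> x \<bullet> inv_lam M" using admissible_D(2)[OF assms] by eventually_elim (rule c(2))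
 moreover have "AE x in LM. \<theta> x \<bullet> inv_lam M \<le> max C 1"
  using admissible_D(2)[OF assms] by eventually_elim (rule max.coboundedI1, rule c(3))
 ultimately show thesis using that[of c "max C 1"] c(1) by auto
qed

lemma weighted_L2:
 assumes "\<theta> \<in> admissible X q" "\<sigma> \<in> L2 X" shows "(\<lambda>x. (\<theta> x \<bullet> inv_lam M) *\<^sub>R \<sigma> x) \<in> L2 X"
proof -
 obtain c C where c: "0 < c" "0 < C" "AE x in LM. c \<le> \<theta> x \<bullet> inv_lam M" "AE x in LM. \<theta> x \<bullet> inv_lam M \<le> C"
  by (rule admissible_bounds[OF assms(1)]) blast
 have "AE x in LM. \<bar>\<theta> x \<bullet> inv_lam M\<bar> \<le> C" using c(3,4) by eventually_elim (use c in auto)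
 then show ?thesis by (rule L2_bounded_mult[OF admissible_D(3)[OF assms(1)] _ assms(2)])
qed

lemma weighted_integrable:
 fixes a b :: "real^'d \<Rightarrow> real^'d"
 assumes "\<theta> \<in> admissible X q" "a \<in> L2 X" "b \<in> L2 X"
 shows "integrable LM (\<lambda>x. (\<theta> x \<bullet> inv_lam M) * (a x \<bullet> b x))" "integrable LM (\<lambda>x. (\<theta> x \<bullet> inv_lam M) * (norm (a x))^2)"
 using L2_inner_integrable[OF weighted_L2[OF assms(1,2)] assms(3)] L2_inner_integrable[OF weighted_L2[OF assms(1,2)] assms(2)]
 by (auto simp: power2_norm_eq_inner)

lemma H_cost_eq: "H_cost X M \<mu> \<theta> \<sigma> = (\<Sum>i\<in>UNIV. \<mu> i * (LINT x|LM. (\<theta> x \<bullet> inv_lam M) * (norm (\<sigma> i x))^2))"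
 by (simp add: H_cost_def lam_minus_eq mult.commute)

lemma reward_eq:
 assumes "\<theta> \<in> admissible X q"
 shows "reward \<theta> = (\<Sum>i\<in>UNIV. \<mu> i * (LINT x|LM. (\<theta> x \<bullet> inv_lam M) * (norm (\<sigma>s i x))^2))"
proof -
 have "reward \<theta> = (LINT x|LM. (\<Sum>i\<in>UNIV. \<mu> i * ((\<theta> x \<bullet> inv_lam M) * (norm (\<sigma>s i x))^2)))"
  unfolding reward_def inner_inv_lam energy_density_def
  by (rule lint_cong) (auto simp: sum_distrib_left mult_ac)
 also have "\<dots> = (\<Sum>i\<in>UNIV. LINT x|LM. \<mu> i * ((\<theta> x \<bullet> inv_lam M) * (norm (\<sigma>s i x))^2))"
  by (rule lint_sum) (intro integrable_mult_right weighted_integrable(2)[OF assms \<sigma>s_L2 \<sigma>s_L2])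
 finally show ?thesis by simp
qed

lemma H_cost_\<sigma>s: "\<theta> \<in> admissible X q ==> H_cost X M \<mu> \<theta> \<sigma>s = reward \<theta>"
 by (simp add: H_cost_eq reward_eq)

text \<open>For radial proportions the weighted flux is a profile of |x| times e_r almost
  everywhere, and \<open>radial_div_free\<close> applies. A Borel profile of the weight is extracted
  first because radiality supplies an arbitrary one.\<close>

lemma radial_orthogonal:
 assumes \<theta>: "\<theta> \<in> admissible X q" "radial_on X \<theta>"
  and \<tau>: "\<tau> \<in> L2 X" "\<And>\<phi>. \<phi> \<in> test ==> (LINT x|LM. \<tau> x \<bullet> grad \<phi> x) = 0"
 shows "(LINT x|LM. (\<theta> x \<bullet> inv_lam M) * (\<sigma>s i x \<bullet> \<tau> x)) = 0"
proof -
 obtain p where p: "AE x in LM. \<theta> x = p (norm x)" using \<theta>(2) by (auto simp: radial_on_def)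
 then have "AE x in LM. \<theta> x \<bullet> inv_lam M = p (norm x) \<bullet> inv_lam M" by eventually_elim simp
 then obtain p0 where p0: "p0 \<in> borel_measurable borel" "AE x in LM. \<theta> x \<bullet> inv_lam M = p0 (norm x)"
  by (rule radial_profile[OF admissible_D(3)[OF \<theta>(1)], where p="\<lambda>r. p r \<bullet> inv_lam M"])
 define h where "h r = p0 r * (- cum (k i) r / (area * r ^ (dm - 1)))" for r
 have h: "h \<in> borel_measurable borel" unfolding h_def[abs_def] using p0(1) cum_measurable[OF k(1)[of i]] by measurable
 have eq: "AE x in LM. h (norm x) *\<^sub>R e_r x = (\<theta> x \<bullet> inv_lam M) *\<^sub>R \<sigma>s i x"
  using p0(2) AE_space by eventually_elim (simp add: h_def \<sigma>s flux_def)
 have hL: "(\<lambda>x. h (norm x)) \<in> L2 X"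
 proof (rule L2_bound[OF radial_measurable[OF h] weighted_L2[OF \<theta>(1) \<sigma>s_L2[of i]]])
  show "AE x in LM. norm (h (norm x)) \<le> norm ((\<theta> x \<bullet> inv_lam M) *\<^sub>R \<sigma>s i x)"
   using eq AE_norm_neq[of 0]
  proof eventually_elim
   case (elim x)
   show ?case unfolding elim(1)[symmetric] using elim(2) by (simp add: e_r_norm)
  qed
 qed
 have hm: "(\<lambda>x. h (norm x) *\<^sub>R e_r x) \<in> borel_measurable LM"
  by (intro borel_measurable_scaleR radial_measurable[OF h] measurable_borel_dom[OF e_r_measurable])
 have "0 = (LINT x|LM. (h (norm x) *\<^sub>R e_r x) \<bullet> \<tau> x)" by (rule radial_div_free[OF \<tau> h hL, symmetric])
 also have "\<dots> = (LINT x|LM. (\<theta> x \<bullet> inv_lam M) * (\<sigma>s i x \<bullet> \<tau> x))"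
 proof (rule integral_cong_AE)
  show "AE x in LM. (h (norm x) *\<^sub>R e_r x) \<bullet> \<tau> x = (\<theta> x \<bullet> inv_lam M) * (\<sigma>s i x \<bullet> \<tau> x)"
   using eq by eventually_elim (simp only: inner_scaleR_left)
  show "(\<lambda>x. (h (norm x) *\<^sub>R e_r x) \<bullet> \<tau> x) \<in> borel_measurable LM" by (intro borel_measurable_inner hm L2_D(1)[OF \<tau>(1)])
  show "(\<lambda>x. (\<theta> x \<bullet> inv_lam M) * (\<sigma>s i x \<bullet> \<tau> x)) \<in> borel_measurable LM"
   by (rule borel_measurable_integrable[OF weighted_integrable(1)[OF \<theta>(1) \<sigma>s_L2 \<tau>(1)]])
 qed
 finally show ?thesis by simp
qed

lemma flux_difference:
 assumes \<sigma>: "\<sigma> \<in> fluxes X f"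
 shows "(\<lambda>x. \<sigma> i x - \<sigma>s i x) \<in> L2 X" "\<phi> \<in> test ==> (LINT x|LM. (\<sigma> i x - \<sigma>s i x) \<bullet> grad \<phi> x) = 0"
proof -
 have L: "\<sigma> i \<in> L2 X" using \<sigma> by (simp add: fluxes_def)
 show "(\<lambda>x. \<sigma> i x - \<sigma>s i x) \<in> L2 X" by (rule L2_diff[OF L \<sigma>s_L2])
 assume t: "\<phi> \<in> test"
 have "(LINT x|LM. \<sigma> i x \<bullet> grad \<phi> x) = (LINT x|LM. f i x * \<phi> x)"
  using \<sigma> t by (simp add: fluxes_def neg_div_eq_def L2_functional_def)
 then show "(LINT x|LM. (\<sigma> i x - \<sigma>s i x) \<bullet> grad \<phi> x) = 0"
  unfolding inner_diff_left using \<sigma>s_div[OF t, of i]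
  by (subst lint_diff) (auto intro: L2_inner_integrable L grad_test_L2[OF t] \<sigma>s_L2)
qed

text \<open>The difference of two admissible fluxes is divergence-free, so the cross term of the
  expanded square vanishes by \<open>radial_orthogonal\<close>.\<close>

lemma H_cost_pythagoras:
 assumes \<theta>: "\<theta> \<in> admissible X q" "radial_on X \<theta>" and \<sigma>: "\<sigma> \<in> fluxes X f"
 shows "H_cost X M \<mu> \<theta> \<sigma> = reward \<theta> + H_cost X M \<mu> \<theta> (\<lambda>i x. \<sigma> i x - \<sigma>s i x)"
proof -
 let ?s = "\<lambda>x. \<theta> x \<bullet> inv_lam M"
 have "(LINT x|LM. ?s x * (norm (\<sigma> i x))^2) = (LINT x|LM. ?s x * (norm (\<sigma>s i x))^2) + (LINT x|LM. ?s x * (norm (\<sigma> i x - \<sigma>s i x))^2)" for i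
 proof -
  note d = flux_difference(1)[OF \<sigma>, of i]
  have o: "(LINT x|LM. ?s x * (\<sigma>s i x \<bullet> (\<sigma> i x - \<sigma>s i x))) = 0"
   by (rule radial_orthogonal[OF \<theta> d]) (rule flux_difference(2)[OF \<sigma>])
  note I = weighted_integrable[OF \<theta>(1)]
  have "(LINT x|LM. ?s x * (norm (\<sigma> i x))^2) =
   (LINT x|LM. (?s x * (norm (\<sigma>s i x))^2 + ?s x * (norm (\<sigma> i x - \<sigma>s i x))^2) + 2 * (?s x * (\<sigma>s i x \<bullet> (\<sigma> i x - \<sigma>s i x))))"
   by (rule lint_cong)
    (auto simp: power2_norm_eq_inner inner_diff_left inner_diff_right inner_commute algebra_simps)
  also have "\<dots> = (LINT x|LM. ?s x * (norm (\<sigma>s i x))^2) + (LINT x|LM. ?s x * (norm (\<sigma> i x - \<sigma>s i x))^2) + 2 * (LINT x|LM. ?s x * (\<sigma>s i x \<bullet> (\<sigma> i x - \<sigma>s i x)))"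
   using I(1)[OF \<sigma>s_L2 d] I(2)[OF \<sigma>s_L2 \<sigma>s_L2, of i] I(2)[OF d d] by simp
  finally show ?thesis using o by simp
 qed
 then show ?thesis by (simp add: H_cost_eq reward_eq[OF \<theta>(1)] distrib_left sum.distrib)
qed

lemma H_cost_nonneg: "\<theta> \<in> admissible X q ==> 0 \<le> H_cost X M \<mu> \<theta> \<sigma>"
proof -
 assume \<theta>: "\<theta> \<in> admissible X q"
 obtain c C where c: "0 < c" "0 < C" "AE x in LM. c \<le> \<theta> x \<bullet> inv_lam M" "AE x in LM. \<theta> x \<bullet> inv_lam M \<le> C"
  by (rule admissible_bounds[OF \<theta>]) blast
 have "AE x in LM. 0 \<le> (\<theta> x \<bullet> inv_lam M) * (norm (\<sigma> i x))^2" for i using c(3) by eventually_elim (use c(1) in auto)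
 then have "0 \<le> (LINT x|LM. (\<theta> x \<bullet> inv_lam M) * (norm (\<sigma> i x))^2)" for i by (rule integral_nonneg_AE)
 then show ?thesis unfolding H_cost_eq using weights by (intro sum_nonneg mult_nonneg_nonneg) (auto intro: less_imp_le)
qed

lemma H_cost_eq_0D:
 assumes \<theta>: "\<theta> \<in> admissible X q" and L: "\<And>i. \<sigma> i \<in> L2 X" and 0: "H_cost X M \<mu> \<theta> \<sigma> = 0"
 shows "AE x in LM. \<sigma> i x = 0"
proof -
 obtain c C where c: "0 < c" "0 < C" "AE x in LM. c \<le> \<theta> x \<bullet> inv_lam M" "AE x in LM. \<theta> x \<bullet> inv_lam M \<le> C"
  by (rule admissible_bounds[OF \<theta>]) blast
 have ae: "AE x in LM. 0 \<le> (\<theta> x \<bullet> inv_lam M) * (norm (\<sigma> i x))^2" for i using c(3) by eventually_elim (use c(1) in auto)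
 then have nn: "0 \<le> (LINT x|LM. (\<theta> x \<bullet> inv_lam M) * (norm (\<sigma> i x))^2)" for i by (rule integral_nonneg_AE)
 have nn': "0 \<le> \<mu> i * (LINT x|LM. (\<theta> x \<bullet> inv_lam M) * (norm (\<sigma> i x))^2)" for i
  by (rule mult_nonneg_nonneg[OF less_imp_le[OF weights] nn])
 have "\<forall>i\<in>UNIV. \<mu> i * (LINT x|LM. (\<theta> x \<bullet> inv_lam M) * (norm (\<sigma> i x))^2) = 0"
  using 0 nn' unfolding H_cost_eq by (subst (asm) sum_nonneg_eq_0_iff) auto
 then have "\<mu> i * (LINT x|LM. (\<theta> x \<bullet> inv_lam M) * (norm (\<sigma> i x))^2) = 0" by (rule bspec) simp
 then have "(LINT x|LM. (\<theta> x \<bullet> inv_lam M) * (norm (\<sigma> i x))^2) = 0" using weights[of i] by simp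
 then have "AE x in LM. (\<theta> x \<bullet> inv_lam M) * (norm (\<sigma> i x))^2 = 0"
  by (subst (asm) integral_nonneg_eq_0_iff_AE[OF weighted_integrable(2)[OF \<theta> L L] ae])
 then show ?thesis using c(3) by eventually_elim (use c(1) in auto)
qed

text \<open>The energy density depends only on |x| almost everywhere, and the bathtub principle
  produces proportions that are functions of this density.\<close>

lemma radial_maximizer:
 obtains \<theta> where "\<theta> \<in> admissible X q" "radial_on X \<theta>" "\<And>\<theta>'. \<theta>' \<in> admissible X q ==> reward \<theta>' \<le> reward \<theta>"
proof -
 interpret finite_measure LM by (rule finite_LM)
 have V: "(\<Sum>i\<in>UNIV. q i) = measure LM (space LM)" using q(2) by (simp add: measure_restrict_space)
 obtain \<Phi> :: "real \<Rightarrow> real^'N" where \<Phi>: "\<Phi> \<in> borel_measurable borel" "AE x in LM. \<Phi> (energy_density x) \<in> proportions"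
  "\<And>i. (LINT x|LM. \<Phi> (energy_density x) $ i) = q i"
  "\<And>\<theta>. \<theta> \<in> borel_measurable LM ==> AE x in LM. \<theta> x \<in> proportions ==> (\<And>i. (LINT x|LM. \<theta> x $ i) = q i) ==>
   (LINT x|LM. (\<Sum>j\<in>UNIV. \<theta> x $ j * (1 / lambda_min (M j))) * energy_density x) \<le> (LINT x|LM. (\<Sum>j\<in>UNIV. \<Phi> (energy_density x) $ j * (1 / lambda_min (M j))) * energy_density x)"
  by (rule bathtub_proportions[OF energy_density_integrable q(1) V, of "\<lambda>j. 1 / lambda_min (M j)"]) blast
 have m: "(\<lambda>x. \<Phi> (energy_density x)) \<in> borel_measurable LM"
  by (rule measurable_compose[OF borel_measurable_integrable[OF energy_density_integrable] \<Phi>(1)])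
 have "AE x in LM. norm (\<Phi> (energy_density x)) \<le> 1" using \<Phi>(2)
 proof eventually_elim
  case (elim x)
  have "norm (\<Phi> (energy_density x)) \<le> (\<Sum>i\<in>UNIV. \<bar>\<Phi> (energy_density x) $ i\<bar>)" by (rule norm_le_l1_cart)
  then show ?case using elim by (simp add: proportions_def)
 qed
 then have adm: "(\<lambda>x. \<Phi> (energy_density x)) \<in> admissible X q" using m \<Phi>(2,3) by (auto simp: admissible_def Linf_into_def Linf_def)
 have "AE x in LM. \<Phi> (energy_density x) = \<Phi> (\<Sum>i\<in>UNIV. \<mu> i * (\<bar>cum (k i) (norm x)\<bar> / (area * norm x ^ (dm - 1)))^2)"
  using AE_norm_neq[of 0] AE_space
 proof eventually_elim
  case (elim x)
  then show ?case using flux_norm[of x] by (simp add: energy_density_def \<sigma>s)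
 qed
 then have "radial_on X (\<lambda>x. \<Phi> (energy_density x))"
  unfolding radial_on_def by (intro exI[of _ "\<lambda>r. \<Phi> (\<Sum>i\<in>UNIV. \<mu> i * (\<bar>cum (k i) r\<bar> / (area * r ^ (dm - 1)))^2)"])
 moreover have "reward \<theta>' \<le> reward (\<lambda>x. \<Phi> (energy_density x))" if \<theta>': "\<theta>' \<in> admissible X q" for \<theta>'
  using \<Phi>(4)[OF admissible_D(1,2)[OF \<theta>']] \<theta>' unfolding reward_def by (simp add: admissible_def)
 ultimately show thesis using that adm by blast
qed

text \<open>The Pythagoras identity makes \<sigma>s and the radial maximizer \<theta>0 a saddle
  point. For any saddle point (\<theta>, \<sigma>), the chain H(\<theta>0, \<sigma>) \<le>
  H(\<theta>, \<sigma>) \<le> H(\<theta>, \<sigma>s) \<le> H(\<theta>0, \<sigma>s) forces the cost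
  of \<sigma> - \<sigma>s at \<theta>0 to vanish, even if \<theta> is not radial.\<close>

lemma optimal_flux: "optimal_flux X M q \<mu> f \<sigma>s"
proof -
 obtain \<theta>0 where \<theta>0: "\<theta>0 \<in> admissible X q" "radial_on X \<theta>0" "\<And>\<theta>. \<theta> \<in> admissible X q ==> reward \<theta> \<le> reward \<theta>0"
  using radial_maximizer by blast
 have low: "reward \<theta>0 \<le> H_cost X M \<mu> \<theta>0 \<sigma>" if "\<sigma> \<in> fluxes X f" for \<sigma>
  using H_cost_pythagoras[OF \<theta>0(1,2) that] H_cost_nonneg[OF \<theta>0(1)] by simp
 have "saddle_point X M q \<mu> f \<theta>0 \<sigma>s"
  using \<theta>0 low \<sigma>s_fluxes by (simp add: saddle_point_def H_cost_\<sigma>s)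
 moreover have "AE x in LM. \<sigma> i x = \<sigma>s i x" if s: "saddle_point X M q \<mu> f \<theta> \<sigma>" for \<theta> \<sigma> i
 proof -
  have \<theta>: "\<theta> \<in> admissible X q" and \<sigma>: "\<sigma> \<in> fluxes X f"
   and s1: "H_cost X M \<mu> \<theta>0 \<sigma> \<le> H_cost X M \<mu> \<theta> \<sigma>" and s2: "H_cost X M \<mu> \<theta> \<sigma> \<le> H_cost X M \<mu> \<theta> \<sigma>s"
   using s \<theta>0(1) \<sigma>s_fluxes by (auto simp: saddle_point_def)
  have "H_cost X M \<mu> \<theta>0 \<sigma> \<le> reward \<theta>0" using s1 s2 \<theta>0(3)[OF \<theta>] by (simp add: H_cost_\<sigma>s[OF \<theta>])
  then have "H_cost X M \<mu> \<theta>0 (\<lambda>i x. \<sigma> i x - \<sigma>s i x) = 0"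
   using H_cost_pythagoras[OF \<theta>0(1,2) \<sigma>] H_cost_nonneg[OF \<theta>0(1), of "\<lambda>i x. \<sigma> i x - \<sigma>s i x"] by simp
  from H_cost_eq_0D[OF \<theta>0(1) flux_difference(1)[OF \<sigma>] this, of i] show ?thesis by eventually_elim simp
 qed
 ultimately show ?thesis by (auto simp: optimal_flux_def)
qed

section \<open>Dirichlet energies compared with the cost of the optimal flux\<close>

lemma h10_functional:
 assumes u: "h10 u G" and \<sigma>: "\<sigma> \<in> L2 X" "\<And>\<phi>. \<phi> \<in> test ==> (LINT x|LM. \<sigma> x \<bullet> grad \<phi> x) = (LINT x|LM. f i x * \<phi> x)"
 shows "(LINT x|LM. \<sigma> x \<bullet> G x) = (LINT x|LM. f i x * u x)"
proof -
 obtain \<phi> where \<phi>: "\<And>n. \<phi> n \<in> test" "l2_lim X \<phi> u" "l2_lim X (\<lambda>n. grad (\<phi> n)) G" using u by (auto simp: h10_def)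
 have "(\<lambda>n. LINT x|LM. f i x * \<phi> n x) \<longlonglongrightarrow> (LINT x|LM. f i x * u x)"
  using l2_lim_inner_left(2)[OF \<phi>(2) f_L2[of i]] by simp
 then show ?thesis using l2_lim_inner_left(2)[OF \<phi>(3) \<sigma>(1)] unfolding \<sigma>(2)[OF \<phi>(1)] by (rule LIMSEQ_unique[rotated])
qed

text \<open>What the upper bound for J asks of A; members of \<open>set_A\<close> and
  \<open>set_B\<close> and the isotropic fields in \<open>I_cost\<close> all have it.\<close>

definition coercive_above :: "(real^'d \<Rightarrow> real^'N) \<Rightarrow> (real^'d \<Rightarrow> real^'d^'d) \<Rightarrow> bool" where
 "coercive_above \<theta> A \<longleftrightarrow> \<theta> \<in> admissible X q \<and> A \<in> Linf_into X Sym \<and>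
   (AE x in LM. \<forall>v. lam_minus M (\<theta> x) * (norm v)^2 \<le> v \<bullet> (A x *v v))"

text \<open>The state is selected by \<open>SOME\<close>, so a solution must exist before its
  equation can be used. The compliance is recorded in two forms, tested with \<sigma>s and with the
  flux of the state itself, for the completion of the square.\<close>

lemma state_props:
 assumes c: "coercive_above \<theta> A"
 obtains G where "G \<in> L2 X" "(\<lambda>x. A x *v G x) \<in> L2 X"
  "\<And>\<phi>. \<phi> \<in> test ==> (LINT x|LM. (A x *v G x) \<bullet> grad \<phi> x) = (LINT x|LM. f i x * \<phi> x)"
  "(LINT x|LM. f i x * state X A (f i) x) = (LINT x|LM. \<sigma>s i x \<bullet> G x)"
  "(LINT x|LM. f i x * state X A (f i) x) = (LINT x|LM. (A x *v G x) \<bullet> G x)"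
proof -
 have \<theta>: "\<theta> \<in> admissible X q" and A: "A \<in> Linf X" and S: "AE x in LM. A x \<in> Sym"
  and low: "AE x in LM. \<forall>v. lam_minus M (\<theta> x) * (norm v)^2 \<le> v \<bullet> (A x *v v)"
  using c by (auto simp: coercive_above_def Linf_into_def)
 obtain c C where c: "0 < c" "0 < C" "AE x in LM. c \<le> \<theta> x \<bullet> inv_lam M" "AE x in LM. \<theta> x \<bullet> inv_lam M \<le> C"
  by (rule admissible_bounds[OF \<theta>]) blast
 have "AE x in LM. transpose (A x) = A x \<and> (\<forall>v. 1 / C * (norm v)^2 \<le> v \<bullet> (A x *v v))"
  using S low c(3,4)
 proof eventually_elim
  case (elim x)
  have "1 / C \<le> lam_minus M (\<theta> x)" unfolding lam_minus_eq using elim(3,4) c(1) by (intro divide_left_mono) auto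
  then have "1 / C * (norm v)^2 \<le> lam_minus M (\<theta> x) * (norm v)^2" for v :: "real^'d" by (intro mult_right_mono) auto
  then show ?case using elim(1,2) order_trans unfolding Sym_def by blast
 qed
 then have "sym_elliptic (1 / C) A" using A c(2) by (simp add: sym_elliptic_def)
 then obtain u0 G0 where "dirichlet_solution X A (L2_functional X (f i)) u0 G0"
  by (rule dirichlet_exists[OF _ H_minus_1_function[OF f_L2[of i]]])
 then have "\<exists>G. dirichlet_solution X A (L2_functional X (f i)) (state X A (f i)) G"
  unfolding state_def by (intro someI[where P="\<lambda>u. \<exists>G. dirichlet_solution X A (L2_functional X (f i)) u G"]) blast
 then obtain G where G: "h10 (state X A (f i)) G" "neg_div_eq X (\<lambda>x. A x *v G x) (L2_functional X (f i))"
  by (auto simp: dirichlet_solution_iff)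
 have GL: "G \<in> L2 X" by (rule h10_L2(2)[OF G(1)])
 have AG: "(\<lambda>x. A x *v G x) \<in> L2 X" by (rule Linf_L2_matrix_vector[OF A GL])
 have div: "(LINT x|LM. (A x *v G x) \<bullet> grad \<phi> x) = (LINT x|LM. f i x * \<phi> x)" if "\<phi> \<in> test" for \<phi>
  using G(2) that by (simp add: neg_div_eq_def L2_functional_def)
 have e1: "(LINT x|LM. \<sigma>s i x \<bullet> G x) = (LINT x|LM. f i x * state X A (f i) x)"
  by (rule h10_functional[OF G(1) \<sigma>s_L2]) (rule \<sigma>s_div)
 have e2: "(LINT x|LM. (A x *v G x) \<bullet> G x) = (LINT x|LM. f i x * state X A (f i) x)"
  by (rule h10_functional[OF G(1) AG]) (rule div)
 show thesis by (rule that[OF GL AG]) (rule div, assumption, rule e1[symmetric], rule e2[symmetric])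
qed

text \<open>The compliance is the integral of 2 \<sigma>s . G - A G . G. With s = \<theta> .
  \<open>inv_lam M\<close> the lower bound reads A G . G \<ge> |G|^2 / s, and |G - s \<sigma>s|^2 /
  s \<ge> 0 bounds the integrand by s |\<sigma>s|^2.\<close>

lemma J_cost_le:
 assumes c: "coercive_above \<theta> A"
 shows "J_cost X \<mu> f (\<theta>, A) \<le> reward \<theta>"
proof -
 have \<theta>: "\<theta> \<in> admissible X q" and low: "AE x in LM. \<forall>v. lam_minus M (\<theta> x) * (norm v)^2 \<le> v \<bullet> (A x *v v)"
  using c by (auto simp: coercive_above_def)
 let ?s = "\<lambda>x. \<theta> x \<bullet> inv_lam M"
 have "(LINT x|LM. f i x * state X A (f i) x) \<le> (LINT x|LM. ?s x * (norm (\<sigma>s i x))^2)" for i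
 proof -
  obtain G where G: "G \<in> L2 X" "(\<lambda>x. A x *v G x) \<in> L2 X"
   "(LINT x|LM. f i x * state X A (f i) x) = (LINT x|LM. \<sigma>s i x \<bullet> G x)"
   "(LINT x|LM. f i x * state X A (f i) x) = (LINT x|LM. (A x *v G x) \<bullet> G x)"
   by (rule state_props[OF c, of i]) blast
  obtain c C where c: "0 < c" "0 < C" "AE x in LM. c \<le> ?s x" "AE x in LM. ?s x \<le> C" by (rule admissible_bounds[OF \<theta>]) blast
  note i1 = L2_inner_integrable[OF \<sigma>s_L2[of i] G(1)] and i2 = L2_inner_integrable[OF G(2,1)]
  have "(LINT x|LM. f i x * state X A (f i) x) = (LINT x|LM. 2 * (\<sigma>s i x \<bullet> G x) - (A x *v G x) \<bullet> G x)"
   using i1 i2 G(3,4) by simp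
  also have "\<dots> \<le> (LINT x|LM. ?s x * (norm (\<sigma>s i x))^2)"
  proof (rule integral_mono_AE)
   show "integrable LM (\<lambda>x. 2 * (\<sigma>s i x \<bullet> G x) - (A x *v G x) \<bullet> G x)" using i1 i2 by auto
   show "integrable LM (\<lambda>x. ?s x * (norm (\<sigma>s i x))^2)" by (rule weighted_integrable(2)[OF \<theta> \<sigma>s_L2 \<sigma>s_L2])
   show "AE x in LM. 2 * (\<sigma>s i x \<bullet> G x) - (A x *v G x) \<bullet> G x \<le> ?s x * (norm (\<sigma>s i x))^2"
    using low c(3)
   proof eventually_elim
    case (elim x)
    have s: "0 < ?s x" using elim(2) c(1) by linarith
    have "0 \<le> (norm (G x - ?s x *\<^sub>R \<sigma>s i x))^2 / ?s x" using s by simp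
    also have "\<dots> = 1 / ?s x * (norm (G x))^2 - 2 * (\<sigma>s i x \<bullet> G x) + ?s x * (norm (\<sigma>s i x))^2"
     using s by (simp add: power2_norm_eq_inner inner_diff_left inner_diff_right inner_commute field_simps)
    finally show ?case using elim(1)[rule_format, of "G x"] unfolding lam_minus_eq by (simp add: inner_commute)
   qed
  qed
  finally show ?thesis .
 qed
 then show ?thesis by (auto simp: J_cost_def reward_eq[OF \<theta>] intro!: sum_mono mult_left_mono less_imp_le[OF weights])
qed

text \<open>A G - \<sigma>s is divergence-free, hence orthogonal to s \<sigma>s for s = \<theta> .
  \<open>inv_lam M\<close>. Symmetry moves A onto \<sigma>s, where the eigenvalue 1 / s cancels the
  weight. The integral of \<sigma>s . G, which is the compliance, thus equals that of s
  |\<sigma>s|^2.\<close>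

lemma J_cost_eq:
 assumes c: "coercive_above \<theta> A" and rad: "radial_on X \<theta>"
  and ev: "AE x in LM. A x *v e_r x = lam_minus M (\<theta> x) *\<^sub>R e_r x"
 shows "J_cost X \<mu> f (\<theta>, A) = reward \<theta>"
proof -
 have \<theta>: "\<theta> \<in> admissible X q" and S: "AE x in LM. A x \<in> Sym" using c by (auto simp: coercive_above_def Linf_into_def)
 let ?s = "\<lambda>x. \<theta> x \<bullet> inv_lam M"
 have "(LINT x|LM. f i x * state X A (f i) x) = (LINT x|LM. ?s x * (norm (\<sigma>s i x))^2)" for i
 proof -
  obtain G where G: "G \<in> L2 X" "(\<lambda>x. A x *v G x) \<in> L2 X"
   "\<And>\<phi>. \<phi> \<in> test ==> (LINT x|LM. (A x *v G x) \<bullet> grad \<phi> x) = (LINT x|LM. f i x * \<phi> x)"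
   "(LINT x|LM. f i x * state X A (f i) x) = (LINT x|LM. \<sigma>s i x \<bullet> G x)"
   by (rule state_props[OF c, of i]) blast
  obtain c C where c: "0 < c" "0 < C" "AE x in LM. c \<le> ?s x" "AE x in LM. ?s x \<le> C" by (rule admissible_bounds[OF \<theta>]) blast
  note \<tau> = L2_diff[OF G(2) \<sigma>s_L2[of i]]
  have \<tau>0: "(LINT x|LM. (A x *v G x - \<sigma>s i x) \<bullet> grad \<phi> x) = 0" if t: "\<phi> \<in> test" for \<phi>
   unfolding inner_diff_left using G(3)[OF t] \<sigma>s_div[OF t, of i]
   by (subst lint_diff) (auto intro: L2_inner_integrable G(2) grad_test_L2[OF t] \<sigma>s_L2)
  have "0 = (LINT x|LM. ?s x * (\<sigma>s i x \<bullet> (A x *v G x - \<sigma>s i x)))" by (rule radial_orthogonal[OF \<theta> rad \<tau> \<tau>0, symmetric])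
  also have "\<dots> = (LINT x|LM. \<sigma>s i x \<bullet> G x - ?s x * (norm (\<sigma>s i x))^2)"
  proof (rule integral_cong_AE)
   show "(\<lambda>x. ?s x * (\<sigma>s i x \<bullet> (A x *v G x - \<sigma>s i x))) \<in> borel_measurable LM"
    by (rule borel_measurable_integrable[OF weighted_integrable(1)[OF \<theta> \<sigma>s_L2 \<tau>]])
   show "(\<lambda>x. \<sigma>s i x \<bullet> G x - ?s x * (norm (\<sigma>s i x))^2) \<in> borel_measurable LM"
    by (intro borel_measurable_diff borel_measurable_integrable L2_inner_integrable weighted_integrable(2)[OF \<theta> _ \<sigma>s_L2[of i]] \<sigma>s_L2 G(1))
   show "AE x in LM. ?s x * (\<sigma>s i x \<bullet> (A x *v G x - \<sigma>s i x)) = \<sigma>s i x \<bullet> G x - ?s x * (norm (\<sigma>s i x))^2"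
    using S ev c(3) AE_space
   proof eventually_elim
    case (elim x)
    have s: "?s x \<noteq> 0" using elim(3) c(1) by linarith
    have "x \<in> X" using elim(4) by simp
    then obtain b where b: "\<sigma>s i x = b *\<^sub>R e_r x" using \<sigma>s[of x i] unfolding flux_def by blast
    have "\<sigma>s i x \<bullet> (A x *v G x) = (A x *v \<sigma>s i x) \<bullet> G x"
     using elim(1) by (intro symmetric_inner[symmetric]) (simp add: Sym_def)
    also have "A x *v \<sigma>s i x = (1 / ?s x) *\<^sub>R \<sigma>s i x"
     unfolding b using elim(2) by (simp add: matrix_vector_mult_scaleR lam_minus_eq)
    finally have "?s x * (\<sigma>s i x \<bullet> (A x *v G x)) = \<sigma>s i x \<bullet> G x" using s by simp
    then show ?case by (simp add: inner_diff_right right_diff_distrib power2_norm_eq_inner)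
   qed
  qed
  also have "\<dots> = (LINT x|LM. \<sigma>s i x \<bullet> G x) - (LINT x|LM. ?s x * (norm (\<sigma>s i x))^2)"
   by (rule lint_diff[OF L2_inner_integrable[OF \<sigma>s_L2 G(1)] weighted_integrable(2)[OF \<theta> \<sigma>s_L2 \<sigma>s_L2]])
  finally show ?thesis using G(4) by simp
 qed
 then show ?thesis unfolding reward_eq[OF \<theta>] J_cost_def by simp
qed

lemma lam_minus_Linf:
 assumes \<theta>: "\<theta> \<in> admissible X q" shows "(\<lambda>x. lam_minus M (\<theta> x)) \<in> Linf X"
proof -
 obtain c C where c: "0 < c" "0 < C" "AE x in LM. c \<le> \<theta> x \<bullet> inv_lam M" "AE x in LM. \<theta> x \<bullet> inv_lam M \<le> C"
  by (rule admissible_bounds[OF \<theta>]) blast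
 have "AE x in LM. norm (lam_minus M (\<theta> x)) \<le> 1 / c" using c(3)
  by eventually_elim (use c(1) in \<open>auto simp: lam_minus_eq intro!: divide_left_mono\<close>)
 moreover have "(\<lambda>x. lam_minus M (\<theta> x)) \<in> borel_measurable LM"
  unfolding lam_minus_eq using admissible_D(3)[OF \<theta>] by measurable
 ultimately show ?thesis by (auto simp: Linf_def)
qed

lemma coercive_isotropic:
 assumes \<theta>: "\<theta> \<in> admissible X q" shows "coercive_above \<theta> (\<lambda>x. lam_minus M (\<theta> x) *\<^sub>R mat 1)"
proof -
 have "(\<lambda>x. mat 1 :: real^'d^'d) \<in> Linf X" by (auto simp: Linf_def)
 from Linf_scaleR[OF lam_minus_Linf[OF \<theta>] this]
 have "(\<lambda>x. lam_minus M (\<theta> x) *\<^sub>R mat 1 :: real^'d^'d) \<in> Linf X" .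
 moreover have "c *\<^sub>R mat 1 \<in> (Sym :: (real^'d^'d) set)" for c by (auto simp: Sym_def transpose_def mat_def vec_eq_iff)
 ultimately show ?thesis using \<theta> by (simp add: coercive_above_def Linf_into_def mat_1_mult power2_norm_eq_inner)
qed

lemma set_B_coercive: "(\<theta>, A) \<in> set_B X M q ==> coercive_above \<theta> A"
 by (auto simp: set_B_def coercive_above_def loewner_le_def mat_1_mult power2_norm_eq_inner elim: eventually_mono)

lemma set_A_coercive:
 assumes "(\<theta>, A) \<in> set_A X M q" shows "coercive_above \<theta> A"
proof -
 have \<theta>: "\<theta> \<in> admissible X q" "A \<in> Linf_into X Sym" and c: "AE x in LM. A x \<in> composites X M (\<theta> x)"
  using assms by (auto simp: set_A_def)
 have "AE x in LM. \<forall>v. lam_minus M (\<theta> x) * (norm v)^2 \<le> v \<bullet> (A x *v v)"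
  using c admissible_D(2)[OF \<theta>(1)] by eventually_elim (intro allI composites_lower_bound[OF sym pos])
 then show ?thesis using \<theta> by (simp add: coercive_above_def)
qed

lemma simple_laminate_props:
 assumes \<theta>: "\<theta> \<in> admissible X q" and R: "laminate_rotations X M R"
 shows "(\<theta>, simple_laminate M R \<theta>) \<in> set_A X M q" "(\<theta>, simple_laminate M R \<theta>) \<in> set_B X M q"
  "AE x in LM. simple_laminate M R \<theta> x *v e_r x = lam_minus M (\<theta> x) *\<^sub>R e_r x"
proof -
 obtain c C where c: "0 < c" "0 < C" "AE x in LM. c \<le> \<theta> x \<bullet> inv_lam M" "AE x in LM. \<theta> x \<bullet> inv_lam M \<le> C"
  by (rule admissible_bounds[OF \<theta>]) blast
 let ?P = "\<lambda>x i. transpose (R i x) ** M i ** R i x"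
 have RL: "R i \<in> Linf X" for i using R by (simp add: laminate_rotations_def Linf_into_def)
 have "AE x in LM. \<forall>i\<in>UNIV. rotation_matrix (R i x) \<and> eigenvector (?P x i) (e_r x) (lambda_min (M i))"
  using R by (intro AE_finite_allI) (auto simp: laminate_rotations_def Linf_into_def)
 \<comment> \<open>Finitely many exceptional sets are merged, so that the results for constant data
   apply at each remaining point.\<close>
 then have good: "AE x in LM. \<theta> x \<in> proportions \<and> norm (e_r x) = 1 \<and> c \<le> \<theta> x \<bullet> inv_lam M \<and>
   (\<forall>i. rotation_matrix (R i x) \<and> eigenvector (?P x i) (e_r x) (lambda_min (M i)))"
  using admissible_D(2)[OF \<theta>] AE_norm_neq[of 0] c(3) by eventually_elim (auto simp: e_r_norm)
 have ev: "?P x i *v e_r x = lambda_min (M i) *\<^sub>R e_r x" if "eigenvector (?P x i) (e_r x) (lambda_min (M i))" for x i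
  using that by (simp add: eigenvector_def)
 show e: "AE x in LM. simple_laminate M R \<theta> x *v e_r x = lam_minus M (\<theta> x) *\<^sub>R e_r x"
  using good
 proof eventually_elim
  case (elim x)
  have "e_r x \<bullet> e_r x = 1" using elim by (simp add: norm_eq_1)
  then show ?case using elim by (simp add: simple_laminate_eq laminate_matrix_mult ev lam_minus_def)
 qed
 have er: "(e_r :: real^'d \<Rightarrow> real^'d) \<in> Linf X"
  unfolding Linf_def using measurable_borel_dom[OF e_r_measurable] by (auto simp: e_r_norm intro!: exI[of _ 1])
 have tens: "(\<lambda>x. tensor (e_r x) (e_r x)) \<in> Linf X" by (rule Linf_continuous[OF er continuous_tensor])
 have \<theta>L: "(\<lambda>x. \<theta> x $ i) \<in> Linf X" for i
 proof -
  have "\<theta> \<in> Linf X" using \<theta> by (simp add: admissible_def Linf_into_def)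
  then show ?thesis by (rule Linf_continuous) (intro continuous_intros)
 qed
 have Linf: "simple_laminate M R \<theta> \<in> Linf X"
 proof -
  have "(\<lambda>x. transpose (R i x) ** M i ** R i x - lambda_min (M i) *\<^sub>R tensor (e_r x) (e_r x)) \<in> Linf X" for i
   using Linf_add[OF Linf_continuous[OF RL[of i] continuous_conjugate[of "M i"]] Linf_continuous[OF tens, of "\<lambda>T. - (lambda_min (M i) *\<^sub>R T)"]]
   by (simp add: continuous_intros)
  then show ?thesis unfolding simple_laminate_def[abs_def]
   by (intro Linf_add Linf_sum Linf_scaleR lam_minus_Linf[OF \<theta>] tens \<theta>L) auto
 qed
 have S: "AE x in LM. simple_laminate M R \<theta> x \<in> Sym"
  using good by eventually_elim (auto simp: Sym_def simple_laminate_eq intro!: laminate_matrix_sym rotated_phase(1) sym)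
 have comp: "AE x in LM. simple_laminate M R \<theta> x \<in> composites X M (\<theta> x)"
  using good
 proof eventually_elim
  case (elim x)
  have "X \<noteq> {}" using rad by (simp add: ball)
  then show ?case unfolding simple_laminate_eq by (rule laminate_in_composites[OF sym pos]) (use elim in auto)
 qed
 show A: "(\<theta>, simple_laminate M R \<theta>) \<in> set_A X M q"
  using \<theta> Linf S comp by (auto simp: set_A_def Linf_into_def)
 have low: "AE x in LM. \<forall>v. lam_minus M (\<theta> x) * (norm v)^2 \<le> v \<bullet> (simple_laminate M R \<theta> x *v v)"
  using set_A_coercive[OF A] by (simp add: coercive_above_def)
 have "AE x in LM. \<forall>v. v \<bullet> (simple_laminate M R \<theta> x *v v) \<le> lam_plus M (\<theta> x) * (norm v)^2"
  using good
 proof eventually_elim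
  case (elim x)
  have "lam_minus M (\<theta> x) \<le> (\<Sum>i\<in>UNIV. \<theta> x $ i * lambda_min (M i))"
   by (rule lam_minus_le_sum[OF _ pos]) (use elim c(1) in auto)
  also have "\<dots> \<le> (\<Sum>i\<in>UNIV. \<theta> x $ i * lambda_max (M i))"
   using elim by (intro sum_mono mult_left_mono lambda_min_le_max[OF sym]) (auto simp: proportions_def)
  finally have le: "1 / (\<Sum>i\<in>UNIV. \<theta> x $ i / lambda_min (M i)) \<le> (\<Sum>i\<in>UNIV. \<theta> x $ i * lambda_max (M i))"
   by (simp add: lam_minus_def)
  have up: "v \<bullet> (?P x i *v v) \<le> lambda_max (M i) * (norm v)^2" for i v
   using rotated_phase(2,3)[OF _ sym[of i], of "R i x" v] lambda_max_upper[OF sym[of i], of "R i x *v v"] elim by simp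
  show ?case unfolding lam_plus_def simple_laminate_eq
   by (intro allI laminate_matrix_upper[OF _ _ _ _ up le]) (use elim in \<open>auto intro: rotated_phase(1)[OF _ sym] ev\<close>)
 qed
 then show "(\<theta>, simple_laminate M R \<theta>) \<in> set_B X M q"
  using \<theta> Linf S low by (auto simp: set_B_def Linf_into_def loewner_le_def mat_1_mult power2_norm_eq_inner elim: eventually_elim2)
qed

text \<open>The same number \<open>reward \<theta>s\<close> bounds I and both versions of J. It is
  attained because e_r is an eigenvector for \<lambda>_- in the isotropic material as well as in the
  laminate.\<close>

lemma maximizers:
 assumes rad: "radial_on X \<theta>s" and max: "is_arg_max reward (\<lambda>\<theta>. \<theta> \<in> admissible X q) \<theta>s"
 shows "is_arg_max (I_cost X M \<mu> f) (\<lambda>\<theta>. \<theta> \<in> admissible X q) \<theta>s"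
  "laminate_rotations X M R ==> is_arg_max (J_cost X \<mu> f) (\<lambda>p. p \<in> set_B X M q) (\<theta>s, simple_laminate M R \<theta>s)"
  "laminate_rotations X M R ==> is_arg_max (J_cost X \<mu> f) (\<lambda>p. p \<in> set_A X M q) (\<theta>s, simple_laminate M R \<theta>s)"
proof -
 have \<theta>s: "\<theta>s \<in> admissible X q" and le: "\<And>\<theta>. \<theta> \<in> admissible X q ==> reward \<theta> \<le> reward \<theta>s"
  using max by (auto simp: is_arg_max_def not_less)
 have J: "J_cost X \<mu> f (\<theta>, A) \<le> reward \<theta>s" if "coercive_above \<theta> A" for \<theta> A
  using J_cost_le[OF that] le[of \<theta>] that by (auto simp: coercive_above_def)
 have "I_cost X M \<mu> f \<theta>s = reward \<theta>s"
  unfolding I_cost_def by (rule J_cost_eq[OF coercive_isotropic[OF \<theta>s] rad]) (simp add: mat_1_mult)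
 then show "is_arg_max (I_cost X M \<mu> f) (\<lambda>\<theta>. \<theta> \<in> admissible X q) \<theta>s"
  using \<theta>s J[OF coercive_isotropic] by (auto simp: is_arg_max_def not_less I_cost_def)
 assume R: "laminate_rotations X M R"
 note P = simple_laminate_props[OF \<theta>s R]
 have eq: "J_cost X \<mu> f (\<theta>s, simple_laminate M R \<theta>s) = reward \<theta>s" by (rule J_cost_eq[OF set_B_coercive[OF P(2)] rad P(3)])
 show "is_arg_max (J_cost X \<mu> f) (\<lambda>p. p \<in> set_B X M q) (\<theta>s, simple_laminate M R \<theta>s)"
  using P(2) J[OF set_B_coercive] by (auto simp: is_arg_max_def not_less eq)
 show "is_arg_max (J_cost X \<mu> f) (\<lambda>p. p \<in> set_A X M q) (\<theta>s, simple_laminate M R \<theta>s)"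
  using P(1) J[OF set_A_coercive] by (auto simp: is_arg_max_def not_less eq)
qed

end

theorem mainTheorem4:
  fixes \<Omega> :: "(real^'d::finite) set" and rad :: real
    and M :: "'N::finite \<Rightarrow> real^'d^'d" and q :: "'N \<Rightarrow> real"
    and \<mu> :: "'m::finite \<Rightarrow> real"
    and f :: "'m \<Rightarrow> real^'d \<Rightarrow> real" and g :: "'m \<Rightarrow> real \<Rightarrow> real"
    and \<sigma>s :: "'m \<Rightarrow> real^'d \<Rightarrow> real^'d" and \<psi> :: "real^'d \<Rightarrow> real"
  assumes dim: "CARD('d) \<ge> 2"
    and ball: "rad > 0" "\<Omega> = ball 0 rad"
    and phases: "\<And>i. M i \<in> Sym" "\<And>i. pos_def (M i)"
    and amounts: "\<And>i. q i \<ge> 0" "(\<Sum>i\<in>UNIV. q i) = measure lebesgue \<Omega>"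
    and weights: "\<And>i. \<mu> i > 0"
    and f_radial: "\<And>i. AE x in lebesgue_on \<Omega>. f i x = g i (norm x)"
    and f_L2: "\<And>i. (\<lambda>r. r powr ((real CARD('d) - 1) / 2) * g i r) \<in> L2 {0<..<rad}"
    and \<sigma>s: "\<And>i. \<sigma>s i = radial_flux (g i)"
    and \<psi>: "\<And>x. \<psi> x = (\<Sum>i\<in>UNIV. \<mu> i * (norm (\<sigma>s i x))\<^sup>2)"
  shows "optimal_flux \<Omega> M q \<mu> f \<sigma>s \<and>
    (\<forall>\<theta>s. radial_on \<Omega> \<theta>s \<and>
        is_arg_max (\<lambda>\<theta>. LINT x|lebesgue_on \<Omega>. (\<Sum>j\<in>UNIV. \<theta> x $ j / lambda_min (M j)) * \<psi> x)
          (\<lambda>\<theta>. \<theta> \<in> admissible \<Omega> q) \<theta>s \<longrightarrow>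
      is_arg_max (I_cost \<Omega> M \<mu> f) (\<lambda>\<theta>. \<theta> \<in> admissible \<Omega> q) \<theta>s \<and>
      (\<forall>R. laminate_rotations \<Omega> M R \<longrightarrow>
         is_arg_max (J_cost \<Omega> \<mu> f) (\<lambda>p. p \<in> set_B \<Omega> M q) (\<theta>s, simple_laminate M R \<theta>s) \<and>
         is_arg_max (J_cost \<Omega> \<mu> f) (\<lambda>p. p \<in> set_A \<Omega> M q) (\<theta>s, simple_laminate M R \<theta>s)))"
proof -
 interpret B: ball_domain \<Omega> rad by unfold_locales (use ball in auto)
 have "\<exists>k. k \<in> borel_measurable borel \<and> (\<lambda>x. k (norm x)) \<in> L2 \<Omega> \<and> (AE x in lebesgue_on \<Omega>. g i (norm x) = k (norm x)) \<and>
   (\<forall>x\<in>\<Omega>. radial_flux (g i) x = B.flux k x)" for i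
  by (rule B.radial_data[of "g i"]) (use f_L2[of i] in \<open>auto simp: B.dm_def\<close>)
 from choice[OF allI[OF this]] obtain k where K: "\<forall>i. k i \<in> borel_measurable borel \<and> (\<lambda>x. k i (norm x)) \<in> L2 \<Omega> \<and>
   (AE x in lebesgue_on \<Omega>. g i (norm x) = k i (norm x)) \<and> (\<forall>x\<in>\<Omega>. radial_flux (g i) x = B.flux (k i) x)"
  by (rule exE)
 have k: "k i \<in> borel_measurable borel" "(\<lambda>x. k i (norm x)) \<in> L2 \<Omega>" "AE x in lebesgue_on \<Omega>. g i (norm x) = k i (norm x)"
  and kf: "x \<in> \<Omega> \<Longrightarrow> radial_flux (g i) x = B.flux (k i) x" for i x
  using K by blast+
 have fk: "AE x in lebesgue_on \<Omega>. f i x = k i (norm x)" for i using f_radial[of i] k(3)[of i] by eventually_elim simp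
 have sym: "transpose (M i) = M i" for i using phases(1)[of i] by (simp add: Sym_def)
 interpret P: radial_problem \<Omega> rad M q \<mu> f k \<sigma>s
  by unfold_locales (use sym lambda_min_pos[OF sym phases(2)] amounts weights k(1,2) fk kf \<sigma>s in auto)
 have "\<psi> = P.energy_density" by (simp add: fun_eq_iff P.energy_density_def \<psi>)
 then have rw: "(\<lambda>\<theta>. LINT x|lebesgue_on \<Omega>. (\<Sum>j\<in>UNIV. \<theta> x $ j / lambda_min (M j)) * \<psi> x) = P.reward"
  by (simp add: fun_eq_iff P.reward_def)
 show ?thesis unfolding rw using P.optimal_flux P.maximizers by blast
qed

end
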